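(* Let $p$ be a prime, $K$ a finite extension of $\mathbb{Q}_p$ with valuation ring $R$, let $G$ be an $m$-dimensional formal group law over $R$ with Lie algebra $\mathfrak{g}$, and let $\mathcal{G}(0)$ be the associated $m$-standard group. Then the limit morphism $$\Phi_\infty: H^n(\mathcal{O}^{la}(\mathcal{G}(0)^\bullet)_e,K)\to H^n(\mathfrak{g},K)$$ is an isomorphism.
   Context: $|\cdot|$ is the absolute value on $K$ with $|p|=p^{-1}$; $R=\{x\in K:|x|\le1\}$. An $m$-dimensional formal group law over $R$ is an $m$-tuple $G$ of power series in $R[[\mathbf{X},\mathbf{Y}]]$ with $G^{(j)}(\mathbf{X},\mathbf{Y})=X_j+Y_j+\sum_{l,k}\gamma^j_{lk}X_lY_k+(\text{total degree}\ge3)$ and $G(G(\mathbf{X},\mathbf{Y}),\mathbf{Z})=G(\mathbf{X},G(\mathbf{Y},\mathbf{Z}))$. Its Lie algebra $\mathfrak{g}$ is the free $R$-module on $e_1,\dots,e_m$ with $[e_l,e_k]=\sum_j(\gamma^j_{lk}-\gamma^j_{kl})e_j$. The standard group is $\mathcal{G}(0)=\{z\in R^m:|z|<1\}$ with multiplication $z_1\cdot z_2=G(z_1,z_2)$ and identity $e=0$. $\mathcal{O}^{la}(\mathcal{G}(0)^n)_e$ is the ring of germs at the identity of locally analytic $K$-valued functions on $\mathcal{G}(0)^n$; equivalently $\varinjlim_{h\in\mathbb{N}}K\langle p^{-h}\underline t_1,\dots,p^{-h}\underline t_n\rangle\subset K[[\underline t_1,\dots,\underline t_n]]$, $\underline t_i=(t_i^{(1)},\dots,t_i^{(m)})$,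 where $K\langle p^{-h}\underline t_1,\dots,p^{-h}\underline t_n\rangle$ is the Tate algebra of power series in the variables $p^{-h}t_i^{(j)}$ with coefficients in $K$ tending to $0$. With the differential $(\partial f)(\underline t_1,\dots,\underline t_{n+1})=f(\underline t_2,\dots,\underline t_{n+1})+\sum_{i=1}^n(-1)^if(\underline t_1,\dots,G(\underline t_i,\underline t_{i+1}),\dots,\underline t_{n+1})+(-1)^{n+1}f(\underline t_1,\dots,\underline t_n)$ (and $K$ in degree $0$) they form a complex, whose cohomology is $H^n(\mathcal{O}^{la}(\mathcal{G}(0)^\bullet)_e,K)$. $H^n(\mathfrak{g},K)$ is the cohomology of $\mathrm{Hom}_R(\bigwedge^n\mathfrak{g},K)$ with $\partial'(\omega)(x_1\wedge\dots\wedge x_{n+1})=\sum_{r<s}(-1)^{r+s}\omega([x_r,x_s]\wedge x_1\wedge\dots\widehat{x_r}\dots\widehat{x_s}\dots\wedge x_{n+1})$. $\Phi_\infty$ is induced by differentiating cochains: the identity for $n=0$, and for $n\ge1$ the germ $f$ is sent to the form $e_{i_1}\wedge\dots\wedge e_{i_n}\mapsto\sum_{\alpha\in S_n}\mathrm{sgn}(\alpha)\frac{\partial^nf}{\partial t_1^{(i_{\alpha(1)})}\cdots\partial t_n^{(i_{\alpha(n)})}}(0)$ (so $f_1\otimes\dots\otimes f_n\mapsto df_1\wedge\dots\wedge df_n$). *)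

theory Defs
  imports
    "HOL-Analysis.Abstract_Metric_Spaces"
    "HOL-Combinatorics.Permutations"
    "HOL-Computational_Algebra.Primes"
    "HOL-Library.Function_Algebras"
    "HOL-Library.Poly_Mapping"
    "HOL-Library.Set_Algebras"
begin

section \<open>Finite extensions of the field of p-adic numbers\<close>

definition nonarch_absolute_value :: "('k::field \<Rightarrow> real) \<Rightarrow> bool" where
  "nonarch_absolute_value absK \<longleftrightarrow>
     (\<forall>x. 0 \<le> absK x) \<and> (\<forall>x. absK x = 0 \<longleftrightarrow> x = 0) \<and>
     (\<forall>x y. absK (x * y) = absK x * absK y) \<and>
     (\<forall>x y. absK (x + y) \<le> max (absK x) (absK y))"

text \<open>
  \<open>Q\<close> is a completion of the rationals inside the ambient field: a subfield that is complete and
  in which the prime field is dense. If \<open>absK\<close> is non-archimedean with \<open>absK p = 1/p\<close>, its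
  restriction to the rationals is the p-adic absolute value, so \<open>Q\<close> is the field of p-adic numbers.
\<close>

definition completion_of_rats :: "('k::field_char_0 \<Rightarrow> real) \<Rightarrow> 'k set \<Rightarrow> bool" where
  "completion_of_rats absK Q \<longleftrightarrow>
     \<rat> \<subseteq> Q \<and>
     (\<forall>x\<in>Q. \<forall>y\<in>Q. x + y \<in> Q \<and> x * y \<in> Q) \<and> (\<forall>x\<in>Q. - x \<in> Q \<and> inverse x \<in> Q) \<and>
     Metric_space.mcomplete Q (\<lambda>x y. absK (x - y)) \<and>
     (\<forall>x\<in>Q. \<forall>e>0. \<exists>q\<in>\<rat>. absK (x - q) < e)"

definition finite_extension_of_Qp :: "nat \<Rightarrow> ('k::field_char_0 \<Rightarrow> real) \<Rightarrow> bool" where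
  "finite_extension_of_Qp p absK \<longleftrightarrow>
     nonarch_absolute_value absK \<and> absK (of_nat p) = 1 / real p \<and>
     (\<exists>Q. completion_of_rats absK Q \<and>
       (\<exists>B. finite B \<and> (\<forall>x. \<exists>c. (\<forall>b\<in>B. c b \<in> Q) \<and> x = (\<Sum>b\<in>B. c b * b))))"

definition val_ring :: "('k::field \<Rightarrow> real) \<Rightarrow> 'k set" where
  "val_ring absK = {x. absK x \<le> 1}"


section \<open>Formal power series in several variables\<close>

text \<open>A series is the family of its coefficients; multi-indices are finitely supported functions
  from the variables to \<open>nat\<close>.\<close>

typedef ('v, 'a) mfps = "UNIV :: (('v \<Rightarrow>\<^sub>0 nat) \<Rightarrow> 'a) set"
  morphisms mcoeff Abs_mfps by simp

lemma mcoeff_Abs [simp]: "mcoeff (Abs_mfps f) = f"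
  by (simp add: Abs_mfps_inverse)

lemma mfps_eqI: "(\<And>b. mcoeff f b = mcoeff g b) \<Longrightarrow> f = g"
  by (metis ext mcoeff_inject)

lemma finite_bounded_multi_indices: "finite {a :: 'v \<Rightarrow>\<^sub>0 nat. \<forall>v. Poly_Mapping.lookup a v \<le> Poly_Mapping.lookup b v}"
proof -
  let ?S = "{a :: 'v \<Rightarrow>\<^sub>0 nat. \<forall>v. Poly_Mapping.lookup a v \<le> Poly_Mapping.lookup b v}"
  let ?N = "\<Sum>v\<in>Poly_Mapping.keys b. Poly_Mapping.lookup b v"
  let ?F = "{f. \<forall>x. (x \<in> Poly_Mapping.keys b \<longrightarrow> f x \<in> {..?N}) \<and> (x \<notin> Poly_Mapping.keys b \<longrightarrow> f x = 0)}"
  have "Poly_Mapping.lookup ` ?S \<subseteq> ?F"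
  proof (clarsimp, intro conjI impI)
    fix a :: "'v \<Rightarrow>\<^sub>0 nat" and x
    assume le: "\<forall>v. Poly_Mapping.lookup a v \<le> Poly_Mapping.lookup b v"
    {
      assume "x \<in> Poly_Mapping.keys b"
      then have "Poly_Mapping.lookup b x \<le> ?N" by (intro member_le_sum) auto
      then show "Poly_Mapping.lookup a x \<le> ?N" using le order_trans by blast
    next
      assume "x \<notin> Poly_Mapping.keys b"
      then show "Poly_Mapping.lookup a x = 0" using le by (metis in_keys_iff le_zero_eq)
    }
  qed
  moreover have "finite ?F" by (intro finite_set_of_finite_funs) auto
  ultimately have "finite (Poly_Mapping.lookup ` ?S)" by (rule finite_subset)
  moreover have "inj_on Poly_Mapping.lookup ?S"
    by (meson inj_onI poly_mapping.lookup_inject)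
  ultimately show ?thesis by (rule finite_imageD)
qed

definition splits :: "('v \<Rightarrow>\<^sub>0 nat) \<Rightarrow> (('v \<Rightarrow>\<^sub>0 nat) \<times> ('v \<Rightarrow>\<^sub>0 nat)) set" where
  "splits b = {(a, c). a + c = b}"

lemma finite_splits [simp]: "finite (splits b)"
proof -
  let ?S = "{a. \<forall>v. Poly_Mapping.lookup a v \<le> Poly_Mapping.lookup b v}"
  have "splits b \<subseteq> ?S \<times> ?S"
    by (auto simp: splits_def lookup_add)
  then show ?thesis
    using finite_bounded_multi_indices finite_subset by blast
qed

instantiation mfps :: (type, comm_ring_1) comm_ring_1
begin

definition "0 = Abs_mfps (\<lambda>_. 0)"
definition "1 = Abs_mfps (\<lambda>b. if b = 0 then 1 else 0)"
definition "f + g = Abs_mfps (\<lambda>b. mcoeff f b + mcoeff g b)"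
definition "- f = Abs_mfps (\<lambda>b. - mcoeff f b)"
definition "f - g = Abs_mfps (\<lambda>b. mcoeff f b - mcoeff g b)"
definition "f * g = Abs_mfps (\<lambda>b. \<Sum>(a, c)\<in>splits b. mcoeff f a * mcoeff g c)"

instance
proof
  fix f g h :: "('a, 'b) mfps"
  show "f + g + h = f + (g + h)" "f + g = g + f" "0 + f = f" "- f + f = 0" "f - g = f + - g"
    by (auto intro!: mfps_eqI
          simp: plus_mfps_def zero_mfps_def uminus_mfps_def minus_mfps_def algebra_simps)
  show "(0 :: ('a, 'b) mfps) \<noteq> 1"
  proof
    assume "(0 :: ('a, 'b) mfps) = 1"
    then have "mcoeff (0 :: ('a, 'b) mfps) 0 = mcoeff 1 0" by (rule arg_cong)
    then show False by (simp add: one_mfps_def zero_mfps_def)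
  qed
  show "f * g = g * f"
  proof (rule mfps_eqI)
    fix b
    have "(\<Sum>(a, c)\<in>splits b. mcoeff f a * mcoeff g c) = (\<Sum>(a, c)\<in>splits b. mcoeff g a * mcoeff f c)"
      by (rule sum.reindex_bij_witness[where i = prod.swap and j = prod.swap])
         (auto simp: splits_def add.commute mult.commute)
    then show "mcoeff (f * g) b = mcoeff (g * f) b" by (simp add: times_mfps_def)
  qed
  show "(f + g) * h = f * h + g * h"
    by (simp add: plus_mfps_def times_mfps_def sum.distrib distrib_right case_prod_unfold)
  show "1 * f = f"
  proof (rule mfps_eqI)
    fix b
    have "(\<Sum>(a, c)\<in>splits b. (if a = 0 then 1 else 0) * mcoeff f c)
        = (\<Sum>(a, c)\<in>{(0 :: 'a \<Rightarrow>\<^sub>0 nat, b)}. (if a = 0 then 1 else 0) * mcoeff f c)"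
      by (rule sum.mono_neutral_right, rule finite_splits) (auto simp: splits_def split: if_splits)
    then show "mcoeff (1 * f) b = mcoeff f b" by (simp add: times_mfps_def one_mfps_def)
  qed
  show "f * g * h = f * (g * h)"
  proof (rule mfps_eqI)
    fix b
    have "mcoeff (f * g * h) b
        = (\<Sum>x\<in>splits b. \<Sum>y\<in>splits (fst x). mcoeff f (fst y) * mcoeff g (snd y) * mcoeff h (snd x))"
      by (simp add: times_mfps_def sum_distrib_right case_prod_unfold)
    also have "\<dots> = (\<Sum>(x, y)\<in>Sigma (splits b) (\<lambda>x. splits (fst x)).
                      mcoeff f (fst y) * mcoeff g (snd y) * mcoeff h (snd x))"
      by (rule sum.Sigma) auto
    also have "\<dots> = (\<Sum>(x, y)\<in>Sigma (splits b) (\<lambda>x. splits (snd x)).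
                      mcoeff f (fst x) * (mcoeff g (fst y) * mcoeff h (snd y)))"
      by (rule sum.reindex_bij_witness
            [where j = "\<lambda>((ac, d), (a, c)). ((a, c + d), (c, d))"
               and i = "\<lambda>((a, cd), (c, d)). ((a + c, d), (a, c))"])
         (auto simp: splits_def add.assoc mult.assoc)
    also have "\<dots> = (\<Sum>x\<in>splits b. \<Sum>y\<in>splits (snd x). mcoeff f (fst x) * (mcoeff g (fst y) * mcoeff h (snd y)))"
      by (rule sum.Sigma[symmetric]) auto
    also have "\<dots> = mcoeff (f * (g * h)) b"
      by (simp add: times_mfps_def sum_distrib_left case_prod_unfold)
    finally show "mcoeff (f * g * h) b = mcoeff (f * (g * h)) b" .
  qed
qed

end

definition mconst :: "'a::zero \<Rightarrow> ('v, 'a) mfps" where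
  "mconst c = Abs_mfps (\<lambda>b. if b = 0 then c else 0)"

definition mvar :: "'v \<Rightarrow> ('v, 'a::zero_neq_one) mfps" where
  "mvar v = Abs_mfps (\<lambda>b. if b = Poly_Mapping.single v 1 then 1 else 0)"

definition total_deg :: "('v \<Rightarrow>\<^sub>0 nat) \<Rightarrow> nat" where
  "total_deg b = (\<Sum>v\<in>Poly_Mapping.keys b. Poly_Mapping.lookup b v)"

definition in_vars :: "'v set \<Rightarrow> ('v, 'a::zero) mfps set" where
  "in_vars V = {f. \<forall>b. mcoeff f b \<noteq> 0 \<longrightarrow> Poly_Mapping.keys b \<subseteq> V}"

definition mderiv :: "'v \<Rightarrow> ('v, 'a::comm_ring_1) mfps \<Rightarrow> ('v, 'a) mfps" where
  "mderiv v f = Abs_mfps (\<lambda>b. of_nat (Poly_Mapping.lookup b v + 1) * mcoeff f (b + Poly_Mapping.single v 1))"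

text \<open>
  Substitution of \<open>s v\<close> for \<open>v\<close>. It is meaningful when \<open>f\<close> involves finitely many variables and the
  series substituted for them have zero constant term: then, for every \<open>b\<close>, only finitely many
  \<open>a\<close> contribute. (\<open>Sum_any\<close> of a family with infinite support is \<open>0\<close>.)
\<close>

definition msubst :: "('v \<Rightarrow> ('w, 'a::comm_ring_1) mfps) \<Rightarrow> ('v, 'a) mfps \<Rightarrow> ('w, 'a) mfps" where
  "msubst s f = Abs_mfps (\<lambda>b. Sum_any (\<lambda>a.
     mcoeff f a * mcoeff (\<Prod>v\<in>Poly_Mapping.keys a. s v ^ Poly_Mapping.lookup a v) b))"


section \<open>Formal group laws\<close>

text \<open>
  The variable \<open>(i, j)\<close> is the \<open>j\<close>-th coordinate of the \<open>i\<close>-th argument, both counted from \<open>1\<close>;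
  \<open>tvar i\<close> is the tuple of coordinates of the \<open>i\<close>-th argument. Thus \<open>X = tvar 1\<close>, \<open>Y = tvar 2\<close>,
  \<open>Z = tvar 3\<close> for formal group laws. Tuples of length \<open>m\<close> are functions on \<open>nat\<close> of which only the
  values on \<open>{1..m}\<close> matter.
\<close>

type_synonym 'k series = "(nat \<times> nat, 'k) mfps"

definition tvar :: "nat \<Rightarrow> nat \<Rightarrow> 'k::comm_ring_1 series" where
  "tvar i j = mvar (i, j)"

text \<open>\<open>f(u 1, u 2, \<dots>)\<close>, where each \<open>u i\<close> is a tuple of series.\<close>

definition at_points :: "'k::comm_ring_1 series \<Rightarrow> (nat \<Rightarrow> nat \<Rightarrow> 'k series) \<Rightarrow> 'k series" where
  "at_points f u = msubst (\<lambda>(i, j). u i j) f"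

definition gmult :: "(nat \<Rightarrow> 'k::comm_ring_1 series) \<Rightarrow>
    (nat \<Rightarrow> 'k series) \<Rightarrow> (nat \<Rightarrow> 'k series) \<Rightarrow> nat \<Rightarrow> 'k series" where
  "gmult G u w j = at_points (G j) (\<lambda>i. if i = 1 then u else w)"

definition fgl_coeff :: "(nat \<Rightarrow> 'k::comm_ring_1 series) \<Rightarrow> nat \<Rightarrow> nat \<Rightarrow> nat \<Rightarrow> 'k" where
  "fgl_coeff G j l k = mcoeff (G j) (Poly_Mapping.single (1, l) 1 + Poly_Mapping.single (2, k) 1)"

definition formal_group_law ::
    "('k::field \<Rightarrow> real) \<Rightarrow> nat \<Rightarrow> (nat \<Rightarrow> 'k series) \<Rightarrow> bool" where
  "formal_group_law absK m G \<longleftrightarrow>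
     (\<forall>j\<in>{1..m}.
        G j \<in> in_vars ({1, 2} \<times> {1..m}) \<and>
        (\<forall>b. mcoeff (G j) b \<in> val_ring absK) \<and>
        (\<forall>b. total_deg b < 3 \<longrightarrow> mcoeff (G j) b =
           mcoeff (tvar 1 j + tvar 2 j +
             (\<Sum>l\<in>{1..m}. \<Sum>k\<in>{1..m}. mconst (fgl_coeff G j l k) * tvar 1 l * tvar 2 k)) b) \<and>
        gmult G (gmult G (tvar 1) (tvar 2)) (tvar 3) j =
        gmult G (tvar 1) (gmult G (tvar 2) (tvar 3)) j)"


section \<open>Cohomology of cochain complexes of vector spaces\<close>

record ('k, 'a) cochain_complex =
  cochains :: "nat \<Rightarrow> 'a set"
  differential :: "nat \<Rightarrow> 'a \<Rightarrow> 'a"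
  scaling :: "'k \<Rightarrow> 'a \<Rightarrow> 'a"

definition cocycles :: "('k, 'a::ab_group_add) cochain_complex \<Rightarrow> nat \<Rightarrow> 'a set" where
  "cocycles C n = {x \<in> cochains C n. differential C n x = 0}"

definition coboundaries :: "('k, 'a::ab_group_add) cochain_complex \<Rightarrow> nat \<Rightarrow> 'a set" where
  "coboundaries C n = (case n of 0 \<Rightarrow> {0} | Suc k \<Rightarrow> differential C k ` cochains C k)"

text \<open>The quotient \<open>cocycles / coboundaries\<close>, as a set of cosets. Cosets are added elementwise.\<close>

definition cohomology :: "('k, 'a::ab_group_add) cochain_complex \<Rightarrow> nat \<Rightarrow> 'a set set" where
  "cohomology C n = (\<lambda>x. x +o coboundaries C n) ` cocycles C n"

definition class_scale :: "('k, 'a::ab_group_add) cochain_complex \<Rightarrow> nat \<Rightarrow> 'k \<Rightarrow> 'a set \<Rightarrow> 'a set" where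
  "class_scale C n c A = (\<Union>x\<in>A. scaling C c x +o coboundaries C n)"

text \<open>The map induced by \<open>F\<close> on classes; the union is a single coset precisely when the class
  of \<open>F x\<close> does not depend on the choice of \<open>x\<close> in \<open>A\<close>.\<close>

definition induced_map :: "('k, 'b::ab_group_add) cochain_complex \<Rightarrow> nat \<Rightarrow> ('a \<Rightarrow> 'b) \<Rightarrow> 'a set \<Rightarrow> 'b set" where
  "induced_map D n F A = (\<Union>x\<in>A. F x +o coboundaries D n)"

definition cohomology_isomorphism :: "('k, 'a::ab_group_add) cochain_complex \<Rightarrow>
    ('k, 'b::ab_group_add) cochain_complex \<Rightarrow> nat \<Rightarrow> ('a set \<Rightarrow> 'b set) \<Rightarrow> bool" where
  "cohomology_isomorphism C D n \<Psi> \<longleftrightarrow>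
     bij_betw \<Psi> (cohomology C n) (cohomology D n) \<and>
     (\<forall>A\<in>cohomology C n. \<forall>B\<in>cohomology C n. \<Psi> (A + B) = \<Psi> A + \<Psi> B) \<and>
     (\<forall>c. \<forall>A\<in>cohomology C n. \<Psi> (class_scale C n c A) = class_scale D n c (\<Psi> A))"


section \<open>The complex of germs of locally analytic functions\<close>

text \<open>\<open>tate_algebra\<close> is the algebra of the series in the variables scaled by \<open>p\<^sup>-\<^sup>h\<close>: the coefficient
  of a series at \<open>b\<close> with respect to the scaled variables is \<open>p\<^bsup>h total_deg b\<^esup>\<close> times its usual one.
  The filter \<open>cofinite\<close> makes this tend to zero over the multi-indices.\<close>

definition tate_algebra ::
    "('k::field_char_0 \<Rightarrow> real) \<Rightarrow> nat \<Rightarrow> 'v set \<Rightarrow> nat \<Rightarrow> ('v, 'k) mfps set" where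
  "tate_algebra absK p V h = {f \<in> in_vars V.
     ((\<lambda>b. absK (of_nat p ^ (h * total_deg b) * mcoeff f b)) \<longlongrightarrow> 0) cofinite}"

text \<open>The transition maps of the direct limit are inclusions inside the ring of formal power series,
  so the limit is a union. For \<open>n = 0\<close> there are no variables and the germs are the constants.\<close>

definition la_germs :: "('k::field_char_0 \<Rightarrow> real) \<Rightarrow> nat \<Rightarrow> nat \<Rightarrow> nat \<Rightarrow> 'k series set" where
  "la_germs absK p m n = (\<Union>h. tate_algebra absK p ({1..n} \<times> {1..m}) h)"

definition la_diff :: "(nat \<Rightarrow> 'k::comm_ring_1 series) \<Rightarrow> nat \<Rightarrow> 'k series \<Rightarrow> 'k series" where
  "la_diff G n f =
     at_points f (\<lambda>k. tvar (k + 1)) +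
     (\<Sum>i\<in>{1..n}. (- 1) ^ i * at_points f (\<lambda>k. if k < i then tvar k
                                             else if k = i then gmult G (tvar i) (tvar (i + 1))
                                             else tvar (k + 1))) +
     (- 1) ^ (n + 1) * at_points f (\<lambda>k. tvar k)"

definition la_complex :: "('k::field_char_0 \<Rightarrow> real) \<Rightarrow> nat \<Rightarrow> nat \<Rightarrow> (nat \<Rightarrow> 'k series) \<Rightarrow>
    ('k, 'k series) cochain_complex" where
  "la_complex absK p m G =
     \<lparr>cochains = la_germs absK p m, differential = la_diff G, scaling = (\<lambda>c f. mconst c * f)\<rparr>"


section \<open>The Lie algebra and its cochain complex\<close>

definition lie_carrier :: "('k::field \<Rightarrow> real) \<Rightarrow> nat \<Rightarrow> (nat \<Rightarrow> 'k) set" where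
  "lie_carrier absK m = {x. (\<forall>j\<in>{1..m}. x j \<in> val_ring absK) \<and> (\<forall>j. j \<notin> {1..m} \<longrightarrow> x j = 0)}"

definition lie_bracket :: "nat \<Rightarrow> (nat \<Rightarrow> 'k::field series) \<Rightarrow> (nat \<Rightarrow> 'k) \<Rightarrow> (nat \<Rightarrow> 'k) \<Rightarrow> nat \<Rightarrow> 'k" where
  "lie_bracket m G x y = (\<lambda>j. if j \<in> {1..m}
     then \<Sum>l\<in>{1..m}. \<Sum>k\<in>{1..m}. x l * y k * (fgl_coeff G j l k - fgl_coeff G j k l) else 0)"

definition lie_tuples :: "('k::field \<Rightarrow> real) \<Rightarrow> nat \<Rightarrow> nat \<Rightarrow> (nat \<Rightarrow> 'k) list set" where
  "lie_tuples absK m n = {xs. length xs = n \<and> set xs \<subseteq> lie_carrier absK m}"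

text \<open>
  Linear maps on the \<open>n\<close>-th exterior power over the valuation ring are alternating multilinear maps
  in \<open>n\<close> arguments: \<open>\<omega> [x\<^sub>1, \<dots>, x\<^sub>n]\<close> is the value at \<open>x\<^sub>1 \<and> \<dots> \<and> x\<^sub>n\<close>. Outside of its
  domain \<open>\<omega>\<close> is normalised to \<open>0\<close>.
\<close>

definition alt_forms :: "('k::field \<Rightarrow> real) \<Rightarrow> nat \<Rightarrow> nat \<Rightarrow> ((nat \<Rightarrow> 'k) list \<Rightarrow> 'k) set" where
  "alt_forms absK m n = {\<omega>.
     (\<forall>xs. xs \<notin> lie_tuples absK m n \<longrightarrow> \<omega> xs = 0) \<and>
     (\<forall>xs ys x y. xs @ x # ys \<in> lie_tuples absK m n \<and> y \<in> lie_carrier absK m \<longrightarrow>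
        \<omega> (xs @ (x + y) # ys) = \<omega> (xs @ x # ys) + \<omega> (xs @ y # ys)) \<and>
     (\<forall>xs ys x. \<forall>c\<in>val_ring absK. xs @ x # ys \<in> lie_tuples absK m n \<longrightarrow>
        \<omega> (xs @ (\<lambda>j. c * x j) # ys) = c * \<omega> (xs @ x # ys)) \<and>
     (\<forall>xs\<in>lie_tuples absK m n. \<not> distinct xs \<longrightarrow> \<omega> xs = 0)}"

text \<open>List positions start at \<open>0\<close>; this does not change the parity of \<open>r + s\<close>.\<close>

definition lie_diff :: "('k::field \<Rightarrow> real) \<Rightarrow> nat \<Rightarrow> (nat \<Rightarrow> 'k series) \<Rightarrow> nat \<Rightarrow>
    ((nat \<Rightarrow> 'k) list \<Rightarrow> 'k) \<Rightarrow> (nat \<Rightarrow> 'k) list \<Rightarrow> 'k" where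
  "lie_diff absK m G n \<omega> = (\<lambda>xs. if xs \<in> lie_tuples absK m (n + 1)
     then \<Sum>s\<in>{..n}. \<Sum>r\<in>{..<s}.
            (- 1) ^ (r + s) * \<omega> (lie_bracket m G (xs ! r) (xs ! s) # nths xs (- {r, s}))
     else 0)"

definition lie_complex :: "('k::field \<Rightarrow> real) \<Rightarrow> nat \<Rightarrow> (nat \<Rightarrow> 'k series) \<Rightarrow>
    ('k, (nat \<Rightarrow> 'k) list \<Rightarrow> 'k) cochain_complex" where
  "lie_complex absK m G =
     \<lparr>cochains = alt_forms absK m, differential = lie_diff absK m G, scaling = (\<lambda>c \<omega> xs. c * \<omega> xs)\<rparr>"


section \<open>Differentiating cochains\<close>

text \<open>The derivative at the origin of \<open>f\<close> with respect to the variables \<open>(k + 1, js ! k)\<close>,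
  \<open>k < length js\<close>.\<close>

definition mixed_deriv_at_0 :: "nat list \<Rightarrow> 'k::comm_ring_1 series \<Rightarrow> 'k" where
  "mixed_deriv_at_0 js f = mcoeff (fold (\<lambda>k. mderiv (k + 1, js ! k)) [0..<length js] f) 0"

text \<open>The value of the form at \<open>e\<^bsub>i\<^sub>1\<^esub> \<and> \<dots> \<and> e\<^bsub>i\<^sub>n\<^esub>\<close>, \<open>is = [i\<^sub>1, \<dots>, i\<^sub>n]\<close>.\<close>

definition Phi_basis :: "'k::comm_ring_1 series \<Rightarrow> nat list \<Rightarrow> 'k" where
  "Phi_basis f is = (\<Sum>\<alpha> | \<alpha> permutes {..<length is}.
     of_int (sign \<alpha>) * mixed_deriv_at_0 (map (\<lambda>k. is ! \<alpha> k) [0..<length is]) f)"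

text \<open>Its multilinear extension to the Lie algebra. For \<open>n = 0\<close> this is the identity of \<open>K\<close>.\<close>

definition Phi :: "('k::field \<Rightarrow> real) \<Rightarrow> nat \<Rightarrow> nat \<Rightarrow> 'k series \<Rightarrow> (nat \<Rightarrow> 'k) list \<Rightarrow> 'k" where
  "Phi absK m n f = (\<lambda>xs. if xs \<in> lie_tuples absK m n
     then \<Sum>is | length is = n \<and> set is \<subseteq> {1..m}.
            (\<Prod>k<n. (xs ! k) (is ! k)) * Phi_basis f is
     else 0)"

definition Phi_infinity :: "('k::field \<Rightarrow> real) \<Rightarrow> nat \<Rightarrow> (nat \<Rightarrow> 'k series) \<Rightarrow> nat \<Rightarrow>
    'k series set \<Rightarrow> ((nat \<Rightarrow> 'k) list \<Rightarrow> 'k) set" where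
  "Phi_infinity absK m G n = induced_map (lie_complex absK m G) n (Phi absK m n)"

end

theory Submission
  imports Defs
begin

text \<open>The comparison runs through a van Est double complex: its terms in bidegree \<open>(n, q)\<close> are the
  \<open>q\<close>-forms, written in left invariant coframes of the last factor, on germs of functions of \<open>n + 1\<close>
  group variables. The group differential has the homotopy ``set the last variable to \<open>0\<close>'', and its
  kernel at \<open>n = 0\<close> consists of the Chevalley-Eilenberg cochains. The other differential is the
  exterior derivative in the last variable, whose kernel at \<open>q = 0\<close> consists of the locally analytic
  cochains, and which is exact by a Poincare lemma: with the field \<open>E = \<Sum> x\<^sub>k D\<^sub>k\<close> built from
  the invariant fields \<open>D\<^sub>k\<close>, the Lie derivative \<open>i\<^sub>E d + d i\<^sub>E\<close> is multiplication by degrees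
  plus an integral operator that raises the degree, so it can be inverted with denominators that are
  bounded by factorials, which preserves convergence. Finally \<open>\<Phi>\<close> extends to a chain map on the whole
  double complex that is the identity on the Chevalley-Eilenberg edge; chasing cocycles along
  staircases then shows that \<open>\<Phi>\<close> itself is bijective on cohomology.\<close>

section \<open>Chevalley-Eilenberg complexes\<close>

text \<open>Left invariant coframes make the two differentials commute: multiplying the last two
  variables is a left translation in the last one, so the invariant fields pass through every face
  map and a form index is never transformed by a group element. The group differential of the double
  complex lacks the last face; the last variable is thus a parameter that carries the forms, and the
  locally analytic cochains reappear as the functions constant in it. The obstacle is convergence.
  The group law, the frames and the faces have coefficients in the valuation ring, so multiplying by
  them or substituting them never worsens a geometric bound; the real loss is the division by
  integers in the Poincare lemma, and |n!| >= p^(-n) keeps it geometric. Forms are functions of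
  lists of basis indices with a differential recursive in the list, which postpones the explicit
  signs and omitted entries to the end, where they are matched with the given descriptions of
  \<open>Phi\<close> and of the Lie differential. No inverse of \<Phi> is built: its extension only
  records, up to a scalar and a coboundary, what a staircase does to the image of a cocycle.\<close>

definition alternating :: "('i list \<Rightarrow> 'a::ab_group_add) \<Rightarrow> bool" where
  "alternating F \<longleftrightarrow> (\<forall>ys k l zs. F (ys @ k # l # zs) = - F (ys @ l # k # zs))"

lemma alternatingD: "alternating F \<Longrightarrow> F (ys @ k # l # zs) = - F (ys @ l # k # zs)"
  unfolding alternating_def by blast

lemma alternating_swap: "alternating F \<Longrightarrow> F (k # l # zs) = - F (l # k # zs)"
  by (metis alternatingD append_Nil)

lemma alternating_contract: "alternating F \<Longrightarrow> alternating (\<lambda>is. F (k # is))"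
  unfolding alternating_def by (metis append_Cons)

lemma alternating_add:
  "alternating F \<Longrightarrow> alternating H \<Longrightarrow> alternating (\<lambda>is. F is + H is)"
  unfolding alternating_def by (metis add.commute minus_add_distrib)

lemma alternating_uminus: "alternating F \<Longrightarrow> alternating (\<lambda>is. - F is)"
  unfolding alternating_def by metis

lemma alternating_diff:
  "alternating F \<Longrightarrow> alternating H \<Longrightarrow> alternating (\<lambda>is. F is - H is)"
  using alternating_add[OF _ alternating_uminus] by simp

lemma alternating_zero: "alternating (\<lambda>is. 0)"
  by (simp add: alternating_def)

lemma alternating_sum:
  "(\<And>x. x \<in> A \<Longrightarrow> alternating (F x)) \<Longrightarrow> alternating (\<lambda>is. \<Sum>x\<in>A. F x is)"
  unfolding alternating_def by (metis (no_types, lifting) sum.cong sum_negf)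

lemma alternating_map:
  "alternating F \<Longrightarrow> (\<And>x. h (- x) = - h x) \<Longrightarrow> alternating (\<lambda>is. h (F is))"
  unfolding alternating_def by metis

text \<open>Unfolds to the sum of (-1)^r a_(i_r) (F with i_r omitted), positions counted from 0: the
  exterior product of the operator-valued one-form \<open>a\<close> with \<open>F\<close>. It occurs
  with \<open>a\<close> the invariant derivations, multiplication by the components of a one-form,
  and the appending of a direction of differentiation.\<close>

fun wedge :: "(nat \<Rightarrow> 'a \<Rightarrow> 'a) \<Rightarrow> nat list \<Rightarrow> (nat list \<Rightarrow> 'a::ab_group_add) \<Rightarrow> 'a" where
  "wedge a [] F = 0"
| "wedge a (k # is) F = a k (F is) - wedge a is (\<lambda>l. F (k # l))"

lemma wedge_zero: "(\<And>k. a k 0 = 0) \<Longrightarrow> wedge a is (\<lambda>l. 0) = 0"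
  by (induction "is") auto

lemma wedge_add:
  assumes "\<And>k x y. a k (x + y) = a k x + a k y"
  shows "wedge a is (\<lambda>l. F l + H l) = wedge a is F + wedge a is H"
  by (induction "is" arbitrary: F H) (auto simp: assms)

lemma additive_uminus:
  assumes "\<And>x y. h (x + y) = h x + (h y :: 'b::ab_group_add)"
  shows "h (- x :: 'a::ab_group_add) = - h x" "h 0 = 0" "h (x - y) = h x - h y"
proof -
  show 0: "h 0 = 0" using assms[of 0 0] by simp
  show 1: "h (- x) = - h x" for x using assms[of x "- x"] 0 by (simp add: eq_neg_iff_add_eq_0 add.commute)
  show "h (x - y) = h x - h y" using assms[of x "- y"] 1 by simp
qed

lemma wedge_uminus:
  assumes "\<And>k x y. a k (x + y) = a k x + a k y"
  shows "wedge a is (\<lambda>l. - F l) = - wedge a is F"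
proof (induction "is" arbitrary: F)
  case (Cons k "is")
  have "a k (- x) = - a k x" for x by (rule additive_uminus(1)) (rule assms)
  then show ?case using Cons by simp
qed simp

lemma wedge_diff:
  assumes "\<And>k x y. a k (x + y) = a k x + a k y"
  shows "wedge a is (\<lambda>l. F l - H l) = wedge a is F - wedge a is H"
proof (induction "is" arbitrary: F H)
  case (Cons k "is")
  have "a k (x - y) = a k x - a k y" for x y by (rule additive_uminus(3)) (rule assms)
  then show ?case using Cons by simp
qed simp

lemma wedge_sum:
  assumes "\<And>k x y. a k (x + y) = a k x + a k y"
  shows "wedge a is (\<lambda>l. \<Sum>x\<in>A. F x l) = (\<Sum>x\<in>A. wedge a is (F x))"
proof -
  have "a k 0 = 0" for k by (rule additive_uminus(2)) (rule assms)
  then show ?thesis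
    by (induction A rule: infinite_finite_induct) (auto simp: wedge_add[OF assms] wedge_zero)
qed

lemma alternating_wedge:
  assumes "\<And>k x y. a k (x + y) = a k x + a k y" and "alternating F"
  shows "alternating (\<lambda>is. wedge a is F)"
  unfolding alternating_def
proof (intro allI)
  fix ys k l zs
  show "wedge a (ys @ k # l # zs) F = - wedge a (ys @ l # k # zs) F"
    using assms(2)
  proof (induction ys arbitrary: F)
    case Nil
    have "wedge a zs (\<lambda>x. F (k # l # x)) = - wedge a zs (\<lambda>x. F (l # k # x))"
      using alternating_swap[OF Nil, of k l] by (simp add: wedge_uminus[OF assms(1)])
    then show ?case by (simp add: algebra_simps)
  next
    case (Cons y ys)
    have "F (ys @ k # l # zs) = - F (ys @ l # k # zs)" using Cons.prems by (rule alternatingD)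
    then have "a y (F (ys @ k # l # zs)) = - a y (F (ys @ l # k # zs))"
      by (metis additive_uminus(1) assms(1))
    then show ?case using Cons.IH[OF alternating_contract[OF Cons.prems], of y] by simp
  qed
qed

text \<open>A form is a function of the list of its indices, and \<open>D\<close> is the action of the basis vectors on
  the coefficients. With \<open>\<theta>\<^sub>k\<close> the Lie derivative along the \<open>k\<close>-th basis vector, the differential is
  determined by Cartan's formula \<open>i\<^sub>k d = \<theta>\<^sub>k - d i\<^sub>k\<close>.\<close>

fun lie_deriv :: "nat set \<Rightarrow> (nat \<Rightarrow> nat \<Rightarrow> nat \<Rightarrow> 'k) \<Rightarrow> ('k \<Rightarrow> 'a \<Rightarrow> 'a) \<Rightarrow> (nat \<Rightarrow> 'a \<Rightarrow> 'a) \<Rightarrow>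
    nat \<Rightarrow> nat list \<Rightarrow> (nat list \<Rightarrow> 'a::ab_group_add) \<Rightarrow> 'a" where
  "lie_deriv I c sc D k [] F = D k (F [])"
| "lie_deriv I c sc D k (i # is) F =
     lie_deriv I c sc D k is (\<lambda>l. F (i # l)) - (\<Sum>j\<in>I. sc (c j k i) (F (j # is)))"

fun ce_diff :: "nat set \<Rightarrow> (nat \<Rightarrow> nat \<Rightarrow> nat \<Rightarrow> 'k) \<Rightarrow> ('k \<Rightarrow> 'a \<Rightarrow> 'a) \<Rightarrow> (nat \<Rightarrow> 'a \<Rightarrow> 'a) \<Rightarrow>
    nat list \<Rightarrow> (nat list \<Rightarrow> 'a::ab_group_add) \<Rightarrow> 'a" where
  "ce_diff I c sc D [] F = 0"
| "ce_diff I c sc D (k # is) F =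
     lie_deriv I c sc D k is F - ce_diff I c sc D is (\<lambda>l. F (k # l))"

text \<open>\<open>c j k l\<close> is the coefficient of e_j in [e_k, e_l]. \<open>c_jacobi\<close>
  is the b-component of [e_l, [e_k, e_i]] - [e_k, [e_l, e_i]] = - [[e_k, e_l], e_i], the shape in
  which it arises from commuting two Lie derivatives in one slot of a form.\<close>

locale structure_constants =
  fixes I :: "nat set" and c :: "nat \<Rightarrow> nat \<Rightarrow> nat \<Rightarrow> 'k::comm_ring_1"
  assumes c_antisym: "c j k l = - c j l k"
    and c_jacobi: "(\<Sum>a\<in>I. c a k i * c b l a) - (\<Sum>a\<in>I. c a l i * c b k a) =
      - (\<Sum>a\<in>I. c a k l * c b a i)"

locale ce_module = structure_constants I c + module sc
  for I :: "nat set" and c :: "nat \<Rightarrow> nat \<Rightarrow> nat \<Rightarrow> 'k::comm_ring_1"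
    and sc :: "'k \<Rightarrow> 'a::ab_group_add \<Rightarrow> 'a" +
  fixes D :: "nat \<Rightarrow> 'a \<Rightarrow> 'a"
  assumes D_add: "D k (x + y) = D k x + D k y"
    and D_scale: "D k (sc a x) = sc a (D k x)"
    and D_bracket: "D k (D l x) - D l (D k x) = (\<Sum>j\<in>I. sc (c j k l) (D j x))"
begin

abbreviation "\<theta> \<equiv> lie_deriv I c sc D"
abbreviation "\<dd> \<equiv> ce_diff I c sc D"

lemmas D_uminus = additive_uminus[of "D k" for k, OF D_add]

lemma theta_add: "\<theta> k is (\<lambda>l. F l + H l) = \<theta> k is F + \<theta> k is H"
  by (induction "is" arbitrary: F H)
     (auto simp: D_add scale_right_distrib sum.distrib)

lemma theta_scale: "\<theta> k is (\<lambda>l. sc a (F l)) = sc a (\<theta> k is F)"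
  by (induction "is" arbitrary: F)
     (auto simp: D_scale scale_right_diff_distrib scale_sum_right mult.commute scale_left_commute)

lemma theta_uminus: "\<theta> k is (\<lambda>l. - F l) = - \<theta> k is F"
  using theta_scale[of k "is" "- 1" F] by simp

lemma theta_diff: "\<theta> k is (\<lambda>l. F l - H l) = \<theta> k is F - \<theta> k is H"
  using theta_add[of k "is" F "\<lambda>l. - H l"] theta_uminus[of k "is" H] by simp

lemma theta_zero: "\<theta> k is (\<lambda>l. 0) = 0"
  using theta_add[of k "is" "\<lambda>l. 0" "\<lambda>l. 0"] by simp

lemma theta_sum: "\<theta> k is (\<lambda>l. \<Sum>x\<in>A. F x l) = (\<Sum>x\<in>A. \<theta> k is (F x))"
  by (induction A rule: infinite_finite_induct) (auto simp: theta_add theta_zero)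

lemma d_add: "\<dd> is (\<lambda>l. F l + H l) = \<dd> is F + \<dd> is H"
  by (induction "is" arbitrary: F H) (auto simp: theta_add)

lemma d_scale: "\<dd> is (\<lambda>l. sc a (F l)) = sc a (\<dd> is F)"
  by (induction "is" arbitrary: F) (auto simp: theta_scale scale_right_diff_distrib)

lemma d_uminus: "\<dd> is (\<lambda>l. - F l) = - \<dd> is F"
  using d_scale[of "is" "- 1" F] by simp

lemma d_diff: "\<dd> is (\<lambda>l. F l - H l) = \<dd> is F - \<dd> is H"
  using d_add[of "is" F "\<lambda>l. - H l"] d_uminus[of "is" H] by simp

lemma d_zero: "\<dd> is (\<lambda>l. 0) = 0"
  using d_add[of "is" "\<lambda>l. 0" "\<lambda>l. 0"] by simp

lemma d_sum: "\<dd> is (\<lambda>l. \<Sum>x\<in>A. F x l) = (\<Sum>x\<in>A. \<dd> is (F x))"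
  by (induction A rule: infinite_finite_induct) (auto simp: d_add d_zero)

text \<open>In the first slot the terms linear in the structure constants occur symmetrically in
  \<open>k\<close> and \<open>a\<close> and cancel; the quadratic ones combine by Jacobi. The
  coefficients contribute \<open>D_bracket\<close>.\<close>

lemma theta_bracket:
  "\<theta> k is (\<lambda>l. \<theta> a l F) - \<theta> a is (\<lambda>l. \<theta> k l F) = (\<Sum>j\<in>I. sc (c j k a) (\<theta> j is F))"
proof (induction "is" arbitrary: F)
  case Nil
  then show ?case by (simp add: D_bracket)
next
  case (Cons i "is")
  have expand: "\<theta> k (i # is) (\<lambda>l. \<theta> a l F) =
      \<theta> k is (\<lambda>l. \<theta> a l (\<lambda>l. F (i # l))) - (\<Sum>b\<in>I. sc (c b a i) (\<theta> k is (\<lambda>l. F (b # l))))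
      - (\<Sum>j\<in>I. sc (c j k i) (\<theta> a is (\<lambda>l. F (j # l)))) +
      (\<Sum>b\<in>I. sc (\<Sum>j\<in>I. c j k i * c b a j) (F (b # is)))" for k a
  proof -
    have "(\<Sum>j\<in>I. sc (c j k i) (\<Sum>b\<in>I. sc (c b a j) (F (b # is)))) =
      (\<Sum>b\<in>I. sc (\<Sum>j\<in>I. c j k i * c b a j) (F (b # is)))"
      by (simp add: scale_sum_right scale_sum_left) (rule sum.swap)
    then show ?thesis
      by (simp add: theta_diff theta_sum theta_scale scale_right_diff_distrib sum_subtractf)
  qed
  have *: "sc (\<Sum>j\<in>I. c j k i * c b a j) x - sc (\<Sum>j\<in>I. c j a i * c b k j) x =
     - sc (\<Sum>j\<in>I. c j k a * c b j i) x" for b x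
    using c_jacobi[of k i b a] by (simp flip: scale_left_diff_distrib)
  have "(\<Sum>b\<in>I. sc (\<Sum>j\<in>I. c j k i * c b a j) (F (b # is))) -
     (\<Sum>b\<in>I. sc (\<Sum>j\<in>I. c j a i * c b k j) (F (b # is)))
    = - (\<Sum>b\<in>I. sc (\<Sum>j\<in>I. c j k a * c b j i) (F (b # is)))"
    by (simp add: * flip: sum_subtractf sum_negf)
  also have "(\<Sum>b\<in>I. sc (\<Sum>j\<in>I. c j k a * c b j i) (F (b # is))) =
      (\<Sum>j\<in>I. sc (c j k a) (\<Sum>b\<in>I. sc (c b j i) (F (b # is))))"
    by (simp add: scale_sum_right scale_sum_left) (rule sum.swap)
  finally have "\<theta> k (i # is) (\<lambda>l. \<theta> a l F) - \<theta> a (i # is) (\<lambda>l. \<theta> k l F) =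
      (\<theta> k is (\<lambda>l. \<theta> a l (\<lambda>l. F (i # l))) - \<theta> a is (\<lambda>l. \<theta> k l (\<lambda>l. F (i # l))))
      - (\<Sum>j\<in>I. sc (c j k a) (\<Sum>b\<in>I. sc (c b j i) (F (b # is))))"
    unfolding expand by (simp add: algebra_simps)
  then show ?case unfolding Cons.IH by (simp add: scale_right_diff_distrib sum_subtractf)
qed

text \<open>Contracting with \<open>a\<close> and applying Cartan's formula leaves the commutator of
  two Lie derivatives, which is exactly the term that \<open>\<theta> k\<close> adds for the slot
  \<open>a\<close>.\<close>

lemma d_theta: "\<dd> is (\<lambda>l. \<theta> k l F) = \<theta> k is (\<lambda>l. \<dd> l F)"
proof (induction "is" arbitrary: F)
  case Nil
  then show ?case by (simp add: D_uminus(2))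
next
  case (Cons a "is")
  have "\<theta> a is (\<lambda>l. \<theta> k l F) - \<theta> k is (\<lambda>l. \<theta> a l F) = (\<Sum>j\<in>I. sc (c j a k) (\<theta> j is F))"
    by (rule theta_bracket)
  also have "\<dots> = - (\<Sum>j\<in>I. sc (c j k a) (\<theta> j is F))"
    by (subst c_antisym) (simp add: sum_negf)
  finally have 1: "\<theta> a is (\<lambda>l. \<theta> k l F) =
     \<theta> k is (\<lambda>l. \<theta> a l F) - (\<Sum>j\<in>I. sc (c j k a) (\<theta> j is F))" by (simp add: algebra_simps)
  show ?case
    by (simp add: 1 d_diff Cons.IH theta_diff d_sum d_scale scale_right_diff_distrib sum_subtractf)
qed

text \<open>By Cartan's formula the contraction of d d with k is \<theta> d - d \<theta> + d d
  applied to the contracted form; the first two terms cancel and induction removes the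
  third.\<close>

lemma d_d: "\<dd> is (\<lambda>l. \<dd> l F) = 0"
  by (induction "is" arbitrary: F) (auto simp: d_diff d_theta)

lemma alternating_theta:
  assumes "alternating F"
  shows "alternating (\<lambda>is. \<theta> y is F)"
  unfolding alternating_def
proof (intro allI)
  fix ys k l zs
  show "\<theta> y (ys @ k # l # zs) F = - \<theta> y (ys @ l # k # zs) F"
    using assms
  proof (induction ys arbitrary: F)
    case Nil
    have "\<theta> y zs (\<lambda>x. F (k # l # x)) = - \<theta> y zs (\<lambda>x. F (l # k # x))"
      using alternating_swap[OF Nil, of k l] by (simp add: theta_uminus)
    moreover have "(\<Sum>j\<in>I. sc (c j y b) (F (a # j # zs))) = - (\<Sum>j\<in>I. sc (c j y b) (F (j # a # zs)))" for a b
    proof -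
      have "F (a # j # zs) = - F (j # a # zs)" for j by (rule alternating_swap[OF Nil])
      then have "(\<Sum>j\<in>I. sc (c j y b) (F (a # j # zs))) = (\<Sum>j\<in>I. sc (c j y b) (- F (j # a # zs)))"
        by (intro sum.cong refl arg_cong2[of _ _ _ _ sc])
      then show ?thesis by (simp add: sum_negf)
    qed
    note S = this
    \<comment> \<open>Swapping the first two indices exchanges the two sums over structure
      constants, hence the crossed order of s' and t'.\<close>
    have "p - s - t = - (p' - t' - s')" if "p = - p'" "s = - s'" "t = - t'"
      for p s t p' s' t' :: 'a using that by simp
    from this[OF calculation S S[symmetric, THEN minus_equation_iff[THEN iffD1], symmetric]]
    show ?case unfolding append_Nil lie_deriv.simps .
  next
    case (Cons i ys)
    have "F (j # ys @ k # l # zs) = - F (j # ys @ l # k # zs)" for j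
      using alternatingD[OF Cons.prems] by (metis append_Cons)
    then show ?case
      using Cons.IH[OF alternating_contract[OF Cons.prems], of i] by (simp add: sum_negf)
  qed
qed

lemma alternating_d:
  assumes "alternating F"
  shows "alternating (\<lambda>is. \<dd> is F)"
  unfolding alternating_def
proof (intro allI)
  fix ys k l zs
  show "\<dd> (ys @ k # l # zs) F = - \<dd> (ys @ l # k # zs) F"
    using assms
  proof (induction ys arbitrary: F)
    case Nil
    have "\<dd> zs (\<lambda>x. F (k # l # x)) = - \<dd> zs (\<lambda>x. F (l # k # x))"
      using alternating_swap[OF Nil, of k l] by (simp add: d_uminus)
    moreover have "(\<Sum>j\<in>I. sc (c j k l) (F (j # zs))) = - (\<Sum>j\<in>I. sc (c j l k) (F (j # zs)))"
      by (subst c_antisym) (simp add: sum_negf)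
    moreover have "t - r - (t' - p) = - (t' - (t - p'))" if "p = - p'" "r = 0" for t r t' p p' :: 'a
      using that by simp
    ultimately show ?case by (simp add: algebra_simps)
  next
    case (Cons i ys)
    show ?case
      using Cons.IH[OF alternating_contract[OF Cons.prems], of i]
        alternatingD[OF alternating_theta[OF Cons.prems], of i ys k l zs] by simp
  qed
qed

section \<open>Exterior multiplication by a one-form with invariant coefficients\<close>

context
  fixes a :: "nat \<Rightarrow> 'a \<Rightarrow> 'a"
  assumes a_add: "a k (x + y) = a k x + a k y"
    and a_scale: "a k (sc r x) = sc r (a k x)"
    and a_D: "D l (a k x) = a k (D l x)"
begin

lemma a_sum: "a k (sum f A) = (\<Sum>x\<in>A. a k (f x))"
  by (induction A rule: infinite_finite_induct)
     (auto simp: a_add additive_uminus(2)[of "a k", OF a_add])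

lemmas a_diff = additive_uminus(3)[of "a k" for k, OF a_add]

lemma wedge_scale: "wedge a is (\<lambda>l. sc r (F l)) = sc r (wedge a is F)"
  by (induction "is" arbitrary: F) (auto simp: a_scale scale_right_diff_distrib)

lemma theta_operator: "\<theta> k is (\<lambda>l. a i (F l)) = a i (\<theta> k is F)"
  by (induction "is" arbitrary: F) (auto simp: a_D a_diff a_sum a_scale)

lemma theta_wedge:
  "\<theta> k is (\<lambda>l. wedge a l F) =
    wedge a is (\<lambda>l. \<theta> k l F) - wedge (\<lambda>l x. \<Sum>j\<in>I. sc (c j k l) (a j x)) is F"
proof (induction "is" arbitrary: F)
  case (Cons i "is")
  then show ?case
    by (simp add: theta_diff theta_operator wedge_diff[OF a_add] wedge_sum[OF a_add] wedge_scale
        a_diff a_sum a_scale scale_right_diff_distrib sum_subtractf)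
qed (simp add: D_uminus(2))

lemma d_operator: "\<dd> is (\<lambda>l. a i (F l)) = a i (\<dd> is F)"
  by (induction "is" arbitrary: F)
     (auto simp: a_diff theta_operator additive_uminus(2)[of "a i", OF a_add])

text \<open>The Leibniz rule d(a \<and> F) + a \<and> dF = da \<and> F in recursive form: since the
  \<open>a k\<close> commute with \<open>D\<close>, the two-form da consists of structure constants
  alone, and the first summand is its contraction with \<open>k\<close>.\<close>

lemma d_wedge_Cons:
  "\<dd> (k # is) (\<lambda>l. wedge a l F) + wedge a (k # is) (\<lambda>l. \<dd> l F) =
    - wedge (\<lambda>l x. \<Sum>j\<in>I. sc (c j k l) (a j x)) is F
    + (\<dd> is (\<lambda>l. wedge a l (\<lambda>l. F (k # l))) + wedge a is (\<lambda>l. \<dd> l (\<lambda>l. F (k # l))))"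
  by (simp add: theta_wedge d_diff d_operator wedge_diff[OF a_add])

end

lemma d_outside:
  assumes "\<And>k x. k \<notin> I \<Longrightarrow> D k x = 0" "\<And>j k l. k \<notin> I \<or> l \<notin> I \<Longrightarrow> c j k l = 0"
    and "\<And>is. length is \<noteq> q \<or> \<not> set is \<subseteq> I \<Longrightarrow> F is = 0"
    and "length is \<noteq> Suc q \<or> \<not> set is \<subseteq> I"
  shows "\<dd> is F = 0"
proof -
  have T: "\<theta> k is F = 0" if "\<And>is. length is \<noteq> q \<or> \<not> set is \<subseteq> I \<Longrightarrow> F is = 0"
    and "length is \<noteq> q \<or> \<not> set is \<subseteq> I \<or> k \<notin> I" for k "is" F q
    using that
  proof (induction "is" arbitrary: F q)
    case Nil
    then show ?case using assms(1) by (cases "q = 0") (auto simp: D_uminus(2))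
  next
    case (Cons i "is")
    have "\<theta> k is (\<lambda>l. F (i # l)) = 0"
    proof (cases q)
      case 0
      then have "(\<lambda>l. F (i # l)) = (\<lambda>l. 0)" using Cons.prems(1) by auto
      then show ?thesis by (simp add: theta_zero)
    next
      case (Suc r)
      show ?thesis
      proof (cases "i \<in> I")
        case True
        show ?thesis
          using Cons.prems True Suc by (intro Cons.IH[of r]) auto
      next
        case False
        then have "(\<lambda>l. F (i # l)) = (\<lambda>l. 0)" using Cons.prems(1) by auto
        then show ?thesis by (simp add: theta_zero)
      qed
    qed
    moreover have "sc (c j k i) (F (j # is)) = 0" if "j \<in> I" for j
    proof (cases "i \<in> I \<and> k \<in> I")
      case True
      then have "F (j # is) = 0" using that Cons.prems by auto
      then show ?thesis by simp
    next
      case False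
      then have "c j k i = 0" using assms(2) by blast
      then show ?thesis by simp
    qed
    ultimately show ?case by simp
  qed
  show ?thesis using assms(3,4)
  proof (induction "is" arbitrary: F q)
    case (Cons k "is")
    have "\<theta> k is F = 0" using Cons.prems by (intro T[of q]) auto
    moreover have "\<dd> is (\<lambda>l. F (k # l)) = 0"
    proof (cases "q = 0 \<or> k \<notin> I")
      case True
      then have "(\<lambda>l. F (k # l)) = (\<lambda>l. 0)" using Cons.prems(1) by fastforce
      then show ?thesis by (simp add: d_zero)
    next
      case False
      then show ?thesis using Cons.prems by (intro Cons.IH[of "q - 1"]) auto
    qed
    ultimately show ?case by simp
  qed simp
qed

end

text \<open>A map compatible with the coefficients commutes with the differential. It is only required
  to be additive on a subspace, since the maps between rings of series below are given by
  substitutions that make sense for series in the right variables only.\<close>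

lemma ce_diff_natural:
  assumes ce: "ce_module I c sc D"
    and S: "module.subspace sc S" "\<And>k x. x \<in> S \<Longrightarrow> D k x \<in> S"
    and h: "\<And>x y. x \<in> S \<Longrightarrow> y \<in> S \<Longrightarrow> h (x + y) = h x + h y"
      "\<And>a x. x \<in> S \<Longrightarrow> h (sc a x) = sc' a (h x)"
      "\<And>k x. x \<in> S \<Longrightarrow> h (D k x) = D' k (h x)"
    and F: "\<And>is. F is \<in> S"
  shows "h (ce_diff I c sc D is F) = ce_diff I c sc' D' is (\<lambda>l. h (F l))"
    and "ce_diff I c sc D is F \<in> S"
proof -
  interpret ce_module I c sc D by fact
  have h0: "h 0 = 0" using h(1)[of 0 0] subspace_0[OF S(1)] by simp
  have hm: "h (- x) = - h x" if "x \<in> S" for x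
    using h(1)[OF that subspace_neg[OF S(1) that]] h0 by (simp add: eq_neg_iff_add_eq_0 add.commute)
  have hd: "h (x - y) = h x - h y" if "x \<in> S" "y \<in> S" for x y
    using h(1)[OF that(1) subspace_neg[OF S(1) that(2)]] hm[OF that(2)] by simp
  have hs: "h (sum f A) = (\<Sum>x\<in>A. h (f x))" if "\<And>x. x \<in> A \<Longrightarrow> f x \<in> S" for f and A :: "nat set"
    using that
  proof (induction A rule: infinite_finite_induct)
    case (insert x A)
    then have "sum f A \<in> S" by (intro subspace_sum[OF S(1)]) auto
    then show ?case using insert by (simp add: h(1))
  qed (auto simp: h0)
  have T: "h (\<theta> k is F) = lie_deriv I c sc' D' k is (\<lambda>l. h (F l)) \<and> \<theta> k is F \<in> S"
    if "\<And>is. F is \<in> S" for k "is" F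
    using that
  proof (induction "is" arbitrary: F)
    case (Cons i "is")
    have 1: "sc (c j k i) (F (j # is)) \<in> S" for j
      using Cons.prems subspace_scale[OF S(1)] by blast
    then have 2: "(\<Sum>j\<in>I. sc (c j k i) (F (j # is))) \<in> S" by (intro subspace_sum[OF S(1)])
    show ?case using Cons.IH[of "\<lambda>l. F (i # l)"] Cons.prems subspace_diff[OF S(1) _ 2]
      by (simp add: hd 2 hs 1 h(2))
  qed (auto simp: h(3) S(2))
  have "h (\<dd> is F) = ce_diff I c sc' D' is (\<lambda>l. h (F l)) \<and> \<dd> is F \<in> S"
    using F
  proof (induction "is" arbitrary: F)
    case (Cons i "is")
    then show ?case using T[of F i "is"] Cons.IH[of "\<lambda>l. F (i # l)"]
      by (auto simp: hd subspace_diff[OF S(1)])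
  qed (auto simp: h0 subspace_0[OF S(1)])
  then show "h (\<dd> is F) = ce_diff I c sc' D' is (\<lambda>l. h (F l))" "\<dd> is F \<in> S" by auto
qed

lemma lie_deriv_split:
  "lie_deriv I c sc D k is F = lie_deriv I c sc (\<lambda>_ _. 0) k is F + D k (F is)"
  by (induction "is" arbitrary: F) auto

text \<open>Separates the part of the differential that knows only the structure constants, and so
  commutes with any linear map of coefficients, from the part that differentiates them.\<close>

lemma ce_diff_split:
  "ce_diff I c sc D is F = ce_diff I c sc (\<lambda>_ _. 0) is F + wedge D is F"
proof (induction "is" arbitrary: F)
  case (Cons k "is")
  show ?case by (simp add: Cons lie_deriv_split[of I c sc D])
qed simp

section \<open>Mixed derivatives as forms: trading a group direction for a form index\<close>

context structure_constants
begin

lemma trivial_ce_module: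
  assumes "module sc"
  shows "ce_module I c sc (\<lambda>_ _. 0)"
proof -
  interpret module sc by fact
  show ?thesis by unfold_locales (auto simp: scale_right_distrib)
qed

definition fscale :: "'k \<Rightarrow> (nat list \<Rightarrow> 'k) \<Rightarrow> nat list \<Rightarrow> 'k" where
  "fscale a \<phi> = (\<lambda>js. a * \<phi> js)"

lemma module_fscale: "module fscale"
  by unfold_locales (auto simp: fscale_def algebra_simps)

sublocale triv: ce_module I c fscale "\<lambda>_ _. 0"
  by (rule trivial_ce_module[OF module_fscale])

lemma module_times: "module ((*) :: 'k \<Rightarrow> 'k \<Rightarrow> 'k)"
  by unfold_locales (auto simp: algebra_simps)

sublocale trivK: ce_module I c "(*)" "\<lambda>_ _. 0"
  by (rule trivial_ce_module[OF module_times])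

definition append_index :: "nat \<Rightarrow> (nat list \<Rightarrow> 'k) \<Rightarrow> nat list \<Rightarrow> 'k" where
  "append_index k \<phi> = (\<lambda>js. \<phi> (js @ [k]))"

text \<open>A function of two lists stands for a family of mixed derivatives (first \<open>is\<close>, the indices of
  a form, then \<open>js\<close>, the directions of differentiation in the group variables). The following
  operator turns the last group variable into a form index.\<close>

definition shift_index :: "(nat list \<Rightarrow> nat list \<Rightarrow> 'k) \<Rightarrow> nat list \<Rightarrow> nat list \<Rightarrow> 'k" where
  "shift_index h is = wedge append_index is h"

definition d0 :: "(nat list \<Rightarrow> nat list \<Rightarrow> 'k) \<Rightarrow> nat list \<Rightarrow> nat list \<Rightarrow> 'k" where
  "d0 h is = ce_diff I c fscale (\<lambda>_ _. 0) is h"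

lemma append_index_add: "append_index k (x + y) = append_index k x + append_index k y"
  by (auto simp: append_index_def)

lemma append_index_scale: "append_index k (fscale a x) = fscale a (append_index k x)"
  by (auto simp: append_index_def fscale_def)

lemma sum_fun_apply: "(sum f A) x = (\<Sum>a\<in>A. f a x)"
  by (induction A rule: infinite_finite_induct) auto

lemma shift_index_Nil: "shift_index h [] js = 0"
  by (simp add: shift_index_def)

lemma shift_index_Cons:
  "shift_index h (k # is) js = h is (js @ [k]) - shift_index (\<lambda>l. h (k # l)) is js"
  by (simp add: shift_index_def append_index_def)

lemma shift_index_add:
  "shift_index (\<lambda>is js. h is js + h' is js) is js = shift_index h is js + shift_index h' is js"
  by (induction "is" arbitrary: h h') (auto simp: shift_index_Nil shift_index_Cons)

lemma shift_index_scale: "shift_index (\<lambda>is js. a * h is js) is js = a * shift_index h is js"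
  by (induction "is" arbitrary: h) (auto simp: shift_index_Nil shift_index_Cons algebra_simps)

lemma shift_index_sum:
  "shift_index (\<lambda>is js. \<Sum>x\<in>A. h x is js) is js = (\<Sum>x\<in>A. shift_index (h x) is js)"
  by (induction "is" arbitrary: h) (auto simp: shift_index_Nil shift_index_Cons sum_subtractf)

text \<open>Identities between mixed derivatives are only available for lists of directions of a
  fixed length. Each shift uses up one direction, so this is enough to rewrite under it.\<close>

lemma shift_index_local:
  assumes "\<And>is js. length js = Suc n \<Longrightarrow> h is js = h' is js" "length js = n"
  shows "shift_index h is js = shift_index h' is js"
  using assms(1)
proof (induction "is" arbitrary: h h')
  case (Cons k "is")
  show ?case
    using Cons.IH[of "\<lambda>l. h (k # l)" "\<lambda>l. h' (k # l)"] Cons.prems assms(2)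
    by (simp add: shift_index_Cons)
qed (simp add: shift_index_Nil)

lemma shift_index_pow_local:
  assumes "\<And>is js. length js = n + r \<Longrightarrow> h is js = h' is js" "length js = n"
  shows "(shift_index ^^ r) h is js = (shift_index ^^ r) h' is js"
  using assms
proof (induction r arbitrary: n js "is")
  case (Suc r)
  show ?case using Suc.prems
    by (simp, intro shift_index_local[of n]) (auto intro!: Suc.IH)
qed simp

lemma shift_index_pow_add:
  "(shift_index ^^ r) (\<lambda>is js. h is js + h' is js) is js =
    (shift_index ^^ r) h is js + (shift_index ^^ r) h' is js"
proof -
  have "(shift_index ^^ r) (\<lambda>is js. h is js + h' is js) =
    (\<lambda>is js. (shift_index ^^ r) h is js + (shift_index ^^ r) h' is js)"
    by (induction r) (simp_all add: shift_index_add[abs_def])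
  then show ?thesis by simp
qed

lemma shift_index_pow_scale:
  "(shift_index ^^ r) (\<lambda>is js. a * h is js) is js = a * (shift_index ^^ r) h is js"
proof -
  have "(shift_index ^^ r) (\<lambda>is js. a * h is js) = (\<lambda>is js. a * (shift_index ^^ r) h is js)"
    by (induction r) (simp_all add: shift_index_scale[abs_def])
  then show ?thesis by simp
qed

lemma shift_index_pow_sum:
  "(shift_index ^^ r) (\<lambda>is js. \<Sum>x\<in>A. h x is js) is js = (\<Sum>x\<in>A. (shift_index ^^ r) (h x) is js)"
proof -
  have "(shift_index ^^ r) (\<lambda>is js. \<Sum>x\<in>A. h x is js) =
      (\<lambda>is js. \<Sum>x\<in>A. (shift_index ^^ r) (h x) is js)"
    by (induction r) (simp_all add: shift_index_sum[abs_def])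
  then show ?thesis by simp
qed

lemma alternating_shift_index: "alternating h \<Longrightarrow> alternating (shift_index h)"
  using alternating_wedge[of append_index h, OF append_index_add] by (simp add: shift_index_def[abs_def])

lemma alternating_shift_index_pow: "alternating h \<Longrightarrow> alternating ((shift_index ^^ r) h)"
  by (induction r) (auto intro: alternating_shift_index)

lemma shift_index_outside:
  assumes "\<And>is js. length is \<noteq> q \<or> \<not> set is \<subseteq> I \<or> \<not> set js \<subseteq> I \<Longrightarrow> h is js = 0"
    and "length is \<noteq> Suc q \<or> \<not> set is \<subseteq> I \<or> \<not> set js \<subseteq> I"
  shows "shift_index h is js = 0"
  using assms
proof (induction "is" arbitrary: h q)
  case (Cons k "is")
  have "h is (js @ [k]) = 0" using Cons.prems by (intro Cons.prems(1)) auto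
  moreover have "shift_index (\<lambda>l. h (k # l)) is js = 0"
  proof (cases "q = 0 \<or> k \<notin> I")
    case True
    then have "(\<lambda>l. h (k # l)) = (\<lambda>l js. 0 * h l js)" using Cons.prems(1) by fastforce
    then show ?thesis using shift_index_scale[of 0 h] by simp
  next
    case False
    then show ?thesis using Cons.prems by (intro Cons.IH[of "q - 1"]) auto
  qed
  ultimately show ?case by (simp add: shift_index_Cons)
qed (simp add: shift_index_Nil)

lemma shift_index_pow_outside:
  assumes "\<And>is js. length is \<noteq> q \<or> \<not> set is \<subseteq> I \<or> \<not> set js \<subseteq> I \<Longrightarrow> h is js = 0"
    and "length is \<noteq> q + r \<or> \<not> set is \<subseteq> I \<or> \<not> set js \<subseteq> I"
  shows "(shift_index ^^ r) h is js = 0"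
  using assms(2)
proof (induction r arbitrary: "is" js)
  case 0
  then show ?case using assms(1) by simp
next
  case (Suc r)
  show ?case using Suc.prems
    by (simp, intro shift_index_outside[of "q + r"]) (auto intro!: Suc.IH)
qed

lemma d0_apply: "d0 h is js = trivK.\<dd> is (\<lambda>l. h l js)"
  unfolding d0_def
  by (rule ce_diff_natural(1)[OF triv.ce_module_axioms, where S = UNIV and h = "\<lambda>\<phi>. \<phi> js"])
     (auto simp: fscale_def triv.subspace_UNIV)

text \<open>The anticommutator of the differential with trivial coefficients and the shift. By the
  Leibniz rule it is exterior multiplication by a two-form of structure constants that appends a
  single direction.\<close>

definition d0_comm :: "(nat list \<Rightarrow> nat list \<Rightarrow> 'k) \<Rightarrow> nat list \<Rightarrow> nat list \<Rightarrow> 'k" where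
  "d0_comm h is js = d0 (shift_index h) is js + shift_index (d0 h) is js"

lemma d0_comm_Nil: "d0_comm h [] js = 0"
  by (simp add: d0_comm_def d0_def shift_index_Nil)

lemma d0_comm_Cons:
  "d0_comm h (k # is) js =
    d0_comm (\<lambda>l. h (k # l)) is js
    - wedge (\<lambda>l x. \<Sum>j\<in>I. fscale (c j k l) (append_index j x)) is h js"
proof -
  have *: "shift_index h = (\<lambda>l. wedge append_index l h)" "d0 h = (\<lambda>l. triv.\<dd> l h)" for h
    by (auto simp: fun_eq_iff shift_index_def d0_def)
  have "d0_comm h is js = (triv.\<dd> is (\<lambda>l. wedge append_index l h) +
      wedge append_index is (\<lambda>l. triv.\<dd> l h)) js" for h "is"
    by (simp only: d0_comm_def * plus_fun_def)
  then show ?thesis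
    using fun_cong[OF triv.d_wedge_Cons[of append_index k "is" h,
        OF append_index_add append_index_scale], of js]
    by (simp only: plus_fun_def fun_Compl_def) (simp add: append_index_def zero_fun_def)
qed

text \<open>The two shifts place the new direction after, respectively before, \<open>k\<close>; the
  commutation rule for the last two directions turns the difference into structure
  constants.\<close>

lemma shift_index_antisym:
  assumes "\<And>is l. h'' is (js @ [k, l]) - h'' is (js @ [l, k]) = (\<Sum>j\<in>I. c j k l * h is (js @ [j]))"
  shows "shift_index h'' is (js @ [k]) - shift_index (\<lambda>l js. h'' l (js @ [k])) is js =
     wedge (\<lambda>l x. \<Sum>j\<in>I. fscale (c j k l) (append_index j x)) is h js"
  using assms
proof (induction "is" arbitrary: h'' h)
  case (Cons a "is")
  have "shift_index h'' (a # is) (js @ [k]) - shift_index (\<lambda>l js. h'' l (js @ [k])) (a # is) js =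
    (h'' is (js @ [k, a]) - h'' is (js @ [a, k])) -
    (shift_index (\<lambda>l. h'' (a # l)) is (js @ [k]) - shift_index (\<lambda>l js. h'' (a # l) (js @ [k])) is js)"
    by (simp add: shift_index_Cons)
  also have "\<dots> = (\<Sum>j\<in>I. fscale (c j k a) (append_index j (h is))) js -
     wedge (\<lambda>l x. \<Sum>j\<in>I. fscale (c j k l) (append_index j x)) is (\<lambda>l. h (a # l)) js"
  proof -
    have "h'' is (js @ [k, a]) - h'' is (js @ [a, k]) =
        (\<Sum>j\<in>I. fscale (c j k a) (append_index j (h is))) js"
      by (simp add: Cons.prems sum_fun_apply fscale_def append_index_def)
    then show ?thesis
      using Cons.IH[of "\<lambda>l. h'' (a # l)" "\<lambda>l. h (a # l)"] Cons.prems by (simp only:)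
  qed
  finally show ?case by simp
qed (simp add: shift_index_Nil)

lemma shift_index_diff:
  "shift_index (\<lambda>is js. h is js - h' is js) is js = shift_index h is js - shift_index h' is js"
  by (induction "is" arbitrary: h h') (auto simp: shift_index_Nil shift_index_Cons)

text \<open>If the last two directions commuted, the square of the shift would vanish by
  antisymmetry. Their commutator makes it minus the two-form behind \<open>d0_comm\<close>; both
  sides satisfy the same recursion.\<close>

lemma shift_shift:
  assumes "\<And>is k l. h'' is (js @ [k, l]) - h'' is (js @ [l, k]) = (\<Sum>j\<in>I. c j k l * h is (js @ [j]))"
  shows "shift_index (shift_index h'') is js = - d0_comm h is js"
  using assms
proof (induction "is" arbitrary: h'' h)
  case (Cons k "is")
  have "shift_index h'' (k # l) = (\<lambda>js. h'' l (js @ [k]) - shift_index (\<lambda>l. h'' (k # l)) l js)" for l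
    by (simp add: shift_index_Cons fun_eq_iff)
  then have "shift_index (shift_index h'') (k # is) js =
     (shift_index h'' is (js @ [k]) - shift_index (\<lambda>l js. h'' l (js @ [k])) is js)
     + shift_index (shift_index (\<lambda>l. h'' (k # l))) is js"
    by (simp add: shift_index_Cons shift_index_diff)
  also have "\<dots> = - d0_comm h (k # is) js"
    using Cons.IH[of "\<lambda>l. h'' (k # l)" "\<lambda>l. h (k # l)"] Cons.prems
    by (simp add: shift_index_antisym[of h'' js k h] d0_comm_Cons)
  finally show ?case .
qed (simp add: shift_index_Nil d0_comm_Nil)

text \<open>The trace that f(G(x, y)) leaves on mixed derivatives: antisymmetrised in one derivative
  along x and one along y, at positions i + 1 and i + 2, it is a single derivative of f along the
  bracket.\<close>

definition merge_rel :: "nat \<Rightarrow> nat \<Rightarrow> (nat list \<Rightarrow> nat list \<Rightarrow> 'k) \<Rightarrow> (nat list \<Rightarrow> nat list \<Rightarrow> 'k) \<Rightarrow> bool" where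
  "merge_rel i n h'' h \<longleftrightarrow> (\<forall>is (js :: nat list) k l rest. length js = i \<longrightarrow> length rest = n \<longrightarrow>
     h'' is (js @ k # l # rest) - h'' is (js @ l # k # rest) = (\<Sum>j\<in>I. c j k l * h is (js @ j # rest)))"

lemma merge_rel_shift_index:
  assumes "merge_rel i (Suc n) h'' h"
  shows "merge_rel i n (shift_index h'') (shift_index h)"
  unfolding merge_rel_def
proof (intro allI impI)
  fix "is" js rest :: "nat list" and k l
  assume len: "length js = i" "length rest = n"
  show "shift_index h'' is (js @ k # l # rest) - shift_index h'' is (js @ l # k # rest) =
     (\<Sum>j\<in>I. c j k l * shift_index h is (js @ j # rest))"
    using assms
  proof (induction "is" arbitrary: h'' h)
    case (Cons a "is")
    have "merge_rel i (Suc n) (\<lambda>l. h'' (a # l)) (\<lambda>l. h (a # l))"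
      using Cons.prems unfolding merge_rel_def by blast
    note IH = Cons.IH[OF this]
    have "h'' is (js @ k # l # rest @ [a]) - h'' is (js @ l # k # rest @ [a]) =
        (\<Sum>j\<in>I. c j k l * h is (js @ j # rest @ [a]))"
      using Cons.prems len unfolding merge_rel_def by force
    then show ?case using IH
      by (simp add: shift_index_Cons right_diff_distrib sum_subtractf algebra_simps)
  qed (simp add: shift_index_Nil)
qed

lemma merge_rel_shift_index_pow:
  "merge_rel i (n + r) h'' h \<Longrightarrow> merge_rel i n ((shift_index ^^ r) h'') ((shift_index ^^ r) h)"
proof (induction r arbitrary: n)
  case (Suc r)
  then have "merge_rel i (Suc n) ((shift_index ^^ r) h'') ((shift_index ^^ r) h)" by simp
  then show ?case by (simp add: merge_rel_shift_index)
qed simp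

lemma shift_shift_pow:
  assumes "merge_rel i n h'' h"
  shows "(shift_index ^^ (i + 2 + n)) h'' is [] = - (shift_index ^^ i) (d0_comm ((shift_index ^^ n) h)) is []"
proof -
  let ?g = "(shift_index ^^ n) h''"
  have "merge_rel i 0 ?g ((shift_index ^^ n) h)"
    using merge_rel_shift_index_pow[of i 0 n] assms by simp
  then have *: "shift_index (shift_index ?g) is js = - 1 * d0_comm ((shift_index ^^ n) h) is js"
    if "length js = i" for "is" js
    using that shift_shift[of ?g js "(shift_index ^^ n) h" "is"] unfolding merge_rel_def by simp
  \<comment> \<open>The innermost n shifts consume the directions behind the merged pair, the next
    two the pair itself, and the outer i those in front of it.\<close>
  have "(shift_index ^^ (i + 2 + n)) h'' is [] = (shift_index ^^ i) (shift_index (shift_index ?g)) is []"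
    unfolding add.assoc funpow_add o_apply numeral_2_eq_2 funpow.simps by simp
  also have "\<dots> = (shift_index ^^ i) (\<lambda>is js. - 1 * d0_comm ((shift_index ^^ n) h) is js) is []"
    by (rule shift_index_pow_local[of 0]) (auto simp only: * list.size add_0)
  also have "\<dots> = - (shift_index ^^ i) (d0_comm ((shift_index ^^ n) h)) is []"
    by (subst shift_index_pow_scale) simp
  finally show ?thesis .
qed

text \<open>With S the shift, moving \<open>d0\<close> through S^p one factor at a time and
  alternating the sign produces one anticommutator per step.\<close>

lemma d0_comm_telescope:
  "(\<Sum>i<p. (- 1) ^ i * (shift_index ^^ i) (d0_comm ((shift_index ^^ (p - 1 - i)) h)) is js) =
    d0 ((shift_index ^^ p) h) is js - (- 1) ^ p * (shift_index ^^ p) (d0 h) is js"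
proof (induction p arbitrary: "is" js)
  case (Suc p)
  let ?S = "\<lambda>is js. \<Sum>i<p. (- 1) ^ i * (shift_index ^^ i) (d0_comm ((shift_index ^^ (p - 1 - i)) h)) is js"
  have IH: "?S = (\<lambda>is js. d0 ((shift_index ^^ p) h) is js - (- 1) ^ p * (shift_index ^^ p) (d0 h) is js)"
    using Suc by blast
  have "(\<Sum>i<Suc p. (- 1) ^ i * (shift_index ^^ i) (d0_comm ((shift_index ^^ (Suc p - 1 - i)) h)) is js) =
    d0_comm ((shift_index ^^ p) h) is js - shift_index ?S is js"
    unfolding sum.lessThan_Suc_shift by (simp add: shift_index_sum shift_index_scale sum_negf)
  also have "\<dots> = d0_comm ((shift_index ^^ p) h) is js
     - (shift_index (d0 ((shift_index ^^ p) h)) is js - (- 1) ^ p * shift_index ((shift_index ^^ p) (d0 h)) is js)"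
    unfolding IH by (simp add: shift_index_diff shift_index_scale)
  finally show ?case unfolding d0_comm_def[of "(shift_index ^^ p) h"] by simp
qed simp

text \<open>Here \<open>h\<close>, \<open>h\<^sub>\<delta>\<close>, \<open>h\<^sub>d\<close> are to be the mixed derivatives of a bigraded cochain with \<open>p\<close> group
  variables and of its two differentials, and \<open>h'' i\<close> those of its image under the face map that
  multiplies the group variables \<open>i + 1\<close> and \<open>i + 2\<close>.\<close>

theorem shift_index_chain_map:
  assumes face: "\<And>i. i < p \<Longrightarrow> merge_rel i (p - 1 - i) (h'' i) h"
    and h\<delta>: "\<And>is js. length js = Suc p \<Longrightarrow>
      h\<^sub>\<delta> is js = (\<Sum>i<p. (- 1) ^ Suc i * h'' i is js) + (- 1) ^ Suc p * h is js"
    and hd: "\<And>is js. length js = p \<Longrightarrow> h\<^sub>d is js = d0 h is js + shift_index h is js"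
  shows "(shift_index ^^ Suc p) h\<^sub>\<delta> is [] + (- 1) ^ p * (shift_index ^^ p) h\<^sub>d is [] =
    trivK.\<dd> is (\<lambda>l. (shift_index ^^ p) h l [])"
proof -
  have "(shift_index ^^ Suc p) h\<^sub>\<delta> is [] =
      (shift_index ^^ Suc p) (\<lambda>is js. (\<Sum>i<p. (- 1) ^ Suc i * h'' i is js) + (- 1) ^ Suc p * h is js) is []"
    by (rule shift_index_pow_local[of 0]) (auto simp only: h\<delta> list.size add_0)
  also have "\<dots> = (\<Sum>i<p. (- 1) ^ Suc i * (shift_index ^^ Suc p) (h'' i) is [])
      + (- 1) ^ Suc p * (shift_index ^^ Suc p) h is []"
    by (simp only: shift_index_pow_add shift_index_pow_sum shift_index_pow_scale)
  \<comment> \<open>The minus sign of \<open>shift_shift_pow\<close> combines with (-1)^(i+1) to the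
    sign that the telescoping sum requires.\<close>
  also have "(\<Sum>i<p. (- 1) ^ Suc i * (shift_index ^^ Suc p) (h'' i) is []) =
     (\<Sum>i<p. (- 1) ^ i * (shift_index ^^ i) (d0_comm ((shift_index ^^ (p - 1 - i)) h)) is [])"
  proof (rule sum.cong[OF refl])
    fix i assume "i \<in> {..<p}"
    then have i: "i < p" by simp
    then have "Suc p = i + 2 + (p - 1 - i)" by simp
    then have "(shift_index ^^ Suc p) (h'' i) is [] =
        - (shift_index ^^ i) (d0_comm ((shift_index ^^ (p - 1 - i)) h)) is []"
      using shift_shift_pow[OF face[OF i], of "is"] by (simp only:)
    then show "(- 1) ^ Suc i * (shift_index ^^ Suc p) (h'' i) is [] =
        (- 1) ^ i * (shift_index ^^ i) (d0_comm ((shift_index ^^ (p - 1 - i)) h)) is []"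
      by simp
  qed
  also have "\<dots> = d0 ((shift_index ^^ p) h) is [] - (- 1) ^ p * (shift_index ^^ p) (d0 h) is []"
    by (rule d0_comm_telescope)
  finally have 1: "(shift_index ^^ Suc p) h\<^sub>\<delta> is [] = d0 ((shift_index ^^ p) h) is []
     - (- 1) ^ p * (shift_index ^^ p) (d0 h) is [] + (- 1) ^ Suc p * (shift_index ^^ Suc p) h is []" .
  have "(shift_index ^^ p) h\<^sub>d is [] = (shift_index ^^ p) (\<lambda>is js. d0 h is js + shift_index h is js) is []"
    by (rule shift_index_pow_local[of 0]) (auto simp only: hd list.size add_0)
  also have "\<dots> = (shift_index ^^ p) (d0 h) is [] + (shift_index ^^ Suc p) h is []"
    by (simp only: shift_index_pow_add funpow_Suc_right o_apply)
  \<comment> \<open>With S the shift: the last face contributes (-1)^(p+1) S^(p+1) h and the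
    differentiating part of the exterior derivative (-1)^p S^(p+1) h; the terms S^p d0 h also
    cancel, so that d0 S^p h is left.\<close>
  finally show ?thesis unfolding 1 d0_apply by (simp add: algebra_simps)
qed

end

section \<open>Power series in several variables\<close>

lemma mcoeff_zero [simp]: "mcoeff 0 b = 0"
  by (simp add: zero_mfps_def)

lemma mcoeff_one: "mcoeff 1 b = (if b = 0 then 1 else 0)"
  by (simp add: one_mfps_def)

lemma mcoeff_add [simp]: "mcoeff (f + g) b = mcoeff f b + mcoeff g b"
  by (simp add: plus_mfps_def)

lemma mcoeff_uminus [simp]: "mcoeff (- f) b = - mcoeff f b"
  by (simp add: uminus_mfps_def)

lemma mcoeff_diff [simp]: "mcoeff (f - g) b = mcoeff f b - mcoeff g b"
  by (simp add: minus_mfps_def)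

lemma mcoeff_mult: "mcoeff (f * g) b = (\<Sum>(a, c)\<in>splits b. mcoeff f a * mcoeff g c)"
  by (simp add: times_mfps_def)

lemma mcoeff_sum [simp]: "mcoeff (sum f A) b = (\<Sum>x\<in>A. mcoeff (f x) b)"
  by (induction A rule: infinite_finite_induct) auto

lemma mcoeff_const: "mcoeff (mconst c) b = (if b = 0 then c else 0)"
  by (simp add: mconst_def)

lemma mcoeff_var: "mcoeff (mvar v) b = (if b = Poly_Mapping.single v 1 then 1 else 0)"
  by (simp add: mvar_def)

lemma mcoeff_const_mult [simp]:
  fixes f :: "('v, 'a::comm_ring_1) mfps"
  shows "mcoeff (mconst c * f) b = c * mcoeff f b"
proof -
  have "mcoeff (mconst c * f) b =
      (\<Sum>(a, d)\<in>{(0, b)}. mcoeff (mconst c :: ('v, 'a) mfps) a * mcoeff f d)"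
    unfolding mcoeff_mult
    by (rule sum.mono_neutral_right, rule finite_splits) (auto simp: splits_def mcoeff_const split: if_splits)
  then show ?thesis by (simp add: mcoeff_const)
qed

lemma mconst_simps:
  "mconst (a + b) = mconst a + mconst b" "mconst (a * b) = mconst a * mconst b"
  "mconst 0 = 0" "mconst 1 = 1" "mconst (- a) = - mconst a"
  by (auto intro!: mfps_eqI simp: mcoeff_const mcoeff_one)

lemma multi_index_add_eq_0_iff: "a + c = 0 \<longleftrightarrow> a = 0 \<and> c = (0 :: 'v \<Rightarrow>\<^sub>0 nat)"
  by (metis add_is_0 add_0 lookup_add lookup_zero poly_mapping_eqI)

lemma mcoeff_mult_0 [simp]:
  fixes f g :: "('v, 'a::comm_ring_1) mfps"
  shows "mcoeff (f * g) 0 = mcoeff f 0 * mcoeff g 0"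
proof -
  have "splits (0 :: 'v \<Rightarrow>\<^sub>0 nat) = {(0, 0)}"
    by (auto simp: splits_def multi_index_add_eq_0_iff)
  then show ?thesis by (simp add: mcoeff_mult)
qed

definition deg_in :: "'v set \<Rightarrow> ('v \<Rightarrow>\<^sub>0 nat) \<Rightarrow> nat" where
  "deg_in S b = (\<Sum>v\<in>Poly_Mapping.keys b \<inter> S. Poly_Mapping.lookup b v)"

lemma deg_in_superset:
  assumes "finite K" "Poly_Mapping.keys b \<subseteq> K"
  shows "deg_in S b = (\<Sum>v\<in>K \<inter> S. Poly_Mapping.lookup b v)"
  unfolding deg_in_def using assms
  by (intro sum.mono_neutral_left) (auto simp: in_keys_iff)

lemma total_deg_conv: "total_deg b = deg_in UNIV b"
  by (simp add: total_deg_def deg_in_def)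

lemma keys_add_nat: "Poly_Mapping.keys (a + b :: 'v \<Rightarrow>\<^sub>0 nat) = Poly_Mapping.keys a \<union> Poly_Mapping.keys b"
  by (auto simp: in_keys_iff lookup_add)

lemma deg_in_add [simp]: "deg_in S (a + b) = deg_in S a + deg_in S b"
proof -
  have "finite (Poly_Mapping.keys a \<union> Poly_Mapping.keys b)" by simp
  from deg_in_superset[OF this] show ?thesis
    by (simp add: keys_add_nat lookup_add sum.distrib)
qed

lemma deg_in_single: "deg_in S (Poly_Mapping.single v n) = (if v \<in> S then n else 0)"
  by (cases "n = 0") (auto simp: deg_in_def)

lemma deg_in_zero [simp]: "deg_in S 0 = 0"
  by (simp add: deg_in_def)

lemma total_deg_add [simp]: "total_deg (a + b) = total_deg a + total_deg b"
  by (simp add: total_deg_conv)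

lemma total_deg_single [simp]: "total_deg (Poly_Mapping.single v n) = n"
  by (simp add: total_deg_conv deg_in_single)

lemma total_deg_zero [simp]: "total_deg 0 = 0"
  by (simp add: total_deg_def)

lemma total_deg_eq_0_iff: "total_deg b = 0 \<longleftrightarrow> b = 0"
proof
  assume "total_deg b = 0"
  then have "\<forall>v\<in>Poly_Mapping.keys b. Poly_Mapping.lookup b v = 0" by (simp add: total_deg_def)
  then have "Poly_Mapping.keys b = {}" by (metis all_not_in_conv in_keys_iff)
  then show "b = 0" by simp
qed auto

lemma lookup_le_total_deg: "Poly_Mapping.lookup b v \<le> total_deg b"
proof (cases "v \<in> Poly_Mapping.keys b")
  case True
  then show ?thesis unfolding total_deg_def by (intro member_le_sum) auto
qed (simp add: in_keys_iff)

definition midx :: "'v set \<Rightarrow> nat \<Rightarrow> ('v \<Rightarrow>\<^sub>0 nat) set" where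
  "midx V N = {a. Poly_Mapping.keys a \<subseteq> V \<and> total_deg a \<le> N}"

lemma finite_midx:
  assumes "finite V"
  shows "finite (midx V N)"
proof -
  have "finite {f. \<forall>x. (x \<in> V \<longrightarrow> f x \<in> {..N}) \<and> (x \<notin> V \<longrightarrow> f x = (0 :: nat))}"
    using assms by (intro finite_set_of_finite_funs) auto
  moreover have "Poly_Mapping.lookup ` midx V N \<subseteq>
     {f. \<forall>x. (x \<in> V \<longrightarrow> f x \<in> {..N}) \<and> (x \<notin> V \<longrightarrow> f x = 0)}"
    by (auto simp: midx_def intro: order_trans[OF lookup_le_total_deg]) (metis in_keys_iff subsetD)
  ultimately have "finite (Poly_Mapping.lookup ` midx V N)" using finite_subset by blast
  then show ?thesis by (rule finite_imageD) (meson inj_onI poly_mapping.lookup_inject)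
qed

definition has_order :: "nat \<Rightarrow> ('v, 'a::zero) mfps \<Rightarrow> bool" where
  "has_order n f \<longleftrightarrow> (\<forall>b. total_deg b < n \<longrightarrow> mcoeff f b = 0)"

lemma has_order_mult:
  assumes "has_order m f" "has_order n g"
  shows "has_order (m + n) (f * g)"
proof -
  have "mcoeff f a * mcoeff g c = 0" if "total_deg (a + c) < m + n" for a c
  proof -
    have "total_deg a < m \<or> total_deg c < n" using that by auto
    then show ?thesis using assms by (auto simp: has_order_def)
  qed
  then have "mcoeff (f * g) b = 0" if "total_deg b < m + n" for b
    unfolding mcoeff_mult using that by (intro sum.neutral) (auto simp: splits_def simp del: total_deg_add)
  then show ?thesis by (simp add: has_order_def)
qed

lemma has_order_0 [simp]: "has_order 0 f"
  by (simp add: has_order_def)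

lemma has_order_1: "has_order (Suc 0) f \<longleftrightarrow> mcoeff f 0 = 0"
  by (auto simp: has_order_def total_deg_eq_0_iff)

lemma has_order_power: "has_order m f \<Longrightarrow> has_order (n * m) (f ^ n)"
  by (induction n) (auto intro: has_order_mult)

lemma has_order_add: "has_order n f \<Longrightarrow> has_order n g \<Longrightarrow> has_order n (f + g)"
  by (simp add: has_order_def)

lemma has_order_sum: "(\<And>x. x \<in> A \<Longrightarrow> has_order n (f x)) \<Longrightarrow> has_order n (sum f A)"
  by (simp add: has_order_def)

lemma has_order_prod:
  assumes "\<And>x. x \<in> A \<Longrightarrow> has_order (n x) (f x)"
  shows "has_order (sum n A) (prod f A)"
  using assms by (induction A rule: infinite_finite_induct) (auto intro: has_order_mult)

definition spow :: "('v \<Rightarrow> 'b::comm_monoid_mult) \<Rightarrow> ('v \<Rightarrow>\<^sub>0 nat) \<Rightarrow> 'b" where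
  "spow s a = (\<Prod>v\<in>Poly_Mapping.keys a. s v ^ Poly_Mapping.lookup a v)"

lemma spow_superset:
  assumes "finite K" "Poly_Mapping.keys a \<subseteq> K"
  shows "spow s a = (\<Prod>v\<in>K. s v ^ Poly_Mapping.lookup a v)"
  unfolding spow_def using assms
  by (intro prod.mono_neutral_left) (auto simp: in_keys_iff)

lemma spow_add: "spow s (a + b) = spow s a * spow s b"
proof -
  let ?K = "Poly_Mapping.keys a \<union> Poly_Mapping.keys b"
  have "spow s x = (\<Prod>v\<in>?K. s v ^ Poly_Mapping.lookup x v)" if "Poly_Mapping.keys x \<subseteq> ?K" for x
    using that by (intro spow_superset) auto
  then show ?thesis
    by (simp add: keys_add_nat lookup_add prod.distrib power_add)
qed

lemma spow_zero [simp]: "spow s 0 = 1"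
  by (simp add: spow_def)

lemma spow_single [simp]: "spow s (Poly_Mapping.single v (Suc 0)) = s v"
  by (simp add: spow_def)

lemma multi_index_induct [consumes 1, case_names zero add]:
  fixes a :: "'v \<Rightarrow>\<^sub>0 nat"
  assumes "Poly_Mapping.keys a \<subseteq> V" "P 0"
    and step: "\<And>a v. Poly_Mapping.keys a \<subseteq> V \<Longrightarrow> v \<in> V \<Longrightarrow> P a \<Longrightarrow> P (a + Poly_Mapping.single v 1)"
  shows "P a"
  using assms(1)
proof (induction "total_deg a" arbitrary: a)
  case 0
  then show ?case using assms(2) total_deg_eq_0_iff by metis
next
  case (Suc n)
  then have "a \<noteq> 0" using total_deg_eq_0_iff[of a] by simp
  then obtain v where v: "v \<in> Poly_Mapping.keys a" by (meson all_not_in_conv keys_eq_empty)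
  let ?a = "a - Poly_Mapping.single v 1"
  have a: "a = ?a + Poly_Mapping.single v 1"
    using v by (intro poly_mapping_eqI) (auto simp: lookup_add lookup_minus lookup_single when_def in_keys_iff)
  have "Poly_Mapping.keys ?a \<subseteq> V" using Suc.prems a by (metis keys_add_nat le_sup_iff)
  moreover have "n = total_deg ?a" using Suc.hyps(2) a by (metis Suc_eq_plus1 add_right_cancel total_deg_add total_deg_single)
  ultimately have "P ?a" using Suc.hyps(1) by blast
  then show ?case using step[of ?a v] \<open>Poly_Mapping.keys ?a \<subseteq> V\<close> v Suc.prems a by (metis subsetD)
qed

lemma has_order_spow:
  assumes "\<And>v. v \<in> Poly_Mapping.keys a \<Longrightarrow> mcoeff (s v) 0 = 0"
  shows "has_order (total_deg a) (spow s a)"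
proof -
  have "has_order (\<Sum>v\<in>Poly_Mapping.keys a. Poly_Mapping.lookup a v) (spow s a)"
    unfolding spow_def
    using has_order_power[of "Suc 0"] assms by (intro has_order_prod) (auto simp: has_order_1)
  then show ?thesis by (simp add: total_deg_def)
qed

text \<open>Series without constant term turn a monomial of degree d into a series of order at least
  d, so only degrees up to that of \<open>b\<close> contribute. \<open>N\<close> is free so that
  several coefficients can share one index set.\<close>

lemma mcoeff_msubst:
  assumes V: "finite V" "f \<in> in_vars V" and s: "\<And>v. v \<in> V \<Longrightarrow> mcoeff (s v) 0 = 0"
    and N: "total_deg b \<le> N"
  shows "mcoeff (msubst s f) b = (\<Sum>a\<in>midx V N. mcoeff f a * mcoeff (spow s a) b)"
proof -
  have sub: "{a. mcoeff f a * mcoeff (spow s a) b \<noteq> 0} \<subseteq> midx V N"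
  proof clarify
    fix a assume ne: "mcoeff f a * mcoeff (spow s a) b \<noteq> 0"
    then have "mcoeff f a \<noteq> 0" and 1: "mcoeff (spow s a) b \<noteq> 0" by auto
    then have k: "Poly_Mapping.keys a \<subseteq> V" using V(2) by (auto simp: in_vars_def)
    then have "has_order (total_deg a) (spow s a)" using s by (intro has_order_spow) auto
    then have "\<not> total_deg b < total_deg a" using 1 by (auto simp: has_order_def)
    then show "a \<in> midx V N" using k N by (auto simp: midx_def)
  qed
  have "mcoeff (msubst s f) b = Sum_any (\<lambda>a. mcoeff f a * mcoeff (spow s a) b)"
    by (simp add: msubst_def spow_def)
  also have "\<dots> = (\<Sum>a\<in>midx V N. mcoeff f a * mcoeff (spow s a) b)"
    by (rule Sum_any.expand_superset[OF finite_midx[OF V(1)] sub])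
  finally show ?thesis .
qed

definition mmonom :: "('v \<Rightarrow>\<^sub>0 nat) \<Rightarrow> ('v, 'a::comm_ring_1) mfps" where
  "mmonom a = Abs_mfps (\<lambda>b. if b = a then 1 else 0)"

lemma mcoeff_mmonom: "mcoeff (mmonom a) b = (if b = a then 1 else 0)"
  by (simp add: mmonom_def)

lemma mmonom_zero [simp]: "mmonom 0 = 1"
  by (auto intro!: mfps_eqI simp: mcoeff_mmonom mcoeff_one)

lemma mmonom_single: "mmonom (Poly_Mapping.single v (Suc 0)) = mvar v"
  by (auto intro!: mfps_eqI simp: mcoeff_mmonom mcoeff_var)

lemma mmonom_add:
  fixes a b :: "'v \<Rightarrow>\<^sub>0 nat"
  shows "(mmonom (a + b) :: ('v, 'a::comm_ring_1) mfps) = mmonom a * mmonom b"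
proof (rule mfps_eqI)
  fix c
  have "mcoeff (mmonom a * mmonom b :: ('v, 'a) mfps) c = (\<Sum>x\<in>splits c. if x = (a, b) then 1 else 0)"
    unfolding mcoeff_mult by (rule sum.cong) (auto simp: mcoeff_mmonom split: if_splits)
  also have "\<dots> = (if (a, b) \<in> splits c then 1 else 0)"
    by simp
  finally show "mcoeff (mmonom (a + b) :: ('v, 'a) mfps) c = mcoeff (mmonom a * mmonom b) c"
    by (auto simp: mcoeff_mmonom splits_def)
qed

lemma in_vars_iff: "f \<in> in_vars V \<longleftrightarrow> (\<forall>b. \<not> Poly_Mapping.keys b \<subseteq> V \<longrightarrow> mcoeff f b = 0)"
  by (auto simp: in_vars_def)

lemma in_vars_mono: "f \<in> in_vars V \<Longrightarrow> V \<subseteq> W \<Longrightarrow> f \<in> in_vars W"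
  by (auto simp: in_vars_def)

lemma in_vars_0 [simp]: "0 \<in> in_vars V"
  by (simp add: in_vars_def)

lemma in_vars_const [simp]: "mconst c \<in> in_vars V"
  by (auto simp: in_vars_def mcoeff_const split: if_splits)

lemma in_vars_1 [simp]: "1 \<in> in_vars V"
  by (auto simp: in_vars_def mcoeff_one split: if_splits)

lemma in_vars_var: "v \<in> V \<Longrightarrow> mvar v \<in> in_vars V"
  by (auto simp: in_vars_def mcoeff_var split: if_splits)

lemma in_vars_add: "f \<in> in_vars V \<Longrightarrow> g \<in> in_vars V \<Longrightarrow> f + g \<in> in_vars V"
  by (auto simp: in_vars_iff)

lemma in_vars_diff: "f \<in> in_vars V \<Longrightarrow> g \<in> in_vars V \<Longrightarrow> f - g \<in> in_vars V"
  by (auto simp: in_vars_iff)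

lemma in_vars_uminus: "f \<in> in_vars V \<Longrightarrow> - f \<in> in_vars V"
  by (auto simp: in_vars_iff)

lemma in_vars_sum: "(\<And>x. x \<in> A \<Longrightarrow> f x \<in> in_vars V) \<Longrightarrow> sum f A \<in> in_vars V"
  by (auto simp: in_vars_iff)

lemma in_vars_mult:
  assumes "f \<in> in_vars V" "g \<in> in_vars V"
  shows "f * g \<in> in_vars V"
proof -
  have "mcoeff (f * g) b = 0" if "\<not> Poly_Mapping.keys b \<subseteq> V" for b
    unfolding mcoeff_mult
  proof (rule sum.neutral, clarify)
    fix a c assume "(a, c) \<in> splits b"
    then have "\<not> Poly_Mapping.keys a \<subseteq> V \<or> \<not> Poly_Mapping.keys c \<subseteq> V"
      using that by (auto simp: splits_def keys_add_nat)
    then show "mcoeff f a * mcoeff g c = 0" using assms by (auto simp: in_vars_iff)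
  qed
  then show ?thesis by (simp add: in_vars_iff)
qed

lemma in_vars_power: "f \<in> in_vars V \<Longrightarrow> f ^ n \<in> in_vars V"
  by (induction n) (auto intro: in_vars_mult)

lemma in_vars_prod: "(\<And>x. x \<in> A \<Longrightarrow> f x \<in> in_vars V) \<Longrightarrow> prod f A \<in> in_vars V"
  by (induction A rule: infinite_finite_induct) (auto intro: in_vars_mult)

lemma in_vars_mmonom: "Poly_Mapping.keys a \<subseteq> V \<Longrightarrow> mmonom a \<in> in_vars V"
  by (auto simp: in_vars_iff mcoeff_mmonom)

section \<open>Partial derivatives\<close>

lemma mcoeff_deriv: "mcoeff (mderiv v f) b =
    of_nat (Poly_Mapping.lookup b v + 1) * mcoeff f (b + Poly_Mapping.single v 1)"
  by (simp add: mderiv_def)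

lemma in_vars_mderiv: "f \<in> in_vars V \<Longrightarrow> mderiv v f \<in> in_vars V"
  by (auto simp: in_vars_iff mcoeff_deriv keys_add_nat)

lemma mderiv_outside: "f \<in> in_vars V \<Longrightarrow> v \<notin> V \<Longrightarrow> mderiv v f = 0"
  by (rule mfps_eqI) (simp add: in_vars_iff mcoeff_deriv keys_add_nat)

lemma mderiv_simps [simp]:
  "mderiv v (f + g) = mderiv v f + mderiv v g" "mderiv v (f - g) = mderiv v f - mderiv v g"
  "mderiv v (- f) = - mderiv v f" "mderiv v 0 = 0"
  by (auto intro!: mfps_eqI simp: mcoeff_deriv algebra_simps)

lemma mderiv_sum: "mderiv v (sum f A) = (\<Sum>x\<in>A. mderiv v (f x))"
  by (induction A rule: infinite_finite_induct) auto

lemma mderiv_const_mult: "mderiv v (mconst c * f) = mconst c * mderiv v f"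
  by (auto intro!: mfps_eqI simp: mcoeff_deriv mult.left_commute)

lemma single_add_ne_0 [simp]: "b + Poly_Mapping.single v (Suc 0) \<noteq> 0"
  by (metis keys_add_nat keys_zero Un_empty keys_single insert_not_empty nat.distinct(1))

lemma mderiv_const [simp]: "mderiv v (mconst c) = 0" "mderiv v 1 = 0"
  by (auto intro!: mfps_eqI simp: mcoeff_deriv mcoeff_const mcoeff_one)

lemma mderiv_var: "mderiv v (mvar w) = (if v = w then 1 else 0)"
proof (rule mfps_eqI)
  fix b :: "'a \<Rightarrow>\<^sub>0 nat"
  have "b + Poly_Mapping.single v 1 = Poly_Mapping.single w 1 \<longleftrightarrow> v = w \<and> b = 0"
  proof
    assume *: "b + Poly_Mapping.single v 1 = Poly_Mapping.single w 1"
    then have "v \<in> Poly_Mapping.keys (Poly_Mapping.single w (1::nat))"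
      by (metis UnCI keys_add_nat keys_single singletonI zero_neq_one)
    then show "v = w \<and> b = 0" using * by auto
  qed auto
  then show "mcoeff (mderiv v (mvar w)) b = mcoeff (if v = w then 1 else 0) b"
    by (auto simp: mcoeff_deriv mcoeff_var mcoeff_one)
qed

lemma mderiv_commute: "mderiv v (mderiv w f) = mderiv w (mderiv v f)"
  by (rule mfps_eqI) (auto simp: mcoeff_deriv lookup_add lookup_single when_def add_ac mult_ac)

text \<open>The exponent of \<open>v\<close> in the target monomial is the sum of its exponents in
  the two factors. Weighting each splitting by either one gives the derivative of the corresponding
  factor after a shift of the index.\<close>

lemma mderiv_mult:
  fixes f g :: "('v, 'a::comm_ring_1) mfps"
  shows "mderiv v (f * g) = mderiv v f * g + f * mderiv v g"
proof (rule mfps_eqI)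
  fix b
  let ?e = "Poly_Mapping.single v (1::nat)"
  have half: "(\<Sum>(a, c)\<in>splits (b + ?e). of_nat (Poly_Mapping.lookup a v) * (mcoeff f a * mcoeff g c)) =
      mcoeff (mderiv v f * g) b" for f g :: "('v, 'a) mfps"
  proof -
    have "(\<Sum>(a, c)\<in>splits (b + ?e). of_nat (Poly_Mapping.lookup a v) * (mcoeff f a * mcoeff g c)) =
      (\<Sum>(a, c)\<in>splits b. of_nat (Poly_Mapping.lookup a v + 1) * mcoeff f (a + ?e) * mcoeff g c)"
    proof -
      let ?S = "{x \<in> splits (b + ?e). Poly_Mapping.lookup (fst x) v \<noteq> 0}"
      have sub: "(a - ?e) + ?e = a" "(a - ?e, c) \<in> splits b" if "(a, c) \<in> ?S" for a c
      proof -
        show a: "(a - ?e) + ?e = a"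
          using that by (intro poly_mapping_eqI) (auto simp: lookup_add lookup_minus lookup_single when_def)
        have "a + c = b + ?e" using that by (auto simp: splits_def)
        then have "((a - ?e) + c) + ?e = b + ?e" using a by (metis add.assoc add.commute)
        then show "(a - ?e, c) \<in> splits b" by (simp add: splits_def)
      qed
      have "(\<Sum>(a, c)\<in>splits (b + ?e). of_nat (Poly_Mapping.lookup a v) * (mcoeff f a * mcoeff g c)) =
        (\<Sum>(a, c)\<in>?S. of_nat (Poly_Mapping.lookup a v) * (mcoeff f a * mcoeff g c))"
        by (rule sum.mono_neutral_right) (auto, metis gr0I mult_zero_left of_nat_0)
      also have "\<dots> = (\<Sum>(a, c)\<in>splits b. of_nat (Poly_Mapping.lookup a v + 1) * mcoeff f (a + ?e) * mcoeff g c)"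
        proof (rule sum.reindex_bij_witness[where i = "\<lambda>(a, c). (a + ?e, c)" and j = "\<lambda>(a, c). (a - ?e, c)"])
        fix x assume x: "x \<in> ?S"
        obtain a c where xac: "x = (a, c)" by (cases x)
        note sub = sub[of a c, OF x[unfolded xac]]
        show "(case case x of (a, c) \<Rightarrow> (a - ?e, c) of (a, c) \<Rightarrow> (a + ?e, c)) = x"
          "(case x of (a, c) \<Rightarrow> (a - ?e, c)) \<in> splits b"
          unfolding xac prod.case using sub by auto
        have "Poly_Mapping.lookup a v = Poly_Mapping.lookup (a - ?e) v + 1"
          using sub(1) by (metis lookup_add lookup_single_eq)
        then show "(case case x of (a, c) \<Rightarrow> (a - ?e, c) of (a, c) \<Rightarrow>
            of_nat (Poly_Mapping.lookup a v + 1) * mcoeff f (a + ?e) * mcoeff g c) =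
          (case x of (a, c) \<Rightarrow> of_nat (Poly_Mapping.lookup a v) * (mcoeff f a * mcoeff g c))"
          unfolding xac prod.case sub(1) by (simp add: mult.assoc)
      qed (auto simp: splits_def lookup_add add_ac)
      finally show ?thesis .
    qed
    then show ?thesis by (simp add: mcoeff_mult mcoeff_deriv)
  qed
  have swap: "(\<Sum>(a, c)\<in>splits (b + ?e). of_nat (Poly_Mapping.lookup c v) * (mcoeff f a * mcoeff g c)) =
     (\<Sum>(a, c)\<in>splits (b + ?e). of_nat (Poly_Mapping.lookup a v) * (mcoeff g a * mcoeff f c))"
    by (rule sum.reindex_bij_witness[where i = prod.swap and j = prod.swap])
       (auto simp: splits_def add.commute mult.commute)
  have "mcoeff (mderiv v (f * g)) b =
     (\<Sum>(a, c)\<in>splits (b + ?e). of_nat (Poly_Mapping.lookup (b + ?e) v) * (mcoeff f a * mcoeff g c))"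
    by (simp add: mcoeff_deriv mcoeff_mult sum_distrib_left case_prod_unfold lookup_add)
  also have "\<dots> = (\<Sum>(a, c)\<in>splits (b + ?e). of_nat (Poly_Mapping.lookup a v) * (mcoeff f a * mcoeff g c)
      + of_nat (Poly_Mapping.lookup c v) * (mcoeff f a * mcoeff g c))"
  proof (rule sum.cong[OF refl], clarify)
    fix a c assume "(a, c) \<in> splits (b + ?e)"
    then have "a + c = b + ?e" by (simp add: splits_def)
    then show "of_nat (Poly_Mapping.lookup (b + ?e) v) * (mcoeff f a * mcoeff g c) =
      of_nat (Poly_Mapping.lookup a v) * (mcoeff f a * mcoeff g c) +
      of_nat (Poly_Mapping.lookup c v) * (mcoeff f a * mcoeff g c)"
      by (metis lookup_add of_nat_add distrib_right)
  qed
  also have "\<dots> = (\<Sum>(a, c)\<in>splits (b + ?e). of_nat (Poly_Mapping.lookup a v) * (mcoeff f a * mcoeff g c))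
      + (\<Sum>(a, c)\<in>splits (b + ?e). of_nat (Poly_Mapping.lookup c v) * (mcoeff f a * mcoeff g c))"
    by (simp add: case_prod_unfold sum.distrib)
  also have "\<dots> = mcoeff (mderiv v f * g + f * mderiv v g) b"
    unfolding swap half by (simp add: mult.commute)
  finally show "mcoeff (mderiv v (f * g)) b = mcoeff (mderiv v f * g + f * mderiv v g) b" .
qed

section \<open>Continuous linear maps between rings of series\<close>

text \<open>Continuity for the filtration by order; \<open>k\<close> is the loss of order that is
  allowed, 0 for substitutions and 1 for derivatives. Identities between such maps need only be
  checked on monomials.\<close>

definition cont_linear :: "'v set \<Rightarrow> nat \<Rightarrow> (('v, 'a::comm_ring_1) mfps \<Rightarrow> ('w, 'a) mfps) \<Rightarrow> bool" where
  "cont_linear V k A \<longleftrightarrow>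
     (\<forall>f\<in>in_vars V. \<forall>g\<in>in_vars V. A (f + g) = A f + A g) \<and>
     (\<forall>c. \<forall>f\<in>in_vars V. A (mconst c * f) = mconst c * A f) \<and>
     (\<forall>n. \<forall>f\<in>in_vars V. has_order (n + k) f \<longrightarrow> has_order n (A f))"

lemma cont_linear_sum:
  fixes A :: "('v, 'a::comm_ring_1) mfps \<Rightarrow> ('w, 'a) mfps"
  assumes "cont_linear V k A" "finite X" "\<And>x. x \<in> X \<Longrightarrow> f x \<in> in_vars V"
  shows "A (\<Sum>x\<in>X. mconst (c x) * f x) = (\<Sum>x\<in>X. mconst (c x) * A (f x))"
  using assms(2,3)
proof (induction X rule: finite_induct)
  case empty
  have "A (mconst 0 * 0) = mconst 0 * A 0" using assms(1) in_vars_0 unfolding cont_linear_def by blast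
  then show ?case by (simp add: mconst_simps)
next
  case (insert x X)
  have "A (mconst (c x) * f x + (\<Sum>x\<in>X. mconst (c x) * f x)) =
      A (mconst (c x) * f x) + A (\<Sum>x\<in>X. mconst (c x) * f x)"
    using insert.prems assms(1) unfolding cont_linear_def
    by (metis (no_types, lifting) in_vars_const in_vars_mult in_vars_sum insertCI)
  also have "A (mconst (c x) * f x) = mconst (c x) * A (f x)"
    using insert.prems assms(1) unfolding cont_linear_def by blast
  finally show ?case using insert by simp
qed

text \<open>To compare coefficients at \<open>b\<close>, truncate f after degree
  \<open>total_deg b + k\<close>. Both maps agree on the polynomial part by linearity, and they send
  the rest to order beyond \<open>total_deg b\<close>.\<close>

lemma cont_linear_eqI:
  fixes A B :: "('v, 'a::comm_ring_1) mfps \<Rightarrow> ('w, 'a) mfps"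
  assumes V: "finite V" and A: "cont_linear V k A" and B: "cont_linear V k B"
    and eq: "\<And>a. Poly_Mapping.keys a \<subseteq> V \<Longrightarrow> A (mmonom a) = B (mmonom a)"
    and f: "f \<in> in_vars V"
  shows "A f = B f"
proof (rule mfps_eqI)
  fix b :: "'w \<Rightarrow>\<^sub>0 nat"
  let ?n = "total_deg b"
  let ?M = "midx V (?n + k)"
  let ?g = "\<Sum>a\<in>?M. mconst (mcoeff f a) * mmonom a"
  have g: "?g \<in> in_vars V"
    by (intro in_vars_sum in_vars_mult in_vars_const in_vars_mmonom) (auto simp: midx_def)
  have fin: "finite ?M" using V by (rule finite_midx)
  have "mcoeff ?g a = mcoeff f a" if "total_deg a \<le> ?n + k" for a
  proof -
    have "mcoeff ?g a = (\<Sum>x\<in>?M. if x = a then mcoeff f a else 0)"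
      by (simp add: mcoeff_mmonom) (rule sum.cong, auto)
    also have "\<dots> = (if a \<in> ?M then mcoeff f a else 0)" using fin by simp
    finally show ?thesis using that f by (auto simp: midx_def in_vars_iff)
  qed
  then have "has_order (Suc ?n + k) (f - ?g)"
    by (simp add: has_order_def less_Suc_eq_le)
  moreover have fg: "f - ?g \<in> in_vars V" using f g by (rule in_vars_diff)
  ultimately have "has_order (Suc ?n) (A (f - ?g))" "has_order (Suc ?n) (B (f - ?g))"
    using A B unfolding cont_linear_def by blast+
  then have "mcoeff (A (f - ?g)) b = mcoeff (B (f - ?g)) b" by (simp add: has_order_def)
  moreover have "A ?g = B ?g"
    using cont_linear_sum[OF A fin] cont_linear_sum[OF B fin]
    by (simp add: midx_def in_vars_mmonom eq)
  moreover have "A (f - ?g + ?g) = A (f - ?g) + A ?g" "B (f - ?g + ?g) = B (f - ?g) + B ?g"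
    using A B fg g unfolding cont_linear_def by blast+
  ultimately show "mcoeff (A f) b = mcoeff (B f) b" by simp
qed

lemma cont_linear_id: "cont_linear V 0 (\<lambda>f. f)"
  by (auto simp: cont_linear_def)

lemma cont_linear_comp:
  fixes A :: "('v, 'a::comm_ring_1) mfps \<Rightarrow> ('w, 'a) mfps" and B :: "('w, 'a) mfps \<Rightarrow> ('u, 'a) mfps"
  assumes "cont_linear V k A" "cont_linear W l B" "\<And>f. f \<in> in_vars V \<Longrightarrow> A f \<in> in_vars W"
  shows "cont_linear V (l + k) (\<lambda>f. B (A f))"
  unfolding cont_linear_def
proof (intro conjI ballI allI impI)
  fix f g :: "('v, 'a) mfps" assume "f \<in> in_vars V" "g \<in> in_vars V"
  then show "B (A (f + g)) = B (A f) + B (A g)"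
    using assms unfolding cont_linear_def by simp
next
  fix c and f :: "('v, 'a) mfps" assume "f \<in> in_vars V"
  then show "B (A (mconst c * f)) = mconst c * B (A f)"
    using assms unfolding cont_linear_def by simp
next
  fix n and f :: "('v, 'a) mfps" assume "f \<in> in_vars V" "has_order (n + (l + k)) f"
  then show "has_order n (B (A f))"
    using assms unfolding cont_linear_def by (metis add.assoc)
qed

lemma cont_linear_mult:
  fixes A :: "('v, 'a::comm_ring_1) mfps \<Rightarrow> ('w, 'a) mfps"
  assumes "cont_linear V k A"
  shows "cont_linear V k (\<lambda>f. A f * g)"
  unfolding cont_linear_def
proof (intro conjI ballI allI impI)
  fix n and f :: "('v, 'a) mfps" assume "f \<in> in_vars V" "has_order (n + k) f"
  then have "has_order n (A f)" using assms unfolding cont_linear_def by blast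
  then show "has_order n (A f * g)" using has_order_mult[of n _ 0] by simp
qed (use assms in \<open>auto simp: cont_linear_def algebra_simps\<close>)

lemma cont_linear_setsum:
  assumes "\<And>x. x \<in> X \<Longrightarrow> cont_linear V k (A x)"
  shows "cont_linear V k (\<lambda>f. \<Sum>x\<in>X. A x f)"
  using assms unfolding cont_linear_def
  by (auto simp: sum.distrib sum_distrib_left intro!: has_order_sum)

lemma cont_linear_mderiv: "cont_linear V 1 (mderiv v)"
  unfolding cont_linear_def by (auto simp: mderiv_const_mult has_order_def mcoeff_deriv)

section \<open>Substitution\<close>

definition subst_dom :: "'v set \<Rightarrow> ('v \<Rightarrow> ('w, 'a::comm_ring_1) mfps) \<Rightarrow> bool" where
  "subst_dom V s \<longleftrightarrow> finite V \<and> (\<forall>v\<in>V. mcoeff (s v) 0 = 0)"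

lemma subst_dom_finite: "subst_dom V s \<Longrightarrow> finite V"
  by (simp add: subst_dom_def)

lemma mcoeff_msubst':
  assumes "subst_dom V s" "f \<in> in_vars V" "total_deg b \<le> N"
  shows "mcoeff (msubst s f) b = (\<Sum>a\<in>midx V N. mcoeff f a * mcoeff (spow s a) b)"
  using assms by (intro mcoeff_msubst) (auto simp: subst_dom_def)

lemma cont_linear_msubst:
  fixes s :: "'v \<Rightarrow> ('w, 'a::comm_ring_1) mfps"
  assumes s: "subst_dom V s"
  shows "cont_linear V 0 (msubst s)"
  unfolding cont_linear_def
proof (intro conjI ballI allI impI)
  fix f g :: "('v, 'a) mfps" assume f: "f \<in> in_vars V" and g: "g \<in> in_vars V"
  show "msubst s (f + g) = msubst s f + msubst s g"
    by (intro mfps_eqI) (simp add: mcoeff_msubst'[OF s f order_refl] mcoeff_msubst'[OF s g order_refl]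
        mcoeff_msubst'[OF s in_vars_add[OF f g] order_refl] distrib_right sum.distrib)
next
  fix c and f :: "('v, 'a) mfps" assume f: "f \<in> in_vars V"
  show "msubst s (mconst c * f) = mconst c * msubst s f"
    by (intro mfps_eqI) (simp add: mcoeff_msubst'[OF s f order_refl]
        mcoeff_msubst'[OF s in_vars_mult[OF in_vars_const f] order_refl] sum_distrib_left mult.assoc)
next
  fix n and f :: "('v, 'a) mfps" assume f: "f \<in> in_vars V" and n: "has_order (n + 0) f"
  show "has_order n (msubst s f)"
    unfolding has_order_def
  proof (intro allI impI)
    fix b :: "'w \<Rightarrow>\<^sub>0 nat" assume b: "total_deg b < n"
    show "mcoeff (msubst s f) b = 0"
      using n b unfolding mcoeff_msubst'[OF s f order_refl]
      by (intro sum.neutral) (auto simp: midx_def has_order_def)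
  qed
qed

lemma msubst_add:
  "subst_dom V s \<Longrightarrow> f \<in> in_vars V \<Longrightarrow> g \<in> in_vars V \<Longrightarrow> msubst s (f + g) = msubst s f + msubst s g"
  using cont_linear_msubst[of V s] unfolding cont_linear_def by blast

lemma msubst_const_mult:
  "subst_dom V s \<Longrightarrow> f \<in> in_vars V \<Longrightarrow> msubst s (mconst c * f) = mconst c * msubst s f"
  using cont_linear_msubst[of V s] unfolding cont_linear_def by blast

lemma msubst_mmonom:
  fixes s :: "'v \<Rightarrow> ('w, 'a::comm_ring_1) mfps"
  assumes s: "subst_dom V s" and a: "Poly_Mapping.keys a \<subseteq> V"
  shows "msubst s (mmonom a) = spow s a"
proof (rule mfps_eqI)
  fix b :: "'w \<Rightarrow>\<^sub>0 nat"
  let ?N = "total_deg a + total_deg b"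
  have "finite (midx V ?N)" using s by (intro finite_midx) (simp add: subst_dom_def)
  moreover have "a \<in> midx V ?N" using a by (simp add: midx_def)
  moreover have "mcoeff (msubst s (mmonom a)) b = (\<Sum>x\<in>midx V ?N. if x = a then mcoeff (spow s a) b else 0)"
    unfolding mcoeff_msubst'[OF s in_vars_mmonom[OF a], of b ?N, OF le_add2]
    by (rule sum.cong) (auto simp: mcoeff_mmonom)
  ultimately show "mcoeff (msubst s (mmonom a)) b = mcoeff (spow s a) b" by simp
qed

text \<open>Both sides are continuous and linear in each factor separately, so the factors are
  reduced to monomials one after the other.\<close>

lemma msubst_mult:
  fixes f g :: "('v, 'a::comm_ring_1) mfps" and s :: "'v \<Rightarrow> ('w, 'a) mfps"
  assumes s: "subst_dom V s" and f: "f \<in> in_vars V" and g: "g \<in> in_vars V"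
  shows "msubst s (f * g) = msubst s f * msubst s g"
proof -
  note V = subst_dom_finite[OF s]
  have lin: "cont_linear V 0 (\<lambda>f. msubst s (f * g))" if g: "g \<in> in_vars V" for g
    using cont_linear_comp[OF cont_linear_mult[OF cont_linear_id] cont_linear_msubst[OF s], of V g]
      in_vars_mult[OF _ g] by simp
  have lin': "cont_linear V 0 (\<lambda>f. msubst s f * g)" for g
    by (rule cont_linear_mult[OF cont_linear_msubst[OF s]])
  have 1: "msubst s (g * mmonom a) = msubst s g * spow s a"
    if a: "Poly_Mapping.keys a \<subseteq> V" and g: "g \<in> in_vars V" for a :: "'v \<Rightarrow>\<^sub>0 nat" and g
  proof (rule cont_linear_eqI[OF V lin[OF in_vars_mmonom[OF a]] lin' _ g])
    fix b :: "'v \<Rightarrow>\<^sub>0 nat" assume b: "Poly_Mapping.keys b \<subseteq> V"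
    then have "msubst s (mmonom (b + a)) = spow s (b + a)"
      using a by (intro msubst_mmonom[OF s]) (auto simp: keys_add_nat)
    then show "msubst s (mmonom b * mmonom a) = msubst s (mmonom b) * spow s a"
      by (simp add: mmonom_add spow_add msubst_mmonom[OF s b])
  qed
  show ?thesis
  proof (rule cont_linear_eqI[OF V lin[OF g] lin' _ f])
    fix a :: "'v \<Rightarrow>\<^sub>0 nat" assume a: "Poly_Mapping.keys a \<subseteq> V"
    then show "msubst s (mmonom a * g) = msubst s (mmonom a) * msubst s g"
      using 1[OF a g] by (simp add: mult.commute msubst_mmonom[OF s a])
  qed
qed

lemma msubst_var: "subst_dom V s \<Longrightarrow> v \<in> V \<Longrightarrow> msubst s (mvar v) = s v"
  using msubst_mmonom[of V s "Poly_Mapping.single v 1"] by (simp add: mmonom_single)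

lemma msubst_one: "msubst s 1 = 1"
proof -
  have "msubst s (mmonom 0) = spow s 0" by (rule msubst_mmonom[of "{}"]) (auto simp: subst_dom_def)
  then show ?thesis by simp
qed

lemma msubst_const [simp]: "msubst s (mconst c) = mconst c"
proof -
  have "msubst s (mconst c * 1) = mconst c * msubst s 1"
    by (rule msubst_const_mult[of "{}"]) (auto simp: subst_dom_def)
  then show ?thesis by (simp add: msubst_one)
qed

lemma msubst_zero [simp]: "msubst s 0 = 0"
  using msubst_const[of s 0] by (simp add: mconst_simps)

lemma msubst_diff:
  assumes "subst_dom V s" "f \<in> in_vars V" "g \<in> in_vars V"
  shows "msubst s (f - g) = msubst s f - msubst s g"
  using msubst_add[OF assms(1) in_vars_diff[OF assms(2,3)] assms(3)] by (simp add: algebra_simps)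

lemma msubst_uminus:
  assumes "subst_dom V s" "f \<in> in_vars V"
  shows "msubst s (- f) = - msubst s f"
  using msubst_diff[OF assms(1) in_vars_0 assms(2)] by simp

lemma msubst_sum:
  assumes "subst_dom V s" "\<And>x. x \<in> A \<Longrightarrow> f x \<in> in_vars V"
  shows "msubst s (sum f A) = (\<Sum>x\<in>A. msubst s (f x))"
  using assms(2)
proof (induction A rule: infinite_finite_induct)
  case (insert x A)
  then show ?case using msubst_add[OF assms(1), of "f x" "sum f A"] by (auto intro: in_vars_sum)
qed auto

lemma spow_cong: "(\<And>v. v \<in> Poly_Mapping.keys a \<Longrightarrow> s v = t v) \<Longrightarrow> spow s a = spow t a"
  unfolding spow_def by (rule prod.cong) auto

lemma msubst_cong:
  assumes "f \<in> in_vars V" "\<And>v. v \<in> V \<Longrightarrow> s v = t v"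
  shows "msubst s f = msubst t f"
proof -
  have "mcoeff f a * mcoeff (spow s a) b = mcoeff f a * mcoeff (spow t a) b" for a b
  proof (cases "mcoeff f a = 0")
    case False
    then have "spow s a = spow t a" using assms by (intro spow_cong) (auto simp: in_vars_def)
    then show ?thesis by simp
  qed simp
  then show ?thesis by (auto intro!: mfps_eqI simp: msubst_def simp flip: spow_def)
qed

lemma mcoeff_msubst_0:
  assumes "subst_dom V s" "f \<in> in_vars V"
  shows "mcoeff (msubst s f) 0 = mcoeff f 0"
proof -
  have "midx V 0 = {0}" by (auto simp: midx_def total_deg_eq_0_iff)
  then show ?thesis using mcoeff_msubst'[OF assms, of 0 0] by (simp add: mcoeff_one)
qed

lemma in_vars_spow:
  "(\<And>v. v \<in> Poly_Mapping.keys a \<Longrightarrow> s v \<in> in_vars W) \<Longrightarrow> spow s a \<in> in_vars W"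
  unfolding spow_def by (intro in_vars_prod in_vars_power)

lemma in_vars_msubst:
  fixes s :: "'v \<Rightarrow> ('w, 'a::comm_ring_1) mfps"
  assumes s: "subst_dom V s" and f: "f \<in> in_vars V" and W: "\<And>v. v \<in> V \<Longrightarrow> s v \<in> in_vars W"
  shows "msubst s f \<in> in_vars W"
  unfolding in_vars_iff
proof (intro allI impI)
  fix b :: "'w \<Rightarrow>\<^sub>0 nat" assume b: "\<not> Poly_Mapping.keys b \<subseteq> W"
  have "mcoeff (spow s a) b = 0" if "a \<in> midx V (total_deg b)" for a
    using in_vars_spow[of a s W] that W b by (auto simp: midx_def in_vars_iff)
  then show "mcoeff (msubst s f) b = 0"
    unfolding mcoeff_msubst'[OF s f order_refl] by (intro sum.neutral) simp
qed

lemma spow_mvar: "spow mvar a = mmonom a"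
proof -
  have "Poly_Mapping.keys a \<subseteq> UNIV" by simp
  then show ?thesis
    by (induction rule: multi_index_induct) (simp_all add: spow_add mmonom_add mmonom_single)
qed

lemma mcoeff_mvar_0 [simp]: "mcoeff (mvar v) 0 = 0"
  using single_add_ne_0[of 0 v] by (simp add: mcoeff_var)

lemma subst_dom_mvar: "finite V \<Longrightarrow> subst_dom V mvar"
  by (simp add: subst_dom_def)

lemma msubst_id:
  assumes "finite V" "f \<in> in_vars V" "\<And>v. v \<in> V \<Longrightarrow> s v = mvar v"
  shows "msubst s f = f"
proof -
  have "msubst s f = msubst mvar f" using assms by (intro msubst_cong) auto
  also have "\<dots> = f"
    by (rule cont_linear_eqI[OF assms(1) cont_linear_msubst[OF subst_dom_mvar[OF assms(1)]] cont_linear_id _ assms(2)])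
       (simp add: msubst_mmonom[OF subst_dom_mvar[OF assms(1)]] spow_mvar)
  finally show ?thesis .
qed

lemma msubst_spow:
  assumes t: "subst_dom W t" and a: "Poly_Mapping.keys a \<subseteq> V" and s: "\<And>v. v \<in> V \<Longrightarrow> s v \<in> in_vars W"
  shows "msubst t (spow s a) = spow (\<lambda>v. msubst t (s v)) a"
  using a
proof (induction rule: multi_index_induct)
  case (add a v)
  have "spow s a \<in> in_vars W" using add s by (intro in_vars_spow) auto
  then show ?case using add s msubst_mult[OF t, of "spow s a" "s v"] by (simp add: spow_add)
qed (simp add: msubst_one)

lemma msubst_comp:
  fixes f :: "('v, 'a::comm_ring_1) mfps" and s :: "'v \<Rightarrow> ('w, 'a) mfps" and t :: "'w \<Rightarrow> ('u, 'a) mfps"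
  assumes s: "subst_dom V s" and t: "subst_dom W t" and f: "f \<in> in_vars V"
    and sW: "\<And>v. v \<in> V \<Longrightarrow> s v \<in> in_vars W"
  shows "msubst t (msubst s f) = msubst (\<lambda>v. msubst t (s v)) f"
proof -
  have st: "subst_dom V (\<lambda>v. msubst t (s v))"
    using s t sW unfolding subst_dom_def by (metis mcoeff_msubst_0 t)
  have 1: "cont_linear V (0 + 0) (\<lambda>f. msubst t (msubst s f))"
    using cont_linear_comp[OF cont_linear_msubst[OF s] cont_linear_msubst[OF t]]
      in_vars_msubst[OF s _ sW] by blast
  show ?thesis
  proof (rule cont_linear_eqI[OF subst_dom_finite[OF s] 1 _ _ f])
    show "cont_linear V (0 + 0) (msubst (\<lambda>v. msubst t (s v)))"
      using cont_linear_msubst[OF st] by simp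
    fix a :: "'v \<Rightarrow>\<^sub>0 nat" assume "Poly_Mapping.keys a \<subseteq> V"
    then show "msubst t (msubst s (mmonom a)) = msubst (\<lambda>v. msubst t (s v)) (mmonom a)"
      using msubst_spow[OF t _ sW] by (simp add: msubst_mmonom[OF s] msubst_mmonom[OF st])
  qed
qed

text \<open>The chain rule. Both sides are continuous with loss of one order, which leaves monomials
  and an induction with the product rule.\<close>

lemma mderiv_msubst:
  fixes f :: "('v, 'a::comm_ring_1) mfps" and s :: "'v \<Rightarrow> ('w, 'a) mfps"
  assumes s: "subst_dom V s" and f: "f \<in> in_vars V"
  shows "mderiv w (msubst s f) = (\<Sum>v\<in>V. msubst s (mderiv v f) * mderiv w (s v))"
proof -
  note V = subst_dom_finite[OF s]
  have l1: "cont_linear V 1 (\<lambda>f. mderiv w (msubst s f))"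
    using cont_linear_comp[OF cont_linear_msubst[OF s] cont_linear_mderiv[of UNIV]]
    by (simp add: in_vars_def)
  have l2: "cont_linear V 1 (\<lambda>f. \<Sum>v\<in>V. msubst s (mderiv v f) * mderiv w (s v))"
    using cont_linear_comp[OF cont_linear_mderiv[of V] cont_linear_msubst[OF s]]
    by (intro cont_linear_setsum cont_linear_mult) (simp add: in_vars_mderiv)
  show ?thesis
  proof (rule cont_linear_eqI[OF V l1 l2 _ f])
    fix a :: "'v \<Rightarrow>\<^sub>0 nat" assume "Poly_Mapping.keys a \<subseteq> V"
    then show "mderiv w (msubst s (mmonom a)) = (\<Sum>v\<in>V. msubst s (mderiv v (mmonom a)) * mderiv w (s v))"
    proof (induction rule: multi_index_induct)
      case zero
      then show ?case by (simp add: msubst_one)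
    next
      case (add a u)
      have m: "(mmonom a :: ('v, 'a) mfps) \<in> in_vars V" "(mvar u :: ('v, 'a) mfps) \<in> in_vars V"
        using add by (auto intro: in_vars_mmonom in_vars_var)
      have d: "msubst s (mderiv v (mmonom a * mvar u)) =
          msubst s (mderiv v (mmonom a)) * s u + msubst s (mmonom a) * (if v = u then 1 else 0)"
        if "v \<in> V" for v
      proof -
        have i: "(mderiv v (mvar u) :: ('v, 'a) mfps) \<in> in_vars V" "(mderiv v (mmonom a) :: ('v, 'a) mfps) \<in> in_vars V"
          using m by (auto intro: in_vars_mderiv)
        then show ?thesis
          using msubst_add[OF s in_vars_mult[OF i(2) m(2)] in_vars_mult[OF m(1) i(1)]]
            msubst_mult[OF s i(2) m(2)] msubst_mult[OF s m(1) i(1)]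
          by (simp add: mderiv_mult mderiv_var msubst_var[OF s add(2)] msubst_one)
      qed
      have "mderiv w (msubst s (mmonom a * mvar u)) =
          mderiv w (msubst s (mmonom a)) * s u + msubst s (mmonom a) * mderiv w (s u)"
        by (simp add: msubst_mult[OF s m] msubst_var[OF s add(2)] mderiv_mult)
      also have "\<dots> = (\<Sum>v\<in>V. msubst s (mderiv v (mmonom a * mvar u)) * mderiv w (s v))"
      proof -
        have "(\<Sum>v\<in>V. msubst s (mderiv v (mmonom a * mvar u)) * mderiv w (s v)) =
           (\<Sum>v\<in>V. (msubst s (mderiv v (mmonom a)) * mderiv w (s v)) * s u +
              (if v = u then msubst s (mmonom a) * mderiv w (s u) else 0))"
        proof (rule sum.cong[OF refl])
          fix v assume "v \<in> V"
          from d[OF this] show "msubst s (mderiv v (mmonom a * mvar u)) * mderiv w (s v) =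
             (msubst s (mderiv v (mmonom a)) * mderiv w (s v)) * s u +
              (if v = u then msubst s (mmonom a) * mderiv w (s u) else 0)"
            by (simp only:) (simp add: algebra_simps)
        qed
        then show ?thesis using V add by (simp add: sum.distrib sum_distrib_right)
      qed
      finally show ?case by (simp add: mmonom_add mmonom_single)
    qed
  qed
qed

lemma mvar_mult_mvar: "mvar v * mvar w = mmonom (Poly_Mapping.single v 1 + Poly_Mapping.single w 1)"
  by (simp add: mmonom_add mmonom_single)

text \<open>A substitution that is the identity up to higher order preserves the lowest homogeneous
  part of a series; hence the coefficients vanish by induction on the degree.\<close>

lemma msubst_eq_0_imp:
  fixes s :: "'v \<Rightarrow> ('v, 'a::comm_ring_1) mfps"
  assumes s: "subst_dom V s" and lead: "\<And>v. v \<in> V \<Longrightarrow> has_order 2 (s v - mvar v)"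
    and f: "f \<in> in_vars V" and 0: "msubst s f = 0"
  shows "f = 0"
proof -
  have lead': "has_order (Suc (total_deg a)) (spow s a - mmonom a)" if "Poly_Mapping.keys a \<subseteq> V" for a
    using that
  proof (induction rule: multi_index_induct)
    case (add a v)
    have o1: "has_order (total_deg a) (spow s a)"
      using s add.hyps by (intro has_order_spow) (auto simp: subst_dom_def)
    have o2: "has_order (Suc 0) (mvar v :: ('v, 'a) mfps)" by (simp add: has_order_1)
    have "spow s (a + Poly_Mapping.single v 1) - mmonom (a + Poly_Mapping.single v 1) =
       spow s a * (s v - mvar v) + (spow s a - mmonom a) * mvar v"
      by (simp add: spow_add mmonom_add mmonom_single algebra_simps)
    moreover have "has_order (total_deg a + 2) (spow s a * (s v - mvar v) + (spow s a - mmonom a) * mvar v)"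
      using has_order_mult[OF o1 lead[OF add.hyps(2)]] has_order_mult[OF add.IH o2]
      by (intro has_order_add) auto
    ultimately show ?case by simp
  qed (simp add: has_order_def)
  have "mcoeff f b = 0" for b
  proof (induction "total_deg b" arbitrary: b rule: less_induct)
    case less
    show ?case
    proof (cases "Poly_Mapping.keys b \<subseteq> V")
      case True
      let ?M = "midx V (total_deg b)"
      have "mcoeff f a * mcoeff (spow s a) b = (if a = b then mcoeff f b else 0)" if "a \<in> ?M" for a
      proof (cases "total_deg a = total_deg b")
        case True
        have "mcoeff (spow s a) b = mcoeff (mmonom a) b"
          using lead'[of a] that True by (auto simp: midx_def has_order_def)
        then show ?thesis by (auto simp: mcoeff_mmonom)
      next
        case False
        then have "mcoeff f a = 0" using that less by (auto simp: midx_def)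
        then show ?thesis using False by auto
      qed
      then have "mcoeff (msubst s f) b = (\<Sum>a\<in>?M. if a = b then mcoeff f b else 0)"
        unfolding mcoeff_msubst'[OF s f order_refl] by (rule sum.cong[OF refl])
      then show ?thesis using True finite_midx[OF subst_dom_finite[OF s]] 0 by (simp add: midx_def)
    qed (use f in \<open>auto simp: in_vars_iff\<close>)
  qed
  then show ?thesis by (auto intro: mfps_eqI)
qed

lemma mconst_diff: "mconst (a - b) = mconst a - mconst b"
  by (auto intro!: mfps_eqI simp: mcoeff_const)

lemma msubst_to_0:
  assumes "finite V" "f \<in> in_vars V"
  shows "msubst (\<lambda>_. 0) f = mconst (mcoeff f 0)"
proof (rule mfps_eqI)
  fix b :: "'c \<Rightarrow>\<^sub>0 nat"
  have s: "subst_dom V (\<lambda>_. 0 :: ('c, 'b) mfps)" using assms by (simp add: subst_dom_def)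
  have sp: "spow (\<lambda>_. 0 :: ('c, 'b) mfps) a = (if a = 0 then 1 else 0)" for a :: "'a \<Rightarrow>\<^sub>0 nat"
  proof (cases "a = 0")
    case False
    then obtain v where v: "v \<in> Poly_Mapping.keys a" by (meson all_not_in_conv keys_eq_empty)
    then have "(0 :: ('c, 'b) mfps) ^ Poly_Mapping.lookup a v = 0" by (simp add: in_keys_iff power_0_left)
    then show ?thesis using v False unfolding spow_def by (auto intro!: prod_zero)
  qed simp
  have "mcoeff (msubst (\<lambda>_. 0) f) b =
      (\<Sum>a\<in>midx V (total_deg b). if a = 0 then mcoeff f 0 * mcoeff 1 b else 0)"
    unfolding mcoeff_msubst'[OF s assms(2) order_refl] by (rule sum.cong) (auto simp: sp)
  then show "mcoeff (msubst (\<lambda>_. 0) f) b = mcoeff (mconst (mcoeff f 0)) b"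
    using finite_midx[OF assms(1)] by (simp add: midx_def mcoeff_const mcoeff_one)
qed

lemma msubst_tvar: "subst_dom V s \<Longrightarrow> (i, l) \<in> V \<Longrightarrow> msubst s (tvar i l) = s (i, l)"
  by (simp add: tvar_def msubst_var)

section \<open>Formal group laws and their invariant vector fields\<close>

definition gsub :: "(nat \<Rightarrow> 'k series) \<Rightarrow> (nat \<Rightarrow> 'k series) \<Rightarrow> nat \<times> nat \<Rightarrow> 'k::comm_ring_1 series" where
  "gsub u w = (\<lambda>(i, j). if i = 1 then u j else w j)"

lemma gmult_gsub: "gmult G u w j = msubst (gsub u w) (G j)"
proof -
  have "(\<lambda>(i, j). (if i = 1 then u else w) j) = gsub u w" by (auto simp: gsub_def)
  then show ?thesis by (simp add: gmult_def at_points_def)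
qed

locale fgl =
  fixes m :: nat and G :: "nat \<Rightarrow> 'k::field series"
  assumes G_vars: "j \<in> {1..m} \<Longrightarrow> G j \<in> in_vars ({1, 2} \<times> {1..m})"
    and G_low: "j \<in> {1..m} \<Longrightarrow> total_deg b < 3 \<Longrightarrow> mcoeff (G j) b =
           mcoeff (tvar 1 j + tvar 2 j +
             (\<Sum>l\<in>{1..m}. \<Sum>k\<in>{1..m}. mconst (fgl_coeff G j l k) * tvar 1 l * tvar 2 k)) b"
    and G_assoc: "j \<in> {1..m} \<Longrightarrow> gmult G (gmult G (tvar 1) (tvar 2)) (tvar 3) j =
        gmult G (tvar 1) (gmult G (tvar 2) (tvar 3)) j"
begin

declare One_nat_def [simp del] atLeastAtMost_iff [simp del]

abbreviation "I \<equiv> {1..m}"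
abbreviation "V2 \<equiv> {1 :: nat, 2} \<times> I"

lemma G_low':
  assumes "j \<in> I" "total_deg b < 2"
  shows "mcoeff (G j) b = mcoeff (tvar 1 j + tvar 2 j) b"
proof -
  have "mcoeff (mconst x * tvar 1 l * tvar 2 k) b = 0" for x :: 'k and l k
    using assms(2) by (auto simp: tvar_def mult.assoc mvar_mult_mvar mcoeff_mmonom)
  then show ?thesis using G_low[of j b] assms by simp
qed

lemma G_0 [simp]: "j \<in> I \<Longrightarrow> mcoeff (G j) 0 = 0"
  by (simp add: G_low' tvar_def)

lemma single_eq_iff: "Poly_Mapping.single v (1::nat) = Poly_Mapping.single w 1 \<longleftrightarrow> v = w"
  by (metis keys_single zero_neq_one singleton_inject)

lemma G_deriv_0:
  "j \<in> I \<Longrightarrow> mcoeff (mderiv (1, k) (G j)) 0 = (if j = k then 1 else 0)"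
  "j \<in> I \<Longrightarrow> mcoeff (mderiv (2, k) (G j)) 0 = (if j = k then 1 else 0)"
  by (auto simp: mcoeff_deriv G_low' tvar_def mcoeff_var single_eq_iff)

lemma G_deriv2_0:
  "mcoeff (mderiv (1, l) (mderiv (2, k) (G j))) 0 = fgl_coeff G j l k"
  by (simp add: mcoeff_deriv fgl_coeff_def lookup_single)

lemma gsub_dom:
  assumes "\<And>l. l \<in> I \<Longrightarrow> mcoeff (u l) 0 = 0" "\<And>l. l \<in> I \<Longrightarrow> mcoeff (w l) 0 = 0"
  shows "subst_dom V2 (gsub u w)"
  using assms by (auto simp: subst_dom_def gsub_def)

lemma gsub_cong:
  assumes "f \<in> in_vars V2" "\<And>l. l \<in> I \<Longrightarrow> u l = u' l" "\<And>l. l \<in> I \<Longrightarrow> w l = w' l"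
  shows "msubst (gsub u w) f = msubst (gsub u' w') f"
  using assms by (intro msubst_cong[OF assms(1)]) (auto simp: gsub_def)

lemma gsub_comp:
  assumes r: "subst_dom W r" and f: "f \<in> in_vars V2"
    and "\<And>l. l \<in> I \<Longrightarrow> mcoeff (u l) 0 = 0" "\<And>l. l \<in> I \<Longrightarrow> mcoeff (w l) 0 = 0"
    and "\<And>l. l \<in> I \<Longrightarrow> u l \<in> in_vars W" "\<And>l. l \<in> I \<Longrightarrow> w l \<in> in_vars W"
  shows "msubst r (msubst (gsub u w) f) = msubst (gsub (\<lambda>l. msubst r (u l)) (\<lambda>l. msubst r (w l))) f"
proof -
  have "msubst r (msubst (gsub u w) f) = msubst (\<lambda>v. msubst r (gsub u w v)) f"
    by (rule msubst_comp[OF gsub_dom r f]) (use assms in \<open>auto simp: gsub_def\<close>)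
  also have "(\<lambda>v. msubst r (gsub u w v)) = gsub (\<lambda>l. msubst r (u l)) (\<lambda>l. msubst r (w l))"
    by (auto simp: gsub_def fun_eq_iff)
  finally show ?thesis .
qed

lemma gmult_comp:
  assumes "subst_dom W r" "j \<in> I"
    and "\<And>l. l \<in> I \<Longrightarrow> mcoeff (u l) 0 = 0" "\<And>l. l \<in> I \<Longrightarrow> mcoeff (w l) 0 = 0"
    and "\<And>l. l \<in> I \<Longrightarrow> u l \<in> in_vars W" "\<And>l. l \<in> I \<Longrightarrow> w l \<in> in_vars W"
  shows "msubst r (gmult G u w j) = gmult G (\<lambda>l. msubst r (u l)) (\<lambda>l. msubst r (w l)) j"
  unfolding gmult_gsub using assms by (intro gsub_comp G_vars)

lemma gmult_cong:
  "j \<in> I \<Longrightarrow> (\<And>l. l \<in> I \<Longrightarrow> u l = u' l) \<Longrightarrow> (\<And>l. l \<in> I \<Longrightarrow> w l = w' l) \<Longrightarrow>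
    gmult G u w j = gmult G u' w' j"
  unfolding gmult_gsub by (intro gsub_cong G_vars)

lemma gmult_0:
  "j \<in> I \<Longrightarrow> (\<And>l. l \<in> I \<Longrightarrow> mcoeff (u l) 0 = 0) \<Longrightarrow> (\<And>l. l \<in> I \<Longrightarrow> mcoeff (w l) 0 = 0) \<Longrightarrow>
    mcoeff (gmult G u w j) 0 = 0"
  unfolding gmult_gsub using mcoeff_msubst_0[OF gsub_dom G_vars, of u w j] by simp

lemma in_vars_gsub:
  assumes "f \<in> in_vars V2" "\<And>l. l \<in> I \<Longrightarrow> mcoeff (u l) 0 = 0" "\<And>l. l \<in> I \<Longrightarrow> mcoeff (w l) 0 = 0"
    and "\<And>l. l \<in> I \<Longrightarrow> u l \<in> in_vars W" "\<And>l. l \<in> I \<Longrightarrow> w l \<in> in_vars W"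
  shows "msubst (gsub u w) f \<in> in_vars W"
  by (rule in_vars_msubst[OF gsub_dom assms(1)]) (use assms in \<open>auto simp: gsub_def\<close>)

lemma in_vars_gmult:
  assumes "j \<in> I" "\<And>l. l \<in> I \<Longrightarrow> mcoeff (u l) 0 = 0" "\<And>l. l \<in> I \<Longrightarrow> mcoeff (w l) 0 = 0"
    and "\<And>l. l \<in> I \<Longrightarrow> u l \<in> in_vars W" "\<And>l. l \<in> I \<Longrightarrow> w l \<in> in_vars W"
  shows "gmult G u w j \<in> in_vars W"
  unfolding gmult_gsub using assms by (intro in_vars_gsub G_vars)

lemma tvar_0 [simp]: "mcoeff (tvar i l) 0 = 0"
  by (simp add: tvar_def)

lemma in_vars_tvar: "(i, l) \<in> W \<Longrightarrow> tvar i l \<in> in_vars W"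
  by (simp add: tvar_def in_vars_var)

lemma mderiv_tvar: "mderiv (i, l) (tvar k j) = (if i = k \<and> l = j then 1 else 0)"
  by (auto simp: tvar_def mderiv_var)

text \<open>The tuple \<open>\<phi> = G(X, 0)\<close> satisfies \<open>\<phi> \<circ> \<phi> = \<phi>\<close>, and \<open>\<phi>\<close> is
  the identity up to terms of higher order, so \<open>(\<phi> - id) \<circ> \<phi> = 0\<close> forces \<open>\<phi> = id\<close>.\<close>

lemma gmult_right_zero_1:
  assumes "j \<in> I"
  shows "gmult G (tvar 1) (\<lambda>_. 0) j = tvar 1 j"
proof -
  define \<phi> where "\<phi> j = gmult G (tvar 1) (\<lambda>_. 0) j" for j
  let ?W = "{1 :: nat} \<times> I"
  let ?W3 = "{1 :: nat, 2, 3} \<times> I"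
  define r :: "nat \<times> nat \<Rightarrow> 'k series" where "r = (\<lambda>(i, l). if i = 1 then tvar 1 l else 0)"
  have r: "subst_dom ?W3 r" by (auto simp: subst_dom_def r_def)
  have r1: "msubst r (tvar 1 l) = tvar 1 l" "msubst r (tvar 2 l) = 0" "msubst r (tvar 3 l) = 0" if "l \<in> I" for l
    using msubst_var[OF r] that by (auto simp: tvar_def r_def)
  have z: "mcoeff (\<phi> l) 0 = 0" if "l \<in> I" for l
    using that by (auto simp: \<phi>_def intro: gmult_0)
  have \<phi>W: "\<phi> l \<in> in_vars ?W" if "l \<in> I" for l
    using that unfolding \<phi>_def by (auto intro!: in_vars_gmult in_vars_tvar)
  \<comment> \<open>\<open>r\<close> sets Y = Z = 0 in the associativity law. The left side becomes
    \<phi> composed with itself, and the right side \<phi>, because G(0, 0) = 0.\<close>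
  have "msubst r (gmult G (gmult G (tvar 1) (tvar 2)) (tvar 3) j) = gmult G \<phi> (\<lambda>_. 0) j"
  proof -
    have "msubst r (gmult G (tvar 1) (tvar 2) l) = \<phi> l" if "l \<in> I" for l
      unfolding \<phi>_def using that
      by (subst gmult_comp[OF r that]) (auto intro!: in_vars_tvar gmult_cong simp: r1)
    then show ?thesis
      using assms by (subst gmult_comp[OF r assms])
         (auto intro!: in_vars_tvar gmult_cong in_vars_gmult gmult_0 simp: r1)
  qed
  moreover have "msubst r (gmult G (tvar 1) (gmult G (tvar 2) (tvar 3)) j) = \<phi> j"
  proof -
    have "msubst r (gmult G (tvar 2) (tvar 3) l) = 0" if "l \<in> I" for l
    proof -
      have "msubst r (gmult G (tvar 2) (tvar 3) l) = gmult G (\<lambda>_. 0) (\<lambda>_. 0) l"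
        using that by (subst gmult_comp[OF r that]) (auto intro!: in_vars_tvar gmult_cong simp: r1)
      also have "\<dots> = msubst (\<lambda>_. 0) (G l)"
        unfolding gmult_gsub by (rule msubst_cong[OF G_vars[OF that]]) (auto simp: gsub_def)
      also have "\<dots> = 0" using msubst_to_0[OF _ G_vars[OF that]] that by (simp add: mconst_simps)
      finally show ?thesis .
    qed
    then show ?thesis unfolding \<phi>_def
      using assms by (subst gmult_comp[OF r assms])
         (auto intro!: in_vars_tvar gmult_cong in_vars_gmult gmult_0 simp: r1)
  qed
  ultimately have idem: "gmult G \<phi> (\<lambda>_. 0) j = \<phi> j" using G_assoc[OF assms] by simp
  define s where "s = (\<lambda>(i :: nat, l). \<phi> l)"
  have s: "subst_dom ?W s" using z by (auto simp: subst_dom_def s_def)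
  have s\<phi>: "msubst s (\<phi> j) = gmult G \<phi> (\<lambda>_. 0) j"
    unfolding \<phi>_def[of j] 
  proof (subst gmult_comp[OF s assms])
    show "gmult G (\<lambda>l. msubst s (tvar 1 l)) (\<lambda>l. msubst s 0) j = gmult G \<phi> (\<lambda>_. 0) j"
      using msubst_var[OF s] by (intro gmult_cong[OF assms]) (auto simp: tvar_def s_def)
  qed (auto intro: in_vars_tvar)
  have st: "msubst s (tvar 1 j) = \<phi> j" using msubst_var[OF s, of "(1, j)"] assms by (simp add: tvar_def s_def)
  have tW: "tvar 1 j \<in> in_vars ?W" using assms by (auto intro: in_vars_tvar)
  have "msubst s (\<phi> j - tvar 1 j) = 0"
    using msubst_diff[OF s \<phi>W[OF assms] tW] by (simp add: st s\<phi> idem)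
  moreover have "has_order 2 (s v - mvar v)" if vW: "v \<in> ?W" for v
  proof -
    obtain l where v: "v = (1, l)" "l \<in> I" using vW by (cases v) auto
    have g0: "subst_dom V2 (gsub (tvar 1) (\<lambda>_. 0 :: 'k series))" by (intro gsub_dom) auto
    have iv: "tvar 1 l + tvar 2 l \<in> in_vars V2" using v by (auto intro!: in_vars_add in_vars_tvar)
    have "has_order 2 (G l - (tvar 1 l + tvar 2 l))" using G_low'[OF v(2)] by (auto simp: has_order_def)
    moreover have "G l - (tvar 1 l + tvar 2 l) \<in> in_vars V2" using iv G_vars[OF v(2)] by (intro in_vars_diff)
    ultimately have "has_order 2 (msubst (gsub (tvar 1) (\<lambda>_. 0)) (G l - (tvar 1 l + tvar 2 l)))"
      using cont_linear_msubst[OF g0] unfolding cont_linear_def by simp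
    also have "msubst (gsub (tvar 1) (\<lambda>_. 0)) (G l - (tvar 1 l + tvar 2 l)) = \<phi> l - tvar 1 l"
    proof -
      have "msubst (gsub (tvar 1) (\<lambda>_. 0 :: 'k series)) (tvar 1 l) = tvar 1 l"
        "msubst (gsub (tvar 1) (\<lambda>_. 0 :: 'k series)) (tvar 2 l) = 0"
        using msubst_tvar[OF g0, of 1 l] msubst_tvar[OF g0, of 2 l] v(2)
        by (simp_all add: gsub_def)
      moreover have t: "tvar 1 l \<in> in_vars V2" "(tvar 2 l :: 'k series) \<in> in_vars V2"
        using v(2) by (auto intro: in_vars_tvar)
      ultimately show ?thesis
        by (simp add: msubst_diff[OF g0 G_vars[OF v(2)] iv] msubst_add[OF g0 t] \<phi>_def gmult_gsub)
    qed
    finally show ?thesis by (simp add: v s_def tvar_def)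
  qed
  ultimately have "\<phi> j - tvar 1 j = 0"
    using msubst_eq_0_imp[OF s _ in_vars_diff[OF \<phi>W[OF assms] tW]] by blast
  then show ?thesis by (simp add: \<phi>_def)
qed

lemma gmult_right_zero:
  assumes j: "j \<in> I" and u: "\<And>l. l \<in> I \<Longrightarrow> mcoeff (u l) 0 = 0"
  shows "gmult G u (\<lambda>_. 0) j = u j"
proof -
  let ?W = "{1 :: nat} \<times> I"
  define s where "s = (\<lambda>(i :: nat, l). u l)"
  have s: "subst_dom ?W s" using u by (auto simp: subst_dom_def s_def)
  have sv: "msubst s (tvar 1 l) = u l" if "l \<in> I" for l
    using msubst_tvar[OF s, of 1 l] that by (simp add: s_def)
  have "msubst s (gmult G (tvar 1) (\<lambda>_. 0) j) = gmult G u (\<lambda>_. 0) j"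
    using j by (subst gmult_comp[OF s j]) (auto intro!: in_vars_tvar gmult_cong simp: sv)
  then show ?thesis
    using msubst_var[OF s, of "(1, j)"] j by (simp add: gmult_right_zero_1[OF j] tvar_def s_def)
qed

lemma gmult_assoc:
  assumes j: "j \<in> I" and X: "\<And>l. l \<in> I \<Longrightarrow> mcoeff (X l) 0 = 0"
    and Y: "\<And>l. l \<in> I \<Longrightarrow> mcoeff (Y l) 0 = 0" and Z: "\<And>l. l \<in> I \<Longrightarrow> mcoeff (Z l) 0 = 0"
  shows "gmult G (gmult G X Y) Z j = gmult G X (gmult G Y Z) j"
proof -
  let ?W = "{1 :: nat, 2, 3} \<times> I"
  define s where "s = (\<lambda>(i :: nat, l). if i = 1 then X l else if i = 2 then Y l else Z l)"
  have s: "subst_dom ?W s" using X Y Z by (auto simp: subst_dom_def s_def)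
  have sv: "msubst s (tvar 1 l) = X l" "msubst s (tvar 2 l) = Y l" "msubst s (tvar 3 l) = Z l" if "l \<in> I" for l
    using msubst_var[OF s] that by (auto simp: tvar_def s_def)
  have 1: "msubst s (gmult G (tvar 1) (tvar 2) l) = gmult G X Y l" if "l \<in> I" for l
    using that by (subst gmult_comp[OF s that]) (auto intro!: in_vars_tvar gmult_cong simp: sv)
  have 2: "msubst s (gmult G (tvar 2) (tvar 3) l) = gmult G Y Z l" if "l \<in> I" for l
    using that by (subst gmult_comp[OF s that]) (auto intro!: in_vars_tvar gmult_cong simp: sv)
  have "msubst s (gmult G (gmult G (tvar 1) (tvar 2)) (tvar 3) j) = gmult G (gmult G X Y) Z j"
    using j by (subst gmult_comp[OF s j])
       (auto intro!: in_vars_tvar gmult_cong in_vars_gmult gmult_0 simp: sv 1 2)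
  moreover have "msubst s (gmult G (tvar 1) (gmult G (tvar 2) (tvar 3)) j) = gmult G X (gmult G Y Z) j"
    using j by (subst gmult_comp[OF s j])
       (auto intro!: in_vars_tvar gmult_cong in_vars_gmult gmult_0 simp: sv 1 2)
  ultimately show ?thesis using G_assoc[OF j] by simp
qed

text \<open>The left invariant vector fields: \<open>W N j k\<close> is the \<open>j\<close>-th component of the \<open>k\<close>-th
  field, at the point \<open>tvar N\<close>.\<close>

definition W :: "nat \<Rightarrow> nat \<Rightarrow> nat \<Rightarrow> 'k series" where
  "W N j k = msubst (gsub (tvar N) (\<lambda>_. 0)) (mderiv (2, k) (G j))"

definition D :: "nat \<Rightarrow> nat \<Rightarrow> 'k series \<Rightarrow> 'k series" where
  "D N k f = (if k \<in> I then \<Sum>j\<in>I. W N j k * mderiv (N, j) f else 0)"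

text \<open>Like \<open>D\<close>, extended by zero outside the index range, so that antisymmetry,
  Jacobi and the commutator formula hold for all natural numbers as indices.\<close>

definition strc :: "nat \<Rightarrow> nat \<Rightarrow> nat \<Rightarrow> 'k" where
  "strc j k l = (if j \<in> I \<and> k \<in> I \<and> l \<in> I then fgl_coeff G j k l - fgl_coeff G j l k else 0)"

abbreviation Gt :: "nat \<Rightarrow> nat \<Rightarrow> 'k series" where
  "Gt N \<equiv> gmult G (tvar N) (tvar (Suc N))"

lemma dG_vars: "j \<in> I \<Longrightarrow> mderiv v (G j) \<in> in_vars V2"
  by (intro in_vars_mderiv G_vars)

lemma W_vars: "j \<in> I \<Longrightarrow> W N j k \<in> in_vars ({N} \<times> I)"
  unfolding W_def by (auto intro!: in_vars_gsub dG_vars in_vars_tvar)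

lemma Gt_vars: "j \<in> I \<Longrightarrow> Gt N j \<in> in_vars ({N, Suc N} \<times> I)"
  by (auto intro!: in_vars_gmult in_vars_tvar)

lemma Gt_0 [simp]: "j \<in> I \<Longrightarrow> mcoeff (Gt N j) 0 = 0"
  by (auto intro: gmult_0)

lemma W_0: "j \<in> I \<Longrightarrow> mcoeff (W N j k) 0 = (if j = k then 1 else 0)"
  unfolding W_def by (subst mcoeff_msubst_0[OF gsub_dom dG_vars]) (auto simp: G_deriv_0)

lemma mderiv_gsub:
  assumes f: "f \<in> in_vars V2"
    and u: "\<And>l. l \<in> I \<Longrightarrow> mcoeff (u l) 0 = 0" and w: "\<And>l. l \<in> I \<Longrightarrow> mcoeff (w l) 0 = 0"
  shows "mderiv x (msubst (gsub u w) f) =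
    (\<Sum>j\<in>I. msubst (gsub u w) (mderiv (1, j) f) * mderiv x (u j)) +
    (\<Sum>j\<in>I. msubst (gsub u w) (mderiv (2, j) f) * mderiv x (w j))"
proof -
  have V2: "V2 = Pair 1 ` I \<union> Pair 2 ` I" by auto
  have "mderiv x (msubst (gsub u w) f) =
     (\<Sum>v\<in>V2. msubst (gsub u w) (mderiv v f) * mderiv x (gsub u w v))"
    by (rule mderiv_msubst[OF gsub_dom[OF u w] f])
  also have "\<dots> = (\<Sum>v\<in>Pair 1 ` I. msubst (gsub u w) (mderiv v f) * mderiv x (gsub u w v))
      + (\<Sum>v\<in>Pair 2 ` I. msubst (gsub u w) (mderiv v f) * mderiv x (gsub u w v))"
    unfolding V2 by (rule sum.union_disjoint) auto
  finally show ?thesis by (simp add: sum.reindex inj_on_def gsub_def)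
qed

lemma sum_delta_I: "k \<in> I \<Longrightarrow> (\<Sum>j\<in>I. f j * (if k = j then 1 else 0)) = (f k :: 'k series)"
proof -
  assume k: "k \<in> I"
  have "(\<Sum>j\<in>I. f j * (if k = j then 1 else 0)) = (\<Sum>j\<in>I. if k = j then f j else 0)"
    by (rule sum.cong) auto
  then show ?thesis using k by simp
qed

lemma sum_delta_I': "k \<in> I \<Longrightarrow> (\<Sum>j\<in>I. f j * (if j = k then 1 else 0)) = (f k :: 'k series)"
proof -
  assume k: "k \<in> I"
  have "(\<Sum>j\<in>I. f j * (if j = k then 1 else 0)) = (\<Sum>j\<in>I. f j * (if k = j then 1 else 0))"
    by (rule sum.cong) auto
  then show ?thesis using sum_delta_I[OF k] by simp
qed

section \<open>Left invariance and commutators of the fields\<close>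

lemma mderiv_Gt_Suc:
  assumes "l \<in> I" "k \<in> I"
  shows "mderiv (Suc N, k) (Gt N l) = msubst (gsub (tvar N) (tvar (Suc N))) (mderiv (2, k) (G l))"
  unfolding gmult_gsub
  by (subst mderiv_gsub) (use assms in \<open>auto simp: G_vars mderiv_tvar sum_delta_I\<close>)

definition zsub :: "nat \<Rightarrow> nat \<times> nat \<Rightarrow> 'k series" where
  "zsub n = (\<lambda>(i, j). if i = n then 0 else tvar i j)"

definition Zero :: "nat \<Rightarrow> 'k series \<Rightarrow> 'k series" where
  "Zero n f = msubst (zsub n) f"

lemma zsub_dom: "finite V \<Longrightarrow> subst_dom V (zsub n)"
  by (auto simp: subst_dom_def zsub_def)

lemma Zero_tvar: "Zero n (tvar i j) = (if i = n then 0 else tvar i j)"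
  unfolding Zero_def using msubst_var[OF zsub_dom, of "{(i, j)}" "(i, j)"]
  by (simp add: tvar_def[of i j]) (simp add: zsub_def tvar_def)

lemma Zero_0 [simp]: "Zero n 0 = 0"
  by (simp add: Zero_def)

lemma Zero_id: "finite V \<Longrightarrow> f \<in> in_vars V \<Longrightarrow> (\<And>j. (n, j) \<notin> V) \<Longrightarrow> Zero n f = f"
  unfolding Zero_def by (rule msubst_id) (auto simp: zsub_def tvar_def)

lemma Zero_gsub:
  assumes W: "finite U" and f: "f \<in> in_vars V2"
    and u: "\<And>l. l \<in> I \<Longrightarrow> mcoeff (u l) 0 = 0" and w: "\<And>l. l \<in> I \<Longrightarrow> mcoeff (w l) 0 = 0"
    and uW: "\<And>l. l \<in> I \<Longrightarrow> u l \<in> in_vars U" and wW: "\<And>l. l \<in> I \<Longrightarrow> w l \<in> in_vars U"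
  shows "Zero n (msubst (gsub u w) f) = msubst (gsub (\<lambda>l. Zero n (u l)) (\<lambda>l. Zero n (w l))) f"
  unfolding Zero_def by (rule gsub_comp[OF zsub_dom[OF W] f u w uW wW])

text \<open>Left translation by x carries the field at y to the field at G(x, y): differentiate
  G(G(x, y), z) = G(x, G(y, z)) in z and set z = 0.\<close>

lemma W_star:
  assumes l: "l \<in> I" and k: "k \<in> I"
  shows "(\<Sum>j\<in>I. mderiv (Suc N, j) (Gt N l) * W (Suc N) j k) =
    msubst (gsub (Gt N) (\<lambda>_. 0)) (mderiv (2, k) (G l))"
proof -
  let ?X = "tvar N" and ?Y = "tvar (Suc N)" and ?Z = "tvar (Suc (Suc N)) :: nat \<Rightarrow> 'k series"
  let ?B = "Gt (Suc N)" and ?v = "(Suc (Suc N), k)" and ?n = "Suc (Suc N)"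
  let ?U = "{N, Suc N, Suc (Suc N)} \<times> I"
  have fin: "finite ?U" by simp
  have GtU: "Gt N j \<in> in_vars ?U" "Gt (Suc N) j \<in> in_vars ?U" if "j \<in> I" for j
    using Gt_vars[OF that] by (auto intro: in_vars_mono)
  have tU: "tvar i j \<in> in_vars ?U" if "j \<in> I" "i \<in> {N, Suc N, Suc (Suc N)}" for i j
    using that by (intro in_vars_tvar) auto
  have d0: "mderiv ?v (Gt N j) = 0" if "j \<in> I" for j
    using mderiv_outside[OF Gt_vars[OF that]] by simp
  have "mderiv ?v (gmult G (Gt N) ?Z l) = msubst (gsub (Gt N) ?Z) (mderiv (2, k) (G l))"
    unfolding gmult_gsub[of G "Gt N"]
    by (subst mderiv_gsub) (use l k in \<open>auto simp: G_vars mderiv_tvar sum_delta_I d0\<close>)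
  moreover have "mderiv ?v (gmult G ?X ?B l) =
      (\<Sum>j\<in>I. msubst (gsub ?X ?B) (mderiv (2, j) (G l)) * mderiv ?v (?B j))"
    unfolding gmult_gsub[of G ?X ?B]
    by (subst mderiv_gsub) (use l k in \<open>auto simp: G_vars mderiv_tvar\<close>)
  moreover have "gmult G (Gt N) ?Z l = gmult G ?X ?B l"
    by (rule gmult_assoc) (use l in auto)
  \<comment> \<open>The derivative in z is taken on both sides of associativity before z is set to
    0; this z is the tuple of index N + 2.\<close>
  ultimately have eq: "msubst (gsub (Gt N) ?Z) (mderiv (2, k) (G l)) =
      (\<Sum>j\<in>I. msubst (gsub ?X ?B) (mderiv (2, j) (G l)) * mderiv ?v (?B j))" by simp
  have "Zero ?n (msubst (gsub (Gt N) ?Z) (mderiv (2, k) (G l))) =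
      msubst (gsub (\<lambda>l. Zero ?n (Gt N l)) (\<lambda>l. Zero ?n (?Z l))) (mderiv (2, k) (G l))"
    using l by (intro Zero_gsub[OF fin]) (auto intro: dG_vars GtU tU)
  also have "\<dots> = msubst (gsub (Gt N) (\<lambda>_. 0)) (mderiv (2, k) (G l))"
  proof (rule gsub_cong[OF dG_vars[OF l]])
    fix j assume "j \<in> I"
    then show "Zero ?n (Gt N j) = Gt N j" by (intro Zero_id[OF _ Gt_vars]) auto
  qed (simp add: Zero_tvar)
  finally have L: "Zero ?n (msubst (gsub (Gt N) ?Z) (mderiv (2, k) (G l))) =
      msubst (gsub (Gt N) (\<lambda>_. 0)) (mderiv (2, k) (G l))" .
  have ZB: "Zero ?n (?B j) = ?Y j" if "j \<in> I" for j
  proof -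
    have "Zero ?n (?B j) = msubst (gsub (\<lambda>l. Zero ?n (?Y l)) (\<lambda>l. Zero ?n (?Z l))) (G j)"
      unfolding gmult_gsub using that by (intro Zero_gsub[OF fin]) (auto intro: G_vars tU)
    also have "\<dots> = gmult G ?Y (\<lambda>_. 0) j"
      unfolding gmult_gsub using that by (intro gsub_cong G_vars) (auto simp: Zero_tvar)
    finally show ?thesis using that by (simp add: gmult_right_zero)
  qed
  have vars: "msubst (gsub ?X ?B) (mderiv (2, j) (G l)) \<in> in_vars ?U" "mderiv ?v (?B j) \<in> in_vars ?U"
    if "j \<in> I" for j
    using l that by (auto intro!: in_vars_gsub dG_vars tU GtU in_vars_mderiv[OF GtU(2)])
  have R1: "Zero ?n (msubst (gsub ?X ?B) (mderiv (2, j) (G l))) = mderiv (Suc N, j) (Gt N l)"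
    if "j \<in> I" for j
  proof -
    have "Zero ?n (msubst (gsub ?X ?B) (mderiv (2, j) (G l))) =
        msubst (gsub (\<lambda>l. Zero ?n (?X l)) (\<lambda>l. Zero ?n (?B l))) (mderiv (2, j) (G l))"
      using l by (intro Zero_gsub[OF fin]) (auto intro: dG_vars GtU tU)
    also have "\<dots> = msubst (gsub ?X ?Y) (mderiv (2, j) (G l))"
      using l by (intro gsub_cong dG_vars) (auto simp: Zero_tvar ZB)
    finally show ?thesis using mderiv_Gt_Suc[OF l that] by simp
  qed
  have R2: "Zero ?n (mderiv ?v (?B j)) = W (Suc N) j k" if "j \<in> I" for j
  proof -
    have "Zero ?n (mderiv ?v (?B j)) =
       msubst (gsub (\<lambda>l. Zero ?n (?Y l)) (\<lambda>l. Zero ?n (?Z l))) (mderiv (2, k) (G j))"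
      unfolding mderiv_Gt_Suc[OF that k]
      using that by (intro Zero_gsub[OF fin]) (auto intro: dG_vars tU)
    also have "\<dots> = W (Suc N) j k"
      unfolding W_def using that by (intro gsub_cong dG_vars) (auto simp: Zero_tvar)
    finally show ?thesis .
  qed
  have "Zero ?n (\<Sum>j\<in>I. msubst (gsub ?X ?B) (mderiv (2, j) (G l)) * mderiv ?v (?B j)) =
     (\<Sum>j\<in>I. Zero ?n (msubst (gsub ?X ?B) (mderiv (2, j) (G l))) * Zero ?n (mderiv ?v (?B j)))"
    unfolding Zero_def
    by (subst msubst_sum[OF zsub_dom[OF fin]])
       (auto intro!: in_vars_mult sum.cong msubst_mult[OF zsub_dom[OF fin]] vars)
  also have "\<dots> = (\<Sum>j\<in>I. mderiv (Suc N, j) (Gt N l) * W (Suc N) j k)"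
    by (rule sum.cong) (simp_all add: R1 R2)
  finally show ?thesis using L eq by simp
qed

lemma Zero_W_0: "j \<in> I \<Longrightarrow> Zero N (mderiv (N, r) (W N j k)) = mconst (mcoeff (mderiv (N, r) (W N j k)) 0)"
proof -
  assume j: "j \<in> I"
  have v: "mderiv (N, r) (W N j k) \<in> in_vars ({N} \<times> I)" by (intro in_vars_mderiv W_vars j)
  have "Zero N (mderiv (N, r) (W N j k)) = msubst (\<lambda>_. 0) (mderiv (N, r) (W N j k))"
    unfolding Zero_def by (rule msubst_cong[OF v]) (auto simp: zsub_def)
  then show ?thesis using msubst_to_0[OF _ v] by simp
qed

lemma mderiv_W:
  assumes "j \<in> I" "r \<in> I"
  shows "mderiv (N, r) (W N j k) = msubst (gsub (tvar N) (\<lambda>_. 0)) (mderiv (1, r) (mderiv (2, k) (G j)))"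
  unfolding W_def by (subst mderiv_gsub) (use assms in \<open>auto simp: dG_vars mderiv_tvar sum_delta_I\<close>)

lemma mderiv_W_0:
  assumes "j \<in> I" "r \<in> I"
  shows "mcoeff (mderiv (N, r) (W N j k)) 0 = fgl_coeff G j r k"
  unfolding mderiv_W[OF assms]
  by (subst mcoeff_msubst_0[OF gsub_dom]) (use assms in \<open>auto simp: G_deriv2_0 intro: in_vars_mderiv G_vars\<close>)

text \<open>The invariance of the k-th field, differentiated in the r-th coordinate of y at y = 0.
  The second derivative of G that remains is symmetric in \<open>k\<close> and \<open>r\<close> and
  drops out of the commutator; the quadratic coefficients of G stay.\<close>

lemma W_bracket_half:
  assumes l: "l \<in> I" and k: "k \<in> I" and r: "r \<in> I"
  shows "(\<Sum>i\<in>I. mderiv (N, i) (W N l k) * W N i r) =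
    Zero (Suc N) (mderiv (Suc N, r) (mderiv (Suc N, k) (Gt N l))) +
    (\<Sum>j\<in>I. mconst (fgl_coeff G j r k) * W N l j)"
proof -
  let ?U = "{N, Suc N} \<times> I" and ?n = "Suc N" and ?v = "(Suc N, r)"
  have fin: "finite ?U" by simp
  have tU: "tvar i j \<in> in_vars ?U" if "j \<in> I" "i \<in> {N, Suc N}" for i j
    using that by (intro in_vars_tvar) auto
  have WU: "W (Suc N) j k \<in> in_vars ?U" if "j \<in> I" for j k
    using W_vars[OF that] by (rule in_vars_mono) auto
  note zd = zsub_dom[OF fin, of ?n]
  have Zmult: "Zero ?n (f * g) = Zero ?n f * Zero ?n g" if "f \<in> in_vars ?U" "g \<in> in_vars ?U" for f g
    unfolding Zero_def by (rule msubst_mult[OF zd that])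
  have Zadd: "Zero ?n (f + g) = Zero ?n f + Zero ?n g" if "f \<in> in_vars ?U" "g \<in> in_vars ?U" for f g
    unfolding Zero_def by (rule msubst_add[OF zd that])
  have Zsum: "Zero ?n (sum f I) = (\<Sum>j\<in>I. Zero ?n (f j))" if "\<And>j. j \<in> I \<Longrightarrow> f j \<in> in_vars ?U" for f
    unfolding Zero_def by (rule msubst_sum[OF zd that])
  have ZG: "Zero ?n (Gt N j) = tvar N j" if "j \<in> I" for j
  proof -
    have "Zero ?n (Gt N j) = msubst (gsub (\<lambda>l. Zero ?n (tvar N l)) (\<lambda>l. Zero ?n (tvar ?n l))) (G j)"
      unfolding gmult_gsub using that by (intro Zero_gsub[OF fin]) (auto intro: G_vars tU)
    also have "\<dots> = gmult G (tvar N) (\<lambda>_. 0) j"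
      unfolding gmult_gsub using that by (intro gsub_cong G_vars) (auto simp: Zero_tvar)
    finally show ?thesis using that by (simp add: gmult_right_zero)
  qed
  have ZdG: "Zero ?n (mderiv (?n, j) (Gt N i)) = W N i j" if "j \<in> I" "i \<in> I" for i j
  proof -
    have "Zero ?n (mderiv (?n, j) (Gt N i)) =
       msubst (gsub (\<lambda>l. Zero ?n (tvar N l)) (\<lambda>l. Zero ?n (tvar ?n l))) (mderiv (2, j) (G i))"
      unfolding mderiv_Gt_Suc[OF that(2,1)]
      using that by (intro Zero_gsub[OF fin]) (auto intro: dG_vars tU)
    also have "\<dots> = W N i j"
      unfolding W_def using that by (intro gsub_cong dG_vars) (auto simp: Zero_tvar)
    finally show ?thesis .
  qed
  have ZW: "Zero ?n (W ?n j k) = mconst (if j = k then 1 else 0)" if "j \<in> I" for j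
  proof -
    have "Zero ?n (W ?n j k) = msubst (\<lambda>_. 0) (W ?n j k)"
      unfolding Zero_def by (rule msubst_cong[OF W_vars[OF that]]) (auto simp: zsub_def)
    then show ?thesis using msubst_to_0[OF _ W_vars[OF that, of ?n k]] W_0[OF that] by simp
  qed
  have dGU: "mderiv v (Gt N i) \<in> in_vars ?U" if "i \<in> I" for i v
    using that Gt_vars by (intro in_vars_mderiv)
  have *: "Zero ?n (mderiv ?v (mderiv (?n, j) (Gt N l) * W ?n j k)) =
     Zero ?n (mderiv ?v (mderiv (?n, j) (Gt N l))) * Zero ?n (W ?n j k)
       + Zero ?n (mderiv (?n, j) (Gt N l)) * Zero ?n (mderiv ?v (W ?n j k))" if "j \<in> I" for j
    unfolding mderiv_mult
    by (simp only: Zadd in_vars_mult in_vars_mderiv[OF dGU[OF l]] in_vars_mderiv[OF WU[OF that]]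
        dGU[OF l] WU[OF that] Zmult)
  have "Zero ?n (mderiv ?v (\<Sum>j\<in>I. mderiv (?n, j) (Gt N l) * W ?n j k)) =
     (\<Sum>j\<in>I. Zero ?n (mderiv ?v (mderiv (?n, j) (Gt N l))) * Zero ?n (W ?n j k)
       + Zero ?n (mderiv (?n, j) (Gt N l)) * Zero ?n (mderiv ?v (W ?n j k)))"
    unfolding mderiv_sum
    by (subst Zsum) (auto simp: * l intro!: in_vars_mderiv in_vars_mult dGU WU Gt_vars)
  also have "\<dots> = (\<Sum>j\<in>I. Zero ?n (mderiv ?v (mderiv (?n, j) (Gt N l))) * (if j = k then 1 else 0)
       + mconst (fgl_coeff G j r k) * W N l j)"
    by (rule sum.cong) (auto simp: ZW ZdG l r Zero_W_0 mderiv_W_0 mconst_simps mult.commute)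
  also have "\<dots> = Zero ?n (mderiv ?v (mderiv (?n, k) (Gt N l))) + (\<Sum>j\<in>I. mconst (fgl_coeff G j r k) * W N l j)"
    by (simp only: sum.distrib sum_delta_I'[OF k])
  finally have L: "Zero ?n (mderiv ?v (\<Sum>j\<in>I. mderiv (?n, j) (Gt N l) * W ?n j k)) = \<dots>" .
  have R: "Zero ?n (msubst (gsub (Gt N) (\<lambda>_. 0)) (mderiv (1, i) (mderiv (2, k) (G l)))) = mderiv (N, i) (W N l k)"
    if "i \<in> I" for i
  proof -
    have "Zero ?n (msubst (gsub (Gt N) (\<lambda>_. 0)) (mderiv (1, i) (mderiv (2, k) (G l)))) =
      msubst (gsub (\<lambda>l. Zero ?n (Gt N l)) (\<lambda>l. Zero ?n 0)) (mderiv (1, i) (mderiv (2, k) (G l)))"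
      using l by (intro Zero_gsub[OF fin]) (auto intro: G_vars in_vars_mderiv Gt_vars)
    also have "\<dots> = msubst (gsub (tvar N) (\<lambda>_. 0)) (mderiv (1, i) (mderiv (2, k) (G l)))"
      using l by (intro gsub_cong in_vars_mderiv dG_vars) (auto simp: ZG G_vars)
    finally show ?thesis using mderiv_W[OF l that] by simp
  qed
  have "mderiv ?v (msubst (gsub (Gt N) (\<lambda>_. 0)) (mderiv (2, k) (G l))) =
    (\<Sum>i\<in>I. msubst (gsub (Gt N) (\<lambda>_. 0)) (mderiv (1, i) (mderiv (2, k) (G l))) * mderiv ?v (Gt N i))"
    by (subst mderiv_gsub) (use l in \<open>auto simp: dG_vars\<close>)
  moreover have "Zero ?n (\<Sum>i\<in>I. msubst (gsub (Gt N) (\<lambda>_. 0)) (mderiv (1, i) (mderiv (2, k) (G l))) * mderiv ?v (Gt N i))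
     = (\<Sum>i\<in>I. mderiv (N, i) (W N l k) * W N i r)"
  proof -
    have i: "msubst (gsub (Gt N) (\<lambda>_. 0)) (mderiv (1, i) (mderiv (2, k) (G l))) \<in> in_vars ?U" for i
      using l by (auto intro!: in_vars_gsub in_vars_mderiv G_vars Gt_vars)
    show ?thesis
      by (subst Zsum) (auto simp: Zmult[OF i dGU] R ZdG r intro!: in_vars_mult i dGU)
  qed
  ultimately show ?thesis using L W_star[OF l k, of N] by simp
qed

lemma W_bracket:
  assumes l: "l \<in> I" and k: "k \<in> I" and r: "r \<in> I"
  shows "(\<Sum>i\<in>I. W N i r * mderiv (N, i) (W N l k)) - (\<Sum>i\<in>I. W N i k * mderiv (N, i) (W N l r)) =
    (\<Sum>j\<in>I. mconst (strc j r k) * W N l j)"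
proof -
  have "(\<Sum>j\<in>I. mconst (strc j r k) * W N l j) =
      (\<Sum>j\<in>I. mconst (fgl_coeff G j r k) * W N l j) - (\<Sum>j\<in>I. mconst (fgl_coeff G j k r) * W N l j)"
    unfolding sum_subtractf[symmetric]
    by (rule sum.cong) (auto simp: strc_def k r mconst_diff left_diff_distrib)
  moreover have "(\<Sum>i\<in>I. W N i x * mderiv (N, i) (W N l y)) = (\<Sum>i\<in>I. mderiv (N, i) (W N l y) * W N i x)" for x y
    by (rule sum.cong) (auto simp: mult.commute)
  ultimately show ?thesis
    using W_bracket_half[OF l k r, of N] W_bracket_half[OF l r k, of N]
      mderiv_commute[of "(Suc N, r)" "(Suc N, k)" "Gt N l"] by simp
qed

lemma D_add: "D N k (f + g) = D N k f + D N k g"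
  by (simp add: D_def distrib_left sum.distrib)

lemma D_const_mult: "D N k (mconst a * f) = mconst a * D N k f"
  by (simp add: D_def mderiv_const_mult sum_distrib_left mult.left_commute)

lemma D_mult: "D N k (f * g) = D N k f * g + f * D N k g"
  by (simp add: D_def mderiv_mult algebra_simps sum.distrib sum_distrib_left sum_distrib_right)

lemma D_zero [simp]: "D N k 0 = 0"
  by (simp add: D_def)

text \<open>The second-order parts of the two compositions agree because partial derivatives
  commute; what is left is the commutator of the component functions,
  \<open>W_bracket\<close>.\<close>

lemma D_bracket:
  "D N r (D N k f) - D N k (D N r f) = (\<Sum>j\<in>I. mconst (strc j r k) * D N j f)"
proof (cases "r \<in> I \<and> k \<in> I")
  case False
  then have "strc j r k = 0" for j by (auto simp: strc_def)
  then show ?thesis using False by (auto simp: mconst_simps) (auto simp: D_def)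
next
  case True
  then have r: "r \<in> I" and k: "k \<in> I" by auto
  define T where "T r k = (\<Sum>i\<in>I. \<Sum>l\<in>I. W N i r * W N l k * mderiv (N, i) (mderiv (N, l) f))" for r k
  have T: "T r k = T k r"
  proof -
    have "T r k = (\<Sum>l\<in>I. \<Sum>i\<in>I. W N i r * W N l k * mderiv (N, i) (mderiv (N, l) f))"
      unfolding T_def by (rule sum.swap)
    also have "\<dots> = T k r"
      unfolding T_def by (intro sum.cong refl) (auto simp: mderiv_commute mult_ac)
    finally show ?thesis .
  qed
  have expand: "D N r (D N k f) =
      (\<Sum>l\<in>I. (\<Sum>i\<in>I. W N i r * mderiv (N, i) (W N l k)) * mderiv (N, l) f) + T r k"
    if "r \<in> I" "k \<in> I" for r k
  proof -
    have "D N r (D N k f) = (\<Sum>i\<in>I. \<Sum>l\<in>I. W N i r * mderiv (N, i) (W N l k) * mderiv (N, l) f) + T r k"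
      using that by (simp add: D_def mderiv_sum mderiv_mult T_def distrib_left sum.distrib sum_distrib_left mult.assoc)
    also have "(\<Sum>i\<in>I. \<Sum>l\<in>I. W N i r * mderiv (N, i) (W N l k) * mderiv (N, l) f) =
       (\<Sum>l\<in>I. (\<Sum>i\<in>I. W N i r * mderiv (N, i) (W N l k)) * mderiv (N, l) f)"
      by (subst sum.swap) (simp add: sum_distrib_right)
    finally show ?thesis .
  qed
  have "D N r (D N k f) - D N k (D N r f) =
     (\<Sum>l\<in>I. ((\<Sum>i\<in>I. W N i r * mderiv (N, i) (W N l k)) - (\<Sum>i\<in>I. W N i k * mderiv (N, i) (W N l r))) * mderiv (N, l) f)"
    unfolding expand[OF r k] expand[OF k r] T by (simp add: left_diff_distrib sum_subtractf)
  also have "\<dots> = (\<Sum>l\<in>I. \<Sum>j\<in>I. mconst (strc j r k) * W N l j * mderiv (N, l) f)"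
    by (rule sum.cong[OF refl]) (simp only: W_bracket[OF _ k r] sum_distrib_right)
  also have "\<dots> = (\<Sum>j\<in>I. mconst (strc j r k) * D N j f)"
    by (subst sum.swap) (simp add: D_def sum_distrib_left mult.assoc)
  finally show ?thesis .
qed

lemma strc_antisym: "strc j k l = - strc j l k"
  by (auto simp: strc_def)

lemma D_diff: "D N k (f - g) = D N k f - D N k g"
  by (simp add: D_def right_diff_distrib sum_subtractf)

lemma D_sum: "D N k (sum f A) = (\<Sum>x\<in>A. D N k (f x))"
  by (induction A rule: infinite_finite_induct) (auto simp: D_add)

lemma D_tvar_0: "k \<in> I \<Longrightarrow> b \<in> I \<Longrightarrow> mcoeff (D N k (tvar N b)) 0 = (if b = k then 1 else 0)"
proof -
  assume kb: "k \<in> I" "b \<in> I"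
  have "mcoeff (D N k (tvar N b)) 0 = (\<Sum>j\<in>I. mcoeff (W N j k) 0 * mcoeff (mderiv (N, j) (tvar N b)) 0)"
    using kb by (simp add: D_def)
  also have "\<dots> = (\<Sum>j\<in>I. if j = b then (if b = k then 1 else 0) else 0)"
    by (rule sum.cong) (auto simp: W_0 mderiv_tvar mcoeff_one)
  finally have "mcoeff (D N k (tvar N b)) 0 = \<dots>" .
  then show ?thesis using kb by simp
qed

text \<open>The Jacobi identity for the structure constants is inherited from the commutators of the
  invariant fields, which are linearly independent.\<close>

lemma strc_jacobi:
  "(\<Sum>a\<in>I. strc a k i * strc b l a) - (\<Sum>a\<in>I. strc a l i * strc b k a) =
      - (\<Sum>a\<in>I. strc a k l * strc b a i)"
proof (cases "k \<in> I \<and> l \<in> I \<and> i \<in> I \<and> b \<in> I")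
  case False
  then show ?thesis by (auto simp: strc_def)
next
  case True
  then have b: "b \<in> I" by simp
  let ?f = "tvar 1 b"
  \<comment> \<open>The double commutator of D_k with [D_l, D_i], applied to the coordinate x_b. At
    the origin D_j x_b is the Kronecker delta, so its value there is the e_b-component of the double
    bracket; the cyclic sum vanishes identically.\<close>
  define C where "C k l i = D 1 k (D 1 l (D 1 i ?f) - D 1 i (D 1 l ?f)) -
      (D 1 l (D 1 i (D 1 k ?f)) - D 1 i (D 1 l (D 1 k ?f)))" for k l i
  have "C k l i = (\<Sum>a\<in>I. mconst (strc a l i) * (D 1 k (D 1 a ?f) - D 1 a (D 1 k ?f)))" for k l i
    unfolding C_def D_bracket[of 1 l i]
    by (simp add: D_sum D_const_mult flip: sum_subtractf right_diff_distrib)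
  then have "mcoeff (C k l i) 0 = (\<Sum>a\<in>I. strc a l i * strc b k a)" for k l i
    using b by (simp add: D_bracket D_tvar_0 mcoeff_const if_distrib cong: if_cong)
  moreover have "C k l i + C l i k + C i k l = 0"
    unfolding C_def D_diff by simp
  ultimately have "(\<Sum>a\<in>I. strc a l i * strc b k a) + (\<Sum>a\<in>I. strc a i k * strc b l a)
      + (\<Sum>a\<in>I. strc a k l * strc b i a) = 0"
    by (metis mcoeff_add mcoeff_zero)
  moreover have "(\<Sum>a\<in>I. strc a i k * strc b l a) = - (\<Sum>a\<in>I. strc a k i * strc b l a)"
    by (subst strc_antisym) (simp add: sum_negf)
  moreover have "(\<Sum>a\<in>I. strc a k l * strc b i a) = - (\<Sum>a\<in>I. strc a k l * strc b a i)"
    by (subst (2) strc_antisym) (simp add: sum_negf)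
  ultimately show ?thesis by (simp add: algebra_simps eq_neg_iff_add_eq_0)
qed

end

sublocale fgl \<subseteq> sc: structure_constants "{1..m}" strc
  by unfold_locales (rule strc_antisym, rule strc_jacobi)

context fgl
begin

definition sscale :: "'k \<Rightarrow> 'k series \<Rightarrow> 'k series" where
  "sscale a f = mconst a * f"

lemma module_sscale: "module sscale"
  by unfold_locales (auto simp: sscale_def mconst_simps algebra_simps)

lemma ce_D: "ce_module I strc sscale (D N)"
proof -
  interpret module sscale by (rule module_sscale)
  show ?thesis
    by unfold_locales (auto simp: D_add D_const_mult D_bracket sscale_def)
qed

section \<open>Face maps\<close>

text \<open>For i = 0 every tuple moves up by one, so the first argument is dropped. If i exceeds
  the number of variables, nothing changes: this is the last face of the bar complex.\<close>

definition fsub :: "nat \<Rightarrow> nat \<times> nat \<Rightarrow> 'k series" where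
  "fsub i = (\<lambda>(k, l). if k < i then tvar k l else if k = i then Gt i l else tvar (Suc k) l)"

definition face :: "nat \<Rightarrow> 'k series \<Rightarrow> 'k series" where
  "face i f = msubst (fsub i) f"

abbreviation V :: "nat \<Rightarrow> (nat \<times> nat) set" where
  "V n \<equiv> {1..n} \<times> I"

lemma at_I: "i \<le> k \<Longrightarrow> k \<le> j \<Longrightarrow> k \<in> {i..j :: nat}"
  by (simp add: atLeastAtMost_iff)

lemma tvar_V: "l \<in> I \<Longrightarrow> 1 \<le> k \<Longrightarrow> k \<le> n \<Longrightarrow> tvar k l \<in> in_vars (V n)"
  by (rule in_vars_tvar) (auto intro: at_I)

lemma V_E:
  assumes "v \<in> V n"
  obtains k l where "v = (k, l)" "1 \<le> k" "k \<le> n" "l \<in> I"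
  using assms that by (cases v) (auto simp: atLeastAtMost_iff)

lemma V_mono: "n \<le> n' \<Longrightarrow> V n \<subseteq> V n'"
  by (auto simp: atLeastAtMost_iff)

lemma in_V_mono: "f \<in> in_vars (V n) \<Longrightarrow> n \<le> n' \<Longrightarrow> f \<in> in_vars (V n')"
  using in_vars_mono[OF _ V_mono] .

lemma finite_V [simp]: "finite (V n)"
  by simp

lemma fsub_dom: "subst_dom (V n) (fsub i)"
  by (auto simp: subst_dom_def fsub_def)

lemma fsub_vars:
  assumes "v \<in> V n" "i \<le> n"
  shows "fsub i v \<in> in_vars (V (Suc n))"
proof -
  obtain k l where v: "v = (k, l)" "1 \<le> k" "k \<le> n" "l \<in> I" using assms(1) by (rule V_E)
  have "Gt k l \<in> in_vars (V (Suc n))"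
    using Gt_vars[OF v(4), of k] by (rule in_vars_mono) (use v in \<open>auto intro: at_I\<close>)
  then show ?thesis using v by (auto simp: fsub_def intro!: tvar_V)
qed

lemma face_vars: "f \<in> in_vars (V n) \<Longrightarrow> i \<le> n \<Longrightarrow> face i f \<in> in_vars (V (Suc n))"
  unfolding face_def by (rule in_vars_msubst[OF fsub_dom]) (auto intro: fsub_vars)

lemma face_tvar: "l \<in> I \<Longrightarrow> 1 \<le> k \<Longrightarrow> face i (tvar k l) = fsub i (k, l)"
  unfolding face_def by (rule msubst_tvar[OF fsub_dom[of k]]) (auto intro: at_I)

lemma face_gmult:
  assumes "l \<in> I" "1 \<le> k" "1 \<le> k'"
  shows "face i (gmult G (tvar k) (tvar k') l) = gmult G (\<lambda>l. fsub i (k, l)) (\<lambda>l. fsub i (k', l)) l"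
proof -
  have "face i (gmult G (tvar k) (tvar k') l) = gmult G (\<lambda>l. face i (tvar k l)) (\<lambda>l. face i (tvar k' l)) l"
    unfolding face_def using assms
    by (intro gmult_comp[OF fsub_dom[of "k + k'"]]) (auto intro!: tvar_V)
  also have "\<dots> = gmult G (\<lambda>l. fsub i (k, l)) (\<lambda>l. fsub i (k', l)) l"
    using assms by (intro gmult_cong) (auto simp: face_tvar)
  finally show ?thesis .
qed

text \<open>Only j = i + 1 at the variable k = i involves associativity; in the other cases the two
  operations touch disjoint places and merely renumber.\<close>

lemma face_face:
  assumes f: "f \<in> in_vars (V n)" and ij: "i < j" and jn: "j \<le> Suc n"
  shows "face j (face i f) = face i (face (j - 1) f)"
proof -
  have 1: "face j (face i f) = msubst (\<lambda>v. face j (fsub i v)) f"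
    unfolding face_def[of j] face_def[of i f] using ij jn
    by (intro msubst_comp[OF fsub_dom fsub_dom f]) (auto intro!: fsub_vars)
  have 2: "face i (face (j - 1) f) = msubst (\<lambda>v. face i (fsub (j - 1) v)) f"
    unfolding face_def[of i] face_def[of "j - 1" f] using ij jn
    by (intro msubst_comp[OF fsub_dom fsub_dom f]) (auto intro!: fsub_vars)
  have "face j (fsub i v) = face i (fsub (j - 1) v)" if vV: "v \<in> V n" for v
  proof -
    obtain k l where v: "v = (k, l)" "1 \<le> k" "k \<le> n" "l \<in> I" using vV by (rule V_E)
    consider "k < i" | "k = i" "j = Suc i" | "k = i" "Suc i < j" | "i < k" "k < j - 1"
      | "i < k" "k = j - 1" | "i < k" "j - 1 < k" using ij by linarith
    then show ?thesis
    proof cases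
      case 2
      have "gmult G (tvar i) (Gt (Suc i)) l = gmult G (Gt i) (tvar (Suc (Suc i))) l"
        using v by (intro gmult_assoc[symmetric]) auto
      then show ?thesis using 2 v ij by (auto simp: fsub_def face_gmult)
    next
      case 5
      then have "j = Suc k" by simp
      then show ?thesis using 5 v ij by (auto simp: fsub_def face_gmult face_tvar)
    qed (use v ij in \<open>auto simp: fsub_def face_gmult face_tvar\<close>)
  qed
  then show ?thesis unfolding 1 2 by (rule msubst_cong[OF f])
qed

lemma face_add: "f \<in> in_vars (V n) \<Longrightarrow> g \<in> in_vars (V n) \<Longrightarrow> face i (f + g) = face i f + face i g"
  unfolding face_def by (rule msubst_add[OF fsub_dom])

lemma face_mult: "f \<in> in_vars (V n) \<Longrightarrow> g \<in> in_vars (V n) \<Longrightarrow> face i (f * g) = face i f * face i g"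
  unfolding face_def by (rule msubst_mult[OF fsub_dom])

lemma face_const_mult: "f \<in> in_vars (V n) \<Longrightarrow> face i (mconst a * f) = mconst a * face i f"
  unfolding face_def by (rule msubst_const_mult[OF fsub_dom])

lemma face_sum: "(\<And>x. x \<in> A \<Longrightarrow> f x \<in> in_vars (V n)) \<Longrightarrow> face i (sum f A) = (\<Sum>x\<in>A. face i (f x))"
  unfolding face_def by (rule msubst_sum[OF fsub_dom])

lemma face_0 [simp]: "face i 0 = 0"
  by (simp add: face_def)

lemma face_const [simp]: "face i (mconst a) = mconst a"
  by (simp add: face_def)

lemma mderiv_face:
  "f \<in> in_vars (V n) \<Longrightarrow> mderiv w (face i f) = (\<Sum>v\<in>V n. face i (mderiv v f) * mderiv w (fsub i v))"
  unfolding face_def by (rule mderiv_msubst[OF fsub_dom])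

lemma mderiv_fsub_low:
  assumes "b < i" "1 \<le> k" "l \<in> I"
  shows "mderiv (b, r) (fsub i (k, l)) = (if (k, l) = (b, r) then 1 else 0)"
  using assms mderiv_outside[OF Gt_vars[OF assms(3), of i], of "(b, r)"]
  by (auto simp: fsub_def mderiv_tvar)

lemma mderiv_fsub_high:
  assumes "i < b" "1 \<le> k" "l \<in> I"
  shows "mderiv (Suc b, r) (fsub i (k, l)) = (if (k, l) = (b, r) then 1 else 0)"
  using assms mderiv_outside[OF Gt_vars[OF assms(3), of i], of "(Suc b, r)"]
  by (auto simp: fsub_def mderiv_tvar)

lemma sum_V_delta:
  assumes "f \<in> in_vars (V n)"
  shows "(\<Sum>v\<in>V n. face i (mderiv v f) * (if v = w then 1 else 0)) = face i (mderiv w f)"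
proof -
  have "(\<Sum>v\<in>V n. face i (mderiv v f) * (if v = w then 1 else 0)) =
      (\<Sum>v\<in>V n. if v = w then face i (mderiv w f) else 0)"
    by (rule sum.cong[OF refl]) simp
  also have "\<dots> = (if w \<in> V n then face i (mderiv w f) else 0)"
    by (rule sum.delta) simp
  finally show ?thesis using mderiv_outside[OF assms, of w] by (simp split: if_splits)
qed

lemma mderiv_face_low:
  assumes f: "f \<in> in_vars (V n)" and b: "b < i"
  shows "mderiv (b, r) (face i f) = face i (mderiv (b, r) f)"
proof -
  have "mderiv (b, r) (face i f) = (\<Sum>v\<in>V n. face i (mderiv v f) * (if v = (b, r) then 1 else 0))"
    unfolding mderiv_face[OF f]
  proof (rule sum.cong[OF refl])
    fix v assume "v \<in> V n"
    then obtain k l where "v = (k, l)" "1 \<le> k" "k \<le> n" "l \<in> I" by (rule V_E)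
    then show "face i (mderiv v f) * mderiv (b, r) (fsub i v) = face i (mderiv v f) * (if v = (b, r) then 1 else 0)"
      using mderiv_fsub_low[OF b, of k l r] by simp
  qed
  then show ?thesis by (simp only: sum_V_delta[OF f])
qed

lemma mderiv_face_high:
  assumes f: "f \<in> in_vars (V n)" and b: "i < b"
  shows "mderiv (Suc b, r) (face i f) = face i (mderiv (b, r) f)"
proof -
  have "mderiv (Suc b, r) (face i f) = (\<Sum>v\<in>V n. face i (mderiv v f) * (if v = (b, r) then 1 else 0))"
    unfolding mderiv_face[OF f]
  proof (rule sum.cong[OF refl])
    fix v assume "v \<in> V n"
    then obtain k l where "v = (k, l)" "1 \<le> k" "k \<le> n" "l \<in> I" by (rule V_E)
    then show "face i (mderiv v f) * mderiv (Suc b, r) (fsub i v) = face i (mderiv v f) * (if v = (b, r) then 1 else 0)"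
      using mderiv_fsub_high[OF b, of k l r] by simp
  qed
  then show ?thesis by (simp only: sum_V_delta[OF f])
qed

lemma mderiv_face_mid:
  assumes f: "f \<in> in_vars (V n)" and b: "b = i \<or> b = Suc i" and i: "1 \<le> i" "i \<le> n"
  shows "mderiv (b, r) (face i f) = (\<Sum>j\<in>I. face i (mderiv (i, j) f) * mderiv (b, r) (Gt i j))"
proof -
  have "mderiv (b, r) (face i f) = (\<Sum>v\<in>V n. face i (mderiv v f) * mderiv (b, r) (fsub i v))"
    by (rule mderiv_face[OF f])
  also have "\<dots> = (\<Sum>v\<in>{i} \<times> I. face i (mderiv v f) * mderiv (b, r) (fsub i v))"
  proof (rule sum.mono_neutral_right)
    show "{i} \<times> I \<subseteq> V n" using i by (auto intro: at_I)
    show "\<forall>v\<in>V n - {i} \<times> I. face i (mderiv v f) * mderiv (b, r) (fsub i v) = 0"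
    proof
      fix v assume v: "v \<in> V n - {i} \<times> I"
      then have "v \<in> V n" by simp
      then obtain k l where "v = (k, l)" "1 \<le> k" "k \<le> n" "l \<in> I" by (rule V_E)
      then show "face i (mderiv v f) * mderiv (b, r) (fsub i v) = 0"
        using v b by (auto simp: fsub_def mderiv_tvar)
    qed
  qed simp
  also have "{i} \<times> I = Pair i ` I" by auto
  finally show ?thesis by (simp add: sum.reindex inj_on_def fsub_def)
qed

lemma face_W:
  assumes j: "j \<in> I" and N: "1 \<le> N"
  shows "face i (W N j k) = msubst (gsub (\<lambda>l. fsub i (N, l)) (\<lambda>_. 0)) (mderiv (2, k) (G j))"
proof -
  have "face i (W N j k) = msubst (gsub (\<lambda>l. face i (tvar N l)) (\<lambda>l. face i 0)) (mderiv (2, k) (G j))"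
    unfolding face_def W_def
    by (rule gsub_comp[OF fsub_dom[of N]]) (use j N in \<open>auto intro!: dG_vars tvar_V\<close>)
  also have "\<dots> = msubst (gsub (\<lambda>l. fsub i (N, l)) (\<lambda>_. 0)) (mderiv (2, k) (G j))"
    using j N by (intro gsub_cong dG_vars) (auto simp: face_tvar)
  finally show ?thesis .
qed

lemma W_V: "j \<in> I \<Longrightarrow> 1 \<le> N \<Longrightarrow> N \<le> n \<Longrightarrow> W N j k \<in> in_vars (V n)"
  by (rule in_vars_mono[OF W_vars]) (auto intro: at_I)

lemma D_vars: "f \<in> in_vars (V n) \<Longrightarrow> 1 \<le> N \<Longrightarrow> N \<le> n \<Longrightarrow> D N k f \<in> in_vars (V n)"
  unfolding D_def by (auto intro!: in_vars_sum in_vars_mult W_V in_vars_mderiv)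

text \<open>For i < N the last tuple is only renumbered. For i = N it is replaced by a product whose
  right factor is the new last tuple, and the claim is left invariance,
  \<open>W_star\<close>.\<close>

lemma face_D:
  assumes f: "f \<in> in_vars (V N)" and N: "1 \<le> N" and i: "i \<le> N"
  shows "D (Suc N) k (face i f) = face i (D N k f)"
proof (cases "k \<in> I")
  case False
  then show ?thesis by (simp add: D_def)
next
  case k: True
  have vars: "W N j k \<in> in_vars (V N)" "mderiv (N, j) f \<in> in_vars (V N)" if "j \<in> I" for j
    using that N f by (auto intro: W_V in_vars_mderiv)
  have R: "face i (D N k f) = (\<Sum>j\<in>I. face i (W N j k) * face i (mderiv (N, j) f))"
    using k vars by (simp add: D_def face_sum[of I _ N] face_mult[of _ N] in_vars_mult)
  show ?thesis
  proof (cases "i < N")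
    case True
    have "face i (W N j k) = W (Suc N) j k" if "j \<in> I" for j
      unfolding face_W[OF that N] unfolding W_def
      using that True by (intro gsub_cong dG_vars) (auto simp: fsub_def)
    then show ?thesis unfolding R using k True by (simp add: D_def mderiv_face_high[OF f])
  next
    case False
    then have iN: "i = N" using i by simp
    have fW: "face i (W N l k) = (\<Sum>j\<in>I. mderiv (Suc N, j) (Gt N l) * W (Suc N) j k)" if "l \<in> I" for l
      unfolding face_W[OF that N] W_star[OF that k]
      using that iN by (intro gsub_cong dG_vars) (auto simp: fsub_def)
    have "D (Suc N) k (face i f) =
       (\<Sum>j\<in>I. \<Sum>l\<in>I. W (Suc N) j k * (face i (mderiv (N, l) f) * mderiv (Suc N, j) (Gt N l)))"
      using k by (simp add: D_def iN mderiv_face_mid[OF f _ N] sum_distrib_left)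
    also have "\<dots> = (\<Sum>l\<in>I. \<Sum>j\<in>I. mderiv (Suc N, j) (Gt N l) * W (Suc N) j k * face i (mderiv (N, l) f))"
      by (subst sum.swap) (simp add: mult_ac)
    also have "\<dots> = face i (D N k f)"
      unfolding R by (rule sum.cong[OF refl]) (simp add: fW sum_distrib_right)
    finally show ?thesis .
  qed
qed

section \<open>The group differential and its contracting homotopy\<close>

lemma zsub_vars: "v \<in> V n \<Longrightarrow> zsub i v \<in> in_vars (V n)"
  by (erule V_E) (auto simp: zsub_def intro!: tvar_V)

lemma Zero_vars: "f \<in> in_vars (V n) \<Longrightarrow> Zero i f \<in> in_vars (V n)"
  unfolding Zero_def by (rule in_vars_msubst[OF zsub_dom]) (auto intro: zsub_vars)

lemma Zero_last_vars:
  assumes "f \<in> in_vars (V (Suc n))"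
  shows "Zero (Suc n) f \<in> in_vars (V n)"
  unfolding Zero_def
proof (rule in_vars_msubst[OF zsub_dom assms])
  fix v assume "v \<in> V (Suc n)"
  then show "zsub (Suc n) v \<in> in_vars (V n)"
    by (rule V_E) (auto simp: zsub_def intro!: tvar_V)
qed simp

lemma Zero_face_last:
  assumes f: "f \<in> in_vars (V N)"
  shows "Zero (Suc N) (face N f) = f"
proof -
  have "Zero (Suc N) (face N f) = msubst (\<lambda>v. Zero (Suc N) (fsub N v)) f"
    unfolding Zero_def face_def
    by (rule msubst_comp[OF fsub_dom zsub_dom[of "V (Suc N)"] f]) (auto intro: fsub_vars)
  also have "\<dots> = f"
  proof (rule msubst_id[OF _ f])
    fix v assume "v \<in> V N"
    then obtain k l where v: "v = (k, l)" "1 \<le> k" "k \<le> N" "l \<in> I" by (rule V_E)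
    have "Zero (Suc N) (Gt N l) = tvar N l"
    proof -
      have "Zero (Suc N) (Gt N l) = gmult G (\<lambda>l. Zero (Suc N) (tvar N l)) (\<lambda>l. Zero (Suc N) (tvar (Suc N) l)) l"
        unfolding Zero_def using v by (intro gmult_comp[OF zsub_dom[of "V (Suc N)"]]) (auto intro!: tvar_V)
      also have "\<dots> = tvar N l"
        using v by (simp add: Zero_tvar gmult_right_zero)
      finally show ?thesis .
    qed
    then show "Zero (Suc N) (fsub N v) = mvar v"
      using v by (auto simp: fsub_def Zero_tvar) (auto simp: tvar_def)
  qed simp
  finally show ?thesis .
qed

lemma Zero_face:
  assumes f: "f \<in> in_vars (V N)" and i: "i < N"
  shows "Zero (Suc N) (face i f) = face i (Zero N f)"
proof -
  have 1: "Zero (Suc N) (face i f) = msubst (\<lambda>v. Zero (Suc N) (fsub i v)) f"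
    unfolding Zero_def face_def
    by (rule msubst_comp[OF fsub_dom zsub_dom[of "V (Suc N)"] f]) (use i in \<open>auto intro: fsub_vars\<close>)
  have 2: "face i (Zero N f) = msubst (\<lambda>v. face i (zsub N v)) f"
    unfolding Zero_def face_def
    by (rule msubst_comp[OF zsub_dom fsub_dom f]) (auto intro: zsub_vars)
  have "Zero (Suc N) (fsub i v) = face i (zsub N v)" if vV: "v \<in> V N" for v
  proof -
    obtain k l where v: "v = (k, l)" "1 \<le> k" "k \<le> N" "l \<in> I" using vV by (rule V_E)
    have "Zero (Suc N) (Gt i l) = Gt i l"
      by (rule Zero_id[OF _ Gt_vars[OF v(4)]]) (use i in auto)
    then show ?thesis using v i by (auto simp: fsub_def zsub_def Zero_tvar face_tvar)
  qed
  then show ?thesis unfolding 1 2 by (rule msubst_cong[OF f])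
qed

text \<open>The bar differential without its last face: f counts as a cochain in N - 1 group
  variables with values in functions of the N-th tuple, which absorbs its left neighbour in the face
  i = N - 1 and is split by the face i = N.\<close>

definition delta :: "nat \<Rightarrow> 'k series \<Rightarrow> 'k series" where
  "delta N f = (\<Sum>i\<le>N. (- 1) ^ i * face i f)"

lemma sign_const: "(- 1) ^ i = (mconst ((- 1) ^ i) :: ('v, 'k) mfps)"
  by (induction i) (simp_all add: mconst_simps)

lemma in_vars_sign: "(f :: ('v, 'k) mfps) \<in> in_vars U \<Longrightarrow> (- 1) ^ i * f \<in> in_vars U"
  unfolding sign_const by (intro in_vars_mult in_vars_const)

lemma face_sign: "f \<in> in_vars (V n) \<Longrightarrow> face i ((- 1) ^ j * f) = (- 1) ^ j * face i f"
  unfolding sign_const by (rule face_const_mult)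

lemma delta_vars: "f \<in> in_vars (V N) \<Longrightarrow> delta N f \<in> in_vars (V (Suc N))"
  unfolding delta_def by (intro in_vars_sum in_vars_sign face_vars) auto

lemma delta_add: "f \<in> in_vars (V N) \<Longrightarrow> g \<in> in_vars (V N) \<Longrightarrow> delta N (f + g) = delta N f + delta N g"
  by (simp add: delta_def face_add distrib_left sum.distrib)

lemma delta_const_mult: "f \<in> in_vars (V N) \<Longrightarrow> delta N (mconst a * f) = mconst a * delta N f"
  by (simp add: delta_def face_const_mult sum_distrib_left mult.left_commute)

lemma delta_0 [simp]: "delta N 0 = 0"
  by (simp add: delta_def)

lemma delta_uminus: "f \<in> in_vars (V N) \<Longrightarrow> delta N (- f) = - delta N f"
  using delta_const_mult[of f N "- 1"] by (simp add: mconst_simps)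

lemma delta_diff: "f \<in> in_vars (V N) \<Longrightarrow> g \<in> in_vars (V N) \<Longrightarrow> delta N (f - g) = delta N f - delta N g"
  using delta_add[of f N "- g"] delta_uminus[of g N] by (simp add: in_vars_uminus)

lemma delta_sign: "f \<in> in_vars (V N) \<Longrightarrow> delta N ((- 1) ^ j * f) = (- 1) ^ j * delta N f"
  unfolding sign_const by (rule delta_const_mult)

lemma D_sign: "D N k ((- 1) ^ j * f) = (- 1) ^ j * D N k f"
  unfolding sign_const by (rule D_const_mult)

text \<open>The two differentials of the double complex commute without a sign; the sign of a total
  complex is carried by \<open>PhiT_chain_map\<close>.\<close>

lemma delta_D: "f \<in> in_vars (V N) \<Longrightarrow> 1 \<le> N \<Longrightarrow> D (Suc N) k (delta N f) = delta N (D N k f)"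
  by (simp add: delta_def D_sum D_sign face_D)

lemma delta_delta:
  assumes f: "f \<in> in_vars (V N)"
  shows "delta (Suc N) (delta N f) = 0"
proof -
  let ?t = "\<lambda>(j, i). (- 1) ^ (i + j) * face j (face i f)"
  let ?A = "{(j, i). j \<le> Suc N \<and> i \<le> N \<and> i < j}" and ?B = "{(j, i). j \<le> i \<and> i \<le> N}"
  have fin: "finite ?A" "finite ?B"
    by (rule finite_subset[of _ "{..Suc N} \<times> {..N}"]; force)+
  have "delta (Suc N) (delta N f) = (\<Sum>j\<le>Suc N. \<Sum>i\<le>N. ?t (j, i))"
    unfolding delta_def
  proof (rule sum.cong[OF refl])
    fix j assume "j \<in> {..Suc N}"
    have "face j (\<Sum>i\<le>N. (- 1) ^ i * face i f) = (\<Sum>i\<le>N. (- 1) ^ i * face j (face i f))"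
      using f by (subst face_sum[of _ _ "Suc N"]) (auto intro!: in_vars_sign face_vars sum.cong face_sign[of _ "Suc N"] simp del: sum.atMost_Suc)
    then show "(- 1) ^ j * face j (\<Sum>i\<le>N. (- 1) ^ i * face i f) = (\<Sum>i\<le>N. ?t (j, i))"
      by (simp add: sum_distrib_left power_add mult_ac)
  qed
  also have "\<dots> = sum ?t ({..Suc N} \<times> {..N})"
    by (simp add: sum.cartesian_product)
  also have "{..Suc N} \<times> {..N} = ?A \<union> ?B" by auto
  also have "sum ?t (?A \<union> ?B) = sum ?t ?A + sum ?t ?B"
    by (rule sum.union_disjoint) (use fin in auto)
  \<comment> \<open>The cosimplicial identity matches the pairs with i < j with the pairs with j <=
    i, and the exponent of the sign changes by one.\<close>
  also have "sum ?t ?A = (\<Sum>x\<in>?B. - ?t x)"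
  proof (rule sum.reindex_bij_witness[where i = "\<lambda>(j, i). (Suc i, j)" and j = "\<lambda>(j, i). (i, j - 1)"])
    fix x assume "x \<in> ?A"
    then obtain j i where x: "x = (j, i)" "j \<le> Suc N" "i \<le> N" "i < j" by auto
    then obtain j' where j': "j = Suc j'" by (cases j) auto
    then show "- ?t (case x of (j, i) \<Rightarrow> (i, j - 1)) = ?t x"
      using x face_face[OF f x(4) x(2)] by (simp add: add.commute)
  qed auto
  finally show ?thesis by (simp add: sum_negf)
qed

text \<open>Putting the last tuple to 0 undoes the face N = n + 1, because G(x, 0) = x, and it
  commutes with all lower faces.\<close>

lemma Zero_delta:
  assumes f: "f \<in> in_vars (V (Suc n))"
  shows "Zero (Suc (Suc n)) (delta (Suc n) f) = delta n (Zero (Suc n) f) + (- 1) ^ Suc n * f"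
proof -
  let ?z = "Zero (Suc (Suc n))"
  have d: "subst_dom (V (Suc (Suc n))) (zsub (Suc (Suc n)))" by (rule zsub_dom) simp
  have "?z (delta (Suc n) f) = (\<Sum>i\<le>Suc n. (- 1) ^ i * ?z (face i f))"
  proof -
    have "?z ((- 1) ^ i * face i f) = (- 1) ^ i * ?z (face i f)" if "i \<le> Suc n" for i
      unfolding Zero_def sign_const using f that by (intro msubst_const_mult[OF d] face_vars)
    moreover have "?z (delta (Suc n) f) = (\<Sum>i\<le>Suc n. ?z ((- 1) ^ i * face i f))"
      unfolding delta_def Zero_def using f by (intro msubst_sum[OF d] in_vars_sign face_vars) auto
    ultimately show ?thesis by (auto simp del: sum.atMost_Suc intro!: sum.cong)
  qed
  also have "\<dots> = (\<Sum>i\<le>n. (- 1) ^ i * ?z (face i f)) + (- 1) ^ Suc n * f"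
    using Zero_face_last[OF f] by simp
  also have "(\<Sum>i\<le>n. (- 1) ^ i * ?z (face i f)) = delta n (Zero (Suc n) f)"
    unfolding delta_def by (rule sum.cong) (auto simp: Zero_face[OF f])
  finally show ?thesis .
qed

lemma la_diff_faces:
  assumes f: "f \<in> in_vars (V N)"
  shows "la_diff G N f = delta N f + (- 1) ^ (N + 1) * f"
proof -
  have at: "at_points f (\<lambda>k. if k < i then tvar k else if k = i then gmult G (tvar i) (tvar (i + 1)) else tvar (k + 1)) = face i f" for i
  proof -
    have "(\<lambda>(k, l). (if k < i then tvar k else if k = i then gmult G (tvar i) (tvar (i + 1)) else tvar (k + 1)) l) = fsub i"
      by (auto simp: fsub_def fun_eq_iff simp flip: Suc_eq_plus1)
    then show ?thesis unfolding at_points_def face_def by (simp only:)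
  qed
  have 0: "at_points f (\<lambda>k. tvar (k + 1)) = face 0 f"
    unfolding at_points_def face_def
  proof (rule msubst_cong[OF f])
    fix v assume "v \<in> V N"
    then show "(case v of (i, j) \<Rightarrow> tvar (i + 1) j) = fsub 0 v"
      by (rule V_E) (auto simp: fsub_def simp flip: Suc_eq_plus1)
  qed
  have last: "at_points f (\<lambda>k. tvar k) = f"
    unfolding at_points_def by (rule msubst_id[OF _ f]) (auto simp: tvar_def)
  have "delta N f = face 0 f + (\<Sum>i\<in>{1..N}. (- 1) ^ i * face i f)"
    unfolding delta_def atMost_atLeast0 by (simp add: sum.atLeast_Suc_atMost One_nat_def)
  then show ?thesis unfolding la_diff_def at 0 last by simp
qed

text \<open>A bar cochain in n variables is a function of n + 1 tuples that is constant in the last;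
  on it the face n + 1 is the identity and supplies the final term of
  \<open>la_diff\<close>.\<close>

lemma delta_constant_last:
  assumes f: "f \<in> in_vars (V n)"
  shows "delta (Suc n) f = la_diff G n f"
proof -
  have "face (Suc n) f = f"
    unfolding face_def
  proof (rule msubst_id[OF _ f])
    fix v assume "v \<in> V n"
    then show "fsub (Suc n) v = mvar v" by (rule V_E) (auto simp: fsub_def tvar_def)
  qed simp
  then have "delta (Suc n) f = delta n f + (- 1) ^ Suc n * f" by (simp add: delta_def)
  then show ?thesis using la_diff_faces[OF f] by (simp flip: Suc_eq_plus1)
qed

section \<open>Mixed derivatives\<close>

abbreviation "md \<equiv> mixed_deriv_at_0"

lemma fold_mderiv_comm:
  "fold (\<lambda>k. mderiv (g k)) ks (mderiv v f) = mderiv v (fold (\<lambda>k. mderiv (g k)) ks f)"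
  by (induction ks arbitrary: f) (simp_all add: mderiv_commute[of _ v])

lemma md_Nil [simp]: "md [] f = mcoeff f 0"
  by (simp add: mixed_deriv_at_0_def)

lemma md_append: "md (js @ [r]) f = md js (mderiv (Suc (length js), r) f)"
proof -
  have "fold (\<lambda>k. mderiv (k + 1, (js @ [r]) ! k)) [0..<length js] f = fold (\<lambda>k. mderiv (k + 1, js ! k)) [0..<length js] f"
    by (rule fold_cong) (auto simp: nth_append)
  then show ?thesis
    by (simp add: mixed_deriv_at_0_def fold_mderiv_comm nth_append flip: Suc_eq_plus1)
qed

lemma md_add: "md js (f + g) = md js f + md js g"
  by (induction js arbitrary: f g rule: rev_induct) (simp_all add: md_append)

lemma md_const_mult: "md js (mconst a * f) = a * md js f"
  by (induction js arbitrary: f rule: rev_induct) (simp_all add: md_append mderiv_const_mult mcoeff_const)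

lemma md_0 [simp]: "md js 0 = 0"
  by (induction js rule: rev_induct) (simp_all add: md_append)

lemma md_diff: "md js (f - g) = md js f - md js g"
  by (induction js arbitrary: f g rule: rev_induct) (simp_all add: md_append)

lemma md_sum: "md js (sum f A) = (\<Sum>x\<in>A. md js (f x))"
  by (induction A rule: infinite_finite_induct) (simp_all add: md_add)

lemma md_sign: "md js ((- 1) ^ i * (f :: 'k series)) = (- 1) ^ i * md js f"
  unfolding sign_const by (rule md_const_mult)

text \<open>The first tuple no longer occurs after this face, and a nonempty list demands a
  derivative in it.\<close>

lemma md_face_0:
  assumes f: "f \<in> in_vars (V n)" and js: "js \<noteq> []"
  shows "md js (face 0 f) = 0"
proof -
  have 1: "mderiv (1, r) (face 0 f) = 0" for r
  proof -
    have "mderiv (1, r) (fsub 0 v) = 0" if "v \<in> V n" for v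
      using that by (rule V_E) (auto simp: fsub_def mderiv_tvar)
    then show ?thesis unfolding mderiv_face[OF f] by simp
  qed
  have "md (r # js) g = 0" if "mderiv (1, r) g = 0" for r js and g :: "'k series"
    using that
  proof (induction js arbitrary: g rule: rev_induct)
    case Nil
    then show ?case using md_append[of "[]" r g] by (simp flip: One_nat_def)
  next
    case (snoc x js)
    have "mderiv (1, r) (mderiv (Suc (Suc (length js)), x) g) = 0"
      using snoc.prems by (simp add: mderiv_commute[of "(1, r)"])
    then show ?case using snoc.IH md_append[of "r # js" x g] by simp
  qed
  then show ?thesis using 1 js by (cases js) auto
qed

lemma mderiv_Gt_0:
  assumes "l \<in> I" "k \<in> I"
  shows "mcoeff (mderiv (i, k) (Gt i l)) 0 = (if l = k then 1 else 0)"
    and "mcoeff (mderiv (Suc i, k) (Gt i l)) 0 = (if l = k then 1 else 0)"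
    and "r \<in> I \<Longrightarrow> mcoeff (mderiv (i, r) (mderiv (Suc i, k) (Gt i l))) 0 = fgl_coeff G l r k"
proof -
  have ev: "mcoeff (msubst (gsub (tvar i) (tvar (Suc i))) f) 0 = mcoeff f 0" if "f \<in> in_vars V2" for f
    by (rule mcoeff_msubst_0[OF gsub_dom that]) auto
  have "mderiv (i, k) (Gt i l) = msubst (gsub (tvar i) (tvar (Suc i))) (mderiv (1, k) (G l))"
    unfolding gmult_gsub
    by (subst mderiv_gsub) (use assms in \<open>auto simp: G_vars mderiv_tvar sum_delta_I\<close>)
  then show "mcoeff (mderiv (i, k) (Gt i l)) 0 = (if l = k then 1 else 0)"
    using assms by (simp add: ev dG_vars G_deriv_0)
  show "mcoeff (mderiv (Suc i, k) (Gt i l)) 0 = (if l = k then 1 else 0)"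
    unfolding mderiv_Gt_Suc[OF assms] using assms by (simp add: ev dG_vars G_deriv_0)
  assume r: "r \<in> I"
  have "mderiv (i, r) (mderiv (Suc i, k) (Gt i l)) =
      msubst (gsub (tvar i) (tvar (Suc i))) (mderiv (1, r) (mderiv (2, k) (G l)))"
    unfolding mderiv_Gt_Suc[OF assms]
    by (subst mderiv_gsub) (use assms r in \<open>auto simp: dG_vars mderiv_tvar sum_delta_I\<close>)
  then show "mcoeff (mderiv (i, r) (mderiv (Suc i, k) (Gt i l))) 0 = fgl_coeff G l r k"
    using assms by (simp add: ev dG_vars in_vars_mderiv G_deriv2_0)
qed

lemma mcoeff_face_0: "f \<in> in_vars (V n) \<Longrightarrow> mcoeff (face i f) 0 = mcoeff f 0"
  unfolding face_def by (rule mcoeff_msubst_0[OF fsub_dom])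

lemma mderiv_not_I:
  assumes "f \<in> in_vars (V n)" "k \<notin> I"
  shows "mderiv (b, k) f = 0"
  by (rule mderiv_outside[OF assms(1)]) (use assms(2) in auto)

lemma sum_delta_K: "k \<in> I \<Longrightarrow> (\<Sum>j\<in>I. f j * (if j = k then 1 else 0)) = (f k :: 'k)"
proof -
  assume k: "k \<in> I"
  have "(\<Sum>j\<in>I. f j * (if j = k then 1 else 0)) = (\<Sum>j\<in>I. if j = k then f j else 0)"
    by (rule sum.cong) auto
  then show ?thesis using k by simp
qed

lemma mderiv_face_mid_0:
  assumes f: "f \<in> in_vars (V n)" and b: "b = i \<or> b = Suc i" and i: "1 \<le> i" "i \<le> n"
  shows "mcoeff (mderiv (b, k) (face i f)) 0 = mcoeff (mderiv (i, k) f) 0"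
proof (cases "k \<in> I")
  case True
  have *: "mcoeff (mderiv (b, k) (Gt i j)) 0 = (if j = k then 1 else 0)" if "j \<in> I" for j
    using mderiv_Gt_0(1,2)[OF that True] b by auto
  have "mcoeff (mderiv (b, k) (face i f)) 0 = (\<Sum>j\<in>I. mcoeff (mderiv (i, j) f) 0 * (if j = k then 1 else 0))"
    unfolding mderiv_face_mid[OF f b i] mcoeff_sum
    by (rule sum.cong[OF refl]) (simp only: mcoeff_mult_0 * mcoeff_face_0[OF in_vars_mderiv[OF f]])
  then show ?thesis by (simp only: sum_delta_K[OF True])
next
  case False
  have "face i f \<in> in_vars (V (Suc n))" using f i by (intro face_vars)
  then show ?thesis using False by (simp add: mderiv_not_I[OF f] mderiv_not_I[of _ "Suc n"])
qed

text \<open>The chain rule for f(G(x, y)) at the origin: second derivatives of f with the identity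
  as Jacobian, and first derivatives of f against the mixed quadratic coefficients of G.\<close>

lemma mderiv2_face_0:
  assumes f: "f \<in> in_vars (V n)" and i: "1 \<le> i" "i \<le> n" and k: "k \<in> I" and l: "l \<in> I"
  shows "mcoeff (mderiv (i, k) (mderiv (Suc i, l) (face i f))) 0 =
    mcoeff (mderiv (i, k) (mderiv (i, l) f)) 0 + (\<Sum>j\<in>I. fgl_coeff G j k l * mcoeff (mderiv (i, j) f) 0)"
proof -
  have "mcoeff (mderiv (i, k) (mderiv (Suc i, l) (face i f))) 0 =
    (\<Sum>j\<in>I. mcoeff (mderiv (i, k) (mderiv (i, j) f)) 0 * (if j = l then 1 else 0)
      + fgl_coeff G j k l * mcoeff (mderiv (i, j) f) 0)"
    unfolding mderiv_face_mid[OF f disjI2[OF refl] i] mderiv_sum mderiv_mult mcoeff_sum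
    by (rule sum.cong[OF refl])
       (simp add: mcoeff_face_0[OF in_vars_mderiv[OF f]] mderiv_Gt_0 k l
          mderiv_face_mid_0[OF in_vars_mderiv[OF f] disjI1[OF refl] i])
  then show ?thesis by (simp only: sum.distrib sum_delta_K[OF l])
qed

text \<open>Antisymmetrising removes the second derivatives of f and turns quadratic coefficients
  into structure constants. Derivatives in earlier tuples pass through the face.\<close>

lemma md_face_merge_end:
  assumes "f \<in> in_vars (V n)" and i: "1 \<le> i" "i \<le> n" and "length js < i"
  shows "md js (mderiv (i, k) (mderiv (Suc i, l) (face i f))) - md js (mderiv (i, l) (mderiv (Suc i, k) (face i f)))
    = (\<Sum>j\<in>I. strc j k l * md js (mderiv (i, j) f))"
  using assms(1,4)
proof (induction js arbitrary: f rule: rev_induct)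
  case Nil
  show ?case
  proof (cases "k \<in> I \<and> l \<in> I")
    case True
    then have "k \<in> I" "l \<in> I" by auto
    then show ?thesis
      using mderiv2_face_0[OF Nil(1) i, of k l] mderiv2_face_0[OF Nil(1) i, of l k]
      by (simp add: mderiv_commute[of "(i, k)" "(i, l)"] strc_def left_diff_distrib flip: sum_subtractf)
  next
    case False
    have "face i f \<in> in_vars (V (Suc n))" using Nil i by (intro face_vars)
    then have "mderiv (i, k) (mderiv (Suc i, l) (face i f)) = 0" "mderiv (i, l) (mderiv (Suc i, k) (face i f)) = 0"
      using False by (auto simp: mderiv_not_I[of _ "Suc n"] in_vars_mderiv)
    moreover have "strc j k l = 0" for j using False by (auto simp: strc_def)
    ultimately show ?thesis by simp
  qed
next
  case (snoc r js)
  let ?b = "(Suc (length js), r)"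
  have comm: "mderiv ?b (mderiv (i, x) (mderiv (Suc i, y) (face i f))) =
      mderiv (i, x) (mderiv (Suc i, y) (face i (mderiv ?b f)))" for x y
    using snoc.prems by (simp add: mderiv_commute[of ?b] mderiv_face_low[OF snoc.prems(1)])
  have "mderiv ?b f \<in> in_vars (V n)" using snoc.prems(1) by (rule in_vars_mderiv)
  from snoc.IH[OF this] snoc.prems show ?case
    by (simp add: md_append comm mderiv_commute[of ?b "(i, j)" f for j])
qed

text \<open>This is \<open>merge_rel\<close> for the face maps; derivatives behind the merged pair
  pass through the face with their tuple number lowered by one.\<close>

lemma md_face_merge:
  assumes "f \<in> in_vars (V n)" and i: "i = Suc (length js)" "i \<le> n"
  shows "md (js @ k # l # rest) (face i f) - md (js @ l # k # rest) (face i f) =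
    (\<Sum>j\<in>I. strc j k l * md (js @ j # rest) f)"
  using assms(1)
proof (induction rest arbitrary: f rule: rev_induct)
  case Nil
  have e: "md (js @ [x, y]) g = md js (mderiv (i, x) (mderiv (Suc i, y) g))" for x y and g :: "'k series"
    using md_append[of "js @ [x]" y g] md_append[of js x] i(1) by simp
  show ?case unfolding e
    using md_face_merge_end[OF Nil, of i js k l] i by (simp add: md_append One_nat_def)
next
  case (snoc r rest)
  let ?b = "Suc (length js + Suc (length rest))"
  have 1: "md (js @ x # y # rest @ [r]) g = md (js @ x # y # rest) (mderiv (Suc ?b, r) g)" for x y and g :: "'k series"
    using md_append[of "js @ x # y # rest" r g] by simp
  have 2: "md (js @ x # rest @ [r]) g = md (js @ x # rest) (mderiv (?b, r) g)" for x and g :: "'k series"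
    using md_append[of "js @ x # rest" r g] by simp
  have "mderiv (Suc ?b, r) (face i f) = face i (mderiv (?b, r) f)"
    by (rule mderiv_face_high[OF snoc.prems]) (simp add: i)
  then show ?case using snoc.IH[OF in_vars_mderiv[OF snoc.prems]] by (simp add: 1 2)
qed

text \<open>No derivative is taken in the new tuple N + 1, and at the origin the derivative of G in
  its first argument is the identity.\<close>

lemma md_face_last:
  assumes "f \<in> in_vars (V N)" "length js = N" "1 \<le> N"
  shows "md js (face N f) = md js f"
proof -
  have *: "md js (mderiv (N, k) (face N f)) = md js (mderiv (N, k) f)"
    if "f \<in> in_vars (V N)" "length js < N" for js k f
    using that
  proof (induction js arbitrary: f rule: rev_induct)
    case Nil
    then show ?case using mderiv_face_mid_0[OF Nil(1) disjI1[OF refl], of N k] by simp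
  next
    case (snoc r js)
    let ?b = "(Suc (length js), r)"
    have "mderiv ?b f \<in> in_vars (V N)" using snoc.prems(1) by (rule in_vars_mderiv)
    from snoc.IH[OF this] snoc.prems show ?case
      by (simp add: md_append mderiv_commute[of ?b] mderiv_face_low[OF snoc.prems(1)])
  qed
  obtain js' k where "js = js' @ [k]" using assms by (cases js rule: rev_cases) auto
  then show ?thesis using *[OF assms(1), of js' k] assms(2) by (simp add: md_append)
qed

text \<open>The face 0 dies and the face p + 1 returns f itself. The p faces in between are numbered
  from 0, so that the face \<open>Suc i\<close> merges the list positions i and i + 1.\<close>

lemma md_delta:
  assumes f: "f \<in> in_vars (V (Suc p))" and js: "length js = Suc p"
  shows "md js (delta (Suc p) f) = (\<Sum>i<p. (- 1) ^ Suc i * md js (face (Suc i) f)) + (- 1) ^ Suc p * md js f"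
proof -
  have "js \<noteq> []" using js by auto
  have "md js (delta (Suc p) f) = (\<Sum>i\<le>Suc p. (- 1) ^ i * md js (face i f))"
    by (simp only: delta_def md_sum md_sign)
  also have "\<dots> = (\<Sum>i\<le>p. (- 1) ^ Suc i * md js (face (Suc i) f))"
    using md_face_0[OF f \<open>js \<noteq> []\<close>] by (simp only: sum.atMost_Suc_shift) simp
  also have "\<dots> = (\<Sum>i<p. (- 1) ^ Suc i * md js (face (Suc i) f)) + (- 1) ^ Suc p * md js f"
    using md_face_last[OF f js] by (simp add: lessThan_Suc_atMost[symmetric])
  finally show ?thesis .
qed

lemma md_W:
  assumes "j \<in> I" "length js < N"
  shows "md js (W N j k * g) = (if j = k then md js g else 0)"
  using assms(2)
proof (induction js arbitrary: g rule: rev_induct)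
  case (snoc r js)
  have "mderiv (Suc (length js), r) (W N j k) = 0"
    by (rule mderiv_outside[OF W_vars[OF assms(1)]]) (use snoc.prems in auto)
  then show ?case using snoc by (simp add: md_append mderiv_mult)
qed (simp add: W_0 assms)

text \<open>The coefficients of the field depend on the tuple p + 1 alone, so the first p
  derivatives do not see them, and at the origin they form the identity matrix.\<close>

lemma md_D:
  assumes f: "f \<in> in_vars (V n)" and js: "length js = p"
  shows "md js (D (Suc p) k f) = md (js @ [k]) f"
proof (cases "k \<in> I")
  case True
  have "md js (D (Suc p) k f) = (\<Sum>j\<in>I. if j = k then md js (mderiv (Suc p, j) f) else 0)"
    using True js by (simp add: D_def md_sum md_W)
  then show ?thesis using True js by (simp add: md_append)
next
  case False
  then show ?thesis using js mderiv_not_I[OF f False] by (simp add: md_append D_def)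
qed

section \<open>The extension of \<open>Phi\<close> to the double complex\<close>

definition hmd :: "(nat list \<Rightarrow> 'k series) \<Rightarrow> nat list \<Rightarrow> nat list \<Rightarrow> 'k" where
  "hmd F is js = md js (F is)"

text \<open>On bidegree \<open>(p, q)\<close>, the extension of \<open>\<Phi>\<close> differentiates once in each of the first \<open>p\<close> group
  variables, antisymmetrises over these directions and the form indices, and evaluates at the origin.\<close>

definition PhiT :: "nat \<Rightarrow> (nat list \<Rightarrow> 'k series) \<Rightarrow> nat list \<Rightarrow> 'k" where
  "PhiT p F is = (sc.shift_index ^^ p) (hmd F) is []"

abbreviation dd :: "nat \<Rightarrow> nat list \<Rightarrow> (nat list \<Rightarrow> 'k series) \<Rightarrow> 'k series" where
  "dd N \<equiv> ce_diff I strc sscale (D N)"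

abbreviation dK :: "nat list \<Rightarrow> (nat list \<Rightarrow> 'k) \<Rightarrow> 'k" where
  "dK \<equiv> ce_diff I strc (*) (\<lambda>_ _. 0)"

lemma subspace_V: "module.subspace sscale (in_vars (V n))"
proof -
  interpret module sscale by (rule module_sscale)
  show ?thesis by (rule subspaceI) (auto simp: sscale_def intro: in_vars_add in_vars_mult)
qed

text \<open>The structure-constant part of the exterior derivative commutes with taking mixed
  derivatives, while each invariant derivation becomes one further direction; wedging with these is
  \<open>shift_index\<close>.\<close>

lemma hmd_dd:
  assumes F: "\<And>is. F is \<in> in_vars (V n)" and js: "length js = p"
  shows "hmd (\<lambda>is. dd (Suc p) is F) is js = sc.d0 (hmd F) is js + sc.shift_index (hmd F) is js"
proof -
  have wedge: "md js (wedge (D (Suc p)) is F) = sc.shift_index (hmd F) is js"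
    using F
  proof (induction "is" arbitrary: F)
    case (Cons k "is")
    have "hmd (\<lambda>l. F (k # l)) = (\<lambda>l. hmd F (k # l))" by (auto simp: hmd_def fun_eq_iff)
    then show ?case using Cons.IH[of "\<lambda>l. F (k # l)"] Cons.prems
      by (simp add: md_diff md_D[OF Cons.prems js] sc.shift_index_Cons hmd_def)
  qed (simp add: sc.shift_index_Nil)
  have triv: "ce_module I strc sscale (\<lambda>_ _. 0)"
    by (rule sc.trivial_ce_module[OF module_sscale])
  have "md js (ce_diff I strc sscale (\<lambda>_ _. 0) is F) = dK is (\<lambda>l. md js (F l))"
    by (rule ce_diff_natural(1)[OF triv, where S = UNIV])
       (auto simp: md_add sscale_def md_const_mult module.subspace_UNIV[OF module_sscale])
  then show ?thesis
    unfolding hmd_def[of "\<lambda>is. dd (Suc p) is F"] ce_diff_split[of I strc sscale "D (Suc p)"]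
    by (simp add: md_add wedge sc.d0_apply hmd_def[abs_def])
qed

text \<open>The map need not respect the two differentials separately: it is a chain map on the
  total complex, where the exterior derivative carries the sign (-1)^p.\<close>

theorem PhiT_chain_map:
  assumes F: "\<And>is. F is \<in> in_vars (V (Suc p))"
  shows "PhiT (Suc p) (\<lambda>is. delta (Suc p) (F is)) is + (- 1) ^ p * PhiT p (\<lambda>is. dd (Suc p) is F) is =
    dK is (PhiT p F)"
proof -
  have "(sc.shift_index ^^ Suc p) (hmd (\<lambda>is. delta (Suc p) (F is))) is [] +
      (- 1) ^ p * (sc.shift_index ^^ p) (hmd (\<lambda>is. dd (Suc p) is F)) is [] =
    dK is (\<lambda>l. (sc.shift_index ^^ p) (hmd F) l [])"
  proof (rule sc.shift_index_chain_map[where h'' = "\<lambda>i. hmd (\<lambda>is. face (Suc i) (F is))"])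
    fix i assume "i < p"
    then show "sc.merge_rel i (p - 1 - i) (hmd (\<lambda>is. face (Suc i) (F is))) (hmd F)"
      unfolding sc.merge_rel_def hmd_def using md_face_merge[OF F] by auto
  next
    fix "is" js :: "nat list" assume "length js = Suc p"
    then show "hmd (\<lambda>is. delta (Suc p) (F is)) is js =
        (\<Sum>i<p. (- 1) ^ Suc i * hmd (\<lambda>is. face (Suc i) (F is)) is js) + (- 1) ^ Suc p * hmd F is js"
      unfolding hmd_def by (rule md_delta[OF F])
  next
    fix "is" js :: "nat list" assume "length js = p"
    then show "hmd (\<lambda>is. dd (Suc p) is F) is js = sc.d0 (hmd F) is js + sc.shift_index (hmd F) is js"
      by (rule hmd_dd[OF F])
  qed
  then show ?thesis by (simp add: PhiT_def[abs_def])
qed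

end

section \<open>Convergence\<close>

locale padic_field =
  fixes absK :: "'k::field_char_0 \<Rightarrow> real" and p :: nat
  assumes nonarch: "nonarch_absolute_value absK"
    and prime_p: "prime p" and abs_p: "absK (of_nat p) = 1 / real p"
begin

section \<open>Absolute values of integers and factorials\<close>

lemma abs_nonneg [simp]: "0 \<le> absK x"
  and abs_eq_0 [simp]: "absK x = 0 \<longleftrightarrow> x = 0"
  and abs_mult: "absK (x * y) = absK x * absK y"
  and abs_add: "absK (x + y) \<le> max (absK x) (absK y)"
  using nonarch by (auto simp: nonarch_absolute_value_def)

lemma abs_zero [simp]: "absK 0 = 0"
  by simp

lemma abs_one [simp]: "absK 1 = 1"
  using abs_mult[of 1 1] abs_eq_0[of 1] by simp

lemma abs_minus [simp]: "absK (- x) = absK x"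
proof -
  have "absK (- 1) * absK (- 1) = 1" using abs_mult[of "- 1" "- 1"] by simp
  then have "absK (- 1) = 1" using abs_nonneg[of "- 1"] by (simp add: square_eq_1_iff)
  then show ?thesis using abs_mult[of "- 1" x] by simp
qed

lemma abs_power: "absK (x ^ n) = absK x ^ n"
  by (induction n) (auto simp: abs_mult)

lemma abs_sum_le: "(\<And>x. x \<in> A \<Longrightarrow> absK (f x) \<le> B) \<Longrightarrow> 0 \<le> B \<Longrightarrow> absK (sum f A) \<le> B"
proof (induction A rule: infinite_finite_induct)
  case (insert x A)
  then show ?case using abs_add[of "f x" "sum f A"] by force
qed auto

lemma abs_add_le: "absK x \<le> B \<Longrightarrow> absK y \<le> B \<Longrightarrow> absK (x + y) \<le> B"
  using abs_add[of x y] by linarith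

lemma abs_diff_le: "absK x \<le> B \<Longrightarrow> absK y \<le> B \<Longrightarrow> absK (x - y) \<le> B"
  using abs_add_le[of x B "- y"] by simp

lemma abs_of_nat_le: "absK (of_nat n) \<le> 1"
  by (induction n) (auto intro: abs_add_le)

lemma abs_of_int_le: "absK (of_int n) \<le> 1"
  by (cases n) (use abs_of_nat_le in \<open>auto simp flip: of_nat_Suc\<close>)

lemma p_gt_1: "real p > 1"
  using prime_p prime_gt_1_nat by simp

text \<open>In a Bezout relation u k + w p = 1 the second term is smaller than 1 in absolute value,
  so the first cannot be; as integers have absolute value at most 1, equality follows.\<close>

lemma abs_coprime:
  assumes "\<not> p dvd k"
  shows "absK (of_nat k) = 1"
proof -
  have "coprime (int k) (int p)"
    using assms prime_p by (metis coprime_commute coprime_int_iff prime_imp_coprime)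
  then obtain u w where "u * int k + w * int p = 1"
    using bezout_int[of "int k" "int p"] by auto
  then have eq: "of_int u * of_nat k + of_int w * of_nat p = (1 :: 'k)"
    by (metis of_int_1 of_int_add of_int_mult of_int_of_nat_eq)
  have wp: "absK (of_int w * of_nat p) < 1"
  proof -
    have "absK (of_int w * of_nat p) \<le> 1 * (1 / real p)"
      unfolding abs_mult abs_p by (intro mult_right_mono abs_of_int_le) simp
    moreover have "1 / real p < 1" using p_gt_1 by simp
    ultimately show ?thesis by linarith
  qed
  have "1 \<le> max (absK (of_int u * of_nat k)) (absK (of_int w * of_nat p))"
    using abs_add[of "of_int u * of_nat k" "of_int w * of_nat p"] eq by simp
  then have "1 \<le> absK (of_int u) * absK (of_nat k)" using wp by (simp add: abs_mult)
  also have "\<dots> \<le> 1 * absK (of_nat k)" by (intro mult_right_mono abs_of_int_le) simp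
  finally show ?thesis using abs_of_nat_le[of k] by simp
qed

text \<open>Legendre's recursion: of the factors of (p t + r)! only p, 2 p, ..., t p are not
  units.\<close>

lemma abs_fact_mult_p:
  "r < p \<Longrightarrow> absK (fact (p * t + r)) = absK (fact t) * (1 / real p) ^ t"
proof (induction t arbitrary: r)
  have step: "absK (fact (p * t + r)) = absK (fact (p * t))" if "r < p" for t r
    using that
  proof (induction r)
    case (Suc r)
    have "\<not> p dvd Suc r" using Suc.prems by (simp add: nat_dvd_not_less)
    then have "\<not> p dvd p * t + Suc r" using dvd_add_right_iff[of p "p * t" "Suc r"] by simp
    then have "absK (of_nat (p * t + Suc r)) = 1" by (rule abs_coprime)
    moreover have "fact (p * t + Suc r) = (of_nat (p * t + Suc r) * fact (p * t + r) :: 'k)"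
      by (simp only: add_Suc_right fact_Suc)
    ultimately show ?case using Suc by (simp add: abs_mult)
  qed simp
  {
    case 0
    then show ?case using step[of r 0] by simp
  next
    case (Suc t)
    have pp: "p - 1 < p" using p_gt_1 by simp
    have "p * Suc t = Suc (p * t + (p - 1))" using p_gt_1 by (simp add: algebra_simps)
    then have "fact (p * Suc t) = (of_nat (p * Suc t) * fact (p * t + (p - 1)) :: 'k)"
      by (metis fact_Suc)
    then have "absK (fact (p * Suc t)) = 1 / real p * absK (of_nat (Suc t)) * (absK (fact t) * (1 / real p) ^ t)"
      using Suc.IH[OF pp] by (simp only: abs_mult of_nat_mult abs_p)
    also have "\<dots> = absK (fact (Suc t)) * (1 / real p) ^ Suc t"
      by (simp add: abs_mult del: of_nat_Suc)
    finally show ?case using step[OF Suc.prems, of "Suc t"] by simp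
  }
qed

text \<open>With t = n div p, Legendre's recursion and the induction hypothesis give the exponent 2
  t, and 2 t <= p t <= n.\<close>

lemma inverse_abs_fact_le: "1 / absK (fact n) \<le> real p ^ n"
proof (induction n rule: less_induct)
  case (less n)
  show ?case
  proof (cases "n = 0")
    case False
    let ?t = "n div p"
    have t: "?t < n" using False prime_p prime_gt_1_nat by simp
    have "p * ?t + n mod p = n" by simp
    then have "absK (fact n) = absK (fact ?t) * (1 / real p) ^ ?t"
      using abs_fact_mult_p[of "n mod p" ?t] p_gt_1 by simp
    then have "1 / absK (fact n) = (1 / absK (fact ?t)) * real p ^ ?t"
      by (simp add: power_one_over field_simps)
    also have "\<dots> \<le> real p ^ ?t * real p ^ ?t" using less.IH[OF t] by (intro mult_right_mono) auto
    also have "\<dots> = real p ^ (2 * ?t)" by (simp add: mult_2 power_add)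
    also have "\<dots> \<le> real p ^ n"
    proof (rule power_increasing)
      have "2 * ?t \<le> p * ?t" using prime_p prime_ge_2_nat by (intro mult_right_mono) auto
      also have "\<dots> \<le> n" by simp
      finally show "2 * ?t \<le> n" .
    qed (use p_gt_1 in simp)
    finally show ?thesis .
  qed simp
qed

text \<open>Geometric growth of the coefficients, which for finitely many variables describes the
  germs. The exponent is the degree plus one and C >= 1, so a single constant takes up both the
  radius and a factor in front.\<close>

definition conv :: "('v, 'k) mfps \<Rightarrow> bool" where
  "conv f \<longleftrightarrow> (\<exists>C\<ge>1. \<forall>b. absK (mcoeff f b) \<le> C ^ Suc (total_deg b))"

definition integral :: "('v, 'k) mfps \<Rightarrow> bool" where
  "integral f \<longleftrightarrow> (\<forall>b. absK (mcoeff f b) \<le> 1)"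

lemma convI: "1 \<le> C \<Longrightarrow> (\<And>b. absK (mcoeff f b) \<le> C ^ Suc (total_deg b)) \<Longrightarrow> conv f"
  unfolding conv_def by blast

lemma convE:
  assumes "conv f"
  obtains C where "1 \<le> C" "\<And>b. absK (mcoeff f b) \<le> C ^ Suc (total_deg b)"
  using assms unfolding conv_def by blast

lemma conv_0 [simp]: "conv 0"
  by (rule convI[of 1]) auto

lemma conv_add:
  fixes f g :: "('v, 'k) mfps"
  assumes "conv f" "conv g"
  shows "conv (f + g)"
proof -
  obtain C where C: "1 \<le> C" "\<And>b. absK (mcoeff f b) \<le> C ^ Suc (total_deg b)" using assms(1) by (rule convE) blast
  obtain E where E: "1 \<le> E" "\<And>b. absK (mcoeff g b) \<le> E ^ Suc (total_deg b)" using assms(2) by (rule convE) blast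
  show ?thesis
  proof (rule convI[of "max C E"])
    fix b :: "'v \<Rightarrow>\<^sub>0 nat"
    have "C ^ Suc (total_deg b) \<le> max C E ^ Suc (total_deg b)" "E ^ Suc (total_deg b) \<le> max C E ^ Suc (total_deg b)"
      using C(1) E(1) by (auto intro!: power_mono simp del: power_Suc)
    then show "absK (mcoeff (f + g) b) \<le> max C E ^ Suc (total_deg b)"
      using C(2)[of b] E(2)[of b] unfolding mcoeff_add by (intro abs_add_le) linarith+
  qed (use C in auto)
qed

lemma conv_const_mult:
  fixes f :: "('v, 'k) mfps"
  assumes "conv f"
  shows "conv (mconst a * f)"
proof -
  obtain C where C: "1 \<le> C" "\<And>b. absK (mcoeff f b) \<le> C ^ Suc (total_deg b)" using assms by (rule convE) blast
  let ?A = "max 1 (absK a)"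
  show ?thesis
  proof (rule convI[of "?A * C"])
    show "1 \<le> ?A * C" using mult_mono[of 1 ?A 1 C] C(1) by simp
    fix b :: "'v \<Rightarrow>\<^sub>0 nat"
    have "absK (mcoeff (mconst a * f) b) \<le> ?A * C ^ Suc (total_deg b)"
      unfolding mcoeff_const_mult abs_mult using C by (intro mult_mono) auto
    also have "\<dots> \<le> ?A ^ Suc (total_deg b) * C ^ Suc (total_deg b)"
      using self_le_power[of ?A "Suc (total_deg b)"] C(1) by (intro mult_right_mono) auto
    finally show "absK (mcoeff (mconst a * f) b) \<le> (?A * C) ^ Suc (total_deg b)"
      by (simp only: power_mult_distrib)
  qed
qed

lemma conv_uminus: "conv f \<Longrightarrow> conv (- f)"
  by (simp add: conv_def)

lemma conv_diff: "conv f \<Longrightarrow> conv g \<Longrightarrow> conv (f - g)"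
  using conv_add[of f "- g"] conv_uminus[of g] by simp

lemma conv_sum: "(\<And>x. x \<in> A \<Longrightarrow> conv (f x)) \<Longrightarrow> conv (sum f A)"
  by (induction A rule: infinite_finite_induct) (auto intro: conv_add)

lemma conv_mderiv:
  fixes f :: "('v, 'k) mfps"
  assumes "conv f"
  shows "conv (mderiv v f)"
proof -
  obtain C where C: "1 \<le> C" "\<And>b. absK (mcoeff f b) \<le> C ^ Suc (total_deg b)" using assms by (rule convE) blast
  show ?thesis
  proof (rule convI[of "C ^ 2"])
    show "1 \<le> C ^ 2" using C(1) by (rule one_le_power)
    fix b :: "'v \<Rightarrow>\<^sub>0 nat"
    let ?b = "b + Poly_Mapping.single v (1 :: nat)"
    have "absK (mcoeff (mderiv v f) b) \<le> 1 * C ^ Suc (total_deg ?b)"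
      unfolding mcoeff_deriv abs_mult by (intro mult_mono C(2) abs_of_nat_le) auto
    also have "\<dots> \<le> C ^ (2 * Suc (total_deg b))"
      unfolding mult_1 using C(1) by (intro power_increasing) auto
    finally show "absK (mcoeff (mderiv v f) b) \<le> (C ^ 2) ^ Suc (total_deg b)" by (simp only: power_mult)
  qed
qed

lemma integral_0: "integral 0" and integral_1: "integral 1"
  and integral_mvar: "integral (mvar v)"
  by (auto simp: integral_def mcoeff_one mcoeff_var)

lemma integral_diff: "integral f \<Longrightarrow> integral g \<Longrightarrow> integral (f - g)"
  by (auto simp: integral_def intro: abs_diff_le)

lemma integral_mult: "integral f \<Longrightarrow> integral g \<Longrightarrow> integral (f * g)"
  unfolding integral_def mcoeff_mult
  by (auto intro!: abs_sum_le simp: abs_mult mult_le_one)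

lemma integral_power: "integral f \<Longrightarrow> integral (f ^ n)"
  by (induction n) (auto intro: integral_1 integral_mult)

lemma integral_prod: "(\<And>x. x \<in> A \<Longrightarrow> integral (f x)) \<Longrightarrow> integral (prod f A)"
  by (induction A rule: infinite_finite_induct) (auto intro: integral_1 integral_mult)

lemma integral_mderiv: "integral f \<Longrightarrow> integral (mderiv v f)"
  unfolding integral_def mcoeff_deriv abs_mult
  by (intro allI mult_le_one abs_of_nat_le) auto

lemma integral_spow: "(\<And>v. v \<in> Poly_Mapping.keys a \<Longrightarrow> integral (s v)) \<Longrightarrow> integral (spow s a)"
  unfolding spow_def by (intro integral_prod integral_power)

lemma integral_msubst:
  fixes s :: "'u \<Rightarrow> ('v, 'k) mfps"
  assumes "subst_dom V s" "f \<in> in_vars V" "\<And>v. v \<in> V \<Longrightarrow> integral (s v)" "integral f"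
  shows "integral (msubst s f)"
  unfolding integral_def mcoeff_msubst'[OF assms(1,2) order_refl]
proof (intro allI abs_sum_le)
  fix b :: "'v \<Rightarrow>\<^sub>0 nat" and a assume "a \<in> midx V (total_deg b)"
  then have "integral (spow s a)" using assms(3) by (intro integral_spow) (auto simp: midx_def)
  then show "absK (mcoeff f a * mcoeff (spow s a) b) \<le> 1"
    using assms(4) by (simp add: integral_def abs_mult mult_le_one)
qed simp

text \<open>The same C works: products of integral series are integral, and a coefficient in degree
  d collects only coefficients of f in degrees at most d.\<close>

lemma conv_msubst:
  fixes s :: "'u \<Rightarrow> ('v, 'k) mfps"
  assumes "subst_dom V s" "f \<in> in_vars V" "\<And>v. v \<in> V \<Longrightarrow> integral (s v)" "conv f"
  shows "conv (msubst s f)"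
proof -
  obtain C where C: "1 \<le> C" "\<And>b. absK (mcoeff f b) \<le> C ^ Suc (total_deg b)" using assms(4) by (rule convE) blast
  show ?thesis
  proof (rule convI[OF C(1)])
    fix b :: "'v \<Rightarrow>\<^sub>0 nat"
    show "absK (mcoeff (msubst s f) b) \<le> C ^ Suc (total_deg b)"
      unfolding mcoeff_msubst'[OF assms(1,2) order_refl]
    proof (rule abs_sum_le)
      fix a assume a: "a \<in> midx V (total_deg b)"
      then have "integral (spow s a)" using assms(3) by (intro integral_spow) (auto simp: midx_def)
      then have "absK (mcoeff f a * mcoeff (spow s a) b) \<le> C ^ Suc (total_deg a) * 1"
        unfolding abs_mult using C by (intro mult_mono) (auto simp: integral_def)
      also have "\<dots> \<le> C ^ Suc (total_deg b)"
        unfolding mult_1_right using C(1) a by (intro power_increasing) (auto simp: midx_def)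
      finally show "absK (mcoeff f a * mcoeff (spow s a) b) \<le> C ^ Suc (total_deg b)" .
    qed (use C(1) in auto)
  qed
qed

lemma conv_integral_mult:
  fixes f :: "('v, 'k) mfps"
  assumes "integral g" "conv f"
  shows "conv (g * f)"
proof -
  obtain C where C: "1 \<le> C" "\<And>b. absK (mcoeff f b) \<le> C ^ Suc (total_deg b)" using assms(2) by (rule convE) blast
  show ?thesis
  proof (rule convI[OF C(1)])
    fix b :: "'v \<Rightarrow>\<^sub>0 nat"
    show "absK (mcoeff (g * f) b) \<le> C ^ Suc (total_deg b)"
      unfolding mcoeff_mult
    proof (rule abs_sum_le)
      fix x assume "x \<in> splits b"
      then obtain a c where x: "x = (a, c)" "a + c = b" by (auto simp: splits_def)
      have "absK (mcoeff g a * mcoeff f c) \<le> 1 * C ^ Suc (total_deg c)"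
        unfolding abs_mult using C assms(1) by (intro mult_mono) (auto simp: integral_def)
      also have "\<dots> \<le> C ^ Suc (total_deg b)"
        unfolding mult_1 using C(1) x(2) by (intro power_increasing) auto
      finally show "absK (case x of (a, c) \<Rightarrow> mcoeff g a * mcoeff f c) \<le> C ^ Suc (total_deg b)"
        by (simp add: x)
    qed (use C(1) in auto)
  qed
qed

text \<open>A family tending to 0 is bounded, which after undoing the scaling by p^h is a geometric
  bound. Conversely a large h makes the scaled coefficients decay geometrically, and only finitely
  many monomials in finitely many variables have bounded degree.\<close>

lemma tate_algebra_conv:
  fixes V :: "'v set"
  assumes "finite V"
  shows "(\<Union>h. tate_algebra absK p V h) = {f \<in> in_vars V. conv f}"
proof safe
  fix h and f :: "('v, 'k) mfps"
  assume f: "f \<in> tate_algebra absK p V h"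
  then show "f \<in> in_vars V" by (simp add: tate_algebra_def)
  let ?g = "\<lambda>b. absK (of_nat p ^ (h * total_deg b) * mcoeff f b)"
  have "(?g \<longlongrightarrow> 0) cofinite" using f by (simp add: tate_algebra_def)
  then have "eventually (\<lambda>b. ?g b < 1) cofinite" by (rule order_tendstoD) simp
  then have fin: "finite {b. \<not> ?g b < 1}" by (simp add: eventually_cofinite)
  define M where "M = Max (insert 1 (?g ` {b. \<not> ?g b < 1}))"
  have M1: "1 \<le> M" unfolding M_def using fin by (intro Max_ge) auto
  have M: "?g b \<le> M" for b
  proof (cases "?g b < 1")
    case False
    then show ?thesis unfolding M_def using fin by (intro Max_ge) auto
  qed (use M1 in auto)
  show "conv f"
  proof (rule convI[of "M * real p ^ h"])
    have "1 * 1 \<le> M * real p ^ h" using M1 p_gt_1 by (intro mult_mono one_le_power) auto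
    then show "1 \<le> M * real p ^ h" by simp
    fix b :: "'v \<Rightarrow>\<^sub>0 nat"
    let ?d = "total_deg b"
    have "?g b = absK (mcoeff f b) / real p ^ (h * ?d)"
      by (simp add: abs_mult abs_power abs_p power_one_over)
    then have "absK (mcoeff f b) \<le> M * real p ^ (h * ?d)"
      using M[of b] p_gt_1 by (simp add: pos_divide_le_eq)
    also have "\<dots> \<le> M ^ Suc ?d * real p ^ (h * Suc ?d)"
      using M1 p_gt_1 self_le_power[of M "Suc ?d"] by (intro mult_mono power_increasing) auto
    also have "\<dots> = (M * real p ^ h) ^ Suc ?d"
      by (simp only: power_mult_distrib power_mult)
    finally show "absK (mcoeff f b) \<le> (M * real p ^ h) ^ Suc ?d" .
  qed
next
  fix f :: "('v, 'k) mfps"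
  assume f: "f \<in> in_vars V" and "conv f"
  then obtain C where C: "1 \<le> C" "\<And>b. absK (mcoeff f b) \<le> C ^ Suc (total_deg b)" by (auto elim: convE)
  \<comment> \<open>The factor 2 leaves a decay of 2^(-d) in degree d.\<close>
  obtain h where h: "2 * C < real p ^ h" using real_arch_pow[OF p_gt_1] by blast
  let ?g = "\<lambda>b. absK (of_nat p ^ (h * total_deg b) * mcoeff f b)"
  have g: "?g b \<le> C * (1 / 2) ^ total_deg b" for b
  proof -
    let ?d = "total_deg b"
    have "?g b = absK (mcoeff f b) / (real p ^ h) ^ ?d"
      by (simp add: abs_mult abs_power abs_p power_one_over flip: power_mult)
    also have "\<dots> \<le> (C * C ^ ?d) / (2 * C) ^ ?d"
      using C h by (intro frac_le power_mono) auto
    also have "\<dots> = C * (1 / 2) ^ ?d"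
      using C(1) by (simp add: power_mult_distrib power_one_over field_simps)
    finally show ?thesis .
  qed
  have "(?g \<longlongrightarrow> 0) cofinite"
  proof (rule order_tendstoI)
    fix e :: real assume "e < 0"
    then have "e < ?g b" for b using abs_nonneg[of "of_nat p ^ (h * total_deg b) * mcoeff f b"] by linarith
    then show "eventually (\<lambda>b. e < ?g b) cofinite" by simp
  next
    fix e :: real assume e: "0 < e"
    obtain N where N: "(1 / 2) ^ N < e / C" using real_arch_pow_inv[of "e / C" "1 / 2"] e C(1) by auto
    have "b \<in> midx V N" if "\<not> ?g b < e" for b :: "'v \<Rightarrow>\<^sub>0 nat"
    proof -
      have "mcoeff f b \<noteq> 0" using that e by auto
      then have "Poly_Mapping.keys b \<subseteq> V" using f by (auto simp: in_vars_def)
      moreover have "total_deg b \<le> N"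
      proof (rule ccontr)
        assume "\<not> total_deg b \<le> N"
        then have "(1 / 2 :: real) ^ total_deg b \<le> (1 / 2) ^ N" by (intro power_decreasing) auto
        then have "(1 / 2 :: real) ^ total_deg b < e / C" using N by linarith
        then have "C * (1 / 2) ^ total_deg b < C * (e / C)" using C(1) by (intro mult_strict_left_mono) auto
        then show False using g[of b] that C(1) by auto
      qed
      ultimately show ?thesis by (simp add: midx_def)
    qed
    then have "{b. \<not> ?g b < e} \<subseteq> midx V N" by blast
    then show "eventually (\<lambda>b. ?g b < e) cofinite"
      unfolding eventually_cofinite using finite_midx[OF assms] finite_subset by blast
  qed
  then show "f \<in> (\<Union>h. tate_algebra absK p V h)" using f by (auto simp: tate_algebra_def)
qed

end

section \<open>The Poincare lemma\<close>

locale analytic_fgl = fgl m G + padic_field absK p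
  for m :: nat and G :: "nat \<Rightarrow> 'k::field_char_0 series" and absK :: "'k \<Rightarrow> real" and p :: nat +
  assumes G_integral: "j \<in> {1..m} \<Longrightarrow> absK (mcoeff (G j) b) \<le> 1"
begin

declare One_nat_def [simp del] atLeastAtMost_iff [simp del]

lemma integral_tvar: "integral (tvar i j)"
  by (simp add: tvar_def integral_mvar)

lemma integral_gsub:
  assumes "f \<in> in_vars V2" "integral f" "\<And>l. l \<in> I \<Longrightarrow> mcoeff (u l) 0 = 0" "\<And>l. l \<in> I \<Longrightarrow> mcoeff (w l) 0 = 0"
    and "\<And>l. l \<in> I \<Longrightarrow> integral (u l)" "\<And>l. l \<in> I \<Longrightarrow> integral (w l)"
  shows "integral (msubst (gsub u w) f)"
  by (rule integral_msubst[OF gsub_dom assms(1)]) (use assms in \<open>auto simp: gsub_def\<close>)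

lemma integral_Gt: "j \<in> I \<Longrightarrow> integral (Gt i j)"
  unfolding gmult_gsub
  by (rule integral_gsub) (auto simp: integral_tvar G_vars integral_def[of "G _"] G_integral)

lemma integral_W: "j \<in> I \<Longrightarrow> integral (W N j k)"
  unfolding W_def
  by (rule integral_gsub)
     (auto simp: integral_tvar integral_0 dG_vars integral_def[of "G _"] G_integral intro!: integral_mderiv)

lemma integral_fsub: "v \<in> V n \<Longrightarrow> integral (fsub i v)"
  by (erule V_E) (auto simp: fsub_def integral_tvar integral_Gt)

lemma conv_face: "f \<in> in_vars (V n) \<Longrightarrow> conv f \<Longrightarrow> conv (face i f)"
  unfolding face_def by (rule conv_msubst[OF fsub_dom]) (auto intro: integral_fsub)

lemma conv_Zero: "f \<in> in_vars (V n) \<Longrightarrow> conv f \<Longrightarrow> conv (Zero i f)"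
  unfolding Zero_def
  by (rule conv_msubst[OF zsub_dom[of "V n"]]) (auto simp: zsub_def integral_tvar integral_0)

lemma conv_delta: "f \<in> in_vars (V n) \<Longrightarrow> conv f \<Longrightarrow> conv (delta n f)"
  unfolding delta_def sign_const by (intro conv_sum conv_const_mult conv_face)

lemma conv_D: "conv f \<Longrightarrow> conv (D N k f)"
  unfolding D_def by (auto intro!: conv_sum conv_integral_mult integral_W conv_mderiv)

lemma abs_strc: "absK (strc j k l) \<le> 1"
  unfolding strc_def fgl_coeff_def by (auto intro!: abs_diff_le G_integral)

section \<open>Bounds graded by the degree in the last tuple\<close>

definition xdeg :: "nat \<Rightarrow> (nat \<times> nat \<Rightarrow>\<^sub>0 nat) \<Rightarrow> nat" where
  "xdeg N b = deg_in ({N} \<times> UNIV) b"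

lemma xdeg_add [simp]: "xdeg N (a + b) = xdeg N a + xdeg N b"
  by (simp add: xdeg_def)

lemma xdeg_le: "xdeg N b \<le> total_deg b"
  unfolding xdeg_def total_deg_conv deg_in_def by (rule sum_mono2) auto

lemma xdeg_single [simp]: "xdeg N (Poly_Mapping.single (i, j) n) = (if i = N then n else 0)"
  by (auto simp: xdeg_def deg_in_single)

text \<open>For \<open>B = 0\<close> the next condition says that the coefficients of \<open>x\<close>-degree less than \<open>d\<close>
  and total degree at most \<open>e\<close> vanish.\<close>

definition bnd :: "nat \<Rightarrow> nat \<Rightarrow> nat \<Rightarrow> real \<Rightarrow> 'k series \<Rightarrow> bool" where
  "bnd N d e B f \<longleftrightarrow> (\<forall>b. xdeg N b < d \<longrightarrow> total_deg b \<le> e \<longrightarrow> absK (mcoeff f b) \<le> B)"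

definition xord :: "nat \<Rightarrow> nat \<Rightarrow> 'k series \<Rightarrow> bool" where
  "xord N d f \<longleftrightarrow> (\<forall>b. xdeg N b < d \<longrightarrow> mcoeff f b = 0)"

lemma xord_bnd: "xord N d f \<longleftrightarrow> (\<forall>e. bnd N d e 0 f)"
  unfolding xord_def bnd_def by (metis abs_eq_0 abs_nonneg order_antisym order_refl)

lemma bnd_0: "0 \<le> B \<Longrightarrow> bnd N d e B 0"
  by (simp add: bnd_def)

lemma bnd_add: "bnd N d e B f \<Longrightarrow> bnd N d e B g \<Longrightarrow> bnd N d e B (f + g)"
  by (auto simp: bnd_def intro!: abs_add_le)

lemma bnd_diff: "bnd N d e B f \<Longrightarrow> bnd N d e B g \<Longrightarrow> bnd N d e B (f - g)"
  by (auto simp: bnd_def intro!: abs_diff_le)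

lemma bnd_sum: "(\<And>x. x \<in> A \<Longrightarrow> bnd N d e B (f x)) \<Longrightarrow> 0 \<le> B \<Longrightarrow> bnd N d e B (sum f A)"
  by (induction A rule: infinite_finite_induct) (auto intro: bnd_add bnd_0)

lemma bnd_const_mult:
  assumes "absK a \<le> 1" "bnd N d e B f" "0 \<le> B"
  shows "bnd N d e B (mconst a * f)"
  unfolding bnd_def
proof (intro allI impI)
  fix b assume "xdeg N b < d" "total_deg b \<le> e"
  then have "absK (mcoeff f b) \<le> B" using assms(2) by (simp add: bnd_def)
  then have "absK a * absK (mcoeff f b) \<le> 1 * B" using assms by (intro mult_mono) auto
  then show "absK (mcoeff (mconst a * f) b) \<le> B" by (simp add: abs_mult)
qed

lemma bnd_mult:
  assumes g: "integral g" "xord N i g" and f: "bnd N d e B f" and B: "0 \<le> B"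
  shows "bnd N (d + i) e B (g * f)"
  unfolding bnd_def
proof (intro allI impI)
  fix b assume b: "xdeg N b < d + i" "total_deg b \<le> e"
  show "absK (mcoeff (g * f) b) \<le> B"
    unfolding mcoeff_mult
  proof (rule abs_sum_le[OF _ B])
    fix x assume "x \<in> splits b"
    then obtain a c where x: "x = (a, c)" "a + c = b" by (auto simp: splits_def)
    have "absK (mcoeff g a * mcoeff f c) \<le> B"
    proof (cases "xdeg N a < i")
      case True
      then show ?thesis using g(2) B by (simp add: xord_def)
    next
      case False
      then have "xdeg N c < d" "total_deg c \<le> e" using b x(2) by auto
      then have "absK (mcoeff f c) \<le> B" using f by (simp add: bnd_def)
      then have "absK (mcoeff g a) * absK (mcoeff f c) \<le> 1 * B"
        using g(1) by (intro mult_mono) (auto simp: integral_def)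
      then show ?thesis by (simp add: abs_mult)
    qed
    then show "absK (case x of (a, c) \<Rightarrow> mcoeff g a * mcoeff f c) \<le> B" by (simp add: x)
  qed
qed

text \<open>The derivative lowers the x-degree by one but \<open>g\<close> raises it by at least
  two, a net gain of one; the total degree of the coefficient of f involved stays at most e. The
  integer factor has absolute value at most 1.\<close>

lemma bnd_mult_mderiv:
  assumes g: "integral g" "xord N 2 g" and f: "bnd N d e B f" and B: "0 \<le> B"
  shows "bnd N (Suc d) e B (g * mderiv (N, j) f)"
  unfolding bnd_def
proof (intro allI impI)
  fix b assume b: "xdeg N b < Suc d" "total_deg b \<le> e"
  show "absK (mcoeff (g * mderiv (N, j) f) b) \<le> B"
    unfolding mcoeff_mult
  proof (rule abs_sum_le[OF _ B])
    fix x assume "x \<in> splits b"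
    then obtain a c where x: "x = (a, c)" "a + c = b" by (auto simp: splits_def)
    have "absK (mcoeff g a * mcoeff (mderiv (N, j) f) c) \<le> B"
    proof (cases "xdeg N a < 2")
      case True
      then show ?thesis using g(2) B by (simp add: xord_def)
    next
      case False
      let ?c = "c + Poly_Mapping.single (N, j) (1 :: nat)"
      have "xdeg N ?c < d" using False b x(2) by auto
      moreover have "total_deg ?c \<le> e"
        using False b x(2) xdeg_le[of N a] by auto
      ultimately have "absK (mcoeff f ?c) \<le> B" using f by (simp add: bnd_def)
      then have "absK (mcoeff (mderiv (N, j) f) c) \<le> 1 * B"
        unfolding mcoeff_deriv abs_mult by (intro mult_mono abs_of_nat_le) auto
      then have "absK (mcoeff g a) * absK (mcoeff (mderiv (N, j) f) c) \<le> 1 * B"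
        using g(1) by (intro mult_mono) (auto simp: integral_def)
      then show ?thesis by (simp add: abs_mult)
    qed
    then show "absK (case x of (a, c) \<Rightarrow> mcoeff g a * mcoeff (mderiv (N, j) f) c) \<le> B" by (simp add: x)
  qed
qed

lemma xord_mult: "xord N i f \<Longrightarrow> xord N j g \<Longrightarrow> xord N (i + j) (f * g)"
proof -
  assume f: "xord N i f" and g: "xord N j g"
  have "mcoeff f a * mcoeff g c = 0" if "xdeg N (a + c) < i + j" for a c
  proof -
    have "xdeg N a < i \<or> xdeg N c < j" using that by auto
    then show ?thesis using f g by (auto simp: xord_def)
  qed
  then have "mcoeff (f * g) b = 0" if "xdeg N b < i + j" for b
    unfolding mcoeff_mult using that by (intro sum.neutral) (auto simp: splits_def simp del: xdeg_add)
  then show ?thesis by (simp add: xord_def)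
qed

lemma xord_tvar: "xord N 1 (tvar N k)"
  by (auto simp: xord_def tvar_def mcoeff_var)

lemma xdeg_0_imp:
  assumes "Poly_Mapping.keys b \<subseteq> {N} \<times> UNIV" "xdeg N b = 0"
  shows "b = 0"
proof -
  have "total_deg b = xdeg N b" unfolding xdeg_def total_deg_def deg_in_def
    using assms(1) by (simp add: Int_absorb2)
  then show ?thesis using assms(2) total_deg_eq_0_iff by metis
qed

text \<open>The deviation of the invariant frame from the coordinate frame. It vanishes at the
  origin, so each factor raises the x-degree.\<close>

definition W' :: "nat \<Rightarrow> nat \<Rightarrow> nat \<Rightarrow> 'k series" where
  "W' N j k = W N j k - (if j = k then 1 else 0)"

lemma W'_props:
  assumes "j \<in> I"
  shows "integral (W' N j k)" "xord N 1 (W' N j k)"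
proof -
  show "integral (W' N j k)"
    unfolding W'_def using integral_W[OF assms] by (auto intro!: integral_diff integral_0 integral_1)
  have v: "W' N j k \<in> in_vars ({N} \<times> I)"
    unfolding W'_def using W_vars[OF assms] by (auto intro!: in_vars_diff)
  have "mcoeff (W' N j k) 0 = 0" unfolding W'_def using W_0[OF assms, of N k] by (auto simp: mcoeff_one)
  then have "mcoeff (W' N j k) b = 0" if "xdeg N b = 0" for b
  proof (cases "b = 0")
    case False
    then have "\<not> Poly_Mapping.keys b \<subseteq> {N} \<times> UNIV" using xdeg_0_imp[of b N] that by blast
    then have "\<not> Poly_Mapping.keys b \<subseteq> {N} \<times> I" by blast
    then show ?thesis using v by (simp add: in_vars_iff)
  qed simp
  then show "xord N 1 (W' N j k)" by (auto simp: xord_def One_nat_def)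
qed

section \<open>The Lie derivative along the field E\<close>

abbreviation theta :: "nat \<Rightarrow> nat \<Rightarrow> nat list \<Rightarrow> (nat list \<Rightarrow> 'k series) \<Rightarrow> 'k series" where
  "theta N \<equiv> lie_deriv I strc sscale (D N)"

lemma theta_mult: "theta N k is (\<lambda>l. g * F l) = g * theta N k is F + D N k g * F is"
  by (induction "is" arbitrary: F)
     (auto simp: D_mult sscale_def algebra_simps sum_distrib_left intro!: sum.cong)

lemma wedge_mult: "dd N is (\<lambda>l. g * F l) = g * dd N is F + wedge (\<lambda>k y. D N k g * y) is F"
  by (induction "is" arbitrary: F) (auto simp: theta_mult algebra_simps)

definition iE :: "nat \<Rightarrow> (nat list \<Rightarrow> 'k series) \<Rightarrow> nat list \<Rightarrow> 'k series" where
  "iE N F is = (\<Sum>k\<in>I. tvar N k * F (k # is))"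

text \<open>The Lie derivative along \<open>\<Sum> x\<^sub>k D\<^sub>k\<close>, where \<open>x\<close> is the \<open>N\<close>-th tuple of variables; to lowest
  order it is the Euler field.\<close>

definition L :: "nat \<Rightarrow> (nat list \<Rightarrow> 'k series) \<Rightarrow> nat list \<Rightarrow> 'k series" where
  "L N F is = iE N (\<lambda>l. dd N l F) is + dd N is (iE N F)"

text \<open>The Lie derivative along the Euler field in the commutative case, where the invariant
  frame is the coordinate frame: it multiplies by x-degree plus form degree.\<close>

definition Nop :: "nat \<Rightarrow> (nat list \<Rightarrow> 'k series) \<Rightarrow> nat list \<Rightarrow> 'k series" where
  "Nop N F is = Abs_mfps (\<lambda>b. of_nat (xdeg N b + length is) * mcoeff (F is) b)"

definition Pop :: "nat \<Rightarrow> (nat list \<Rightarrow> 'k series) \<Rightarrow> nat list \<Rightarrow> 'k series" where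
  "Pop N F is = L N F is - Nop N F is"

text \<open>By Cartan's formula the terms x_k d i_k F of the two compositions cancel. What remains
  is \<Sum> x_k \<theta>_k F together with the exterior products of d x_k with i_k F.\<close>

lemma L_expand:
  "L N F is = (\<Sum>k\<in>I. tvar N k * theta N k is F) +
    (\<Sum>k\<in>I. wedge (\<lambda>l y. D N l (tvar N k) * y) is (\<lambda>l. F (k # l)))"
proof -
  interpret ce_module I strc sscale "D N" by (rule ce_D)
  have "dd N is (iE N F) = (\<Sum>k\<in>I. tvar N k * dd N is (\<lambda>l. F (k # l)) +
      wedge (\<lambda>l y. D N l (tvar N k) * y) is (\<lambda>l. F (k # l)))"
    unfolding iE_def[abs_def] d_sum wedge_mult ..
  then show ?thesis by (simp add: L_def iE_def algebra_simps sum.distrib sum_subtractf)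
qed

lemma wedge_add_op: "wedge (\<lambda>l y. a l y + b l y) is F = wedge a is F + wedge b is F"
  by (induction "is" arbitrary: F) auto

lemma wedge_op_cong:
  "set is \<subseteq> I \<Longrightarrow> (\<And>k x. k \<in> I \<Longrightarrow> a k x = b k x) \<Longrightarrow> wedge a is F = wedge b is F"
  by (induction "is" arbitrary: F) auto

text \<open>Contracting with every basis vector and wedging with the dual basis reproduces an
  alternating q-form q times, once for each slot.\<close>

lemma wedge_identity:
  assumes "alternating F" "set is \<subseteq> I"
  shows "(\<Sum>k\<in>I. wedge (\<lambda>l y. if k = l then y else 0) is (\<lambda>l. F (k # l))) = of_nat (length is) * (F is :: 'k series)"
  using assms
proof (induction "is" arbitrary: F)
  case (Cons i "is")
  have add: "(if k = l then x + y else 0) = (if k = l then x else 0) + (if k = l then y else (0 :: 'k series))" for k l :: nat and x y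
    by simp
  have "wedge (\<lambda>l y. if k = l then y else 0) is (\<lambda>l. F (k # i # l)) =
     - wedge (\<lambda>l y. if k = l then y else 0) is (\<lambda>l. F (i # k # l))" for k
    unfolding alternating_swap[OF Cons.prems(1), of k i]
    by (rule wedge_uminus) (rule add)
  then have "(\<Sum>k\<in>I. wedge (\<lambda>l y. if k = l then y else 0) (i # is) (\<lambda>l. F (k # l))) =
     (\<Sum>k\<in>I. if k = i then F (i # is) else 0) + (\<Sum>k\<in>I. wedge (\<lambda>l y. if k = l then y else 0) is (\<lambda>l. F (i # k # l)))"
    by (simp add: sum.distrib)
  also have "\<dots> = F (i # is) + of_nat (length is) * F (i # is)"
    using Cons.IH[OF alternating_contract[OF Cons.prems(1)], of i] Cons.prems(2) by simp
  finally show ?case by (simp add: algebra_simps)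
qed simp

lemma mcoeff_of_nat_mult: "mcoeff (of_nat n * f) b = of_nat n * mcoeff f b"
  by (induction n) (auto simp: algebra_simps)

lemma mcoeff_var_mult_mderiv: 
  "mcoeff (mvar v * mderiv v f) b = of_nat (Poly_Mapping.lookup b v) * mcoeff f b"
proof (cases "Poly_Mapping.lookup b v = 0")
  case True
  have "mcoeff (mvar v * mderiv v f) b = 0"
    unfolding mcoeff_mult
  proof (rule sum.neutral, clarify)
    fix a c assume "(a, c) \<in> splits b"
    then have "Poly_Mapping.lookup a v = 0" using True by (auto simp: splits_def lookup_add)
    then have "a \<noteq> Poly_Mapping.single v 1" by auto
    then show "mcoeff (mvar v) a * mcoeff (mderiv v f) c = 0" by (simp add: mcoeff_var)
  qed
  then show ?thesis using True by simp
next
  case False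
  let ?e = "Poly_Mapping.single v (1 :: nat)"
  have b: "?e + (b - ?e) = b"
    using False by (intro poly_mapping_eqI) (auto simp: lookup_add lookup_minus lookup_single when_def)
  have "mcoeff (mvar v * mderiv v f) b = (\<Sum>x\<in>{(?e, b - ?e)}. case x of (a, c) \<Rightarrow> mcoeff (mvar v) a * mcoeff (mderiv v f) c)"
    unfolding mcoeff_mult
  proof (rule sum.mono_neutral_right, rule finite_splits)
    show "{(?e, b - ?e)} \<subseteq> splits b" using b by (simp add: splits_def)
    show "\<forall>x\<in>splits b - {(?e, b - ?e)}. (case x of (a, c) \<Rightarrow> mcoeff (mvar v) a * mcoeff (mderiv v f) c) = 0"
    proof
      fix x assume x: "x \<in> splits b - {(?e, b - ?e)}"
      obtain a c where xac: "x = (a, c)" by (cases x)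
      have "a \<noteq> ?e"
      proof
        assume "a = ?e"
        then have "?e + c = ?e + (b - ?e)" using x xac b by (simp add: splits_def)
        then show False using x xac \<open>a = ?e\<close> by simp
      qed
      then show "(case x of (a, c) \<Rightarrow> mcoeff (mvar v) a * mcoeff (mderiv v f) c) = 0"
        by (simp add: xac mcoeff_var)
    qed
  qed
  also have "\<dots> = of_nat (Poly_Mapping.lookup (b - ?e) v + 1) * mcoeff f ((b - ?e) + ?e)"
    by (simp add: mcoeff_var mcoeff_deriv)
  also have "(b - ?e) + ?e = b" using b by (simp add: add.commute)
  also have "Poly_Mapping.lookup (b - ?e) v + 1 = Poly_Mapping.lookup b v"
    using False by (simp add: lookup_minus)
  finally show ?thesis .
qed

lemma euler:
  assumes "f \<in> in_vars (V n)"
  shows "mcoeff (\<Sum>k\<in>I. tvar N k * mderiv (N, k) f) b = of_nat (xdeg N b) * mcoeff f b"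
proof (cases "mcoeff f b = 0")
  case False
  then have k: "Poly_Mapping.keys b \<subseteq> V n" using assms by (auto simp: in_vars_def)
  have "mcoeff (\<Sum>k\<in>I. tvar N k * mderiv (N, k) f) b = of_nat (\<Sum>k\<in>I. Poly_Mapping.lookup b (N, k)) * mcoeff f b"
    by (simp add: tvar_def mcoeff_var_mult_mderiv sum_distrib_right)
  also have "(\<Sum>k\<in>I. Poly_Mapping.lookup b (N, k)) = (\<Sum>v\<in>Pair N ` I. Poly_Mapping.lookup b v)"
    by (simp add: sum.reindex inj_on_def)
  also have "\<dots> = xdeg N b"
    unfolding xdeg_def deg_in_def
    by (rule sum.mono_neutral_right) (use k in \<open>auto simp: in_keys_iff\<close>)
  finally show ?thesis .
next
  case True
  then show ?thesis by (simp add: tvar_def mcoeff_var_mult_mderiv)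
qed

lemma theta_bnd:
  assumes "\<And>is. bnd N d e B (F is)" "0 \<le> B"
  shows "bnd N d e B (lie_deriv I strc sscale (\<lambda>_ _. 0) k is F)"
  using assms(1)
  by (induction "is" arbitrary: F)
     (auto simp: sscale_def intro!: bnd_0 bnd_diff bnd_sum bnd_const_mult abs_strc assms(2))

lemma wedge_bnd:
  assumes "\<And>l. integral (g l)" "\<And>l. xord N 1 (g l)" "\<And>is. bnd N d e B (F is)" "0 \<le> B"
  shows "bnd N (Suc d) e B (wedge (\<lambda>l y. g l * y) is F)"
  using assms(3)
proof (induction "is" arbitrary: F)
  case Nil
  then show ?case using assms by (simp add: bnd_0)
next
  case (Cons i "is")
  have "bnd N (d + 1) e B (g i * F is)" using assms Cons.prems by (intro bnd_mult) auto
  moreover have "bnd N (d + 1) e B (wedge (\<lambda>l y. g l * y) is (\<lambda>l. F (i # l)))"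
    using Cons.IH[of "\<lambda>l. F (i # l)"] Cons.prems by (simp only: Suc_eq_plus1)
  ultimately show ?case by (simp only: Suc_eq_plus1 wedge.simps bnd_diff)
qed

text \<open>Write the frame as the identity plus \<open>W'\<close>. The identity yields the Euler
  operator on coefficients and the form degree, that is \<open>Nop\<close>; every other term
  contains a factor \<open>W'\<close> or a bare x_k without a derivative.\<close>

lemma Pop_expand:
  assumes F: "alternating F" "\<And>is. F is \<in> in_vars (V n)" and "is": "set is \<subseteq> I"
  shows "Pop N F is =
    (\<Sum>k\<in>I. \<Sum>j\<in>I. tvar N k * W' N j k * mderiv (N, j) (F is)) +
    (\<Sum>k\<in>I. tvar N k * lie_deriv I strc sscale (\<lambda>_ _. 0) k is F) +
    (\<Sum>k\<in>I. wedge (\<lambda>l y. (if l \<in> I then W' N k l else 0) * y) is (\<lambda>l. F (k # l)))"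
proof -
  have D1: "D N k f = mderiv (N, k) f + (\<Sum>j\<in>I. W' N j k * mderiv (N, j) f)" if "k \<in> I" for k f
  proof -
    have "(\<Sum>j\<in>I. W' N j k * mderiv (N, j) f) = D N k f - (\<Sum>j\<in>I. mderiv (N, j) f * (if j = k then 1 else 0))"
      using that by (simp add: W'_def D_def left_diff_distrib right_diff_distrib sum_subtractf mult.commute)
    then show ?thesis by (simp add: sum_delta_I'[OF that])
  qed
  have D2: "D N l (tvar N k) = (if k = l then 1 else 0) + W' N k l" if "l \<in> I" "k \<in> I" for k l
    using that by (simp add: D_def mderiv_tvar W'_def sum_delta_I')
  have 1: "(\<Sum>k\<in>I. tvar N k * theta N k is F) =
     (\<Sum>k\<in>I. tvar N k * mderiv (N, k) (F is)) +
     (\<Sum>k\<in>I. \<Sum>j\<in>I. tvar N k * W' N j k * mderiv (N, j) (F is)) +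
     (\<Sum>k\<in>I. tvar N k * lie_deriv I strc sscale (\<lambda>_ _. 0) k is F)"
    by (simp add: lie_deriv_split[of I strc sscale "D N"] D1 distrib_left sum.distrib sum_distrib_left mult.assoc)
  have 2: "(\<Sum>k\<in>I. wedge (\<lambda>l y. D N l (tvar N k) * y) is (\<lambda>l. F (k # l))) =
     of_nat (length is) * F is +
     (\<Sum>k\<in>I. wedge (\<lambda>l y. (if l \<in> I then W' N k l else 0) * y) is (\<lambda>l. F (k # l)))"
    unfolding wedge_identity[OF F(1) "is", symmetric] sum.distrib[symmetric]
  proof (rule sum.cong[OF refl])
    fix k assume k: "k \<in> I"
    show "wedge (\<lambda>l y. D N l (tvar N k) * y) is (\<lambda>l. F (k # l)) =
       wedge (\<lambda>l y. if k = l then y else 0) is (\<lambda>l. F (k # l)) +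
       wedge (\<lambda>l y. (if l \<in> I then W' N k l else 0) * y) is (\<lambda>l. F (k # l))"
      unfolding wedge_add_op[symmetric] by (rule wedge_op_cong[OF "is"]) (auto simp: D2 k distrib_right)
  qed
  have 3: "(\<Sum>k\<in>I. tvar N k * mderiv (N, k) (F is)) + of_nat (length is) * F is = Nop N F is"
    by (rule mfps_eqI)
       (simp add: Nop_def euler[OF F(2)] mcoeff_of_nat_mult distrib_right del: mcoeff_sum)
  have cancel: "u + v + w + (x + y) - (u + x) = v + w + y" for u v w x y :: "'k series"
    by (simp add: algebra_simps)
  show ?thesis unfolding Pop_def L_expand 1 2 3[symmetric] by (rule cancel)
qed

text \<open>Each of the three sums has integral coefficients and gains one x-degree: x_k
  \<open>W'\<close> against one derivative, the factor x_k, or the factor \<open>W'\<close>. The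
  cutoff \<open>e\<close> is kept because the estimates for the solution grow with the total
  degree.\<close>

lemma Pop_bnd:
  assumes F: "alternating F" "\<And>is. F is \<in> in_vars (V n)" and "is": "set is \<subseteq> I"
    and b: "\<And>is. bnd N d e B (F is)" and B: "0 \<le> B"
  shows "bnd N (Suc d) e B (Pop N F is)"
  unfolding Pop_expand[OF F "is"]
proof (intro bnd_add bnd_sum B)
  fix k j assume "k \<in> I" and j: "j \<in> I"
  have "xord N 2 (tvar N k * W' N j k)"
    using xord_mult[OF xord_tvar W'_props(2)[OF j]] by (simp add: one_add_one)
  then show "bnd N (Suc d) e B (tvar N k * W' N j k * mderiv (N, j) (F is))"
    using j B b by (intro bnd_mult_mderiv integral_mult integral_tvar W'_props)
next
  fix k
  have "bnd N (d + 1) e B (tvar N k * lie_deriv I strc sscale (\<lambda>_ _. 0) k is F)"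
    using B b by (intro bnd_mult integral_tvar xord_tvar theta_bnd)
  then show "bnd N (Suc d) e B (tvar N k * lie_deriv I strc sscale (\<lambda>_ _. 0) k is F)"
    by (simp only: Suc_eq_plus1)
next
  fix k assume k: "k \<in> I"
  show "bnd N (Suc d) e B (wedge (\<lambda>l y. (if l \<in> I then W' N k l else 0) * y) is (\<lambda>l. F (k # l)))"
    by (rule wedge_bnd) (auto simp: k W'_props integral_0 xord_def[of _ _ 0] b B)
qed

text \<open>Alternating \<open>q\<close>-forms whose coefficients are formal, respectively convergent, series in
  the first \<open>N\<close> tuples of variables. Exterior differentiation is with respect to the last tuple.\<close>

definition aform :: "nat \<Rightarrow> nat \<Rightarrow> (nat list \<Rightarrow> 'k series) \<Rightarrow> bool" where
  "aform N q F \<longleftrightarrow> alternating F \<and> (\<forall>is. length is \<noteq> q \<or> \<not> set is \<subseteq> I \<longrightarrow> F is = 0) \<and>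
     (\<forall>is. F is \<in> in_vars (V N))"

definition cform :: "nat \<Rightarrow> nat \<Rightarrow> (nat list \<Rightarrow> 'k series) \<Rightarrow> bool" where
  "cform N q F \<longleftrightarrow> aform N q F \<and> (\<forall>is. conv (F is))"

lemma aformD:
  assumes "aform N q F"
  shows "alternating F" "length is \<noteq> q \<or> \<not> set is \<subseteq> I \<Longrightarrow> F is = 0" "F is \<in> in_vars (V N)"
  using assms by (auto simp: aform_def)

lemma aform_dd:
  assumes N: "1 \<le> N" and F: "aform N q F"
  shows "aform N (Suc q) (\<lambda>is. dd N is F)"
  unfolding aform_def
proof (intro conjI allI impI)
  interpret ce_module I strc sscale "D N" by (rule ce_D)
  show "alternating (\<lambda>is. dd N is F)" by (rule alternating_d[OF aformD(1)[OF F]])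
  fix "is" :: "nat list"
  show "dd N is F \<in> in_vars (V N)"
    by (rule ce_diff_natural(2)[OF ce_D subspace_V, where h = id and sc' = sscale and D' = "D N"])
       (auto intro: D_vars N aformD(3)[OF F])
  assume isq: "length is \<noteq> Suc q \<or> \<not> set is \<subseteq> I"
  show "dd N is F = 0"
  proof (rule d_outside[OF _ _ _ isq])
    show "D N k x = 0" if "k \<notin> I" for k x using that by (simp add: D_def)
    show "strc j k l = 0" if "k \<notin> I \<or> l \<notin> I" for j k l using that by (auto simp: strc_def)
    show "F js = 0" if "length js \<noteq> q \<or> \<not> set js \<subseteq> I" for js using aformD(2)[OF F that] .
  qed
qed

lemma conv_dd:
  assumes "\<And>is. conv (F is)"
  shows "conv (dd N is F)"
proof -
  have "module.subspace sscale {f. conv f}"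
    unfolding module.subspace_def[OF module_sscale]
    by (auto simp: sscale_def conv_add conv_const_mult)
  from ce_diff_natural(2)[OF ce_D this, where h = id and sc' = sscale and D' = "D N"] show ?thesis
    using assms by (auto intro: conv_D)
qed

lemma cform_dd: "1 \<le> N \<Longrightarrow> cform N q F \<Longrightarrow> cform N (Suc q) (\<lambda>is. dd N is F)"
  by (auto simp: cform_def intro: aform_dd conv_dd)

lemma aform_iE:
  assumes N: "1 \<le> N" and F: "aform N (Suc q) F"
  shows "aform N q (iE N F)"
  unfolding aform_def
proof (intro conjI allI impI)
  have "alternating (\<lambda>is. \<Sum>k\<in>I. tvar N k * F (k # is))"
    by (intro alternating_sum alternating_map[OF alternating_contract[OF aformD(1)[OF F]]]) simp
  then show "alternating (iE N F)" by (simp add: iE_def[abs_def])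
  fix "is" :: "nat list"
  show "iE N F is \<in> in_vars (V N)"
    unfolding iE_def using N by (auto intro!: in_vars_sum in_vars_mult tvar_V aformD(3)[OF F])
  assume "length is \<noteq> q \<or> \<not> set is \<subseteq> I"
  then show "iE N F is = 0" unfolding iE_def using aformD(2)[OF F] by (intro sum.neutral) auto
qed

lemma conv_iE: "(\<And>is. conv (F is)) \<Longrightarrow> conv (iE N F is)"
  unfolding iE_def by (intro conv_sum conv_integral_mult integral_tvar)

lemma cform_iE: "1 \<le> N \<Longrightarrow> cform N (Suc q) F \<Longrightarrow> cform N q (iE N F)"
  unfolding cform_def by (auto intro!: aform_iE conv_iE)

lemma aform_diff: "aform N q F \<Longrightarrow> aform N q H \<Longrightarrow> aform N q (\<lambda>is. F is - H is)"
  unfolding aform_def by (auto intro: alternating_diff in_vars_diff)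

lemma aform_add: "aform N q F \<Longrightarrow> aform N q H \<Longrightarrow> aform N q (\<lambda>is. F is + H is)"
  unfolding aform_def by (auto intro: alternating_add in_vars_add)

lemma aform_0: "aform N q (\<lambda>is. 0)"
  unfolding aform_def by (auto intro: alternating_zero)

lemma iE_0 [simp]: "iE N (\<lambda>is. 0) is = 0"
  by (simp add: iE_def)

lemma aform_L:
  assumes N: "1 \<le> N" and F: "aform N q F"
  shows "aform N q (L N F)"
proof -
  interpret ce_module I strc sscale "D N" by (rule ce_D)
  have 1: "aform N q (iE N (\<lambda>l. dd N l F))" by (rule aform_iE[OF N aform_dd[OF N F]])
  have 2: "aform N q (\<lambda>is. dd N is (iE N F))"
  proof (cases q)
    case 0
    \<comment> \<open>A 0-form vanishes on nonempty lists by normalisation, so its contraction is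
      zero.\<close>
    have "F (k # is) = 0" for k "is" using aformD(2)[OF F] 0 by simp
    then have "iE N F = (\<lambda>is. 0)" by (simp add: iE_def fun_eq_iff)
    then show ?thesis by (simp add: d_zero aform_0)
  next
    case (Suc r)
    then show ?thesis using aform_dd[OF N aform_iE[OF N]] F by simp
  qed
  show ?thesis using aform_add[OF 1 2] by (simp add: L_def[abs_def])
qed

lemma alternating_length_scale:
  fixes F :: "nat list \<Rightarrow> 'b::ab_group_add"
  assumes "alternating F" "\<And>n x. h n (- x) = - h n x"
  shows "alternating (\<lambda>is. h (length is) (F is))"
  unfolding alternating_def
proof (intro allI)
  fix ys k l and zs :: "nat list"
  have "F (ys @ k # l # zs) = - F (ys @ l # k # zs)" using assms(1) by (rule alternatingD)
  then show "h (length (ys @ k # l # zs)) (F (ys @ k # l # zs)) = - h (length (ys @ l # k # zs)) (F (ys @ l # k # zs))"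
    using assms(2) by simp
qed

lemma aform_coeffwise:
  assumes F: "aform N q F"
  shows "aform N q (\<lambda>is. Abs_mfps (\<lambda>b. c (length is) b * mcoeff (F is) b))"
  unfolding aform_def
proof (intro conjI allI impI)
  show "alternating (\<lambda>is. Abs_mfps (\<lambda>b. c (length is) b * mcoeff (F is) b))"
    by (rule alternating_length_scale[OF aformD(1)[OF F], where h = "\<lambda>n x. Abs_mfps (\<lambda>b. c n b * mcoeff x b)"])
       (auto intro: mfps_eqI)
  fix "is" :: "nat list"
  show "Abs_mfps (\<lambda>b. c (length is) b * mcoeff (F is) b) \<in> in_vars (V N)"
    using aformD(3)[OF F, of "is"] by (auto simp: in_vars_iff)
  assume "length is \<noteq> q \<or> \<not> set is \<subseteq> I"
  then show "Abs_mfps (\<lambda>b. c (length is) b * mcoeff (F is) b) = 0"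
    using aformD(2)[OF F] by (auto intro: mfps_eqI)
qed

lemma aform_Nop: "aform N q F \<Longrightarrow> aform N q (Nop N F)"
  using aform_coeffwise[of N q F "\<lambda>n b. of_nat (xdeg N b + n)"] by (simp add: Nop_def[abs_def])

lemma aform_Pop: "1 \<le> N \<Longrightarrow> aform N q F \<Longrightarrow> aform N q (Pop N F)"
  unfolding Pop_def[abs_def] by (intro aform_diff aform_L aform_Nop)

lemma L_diff: "L N (\<lambda>is. F is - H is) is = L N F is - L N H is"
proof -
  interpret ce_module I strc sscale "D N" by (rule ce_D)
  have "iE N (\<lambda>is. F is - H is) = (\<lambda>is. iE N F is - iE N H is)" for F H
    by (auto simp: iE_def right_diff_distrib sum_subtractf)
  then show ?thesis by (simp add: L_def d_diff)
qed

lemma Pop_diff: "Pop N (\<lambda>is. F is - H is) is = Pop N F is - Pop N H is"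
proof -
  have "Nop N (\<lambda>is. F is - H is) is = Nop N F is - Nop N H is"
    by (rule mfps_eqI) (simp add: Nop_def right_diff_distrib)
  then show ?thesis by (simp add: Pop_def L_diff)
qed

lemma Pop_xord:
  assumes N: "1 \<le> N" and F: "aform N q F" and x: "\<And>is. xord N d (F is)"
  shows "xord N (Suc d) (Pop N F is)"
proof (cases "set is \<subseteq> I")
  case True
  show ?thesis
    unfolding xord_bnd
    using x by (intro allI Pop_bnd[OF aformD(1)[OF F] aformD(3)[OF F] True]) (auto simp: xord_bnd)
next
  case False
  then show ?thesis using aformD(2)[OF aform_Pop[OF N F]] by (simp add: xord_def)
qed

text \<open>From Nop F = - Pop F and the gain of one x-degree under \<open>Pop\<close>, the x-order
  of F grows without end. The one weight that cannot be divided out is 0, at x-degree 0 of a 0-form,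
  and \<open>start\<close> covers it.\<close>

lemma L_injective:
  assumes N: "1 \<le> N" and F: "aform N q F" and 0: "\<And>is. L N F is = 0"
    and start: "q \<noteq> 0 \<or> (\<forall>is. xord N 1 (F is))"
  shows "F is = 0"
proof -
  have step: "mcoeff (F is) b = 0" if "mcoeff (Pop N F is) b = 0" "xdeg N b + length is \<noteq> 0" for b "is"
  proof -
    have "Nop N F is = - Pop N F is" using 0 by (simp add: Pop_def)
    then have "mcoeff (Nop N F is) b = 0" using that(1) by simp
    moreover have "mcoeff (Nop N F is) b = of_nat (xdeg N b + length is) * mcoeff (F is) b"
      by (simp only: Nop_def mcoeff_Abs)
    ultimately show ?thesis using that(2) by (simp only: mult_eq_0_iff of_nat_eq_0_iff simp_thms)
  qed
  have "xord N d (F is)" for d "is"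
  proof (induction d arbitrary: "is")
    case (Suc d)
    show ?case
      unfolding xord_def
    proof (intro allI impI)
      fix b assume b: "xdeg N b < Suc d"
      show "mcoeff (F is) b = 0"
      proof (cases "xdeg N b + length is = 0")
        case True
        then show ?thesis using start aformD(2)[OF F, of "is"] by (cases "q = 0") (auto simp: xord_def)
      next
        case False
        then show ?thesis using Pop_xord[OF N F Suc, of "is"] b by (intro step) (auto simp: xord_def)
      qed
    qed
  qed (simp add: xord_def)
  then show ?thesis by (intro mfps_eqI) (auto simp: xord_def)
qed

text \<open>The equation \<open>L v = F\<close> reads \<open>Nop v + Pop v = F\<close>, where \<open>Nop\<close> multiplies by degrees and
  \<open>Pop\<close> is integral and raises the \<open>x\<close>-degree. It is solved degree by degree; up to
  degree \<open>d\<close> the denominators multiply to at most \<open>(d + q)!\<close>, so their growth is geometric.\<close>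

fun Lsol :: "nat \<Rightarrow> (nat list \<Rightarrow> 'k series) \<Rightarrow> nat \<Rightarrow> nat list \<Rightarrow> 'k series" where
  "Lsol N F 0 is = 0"
| "Lsol N F (Suc i) is =
     Abs_mfps (\<lambda>b. inverse (of_nat (xdeg N b + length is)) * mcoeff (F is - Pop N (Lsol N F i) is) b)"

text \<open>The coefficient at \<open>b\<close> is read off from the iterate
  \<open>xdeg N b + 1\<close>, from which point on it is stationary.\<close>

definition Lsol_lim :: "nat \<Rightarrow> (nat list \<Rightarrow> 'k series) \<Rightarrow> nat list \<Rightarrow> 'k series" where
  "Lsol_lim N F is = Abs_mfps (\<lambda>b. mcoeff (Lsol N F (Suc (xdeg N b)) is) b)"

section \<open>The solution of L v = F and its convergence\<close>

lemma aform_Lsol: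
  assumes N: "1 \<le> N" and F: "aform N q F"
  shows "aform N q (Lsol N F i)"
proof (induction i)
  case 0
  have "Lsol N F 0 = (\<lambda>is. 0)" by (rule ext) simp
  then show ?case using aform_0[of N q] by simp
next
  case (Suc i)
  have "Lsol N F (Suc i) = (\<lambda>is. Abs_mfps (\<lambda>b. inverse (of_nat (xdeg N b + length is)) * mcoeff (F is - Pop N (Lsol N F i) is) b))"
    by (rule ext) simp
  then show ?case
    using aform_coeffwise[OF aform_diff[OF F aform_Pop[OF N Suc]], of "\<lambda>n b. inverse (of_nat (xdeg N b + n))"] by simp
qed

text \<open>Consecutive iterates differ through \<open>Pop\<close> of the previous difference, so
  every step settles one more x-degree.\<close>

lemma Lsol_step_xord:
  assumes N: "1 \<le> N" and F: "aform N q F"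
  shows "xord N i (Lsol N F (Suc i) is - Lsol N F i is)"
proof (induction i arbitrary: "is")
  case 0
  then show ?case by (simp add: xord_def)
next
  case (Suc i)
  let ?d = "\<lambda>is. Lsol N F (Suc i) is - Lsol N F i is"
  have "aform N q ?d" by (intro aform_diff aform_Lsol N F)
  from Pop_xord[OF N this Suc, of "is"] have x: "xord N (Suc i) (Pop N (Lsol N F (Suc i)) is - Pop N (Lsol N F i) is)"
    by (simp only: Pop_diff)
  show ?case
    unfolding xord_def
  proof (intro allI impI)
    fix b assume "xdeg N b < Suc i"
    then have "mcoeff (Pop N (Lsol N F (Suc i)) is) b = mcoeff (Pop N (Lsol N F i) is) b"
      using x by (simp add: xord_def del: Lsol.simps)
    then show "mcoeff (Lsol N F (Suc (Suc i)) is - Lsol N F (Suc i) is) b = 0"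
      unfolding Lsol.simps(2)[of N F] by (simp del: Lsol.simps)
  qed
qed

lemma Lsol_stable:
  assumes N: "1 \<le> N" and F: "aform N q F" and b: "xdeg N b < i"
  shows "mcoeff (Lsol N F i is) b = mcoeff (Lsol_lim N F is) b"
  using b
proof (induction i)
  case (Suc i)
  show ?case
  proof (cases "xdeg N b = i")
    case True
    then show ?thesis by (simp add: Lsol_lim_def del: Lsol.simps)
  next
    case False
    then have "xdeg N b < i" using Suc.prems by simp
    then show ?thesis
      using Suc.IH Lsol_step_xord[OF N F, of i "is"] by (simp add: xord_def del: Lsol.simps)
  qed
qed simp

lemma aform_Lsol_lim:
  assumes N: "1 \<le> N" and F: "aform N q F"
  shows "aform N q (Lsol_lim N F)"
  unfolding aform_def
proof (intro conjI allI impI)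
  note S = aform_Lsol[OF N F]
  show "alternating (Lsol_lim N F)"
    unfolding alternating_def Lsol_lim_def
  proof (intro allI mfps_eqI)
    fix ys k l zs b
    have "Lsol N F j (ys @ k # l # zs) = - Lsol N F j (ys @ l # k # zs)" for j
      by (rule alternatingD[OF aformD(1)[OF S]])
    then show "mcoeff (Abs_mfps (\<lambda>b. mcoeff (Lsol N F (Suc (xdeg N b)) (ys @ k # l # zs)) b)) b =
       mcoeff (- Abs_mfps (\<lambda>b. mcoeff (Lsol N F (Suc (xdeg N b)) (ys @ l # k # zs)) b)) b"
      by (simp only: mcoeff_Abs mcoeff_uminus)
  qed
  fix "is" :: "nat list"
  show "Lsol_lim N F is \<in> in_vars (V N)"
    using aformD(3)[OF S] by (auto simp: in_vars_iff Lsol_lim_def simp del: Lsol.simps)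
  assume "length is \<noteq> q \<or> \<not> set is \<subseteq> I"
  then show "Lsol_lim N F is = 0"
    using aformD(2)[OF S] by (auto simp: Lsol_lim_def intro: mfps_eqI simp del: Lsol.simps)
qed

text \<open>At \<open>b\<close> the operator \<open>Pop\<close> sees only smaller x-degrees, where
  the limit agrees with the iterate \<open>xdeg N b\<close>. The positive form degree keeps the
  weight in \<open>Nop\<close> nonzero, so the division can be undone.\<close>

lemma L_Lsol_lim:
  assumes N: "1 \<le> N" and F: "aform N (Suc q) F"
  shows "L N (Lsol_lim N F) is = F is"
proof (rule mfps_eqI)
  fix b
  let ?v = "Lsol_lim N F" and ?i = "xdeg N b"
  note v = aform_Lsol_lim[OF N F]
  show "mcoeff (L N ?v is) b = mcoeff (F is) b"
  proof (cases "length is = Suc q")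
    case False
    then show ?thesis using aformD(2)[OF F] aformD(2)[OF aform_L[OF N v]] by simp
  next
    case True
    have "xord N ?i (?v is - Lsol N F ?i is)" for "is"
      using Lsol_stable[OF N F] by (auto simp: xord_def)
    from Pop_xord[OF N aform_diff[OF v aform_Lsol[OF N F]] this, of "is"]
    have P: "mcoeff (Pop N ?v is) b = mcoeff (Pop N (Lsol N F ?i) is) b"
      by (simp add: Pop_diff xord_def)
    have nz: "(of_nat (?i + length is) :: 'k) \<noteq> 0" using True by (metis add_is_0 nat.distinct(1) of_nat_eq_0_iff)
    have "inverse (of_nat (?i + length is)) * mcoeff (F is - Pop N (Lsol N F ?i) is) b = mcoeff (?v is) b"
      using Lsol_stable[OF N F, of b "Suc ?i" "is"] by simp
    then have "of_nat (?i + length is) * mcoeff (?v is) b = mcoeff (F is - Pop N (Lsol N F ?i) is) b"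
      using nz by (metis mult.assoc mult_1 right_inverse)
    then have "mcoeff (Nop N ?v is) b = mcoeff (F is - Pop N (Lsol N F ?i) is) b"
      by (simp add: Nop_def)
    then show ?thesis using P by (simp add: Pop_def)
  qed
qed

text \<open>Only finitely many lists of indices carry a nonzero coefficient, so their constants have
  a maximum.\<close>

lemma conv_uniform:
  assumes "\<And>is. conv (F is)" "\<And>is. length is \<noteq> q \<or> \<not> set is \<subseteq> I \<Longrightarrow> F is = 0"
  shows "\<exists>C\<ge>1. \<forall>is b. absK (mcoeff (F is) b) \<le> C ^ Suc (total_deg b)"
proof -
  have "\<forall>is. \<exists>C. 1 \<le> C \<and> (\<forall>b. absK (mcoeff (F is) b) \<le> C ^ Suc (total_deg b))"
    using assms(1) unfolding conv_def by blast
  then obtain C where C: "\<And>is. 1 \<le> C is" "\<And>is b. absK (mcoeff (F is) b) \<le> C is ^ Suc (total_deg b)" by metis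
  let ?S = "{is. set is \<subseteq> I \<and> length is = q}"
  have fin: "finite ?S" by (rule finite_lists_length_eq) simp
  define M where "M = Max (insert 1 (C ` ?S))"
  have M1: "1 \<le> M" unfolding M_def using fin by (intro Max_ge) auto
  have "absK (mcoeff (F is) b) \<le> M ^ Suc (total_deg b)" for "is" b
  proof (cases "is \<in> ?S")
    case True
    then have "C is \<le> M" unfolding M_def using fin by (intro Max_ge) auto
    then have "C is ^ Suc (total_deg b) \<le> M ^ Suc (total_deg b)"
      using C(1)[of "is"] by (intro power_mono) auto
    then show ?thesis using C(2)[of "is" b] by linarith
  next
    case False
    then have "F is = 0" using assms(2) by blast
    then show ?thesis using M1 by simp
  qed
  then show ?thesis using M1 by blast
qed

lemma abs_fact_antimono: "k \<le> n \<Longrightarrow> absK (fact n) \<le> absK (fact k)"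
proof (induction rule: dec_induct)
  case (step n)
  have "absK (fact (Suc n)) \<le> 1 * absK (fact n)"
    unfolding fact_Suc abs_mult by (intro mult_right_mono abs_of_nat_le) simp
  then show ?case using step by simp
qed simp

text \<open>By induction on the x-degree x, a coefficient of total degree d is at most C^(d+1) / |(x
  + q + 1)!|: \<open>Pop\<close> loses nothing, and solving in x-degree x divides by the weight x +
  q + 1.\<close>

lemma conv_Lsol_lim:
  assumes N: "1 \<le> N" and F: "cform N (Suc q) F"
  shows "conv (Lsol_lim N F is)"
proof -
  let ?v = "Lsol_lim N F"
  have aF: "aform N (Suc q) F" using F by (simp add: cform_def)
  note v = aform_Lsol_lim[OF N aF]
  have cF: "conv (F is)" for "is" using F by (simp add: cform_def)
  obtain C where C: "1 \<le> C" "\<And>is b. absK (mcoeff (F is) b) \<le> C ^ Suc (total_deg b)"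
    using conv_uniform[where F = F and q = "Suc q", OF cF aformD(2)[OF aF]] by blast
  have pos: "0 < absK (fact n)" for n by (simp add: less_le)
  have bound: "absK (mcoeff (?v is) b) \<le> 1 / absK (fact (xdeg N b + Suc q)) * C ^ Suc (total_deg b)" for "is" b
  proof (induction "xdeg N b" arbitrary: b "is" rule: less_induct)
    case less
    let ?x = "xdeg N b" and ?n = "xdeg N b + Suc q" and ?C = "C ^ Suc (total_deg b)"
    let ?B = "1 / absK (fact (?x + q)) * ?C"
    have C0: "0 \<le> ?C" using C(1) by simp
    have B0: "0 \<le> ?B" using C(1) by simp
    have one: "1 \<le> 1 / absK (fact n)" for n
      using abs_fact_antimono[of 0 n] pos[of n] by simp
    show ?case
    proof (cases "length is = Suc q \<and> set is \<subseteq> I")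
      case False
      then have "?v is = 0" using aformD(2)[OF v] by blast
      then show ?thesis using C(1) by simp
    next
      case True
      \<comment> \<open>A smaller x-degree x' satisfies x' + q + 1 <= x + q, and |n!| decreases with
        n, so the factorial of x + q serves all of them at once.\<close>
      have "bnd N ?x (total_deg b) ?B (?v js)" for js
        unfolding bnd_def
      proof (intro allI impI)
        fix b' assume b': "xdeg N b' < ?x" "total_deg b' \<le> total_deg b"
        have "absK (mcoeff (?v js) b') \<le> 1 / absK (fact (xdeg N b' + Suc q)) * C ^ Suc (total_deg b')"
          by (rule less[OF b'(1)])
        also have "\<dots> \<le> ?B"
        proof (rule mult_mono)
          show "1 / absK (fact (xdeg N b' + Suc q)) \<le> 1 / absK (fact (?x + q))"
            using b' by (intro divide_left_mono abs_fact_antimono mult_pos_pos pos) linarith+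
          show "C ^ Suc (total_deg b') \<le> ?C"
            using b' C(1) by (intro power_increasing) auto
        qed (use C(1) in \<open>simp_all del: fact_Suc add_Suc_right\<close>)
        finally show "absK (mcoeff (?v js) b') \<le> ?B" .
      qed
      then have "bnd N (Suc ?x) (total_deg b) ?B (Pop N ?v is)"
        using True B0 by (intro Pop_bnd[OF aformD(1)[OF v] aformD(3)[OF v]]) auto
      then have P: "absK (mcoeff (Pop N ?v is) b) \<le> ?B" by (simp add: bnd_def)
      have "absK (mcoeff (F is) b) \<le> 1 * ?C" using C(2) by simp
      also have "\<dots> \<le> ?B" using C0 one by (intro mult_right_mono) auto
      finally have FP: "absK (mcoeff (F is - Pop N ?v is) b) \<le> ?B"
        unfolding mcoeff_diff by (rule abs_diff_le[OF _ P])
      have NB: "mcoeff (Nop N ?v is) b = of_nat ?n * mcoeff (?v is) b"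
        using True by (simp only: Nop_def mcoeff_Abs)
      have "Nop N ?v is = F is - Pop N ?v is"
        using L_Lsol_lim[OF N aF, of "is"] by (simp add: Pop_def)
      then have "of_nat ?n * mcoeff (?v is) b = mcoeff (F is - Pop N ?v is) b"
        by (simp only: NB[symmetric])
      then have "absK (of_nat ?n) * absK (mcoeff (?v is) b) \<le> ?B" using FP by (simp flip: abs_mult)
      moreover have divI: "y \<le> B / x" if "x * y \<le> B" "0 < x" for x y B :: real
        using that by (simp add: pos_le_divide_eq mult.commute)
      moreover have np: "0 < absK (of_nat ?n)" using abs_eq_0[of "of_nat ?n"] by (simp add: less_le del: of_nat_add of_nat_Suc)
      ultimately have "absK (mcoeff (?v is) b) \<le> ?B / absK (of_nat ?n)"
        by (intro divI)
      also have "\<dots> = 1 / absK (fact ?n) * ?C"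
        by (simp add: abs_mult del: of_nat_Suc of_nat_add)
      finally show ?thesis .
    qed
  qed
  show ?thesis
  \<comment> \<open>In degree d the inverse factorial costs at most p^(x + q + 1), and x + q + 1 <=
    (q + 2) (d + 1) because x <= d.\<close>
  proof (rule convI[of "real p ^ Suc (Suc q) * C"])
    have p1: "1 \<le> real p" using p_gt_1 by simp
    show "1 \<le> real p ^ Suc (Suc q) * C"
      using mult_mono[of 1 "real p ^ Suc (Suc q)" 1 C] one_le_power[OF p1, of "Suc (Suc q)"] C(1) by simp
    fix b :: "nat \<times> nat \<Rightarrow>\<^sub>0 nat"
    let ?d = "total_deg b"
    have "absK (mcoeff (?v is) b) \<le> real p ^ (xdeg N b + Suc q) * C ^ Suc ?d"
      using bound[of "is" b] mult_right_mono[OF inverse_abs_fact_le[of "xdeg N b + Suc q"], of "C ^ Suc ?d"] C(1)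
      by simp
    also have "real p ^ (xdeg N b + Suc q) \<le> real p ^ (Suc (Suc q) * Suc ?d)"
      using p1 xdeg_le[of N b] by (intro power_increasing) auto
    also have "real p ^ (Suc (Suc q) * Suc ?d) * C ^ Suc ?d = (real p ^ Suc (Suc q) * C) ^ Suc ?d"
      by (simp only: power_mult_distrib power_mult)
    finally show "absK (mcoeff (?v is) b) \<le> (real p ^ Suc (Suc q) * C) ^ Suc ?d"
      using C(1) by (simp add: mult_right_mono)
  qed
qed

text \<open>Let L v = F. As L commutes with d, the form d v is annihilated by L and hence zero; then
  L v = d (i_E v), and the primitive is i_E v.\<close>

theorem poincare:
  assumes N: "1 \<le> N" and F: "cform N (Suc q) F" and closed: "\<And>is. dd N is F = 0"
  obtains u where "cform N q u" "\<And>is. dd N is u = F is"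
proof -
  interpret ce_module I strc sscale "D N" by (rule ce_D)
  let ?v = "Lsol_lim N F"
  have aF: "aform N (Suc q) F" using F by (simp add: cform_def)
  have v: "cform N (Suc q) ?v" using aform_Lsol_lim[OF N aF] conv_Lsol_lim[OF N F] by (simp add: cform_def)
  let ?w = "\<lambda>l. dd N l ?v"
  have "L N ?w is = dd N is (L N ?v)" for "is"
    by (simp add: L_def[abs_def] d_add d_d)
  moreover have "L N ?v = F" by (rule ext) (rule L_Lsol_lim[OF N aF])
  ultimately have "L N ?w is = 0" for "is" using closed by simp
  then have w: "?w is = 0" for "is"
    using L_injective[OF N aform_dd[OF N], of "Suc q" ?v "is"] v by (auto simp: cform_def)
  show thesis
  proof (rule that[of "iE N ?v"])
    show "cform N q (iE N ?v)" by (rule cform_iE[OF N v])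
    fix "is"
    have "F is = iE N ?w is + dd N is (iE N ?v)"
      using L_Lsol_lim[OF N aF, of "is"] by (simp add: L_def)
    also have "iE N ?w is = 0" by (simp add: w iE_def)
    finally show "dd N is (iE N ?v) = F is" by simp
  qed
qed

section \<open>The diagram chase\<close>

declare sc.trivK.scale_scale [simp del]

text \<open>Putting the N-th tuple to 0 keeps exactly the monomials of x-degree 0; this truncation
  is the map \<open>R\<close>.\<close>

lemma Zero_xord:
  assumes f: "f \<in> in_vars (V n)"
  shows "xord N 1 (f - Zero N f)"
proof -
  define R where "R f = Abs_mfps (\<lambda>b. if xdeg N b = 0 then mcoeff f b else 0)" for f :: "'k series"
  have cR: "cont_linear (V n) 0 R"
    unfolding cont_linear_def by (auto simp: R_def has_order_def intro: mfps_eqI)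
  have sp: "spow (zsub N) a = R (mmonom a)" if "Poly_Mapping.keys a \<subseteq> V n" for a
    using that
  proof (induction rule: multi_index_induct)
    case zero
    have "xdeg N 0 = 0" by (simp add: xdeg_def)
    then show ?case by (auto intro!: mfps_eqI simp: R_def mcoeff_one)
  next
    case (add a v)
    obtain i j where v: "v = (i, j)" by (cases v)
    have "R (mmonom (a + Poly_Mapping.single v 1)) = R (mmonom a) * zsub N v"
    proof (cases "i = N")
      case True
      then show ?thesis by (auto intro!: mfps_eqI simp: R_def v zsub_def mcoeff_mmonom)
    next
      case False
      have R: "R (mmonom a) = (if xdeg N a = 0 then mmonom a else 0)" for a
        by (auto intro!: mfps_eqI simp: R_def mcoeff_mmonom)
      have "mmonom (a + Poly_Mapping.single v 1) = mmonom a * (tvar i j :: 'k series)"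
        by (simp add: mmonom_add tvar_def v mmonom_single[unfolded One_nat_def[symmetric]])
      then show ?thesis using False unfolding R by (auto simp: v zsub_def)
    qed
    then show ?case using add.IH by (simp add: spow_add spow_single[unfolded One_nat_def[symmetric]])
  qed
  have "Zero N f = R f"
    unfolding Zero_def
    by (rule cont_linear_eqI[OF _ cont_linear_msubst[OF zsub_dom] cR _ f])
       (auto simp: msubst_mmonom[OF zsub_dom[of "V n"]] sp)
  then show ?thesis by (auto simp: xord_def R_def One_nat_def)
qed

definition form0 :: "'a::zero \<Rightarrow> nat list \<Rightarrow> 'a" where
  "form0 f is = (if is = [] then f else 0)"

lemma aform_form0: "f \<in> in_vars (V N) \<Longrightarrow> aform N 0 (form0 f)"
  by (auto simp: aform_def alternating_def form0_def)

lemma aform_0_eq: "aform N 0 F \<Longrightarrow> F = form0 (F [])"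
  using aformD(2)[of N 0 F] by (auto simp: form0_def fun_eq_iff)

lemma D_constant_last: "f \<in> in_vars (V n) \<Longrightarrow> D (Suc n) k f = 0"
  unfolding D_def by (auto intro!: sum.neutral simp: mderiv_outside atLeastAtMost_iff)

text \<open>Subtracting the value at x = 0 leaves a 0-form of positive x-order that L annihilates;
  injectivity of L makes it zero.\<close>

lemma closed_0:
  assumes f: "f \<in> in_vars (V (Suc n))" and D: "\<And>k. k \<in> I \<Longrightarrow> D (Suc n) k f = 0"
  shows "f \<in> in_vars (V n)"
proof -
  let ?N = "Suc n"
  let ?g = "f - Zero ?N f"
  have Z: "Zero ?N f \<in> in_vars (V n)" by (rule Zero_last_vars[OF f])
  have g: "?g \<in> in_vars (V ?N)" using f Zero_vars[OF f] by (rule in_vars_diff)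
  have N: "1 \<le> ?N" by simp
  have a: "aform ?N 0 (form0 ?g)" by (rule aform_form0[OF g])
  have "L ?N (form0 ?g) is = 0" for "is"
  proof (cases "is = []")
    case True
    have "D ?N k ?g = 0" if "k \<in> I" for k
      using D[OF that] D_constant_last[OF Z] by (simp add: D_diff)
    then show ?thesis by (simp add: True L_def iE_def form0_def)
  next
    case False
    then show ?thesis using aformD(2)[OF aform_L[OF N a], of "is"] by simp
  qed
  moreover have "xord ?N 1 (form0 ?g is)" for "is"
    using Zero_xord[OF f, of ?N] by (auto simp: form0_def xord_def)
  ultimately have "form0 ?g [] = 0" using L_injective[OF N a, of "[]"] by blast
  then have "f = Zero ?N f" by (simp add: form0_def)
  then show ?thesis using Z by simp
qed

lemma alternating_map_on:
  assumes "alternating F" "\<And>is. F is \<in> S" "\<And>x. x \<in> S \<Longrightarrow> h (- x) = - h x"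
  shows "alternating (\<lambda>is. h (F is))"
  unfolding alternating_def
proof (intro allI)
  fix ys k l zs
  have "F (ys @ k # l # zs) = - F (ys @ l # k # zs)" using assms(1) by (rule alternatingD)
  then show "h (F (ys @ k # l # zs)) = - h (F (ys @ l # k # zs))"
    using assms(3)[OF assms(2)[of "ys @ l # k # zs"]] by simp
qed

section \<open>Compatibility of the differentials and exactness of the rows\<close>

lemma cform_delta:
  assumes F: "cform N q F"
  shows "cform (Suc N) q (\<lambda>is. delta N (F is))"
proof -
  have a: "aform N q F" using F by (simp add: cform_def)
  have "alternating (\<lambda>is. delta N (F is))"
    by (rule alternating_map_on[OF aformD(1)[OF a] aformD(3)[OF a]]) (rule delta_uminus)
  then show ?thesis
    using F aformD(2)[OF a] unfolding cform_def aform_def by (auto intro: delta_vars conv_delta)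
qed

lemma dd_delta:
  assumes N: "1 \<le> N" and F: "\<And>is. F is \<in> in_vars (V N)"
  shows "dd (Suc N) is (\<lambda>l. delta N (F l)) = delta N (dd N is F)"
  by (rule ce_diff_natural(1)[OF ce_D subspace_V[of N], symmetric])
     (use N F in \<open>auto simp: delta_add sscale_def delta_const_mult delta_D intro: D_vars\<close>)

lemma cform_sign_mult: "cform N q F \<Longrightarrow> cform N q (\<lambda>is. (- 1) ^ i * F is)"
  unfolding cform_def aform_def sign_const
  by (auto intro: in_vars_mult conv_const_mult alternating_map[where h = "\<lambda>x. mconst c * x" for c])

lemma cform_diff: "cform N q F \<Longrightarrow> cform N q H \<Longrightarrow> cform N q (\<lambda>is. F is - H is)"
  unfolding cform_def by (auto intro: aform_diff conv_diff)

text \<open>On a closed form the homotopy identity says that \<open>delta N\<close> of the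
  restriction to last tuple 0 is F up to the sign (-1)^N.\<close>

lemma rows_exact:
  assumes F: "cform (Suc N) q F" and 0: "\<And>is. delta (Suc N) (F is) = 0"
  obtains v where "cform N q v" "\<And>is. delta N (v is) = F is"
proof (rule that)
  have a: "aform (Suc N) q F" using F by (simp add: cform_def)
  have Z: "cform N q (\<lambda>is. Zero (Suc N) (F is))"
  proof -
    have "alternating (\<lambda>is. Zero (Suc N) (F is))"
      by (rule alternating_map_on[OF aformD(1)[OF a] aformD(3)[OF a]])
         (auto simp: Zero_def intro: msubst_uminus[OF zsub_dom])
    then show ?thesis using F aformD(2)[OF a] unfolding cform_def aform_def
      by (auto intro: Zero_last_vars conv_Zero)
  qed
  show "cform N q (\<lambda>is. (- 1) ^ N * Zero (Suc N) (F is))" by (rule cform_sign_mult[OF Z])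
  fix "is"
  have FV: "F is \<in> in_vars (V (Suc N))" by (rule aformD(3)[OF a])
  have "delta N (Zero (Suc N) (F is)) + (- 1) ^ Suc N * F is = 0"
    using Zero_delta[OF FV] 0[of "is"] by simp
  then have "delta N (Zero (Suc N) (F is)) = (- 1) ^ N * F is" by (simp add: eq_neg_iff_add_eq_0)
  then show "delta N ((- 1) ^ N * Zero (Suc N) (F is)) = F is"
    using delta_sign[OF Zero_last_vars[OF FV]] by (simp flip: mult.assoc power_mult_distrib)
qed

text \<open>Here \<open>delta 1 f\<close> is f(y) - f(G(x, y)); at y = 0 this gives f(x) =
  f(0).\<close>

lemma delta_0_const:
  assumes f: "f \<in> in_vars (V 1)" and 0: "delta 1 f = 0"
  shows "f = mconst (mcoeff f 0)"
proof -
  have "Zero (Suc 0) f \<in> in_vars (V 0)" using f by (intro Zero_last_vars) (simp flip: One_nat_def)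
  then have "Zero (Suc 0) f = mconst (mcoeff (Zero (Suc 0) f) 0)"
    by (intro mfps_eqI) (auto simp: in_vars_iff mcoeff_const atLeastAtMost_iff)
  then obtain a where a: "Zero (Suc 0) f = mconst a" by blast
  have "Zero (Suc (Suc 0)) (delta (Suc 0) f) = delta 0 (Zero (Suc 0) f) + (- 1) ^ Suc 0 * f"
    using f by (intro Zero_delta) (simp flip: One_nat_def)
  then have "f = mconst a" using 0 a by (simp add: delta_def flip: One_nat_def)
  then show ?thesis by (simp add: mcoeff_const)
qed

text \<open>A Lie cochain recorded by its values on lists of basis vectors, and zero on all other
  lists.\<close>

definition kform :: "nat \<Rightarrow> (nat list \<Rightarrow> 'k) \<Rightarrow> bool" where
  "kform q \<phi> \<longleftrightarrow> alternating \<phi> \<and> (\<forall>is. length is \<noteq> q \<or> \<not> set is \<subseteq> I \<longrightarrow> \<phi> is = 0)"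

lemma conv_const: "conv (mconst a)"
proof (rule convI[of "max 1 (absK a)"])
  fix b :: "'a \<Rightarrow>\<^sub>0 nat"
  have "absK (mcoeff (mconst a) b) \<le> max 1 (absK a)" by (auto simp: mcoeff_const)
  also have "\<dots> \<le> max 1 (absK a) ^ Suc (total_deg b)" by (rule self_le_power) auto
  finally show "absK (mcoeff (mconst a) b) \<le> max 1 (absK a) ^ Suc (total_deg b)" .
qed simp

lemma cform_const: "kform q \<phi> \<Longrightarrow> cform N q (\<lambda>is. mconst (\<phi> is))"
  unfolding cform_def aform_def kform_def
  by (auto simp: mconst_simps conv_const intro: alternating_map)

lemma D_mconst [simp]: "D N k (mconst a) = 0"
  by (simp add: D_def)

lemma dd_const: "dd N is (\<lambda>l. mconst (\<phi> l)) = mconst (dK is \<phi>)"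
  by (rule ce_diff_natural(1)[OF sc.trivial_ce_module[OF sc.module_times], where S = UNIV, symmetric])
     (auto simp: mconst_simps sscale_def module.subspace_UNIV[OF sc.module_times])

lemma md_not_I:
  assumes "f \<in> in_vars (V n)" "\<not> set js \<subseteq> I"
  shows "md js f = 0"
  using assms
proof (induction js arbitrary: f rule: rev_induct)
  case (snoc k js)
  show ?case
  proof (cases "k \<in> I")
    case True
    then have "\<not> set js \<subseteq> I" using snoc.prems(2) by simp
    then show ?thesis using snoc.IH[OF in_vars_mderiv[OF snoc.prems(1)]] by (simp add: md_append)
  next
    case False
    then show ?thesis by (simp add: md_append mderiv_not_I[OF snoc.prems(1)])
  qed
qed simp

lemma md_uminus: "md js (- f) = - md js f"
  using md_diff[of js 0 f] by simp

lemma PhiT_kform: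
  assumes F: "aform N q F"
  shows "kform (t + q) (PhiT t F)"
proof -
  have "alternating (hmd F)"
    unfolding hmd_def[abs_def]
    by (rule alternating_map[OF aformD(1)[OF F]]) (auto simp: md_uminus)
  then have "alternating ((sc.shift_index ^^ t) (hmd F))" by (rule sc.alternating_shift_index_pow)
  then have "alternating (PhiT t F)"
    unfolding PhiT_def[abs_def] by (rule alternating_map[where h = "\<lambda>\<phi>. \<phi> []"]) simp
  moreover have "PhiT t F is = 0" if "length is \<noteq> t + q \<or> \<not> set is \<subseteq> I" for "is"
    unfolding PhiT_def
  proof (rule sc.shift_index_pow_outside[where q = q])
    fix "is" js :: "nat list"
    assume "length is \<noteq> q \<or> \<not> set is \<subseteq> I \<or> \<not> set js \<subseteq> I"
    then show "hmd F is js = 0"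
      using aformD(2)[OF F] md_not_I[OF aformD(3)[OF F]] unfolding hmd_def by (metis md_0)
  qed (use that in \<open>auto simp: add.commute\<close>)
  ultimately show ?thesis by (simp add: kform_def)
qed

lemma PhiT_add: "PhiT t (\<lambda>is. F is + H is) is = PhiT t F is + PhiT t H is"
  unfolding PhiT_def hmd_def[abs_def] md_add by (rule sc.shift_index_pow_add)

lemma PhiT_const_mult: "PhiT t (\<lambda>is. mconst a * F is) is = a * PhiT t F is"
  unfolding PhiT_def hmd_def[abs_def] md_const_mult by (rule sc.shift_index_pow_scale)

lemma PhiT_0: "PhiT t (\<lambda>is. 0) is = 0"
  using PhiT_const_mult[of t 0 "\<lambda>is. 0" "is"] by simp

lemma PhiT_zero: "PhiT 0 F is = mcoeff (F is) 0"
  by (simp add: PhiT_def hmd_def)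

lemma kform_scale: "kform q \<phi> \<Longrightarrow> kform q (\<lambda>is. a * \<phi> is)"
  unfolding kform_def by (auto intro: alternating_map)

lemma kform_diff: "kform q \<phi> \<Longrightarrow> kform q \<psi> \<Longrightarrow> kform q (\<lambda>is. \<phi> is - \<psi> is)"
  unfolding kform_def by (auto intro: alternating_diff)

lemma kform_0: "kform q (\<lambda>is. 0)"
  unfolding kform_def by (auto intro: alternating_zero)

lemma PhiT_dd:
  assumes "cform (Suc t) q u"
  shows "PhiT t (\<lambda>is. dd (Suc t) is u) is =
    (- 1) ^ t * (dK is (PhiT t u) - PhiT (Suc t) (\<lambda>is. delta (Suc t) (u is)) is)"
proof -
  have "u is \<in> in_vars (V (Suc t))" for "is" using assms by (simp add: cform_def aform_def)
  from PhiT_chain_map[OF this, of "\<lambda>l. l" "is"]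
  have "(- 1) ^ t * PhiT t (\<lambda>is. dd (Suc t) is u) is =
     dK is (PhiT t u) - PhiT (Suc t) (\<lambda>is. delta (Suc t) (u is)) is" by (simp add: algebra_simps)
  then have "(- 1) ^ t * ((- 1) ^ t * PhiT t (\<lambda>is. dd (Suc t) is u) is) =
     (- 1) ^ t * (dK is (PhiT t u) - PhiT (Suc t) (\<lambda>is. delta (Suc t) (u is)) is)" by simp
  then show ?thesis by (simp flip: mult.assoc power_mult_distrib)
qed

text \<open>Write F = d u. Then \<delta> u is again a bicocycle, with one more group variable and
  form degree lower by one, and the chain map property gives it the image of F up to sign and the
  coboundary of \<open>PhiT t u\<close>. At form degree 0 one has arrived at a group cocycle. The
  scalar \<open>s\<close> collects the signs.\<close>

lemma chase_surjective:
  assumes "cform (Suc t) q F" "\<And>is. dd (Suc t) is F = 0" "\<And>is. delta (Suc t) (F is) = 0"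
  shows "\<exists>f \<rho> s. f \<in> in_vars (V (t + q)) \<and> conv f \<and> la_diff G (t + q) f = 0 \<and> kform (t + q - 1) \<rho> \<and>
    (\<forall>is. PhiT t F is = s * PhiT (t + q) (form0 f) is + dK is \<rho>)"
  using assms
proof (induction q arbitrary: t F)
  case 0
  have a: "aform (Suc t) 0 F" using 0 by (simp add: cform_def)
  have f: "F [] \<in> in_vars (V t)"
  proof (rule closed_0[OF aformD(3)[OF a]])
    fix k
    show "D (Suc t) k (F []) = 0" using 0(2)[of "[k]"] by simp
  qed
  have "la_diff G t (F []) = 0" using 0(3)[of "[]"] delta_constant_last[OF f] by simp
  moreover have "PhiT t F is = 1 * PhiT t (form0 (F [])) is + dK is (\<lambda>is. 0)" for "is"
    using aform_0_eq[OF a] by (simp add: sc.trivK.d_zero)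
  ultimately show ?case using f 0(1) kform_0 unfolding cform_def by (metis add_0_right)
next
  case (Suc q)
  have p1: "1 \<le> Suc t" by simp
  obtain u where u: "cform (Suc t) q u" "\<And>is. dd (Suc t) is u = F is"
    using poincare[OF p1 Suc.prems(1,2)] by blast
  have uV: "u is \<in> in_vars (V (Suc t))" for "is" using u(1) by (simp add: cform_def aform_def)
  let ?H = "\<lambda>is. delta (Suc t) (u is)"
  have H: "cform (Suc (Suc t)) q ?H" by (rule cform_delta[OF u(1)])
  have "dd (Suc (Suc t)) is ?H = 0" for "is"
    using dd_delta[OF p1, of u "is"] uV u(2) Suc.prems(3) by simp
  moreover have "delta (Suc (Suc t)) (?H is) = 0" for "is" by (rule delta_delta[OF uV])
  ultimately obtain f \<rho> s where f: "f \<in> in_vars (V (Suc t + q))" "conv f" "la_diff G (Suc t + q) f = 0"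
      "kform (Suc t + q - 1) \<rho>"
    and eq: "\<And>is. PhiT (Suc t) ?H is = s * PhiT (Suc t + q) (form0 f) is + dK is \<rho>"
    using Suc.IH[OF H] by blast
  let ?\<rho> = "\<lambda>is. (- 1) ^ t * (PhiT t u is - \<rho> is)"
  have "kform (t + q) (PhiT t u)" using u(1) by (intro PhiT_kform[of "Suc t"]) (simp add: cform_def)
  then have k: "kform (t + Suc q - 1) ?\<rho>" using f(4) by (intro kform_scale kform_diff) (auto simp: One_nat_def)
  have "PhiT t F is = (- ((- 1) ^ t) * s) * PhiT (t + Suc q) (form0 f) is + dK is ?\<rho>" for "is"
  proof -
    have e1: "PhiT t F is = (- 1) ^ t * (dK is (PhiT t u) - (s * PhiT (Suc t + q) (form0 f) is + dK is \<rho>))"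
      using PhiT_dd[OF u(1), of "is"] u(2) eq by simp
    have e2: "dK is ?\<rho> = (- 1) ^ t * (dK is (PhiT t u) - dK is \<rho>)"
      by (simp add: sc.trivK.d_scale sc.trivK.d_diff)
    have "z * (x - (s * y + w)) = (- z * s) * y + z * (x - w)" for x y z w :: 'k
      by (simp add: algebra_simps)
    then show ?thesis unfolding e1 e2 add_Suc_right add_Suc .
  qed
  then show ?case using f k by (intro exI[of _ f] exI[of _ ?\<rho>] exI[of _ "- ((- 1) ^ t) * s"]) simp
qed

text \<open>Induction moves a bicocycle \<open>F\<close> whose image under \<open>\<Phi>\<close> is a coboundary along its
  staircase to the Chevalley-Eilenberg edge; the case \<open>q = 0\<close> is the injectivity of \<open>\<Phi>\<close>.\<close>

lemma chase_injective:
  assumes "cform (Suc t) q F" "\<And>is. dd (Suc t) is F = 0" "\<And>is. delta (Suc t) (F is) = 0"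
    and "kform (t + q - 1) \<rho>" "\<And>is. PhiT t F is = dK is \<rho>" "t + q \<noteq> 0"
  shows "(q = 0 \<longrightarrow> (\<exists>g \<in> in_vars (V (t - 1)). conv g \<and> F [] = la_diff G (t - 1) g)) \<and>
    (\<forall>r. q = Suc r \<longrightarrow> (\<exists>w. cform (Suc t) r w \<and> (\<forall>is. dd (Suc t) is w = F is) \<and> (\<forall>is. delta (Suc t) (w is) = 0)))"
  using assms
proof (induction t arbitrary: q F \<rho>)
  case 0
  have a: "aform (Suc 0) q F" using 0 by (simp add: cform_def)
  \<comment> \<open>For t = 0 a \<delta>-closed form is constant and \<open>PhiT 0\<close> reads off
    the constant, so \<rho> itself, as a constant form, is the primitive.\<close>
  have "F is = dd (Suc 0) is (\<lambda>l. mconst (\<rho> l))" for "is"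
  proof -
    have "F is = mconst (mcoeff (F is) 0)"
      using aformD(3)[OF a, of "is"] 0(3)[of "is"] by (intro delta_0_const) (auto simp: One_nat_def)
    then show ?thesis using 0(5)[of "is"] by (simp add: PhiT_zero dd_const)
  qed
  moreover have "cform (Suc 0) (q - 1) (\<lambda>l. mconst (\<rho> l))" using 0(4) by (intro cform_const) simp
  moreover have "delta (Suc 0) (mconst x) = 0" for x by (simp add: delta_def)
  ultimately show ?case using 0(6) by (auto simp: One_nat_def)
next
  case (Suc t)
  have p1: "1 \<le> Suc t" by simp
  obtain v where v: "cform (Suc t) q v" "\<And>is. delta (Suc t) (v is) = F is"
    using rows_exact[OF Suc.prems(1,3)] by blast
  have vV: "v is \<in> in_vars (V (Suc t))" for "is" using v(1) by (simp add: cform_def aform_def)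
  interpret cd: ce_module I strc sscale "D (Suc t)" by (rule ce_D)
  let ?F = "\<lambda>is. dd (Suc t) is v"
  have F: "cform (Suc t) (Suc q) ?F" by (rule cform_dd[OF p1 v(1)])
  have d: "delta (Suc t) (?F is) = 0" for "is"
    using dd_delta[OF p1, of v "is"] vV v(2) Suc.prems(2) by simp
  let ?\<rho> = "\<lambda>is. (- 1) ^ t * (PhiT t v is - \<rho> is)"
  have "kform (t + q) (PhiT t v)" using v(1) by (intro PhiT_kform[of "Suc t"]) (simp add: cform_def)
  then have k: "kform (t + Suc q - 1) ?\<rho>" using Suc.prems(4) by (intro kform_scale kform_diff) (auto simp: One_nat_def)
  have e: "PhiT t ?F is = dK is ?\<rho>" for "is"
    using PhiT_dd[OF v(1), of "is"] v(2) Suc.prems(5) by (simp add: sc.trivK.d_scale sc.trivK.d_diff)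
  \<comment> \<open>The form d v has one group variable fewer, and its image is a coboundary as
    well. By induction it has a \<delta>-closed primitive w, so that v - w is d-closed with \<delta>
    (v - w) = F.\<close>
  obtain w where w: "cform (Suc t) q w" "\<And>is. dd (Suc t) is w = dd (Suc t) is v" "\<And>is. delta (Suc t) (w is) = 0"
    using Suc.IH[OF F cd.d_d d k e] by auto
  let ?y = "\<lambda>is. v is - w is"
  have y: "cform (Suc t) q ?y" by (rule cform_diff[OF v(1) w(1)])
  have wV: "w is \<in> in_vars (V (Suc t))" for "is" using w(1) by (simp add: cform_def aform_def)
  have dy: "dd (Suc t) is ?y = 0" for "is" by (simp add: cd.d_diff w(2))
  have Fy: "delta (Suc t) (?y is) = F is" for "is" by (simp add: delta_diff[OF vV wV] v(2) w(3))
  show ?case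
  proof (intro conjI impI allI)
    assume q: "q = 0"
    \<comment> \<open>A d-closed function is constant in its last tuple, so v - w is a group cochain
      in t variables with coboundary F.\<close>
    have g: "?y [] \<in> in_vars (V t)"
    proof (rule closed_0)
      show "?y [] \<in> in_vars (V (Suc t))" by (rule in_vars_diff[OF vV wV])
      show "D (Suc t) k (?y []) = 0" for k using dy[of "[k]"] by simp
    qed
    have "conv (?y [])" using y by (simp add: cform_def)
    moreover have "F [] = la_diff G t (?y [])" using Fy[of "[]"] delta_constant_last[OF g] by simp
    ultimately show "\<exists>g \<in> in_vars (V (Suc t - 1)). conv g \<and> F [] = la_diff G (Suc t - 1) g"
      using g by (intro bexI[of _ "?y []"]) (auto simp: One_nat_def)
  next
    fix r assume q: "q = Suc r"
    obtain z where z: "cform (Suc t) r z" "\<And>is. dd (Suc t) is z = ?y is"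
      using poincare[OF p1 y[unfolded q] dy] by blast
    have zV: "z is \<in> in_vars (V (Suc t))" for "is" using z(1) by (simp add: cform_def aform_def)
    \<comment> \<open>Since v - w = d z, the form \<delta> z is mapped by d to \<delta> (v - w) = F,
      and it is \<delta>-closed.\<close>
    let ?w = "\<lambda>is. delta (Suc t) (z is)"
    have "cform (Suc (Suc t)) r ?w" by (rule cform_delta[OF z(1)])
    moreover have "dd (Suc (Suc t)) is ?w = F is" for "is"
      using dd_delta[OF p1, of z "is"] zV z(2) Fy by simp
    moreover have "delta (Suc (Suc t)) (?w is) = 0" for "is" by (rule delta_delta[OF zV])
    ultimately show "\<exists>w. cform (Suc (Suc t)) r w \<and> (\<forall>is. dd (Suc (Suc t)) is w = F is) \<and>
        (\<forall>is. delta (Suc (Suc t)) (w is) = 0)" by blast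
  qed
qed

text \<open>The extended map on the edge of 0-forms: f is regarded as constant in one additional
  tuple, and \<open>Pb n f\<close> lists the values of \<Phi>(f) on basis vectors.\<close>

definition Pb :: "nat \<Rightarrow> 'k series \<Rightarrow> nat list \<Rightarrow> 'k" where
  "Pb n f = PhiT n (form0 f)"

lemma Pb_kform: "f \<in> in_vars (V n) \<Longrightarrow> kform n (Pb n f)"
  using PhiT_kform[OF aform_form0, of f n n] by (simp add: Pb_def)

lemma Pb_add: "Pb n (f + g) is = Pb n f is + Pb n g is"
proof -
  have "form0 (f + g) = (\<lambda>is. form0 f is + form0 g is)" by (auto simp: form0_def)
  then show ?thesis unfolding Pb_def by (simp only: PhiT_add)
qed

lemma Pb_const_mult: "Pb n (mconst a * f) is = a * Pb n f is"
proof -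
  have "form0 (mconst a * f) = (\<lambda>is. mconst a * form0 f is)" by (auto simp: form0_def)
  then show ?thesis unfolding Pb_def by (simp only: PhiT_const_mult)
qed

lemma form0_closed:
  assumes f: "f \<in> in_vars (V n)"
  shows "dd (Suc n) is (form0 f) = 0"
proof (cases "\<exists>k. is = [k]")
  case True
  then obtain k where "is = [k]" by blast
  then show ?thesis using D_constant_last[OF f] by (simp add: form0_def)
next
  case False
  have "aform (Suc n) (Suc 0) (\<lambda>is. dd (Suc n) is (form0 f))"
    using in_V_mono[OF f] by (intro aform_dd aform_form0) auto
  from aformD(2)[OF this, of "is"] False show ?thesis by (auto simp: length_Suc_conv)
qed

lemma delta_form0: "f \<in> in_vars (V n) \<Longrightarrow> delta (Suc n) (form0 f is) = form0 (la_diff G n f) is"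
  by (cases "is = []") (simp_all add: form0_def delta_constant_last)

lemma Pb_chain_map:
  assumes f: "f \<in> in_vars (V n)"
  shows "Pb (Suc n) (la_diff G n f) is = dK is (Pb n f)"
proof -
  have v: "form0 f is \<in> in_vars (V (Suc n))" for "is"
    using in_V_mono[OF f, of "Suc n"] by (simp add: form0_def)
  have "(\<lambda>is. delta (Suc n) (form0 f is)) = form0 (la_diff G n f)"
    using delta_form0[OF f] by (rule ext)
  moreover have "(\<lambda>is. dd (Suc n) is (form0 f)) = (\<lambda>is. 0)"
    using form0_closed[OF f] by (rule ext)
  ultimately show ?thesis
    using PhiT_chain_map[OF v, of "\<lambda>l. l" "is"] by (simp add: PhiT_0 Pb_def)
qed

theorem Pb_injective:
  assumes f: "f \<in> in_vars (V (Suc n))" "conv f" "la_diff G (Suc n) f = 0"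
    and \<rho>: "kform n \<rho>" "\<And>is. Pb (Suc n) f is = dK is \<rho>"
  obtains g where "g \<in> in_vars (V n)" "conv g" "f = la_diff G n g"
proof -
  have F: "cform (Suc (Suc n)) 0 (form0 f)"
    using aform_form0[OF in_V_mono[OF f(1)]] f(2) by (auto simp: cform_def form0_def)
  have "delta (Suc (Suc n)) (form0 f is) = 0" for "is"
    using delta_form0[OF f(1)] f(3) by (simp add: form0_def)
  from chase_injective[OF F form0_closed[OF f(1)] this, of \<rho>] \<rho>
  obtain g where "g \<in> in_vars (V n)" "conv g" "form0 f [] = la_diff G n g"
    by (auto simp: Pb_def One_nat_def)
  then show thesis using that by (simp add: form0_def)
qed

text \<open>The chase starts from \<omega> as a form with constant coefficients and no group
  variables, where the extended map is the identity; the scalar of the chase is absorbed into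
  f.\<close>

theorem Pb_surjective:
  assumes \<omega>: "kform n \<omega>" "\<And>is. dK is \<omega> = 0"
  obtains f \<rho> where "f \<in> in_vars (V n)" "conv f" "la_diff G n f = 0" "kform (n - 1) \<rho>"
    "\<And>is. \<omega> is = Pb n f is + dK is \<rho>"
proof -
  let ?F = "\<lambda>is. mconst (\<omega> is)"
  have 1: "cform (Suc 0) n ?F" by (rule cform_const[OF \<omega>(1)])
  have 2: "dd (Suc 0) is ?F = 0" for "is" by (simp add: dd_const \<omega>(2) mconst_simps)
  have 3: "delta (Suc 0) (?F is) = 0" for "is" by (simp add: delta_def)
  obtain f \<rho> s where f: "f \<in> in_vars (V n)" "conv f" "la_diff G n f = 0" "kform (n - 1) \<rho>"
    and eq: "\<And>is. PhiT 0 ?F is = s * Pb n f is + dK is \<rho>"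
    using chase_surjective[OF 1 2 3] by (auto simp: Pb_def)
  show thesis
  proof (rule that[of "mconst s * f" \<rho>])
    show "mconst s * f \<in> in_vars (V n)" using f by (intro in_vars_mult) auto
    show "conv (mconst s * f)" using f by (intro conv_const_mult)
    show "la_diff G n (mconst s * f) = 0"
      using f delta_const_mult[of f "Suc n" s] in_V_mono[OF f(1), of "Suc n"]
        delta_constant_last[OF f(1)] delta_constant_last[of "mconst s * f" n]
      by (simp add: in_vars_mult)
    show "kform (n - 1) \<rho>" by fact
    show "\<omega> is = Pb n (mconst s * f) is + dK is \<rho>" for "is"
      using eq[of "is"] by (simp add: PhiT_zero mcoeff_const Pb_const_mult)
  qed
qed

end

section \<open>The antisymmetrised mixed derivatives\<close>

definition antisymmetrize :: "(nat list \<Rightarrow> 'a::comm_ring_1) \<Rightarrow> nat list \<Rightarrow> 'a" where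
  "antisymmetrize g is = (\<Sum>\<alpha> | \<alpha> permutes {..<length is}.
     of_int (sign \<alpha>) * g (map (\<lambda>k. is ! \<alpha> k) [0..<length is]))"

text \<open>Every permutation of {0..n} is the transposition of 0 with its image b of 0, composed
  with a permutation fixing 0, which is a shifted permutation of {0..<n}.\<close>

lemma sum_permutes_Suc:
  fixes f :: "(nat \<Rightarrow> nat) \<Rightarrow> 'a::comm_monoid_add"
  shows "(\<Sum>\<alpha> | \<alpha> permutes {..<Suc n}. f \<alpha>) =
    (\<Sum>b<Suc n. \<Sum>\<beta> | \<beta> permutes {..<n}. f (Transposition.transpose 0 b \<circ> map_permutation {..<n} Suc \<beta>))"
proof -
  let ?S = "Suc ` {..<n}"
  have S: "{..<Suc n} = insert 0 ?S" by (auto simp: image_iff less_Suc_eq_0_disj)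
  let ?u = "map_permutation {..<n} Suc" and ?d = "map_permutation ?S (\<lambda>x. x - Suc 0)"
  have bij: "bij_betw Suc {..<n} ?S" "bij_betw (\<lambda>x. x - Suc 0) ?S {..<n}"
    by (auto simp: bij_betw_def inj_on_def image_image)
  have "(\<Sum>\<beta> | \<beta> permutes ?S. f (Transposition.transpose 0 b \<circ> \<beta>)) =
      (\<Sum>\<beta> | \<beta> permutes {..<n}. f (Transposition.transpose 0 b \<circ> ?u \<beta>))" for b
  proof (rule sum.reindex_bij_witness[where i = ?u and j = ?d])
    fix \<beta> assume "\<beta> \<in> {\<beta>. \<beta> permutes ?S}"
    then have \<beta>: "\<beta> permutes ?S" by simp
    show "?u (?d \<beta>) = \<beta>" by (rule map_permutation_compose_inv[OF bij(2) \<beta>]) auto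
    then show "f (Transposition.transpose 0 b \<circ> ?u (?d \<beta>)) = f (Transposition.transpose 0 b \<circ> \<beta>)" by simp
    show "?d \<beta> \<in> {\<beta>. \<beta> permutes {..<n}}" using map_permutation_permutes[OF bij(2) \<beta>] by simp
  next
    fix \<beta> assume "\<beta> \<in> {\<beta>. \<beta> permutes {..<n}}"
    then have \<beta>: "\<beta> permutes {..<n}" by simp
    show "?d (?u \<beta>) = \<beta>" by (rule map_permutation_compose_inv[OF bij(1) \<beta>]) auto
    show "?u \<beta> \<in> {\<beta>. \<beta> permutes ?S}" using map_permutation_permutes[OF bij(1) \<beta>] by simp
  qed
  then show ?thesis
    unfolding S by (subst sum_over_permutations_insert) auto
qed

text \<open>Expansion along the first argument: entry b trades places with entry 0, and the
  remaining entries are antisymmetrised.\<close>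

lemma antisymmetrize_expand:
  assumes "length is = Suc n"
  shows "antisymmetrize g is = (\<Sum>b<Suc n. of_int (sign (Transposition.transpose 0 b)) *
    antisymmetrize (\<lambda>l. g (is ! b # l)) (tl (is[0 := is ! b, b := is ! 0])))"
proof -
  have "of_int (sign (Transposition.transpose 0 b \<circ> map_permutation {..<n} Suc \<beta>)) *
      g (map (\<lambda>k. is ! (Transposition.transpose 0 b \<circ> map_permutation {..<n} Suc \<beta>) k) [0..<Suc n]) =
    of_int (sign (Transposition.transpose 0 b)) * (of_int (sign \<beta>) *
      g (is ! b # map (\<lambda>k. tl (is[0 := is ! b, b := is ! 0]) ! \<beta> k) [0..<n]))"
    if b: "b < Suc n" and \<beta>: "\<beta> permutes {..<n}" for b \<beta>
  proof -
    let ?q = "map_permutation {..<n} Suc \<beta>"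
    have bij: "bij_betw Suc {..<n} (Suc ` {..<n})" by (auto simp: bij_betw_def)
    have q: "?q permutes Suc ` {..<n}" by (rule map_permutation_permutes[OF bij \<beta>])
    have q0: "?q 0 = 0" using q by (rule permutes_not_in) auto
    have qS: "?q (Suc k) = Suc (\<beta> k)" if "k < n" for k
      using that by (intro map_permutation_apply) auto
    have s: "sign (Transposition.transpose 0 b \<circ> ?q) = sign (Transposition.transpose 0 b) * sign \<beta>"
    proof -
      have "permutation ?q" using q permutation_permutes by blast
      moreover have "sign ?q = sign \<beta>" using \<beta> by (intro sign_map_permutation) auto
      ultimately show ?thesis by (simp add: sign_compose permutation_swap_id)
    qed
    have "is ! Transposition.transpose 0 b (Suc (\<beta> k)) = tl (is[0 := is ! b, b := is ! 0]) ! \<beta> k" if "k < n" for k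
    proof -
      have "\<beta> k < n" using permutes_in_image[OF \<beta>, of k] that by simp
      then show ?thesis using assms b by (auto simp: transpose_def nth_tl nth_list_update)
    qed
    then have "map (\<lambda>k. is ! (Transposition.transpose 0 b \<circ> ?q) k) [0..<Suc n] =
        is ! b # map (\<lambda>k. tl (is[0 := is ! b, b := is ! 0]) ! \<beta> k) [0..<n]"
      by (auto simp: q0 qS map_upt_Suc simp del: upt_Suc intro!: map_cong)
    then show ?thesis by (simp add: s mult.assoc)
  qed
  then show ?thesis
    unfolding antisymmetrize_def using assms
    by (simp add: sum_permutes_Suc sum_distrib_left del: sum.lessThan_Suc upt_Suc)
qed

lemma alternating_move_front:
  assumes "alternating F"
  shows "F (ys @ x # zs) = (- 1) ^ length ys * (F (x # ys @ zs) :: 'a::comm_ring_1)"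
  using assms
proof (induction ys arbitrary: F)
  case (Cons y ys)
  have "F (y # ys @ x # zs) = (- 1) ^ length ys * F (y # x # ys @ zs)"
    using Cons.IH[OF alternating_contract[OF Cons.prems], of y] by simp
  also have "F (y # x # ys @ zs) = - F (x # y # ys @ zs)" by (rule alternating_swap[OF Cons.prems])
  finally show ?case by simp
qed simp

context structure_constants
begin

lemma shift_index_formula:
  "shift_index h is js = (\<Sum>r<length is. (- 1) ^ r * h (take r is @ drop (Suc r) is) (js @ [is ! r]))"
proof (induction "is" arbitrary: h)
  case (Cons k "is")
  then show ?case
    by (simp add: shift_index_Cons sum.lessThan_Suc_shift sum_negf del: sum.lessThan_Suc)
qed (simp add: shift_index_Nil)

text \<open>The shifts, starting from a function concentrated on the empty list of form indices,
  extract one entry at a time with its position sign. This is the expansion of the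
  antisymmetrisation, except that entries are removed in place rather than swapped.\<close>

lemma shift_index_pow_antisymmetrize:
  fixes g :: "nat list \<Rightarrow> 'k"
  assumes "length is = n"
  shows "(shift_index ^^ n) (\<lambda>is js. if is = [] then g js else 0) is js = antisymmetrize (\<lambda>l. g (js @ l)) is"
  using assms
proof (induction n arbitrary: g "is" js)
  case 0
  then show ?case by (simp add: antisymmetrize_def)
next
  case (Suc n)
  let ?h = "\<lambda>g is js. if is = [] then g js else 0"
  have alt: "alternating (\<lambda>is. (shift_index ^^ n) (?h g) is js)" for g js
  proof -
    have "alternating (?h g)" by (auto simp: alternating_def fun_eq_iff)
    then have "alternating ((shift_index ^^ n) (?h g))" by (rule alternating_shift_index_pow)
    then show ?thesis by (rule alternating_map[where h = "\<lambda>\<phi>. \<phi> js"]) simp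
  qed
  have "(shift_index ^^ Suc n) (?h g) is js =
    (\<Sum>r<Suc n. (- 1) ^ r * (shift_index ^^ n) (?h g) (take r is @ drop (Suc r) is) (js @ [is ! r]))"
    using Suc.prems by (simp add: shift_index_formula del: sum.lessThan_Suc)
  also have "\<dots> = (\<Sum>r<Suc n. of_int (sign (Transposition.transpose 0 r)) *
      antisymmetrize (\<lambda>l. g (js @ is ! r # l)) (tl (is[0 := is ! r, r := is ! 0])))"
  proof (rule sum.cong[OF refl])
    fix r assume "r \<in> {..<Suc n}"
    then have r: "r < Suc n" by simp
    obtain x xs where isx: "is = x # xs" "length xs = n" using Suc.prems by (cases "is") auto
    show "(- 1) ^ r * (shift_index ^^ n) (?h g) (take r is @ drop (Suc r) is) (js @ [is ! r]) =
      of_int (sign (Transposition.transpose 0 r)) * antisymmetrize (\<lambda>l. g (js @ is ! r # l)) (tl (is[0 := is ! r, r := is ! 0]))"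
    proof (cases r)
      case 0
      then show ?thesis using Suc.IH[of xs g "js @ [x]"] isx by simp
    next
      case (Suc s)
      \<comment> \<open>Swapping puts the first entry at position s of the rest, while removal in
        place keeps it in front. Moving it costs (-1)^s, and the sign -1 of the transposition
        completes this to (-1)^r.\<close>
      let ?js = "js @ [is ! r]"
      have s: "s < n" using r Suc by simp
      have tl: "tl (is[0 := is ! r, r := is ! 0]) = take s xs @ x # drop (Suc s) xs"
        using s isx by (simp add: Suc upd_conv_take_nth_drop)
      have len: "length (take s xs @ x # drop (Suc s) xs) = n" using s isx by simp
      have "antisymmetrize (\<lambda>l. g (js @ is ! r # l)) (take s xs @ x # drop (Suc s) xs) =
          (shift_index ^^ n) (?h g) (take s xs @ x # drop (Suc s) xs) ?js"
        using Suc.IH[OF len, of g ?js] by simp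
      also have "\<dots> = (- 1) ^ s * (shift_index ^^ n) (?h g) (x # take s xs @ drop (Suc s) xs) ?js"
        using alternating_move_front[OF alt[of g ?js], of "take s xs" x "drop (Suc s) xs"] s isx by simp
      finally show ?thesis
        unfolding tl using Suc isx
        by (simp add: sign_swap_id)
    qed
  qed
  also have "\<dots> = antisymmetrize (\<lambda>l. g (js @ l)) is"
    using antisymmetrize_expand[OF Suc.prems, of "\<lambda>l. g (js @ l)"] by (simp del: sum.lessThan_Suc)
  finally show ?case .
qed

end

context analytic_fgl
begin

declare One_nat_def [simp del] atLeastAtMost_iff [simp del] sc.trivK.scale_scale [simp del]

lemma Phi_basis_eq: "length is = n \<Longrightarrow> Phi_basis f is = Pb n f is"
proof -
  assume n: "length is = n"
  have "hmd (form0 f) = (\<lambda>is js. if is = [] then md js f else 0)"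
    by (auto simp: hmd_def form0_def fun_eq_iff)
  then have "Pb n f is = antisymmetrize (\<lambda>js. md js f) is"
    using sc.shift_index_pow_antisymmetrize[OF n, of "\<lambda>js. md js f" "[]"] by (simp add: Pb_def PhiT_def)
  then show ?thesis by (simp add: Phi_basis_def antisymmetrize_def)
qed

section \<open>Multilinear extension\<close>

fun ext :: "(nat list \<Rightarrow> 'k) \<Rightarrow> (nat \<Rightarrow> 'k) list \<Rightarrow> 'k" where
  "ext \<phi> [] = \<phi> []"
| "ext \<phi> (x # xs) = (\<Sum>i\<in>I. x i * ext (\<lambda>l. \<phi> (i # l)) xs)"

lemma ext_add: "ext (\<lambda>l. \<phi> l + \<psi> l) xs = ext \<phi> xs + ext \<psi> xs"
  by (induction xs arbitrary: \<phi> \<psi>) (auto simp: distrib_left sum.distrib)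

lemma ext_scale: "ext (\<lambda>l. a * \<phi> l) xs = a * ext \<phi> xs"
  by (induction xs arbitrary: \<phi>) (auto simp: sum_distrib_left mult.left_commute)

lemma ext_zero: "ext (\<lambda>l. 0) xs = 0"
  by (induction xs) auto

lemma ext_uminus: "ext (\<lambda>l. - \<phi> l) xs = - ext \<phi> xs"
  using ext_scale[of "- 1" \<phi> xs] by simp

lemma ext_diff: "ext (\<lambda>l. \<phi> l - \<psi> l) xs = ext \<phi> xs - ext \<psi> xs"
  using ext_add[of \<phi> "\<lambda>l. - \<psi> l" xs] ext_uminus[of \<psi> xs] by simp

lemma ext_sum: "ext (\<lambda>l. \<Sum>a\<in>A. \<phi> a l) xs = (\<Sum>a\<in>A. ext (\<phi> a) xs)"
  by (induction A rule: infinite_finite_induct) (auto simp: ext_add ext_zero)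

lemma ext_expand:
  "ext \<phi> xs = (\<Sum>is | length is = length xs \<and> set is \<subseteq> I. (\<Prod>k<length xs. (xs ! k) (is ! k)) * \<phi> is)"
proof (induction xs arbitrary: \<phi>)
  case Nil
  have "{is. length is = length ([] :: (nat \<Rightarrow> 'k) list) \<and> set is \<subseteq> I} = {[]}" by auto
  then show ?case by simp
next
  case (Cons x xs)
  let ?S = "{is. length is = length xs \<and> set is \<subseteq> I}"
  have S: "{is. length is = length (x # xs) \<and> set is \<subseteq> I} = (\<lambda>(i, l). i # l) ` (I \<times> ?S)"
    by (auto simp: length_Suc_conv image_iff)
  have "(\<Sum>is | length is = length (x # xs) \<and> set is \<subseteq> I. (\<Prod>k<length (x # xs). ((x # xs) ! k) (is ! k)) * \<phi> is) =
    (\<Sum>(i, l)\<in>I \<times> ?S. x i * ((\<Prod>k<length xs. (xs ! k) (l ! k)) * \<phi> (i # l)))"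
    unfolding S
    by (subst sum.reindex)
       (auto simp: inj_on_def prod.lessThan_Suc_shift mult.assoc simp del: prod.lessThan_Suc intro!: sum.cong)
  also have "\<dots> = (\<Sum>i\<in>I. x i * ext (\<lambda>l. \<phi> (i # l)) xs)"
    by (simp add: Cons.IH sum_distrib_left sum.cartesian_product)
  finally show ?case by simp
qed

text \<open>Zero off the admissible tuples, in accordance with the normalisation of
  \<open>alt_forms\<close>; this makes \<open>Ex n\<close> a bijection from \<open>kform n\<close>
  onto \<open>alt_forms absK m n\<close>.\<close>

definition Ex :: "nat \<Rightarrow> (nat list \<Rightarrow> 'k) \<Rightarrow> (nat \<Rightarrow> 'k) list \<Rightarrow> 'k" where
  "Ex n \<phi> xs = (if xs \<in> lie_tuples absK m n then ext \<phi> xs else 0)"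

lemma Phi_eq_Ex: "Phi absK m n f = Ex n (Pb n f)"
proof
  fix xs
  have "(\<Sum>is | length is = n \<and> set is \<subseteq> I. (\<Prod>k<n. (xs ! k) (is ! k)) * Phi_basis f is) = ext (Pb n f) xs"
    if "length xs = n"
    unfolding ext_expand that by (rule sum.cong) (auto simp: Phi_basis_eq)
  then show "Phi absK m n f xs = Ex n (Pb n f) xs"
    by (auto simp: Phi_def Ex_def lie_tuples_def)
qed

lemma ext_append_add: "ext \<phi> (xs @ (x + y) # ys) = ext \<phi> (xs @ x # ys) + ext \<phi> (xs @ y # ys)"
  by (induction xs arbitrary: \<phi>) (auto simp: distrib_left distrib_right sum.distrib)

lemma ext_append_scale: "ext \<phi> (xs @ (\<lambda>j. a * x j) # ys) = a * ext \<phi> (xs @ x # ys)"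
  by (induction xs arbitrary: \<phi>) (auto simp: sum_distrib_left mult.left_commute mult.assoc)

lemma alternating_ext:
  assumes "alternating \<phi>"
  shows "alternating (ext \<phi>)"
  unfolding alternating_def
proof (intro allI)
  fix ys :: "(nat \<Rightarrow> 'k) list" and x y zs
  show "ext \<phi> (ys @ x # y # zs) = - ext \<phi> (ys @ y # x # zs)"
    using assms
  proof (induction ys arbitrary: \<phi>)
    case Nil
    have e: "(\<lambda>l. \<phi> (i # j # l)) = (\<lambda>l. - \<phi> (j # i # l))" for i j
      using alternating_swap[OF Nil] by blast
    have e': "ext (\<lambda>l. \<phi> (i # j # l)) zs = - ext (\<lambda>l. \<phi> (j # i # l)) zs" for i j
      using arg_cong[OF e[of i j], of "\<lambda>F. ext F zs"] by (simp only: ext_uminus)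
    have "ext \<phi> (x # y # zs) = (\<Sum>i\<in>I. \<Sum>j\<in>I. x i * (y j * ext (\<lambda>l. \<phi> (i # j # l)) zs))"
      by (simp only: ext.simps sum_distrib_left)
    also have "\<dots> = (\<Sum>i\<in>I. \<Sum>j\<in>I. x i * (y j * - ext (\<lambda>l. \<phi> (j # i # l)) zs))"
      by (intro sum.cong refl arg_cong2[of _ _ _ _ "(*)"] e')
    also have "\<dots> = - ext \<phi> (y # x # zs)"
      by (subst sum.swap) (simp add: sum_negf sum_distrib_left mult.left_commute)
    finally show ?case by simp
  next
    case (Cons z ys)
    then show ?case by (simp add: alternating_contract sum_negf)
  qed
qed

text \<open>Moving the second occurrence next to the first costs only a sign; swapping the equal
  neighbours then gives F = - F, and 2 is invertible in characteristic 0.\<close>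

lemma alternating_not_distinct:
  fixes F :: "'b list \<Rightarrow> 'k"
  assumes "alternating F" "\<not> distinct xs"
  shows "F xs = 0"
proof -
  obtain as bs cs x where xs: "xs = as @ [x] @ bs @ [x] @ cs" using assms(2) not_distinct_decomp by blast
  have dup: "F (as @ x # x # zs) = 0" for zs
  proof -
    have "F (as @ x # x # zs) = - F (as @ x # x # zs)" by (rule alternatingD[OF assms(1)])
    then have "2 * F (as @ x # x # zs) = 0" by (metis add.right_inverse mult_2)
    then show ?thesis by simp
  qed
  have "alternating (\<lambda>l. F (as @ x # l))"
    using assms(1) unfolding alternating_def by (metis append_Cons append_assoc)
  from alternating_move_front[OF this, of bs x cs] show ?thesis by (simp add: xs dup)
qed

lemma carrier_iff: "x \<in> lie_carrier absK m \<longleftrightarrow> (\<forall>j\<in>I. absK (x j) \<le> 1) \<and> (\<forall>j. j \<notin> I \<longrightarrow> x j = 0)"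
  by (simp add: lie_carrier_def val_ring_def)

lemma carrier_add: "x \<in> lie_carrier absK m \<Longrightarrow> y \<in> lie_carrier absK m \<Longrightarrow> x + y \<in> lie_carrier absK m"
  by (auto simp: carrier_iff intro: abs_add_le)

lemma carrier_scale: "a \<in> val_ring absK \<Longrightarrow> x \<in> lie_carrier absK m \<Longrightarrow> (\<lambda>j. a * x j) \<in> lie_carrier absK m"
  by (auto simp: carrier_iff val_ring_def abs_mult intro: mult_le_one)

lemma lie_bracket_eq:
  "lie_bracket m G x y = (\<lambda>j. \<Sum>l\<in>I. \<Sum>k\<in>I. x l * y k * strc j l k)"
  by (rule ext) (auto simp: lie_bracket_def strc_def intro!: sum.cong)

lemma carrier_bracket:
  assumes "x \<in> lie_carrier absK m" "y \<in> lie_carrier absK m"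
  shows "lie_bracket m G x y \<in> lie_carrier absK m"
proof -
  have "absK (\<Sum>l\<in>I. \<Sum>k\<in>I. x l * y k * strc j l k) \<le> 1" for j
    using assms abs_strc by (auto intro!: abs_sum_le mult_le_one simp: abs_mult carrier_iff)
  moreover have "(\<Sum>l\<in>I. \<Sum>k\<in>I. x l * y k * strc j l k) = 0" if "j \<notin> I" for j
    using that by (simp add: strc_def)
  ultimately show ?thesis unfolding lie_bracket_eq carrier_iff by blast
qed

definition bvec :: "nat \<Rightarrow> nat \<Rightarrow> 'k" where
  "bvec i = (\<lambda>j. if j = i then 1 else 0)"

lemma bvec_carrier: "i \<in> I \<Longrightarrow> bvec i \<in> lie_carrier absK m"
  by (auto simp: carrier_iff bvec_def)

lemma ext_bvec: "set is \<subseteq> I \<Longrightarrow> ext \<phi> (map bvec is) = \<phi> is"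
proof (induction "is" arbitrary: \<phi>)
  case (Cons i "is")
  have "bvec i j * ext (\<lambda>l. \<phi> (j # l)) (map bvec is) = (if j = i then \<phi> (i # is) else 0)" for j
    using Cons.prems by (simp add: Cons.IH bvec_def[of i])
  then have "ext \<phi> (map bvec (i # is)) = (\<Sum>j\<in>I. if j = i then \<phi> (i # is) else 0)"
    by simp
  then show ?case using Cons.prems by simp
qed simp

lemma bvec_tuples: "length is = n \<Longrightarrow> set is \<subseteq> I \<Longrightarrow> map bvec is \<in> lie_tuples absK m n"
  using bvec_carrier by (auto simp: lie_tuples_def)

lemma Ex_inject:
  assumes "kform n \<phi>" "kform n \<psi>" "Ex n \<phi> = Ex n \<psi>"
  shows "\<phi> = \<psi>"
proof (rule HOL.ext)
  fix "is"
  show "\<phi> is = \<psi> is"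
  proof (cases "length is = n \<and> set is \<subseteq> I")
    case True
    then have "Ex n \<phi> (map bvec is) = Ex n \<psi> (map bvec is)" using assms(3) by simp
    then show ?thesis using True by (simp add: Ex_def bvec_tuples ext_bvec)
  next
    case False
    then show ?thesis using assms(1,2) unfolding kform_def by metis
  qed
qed

lemma Ex_add: "Ex n \<phi> + Ex n \<psi> = Ex n (\<lambda>l. \<phi> l + \<psi> l)"
  by (auto simp: Ex_def ext_add)

lemma Ex_diff: "Ex n \<phi> - Ex n \<psi> = Ex n (\<lambda>l. \<phi> l - \<psi> l)"
  by (auto simp: Ex_def ext_diff)

lemma Ex_scale: "(\<lambda>xs. a * Ex n \<phi> xs) = Ex n (\<lambda>l. a * \<phi> l)"
  by (auto simp: Ex_def ext_scale)

lemma Ex_zero: "Ex n (\<lambda>l. 0) = 0"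
  by (auto simp: Ex_def ext_zero)

lemma Ex_alt_form:
  assumes "kform n \<phi>"
  shows "Ex n \<phi> \<in> alt_forms absK m n"
proof -
  have alt: "alternating (ext \<phi>)" using assms by (intro alternating_ext) (simp add: kform_def)
  have t: "xs @ z # ys \<in> lie_tuples absK m n" if "xs @ x # ys \<in> lie_tuples absK m n" "z \<in> lie_carrier absK m" for xs ys x z
    using that by (auto simp: lie_tuples_def)
  have xc: "x \<in> lie_carrier absK m" if "xs @ x # ys \<in> lie_tuples absK m n" for xs ys x
    using that by (auto simp: lie_tuples_def)
  show ?thesis
    unfolding alt_forms_def
  proof (intro CollectI conjI allI impI ballI)
    fix xs ys x y
    assume a: "xs @ x # ys \<in> lie_tuples absK m n \<and> y \<in> lie_carrier absK m"
    then show "Ex n \<phi> (xs @ (x + y) # ys) = Ex n \<phi> (xs @ x # ys) + Ex n \<phi> (xs @ y # ys)"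
      using t[of xs x ys] carrier_add[OF xc[of xs x ys]] by (simp add: Ex_def ext_append_add)
  next
    fix xs ys x a assume "a \<in> val_ring absK" "xs @ x # ys \<in> lie_tuples absK m n"
    then show "Ex n \<phi> (xs @ (\<lambda>j. a * x j) # ys) = a * Ex n \<phi> (xs @ x # ys)"
      using t[of xs x ys] carrier_scale[OF _ xc[of xs x ys]] by (simp add: Ex_def ext_append_scale)
  next
    fix xs assume "xs \<in> lie_tuples absK m n" "\<not> distinct xs"
    then show "Ex n \<phi> xs = 0" using alternating_not_distinct[OF alt] by (simp add: Ex_def)
  qed (simp add: Ex_def)
qed

text \<open>Take \<phi> to be the values of \<omega> on basis vectors. Vanishing on repeated
  arguments gives the sign change under swaps, and multilinearity recovers \<omega> one argument at
  a time.\<close>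

lemma alt_form_Ex:
  assumes \<omega>: "\<omega> \<in> alt_forms absK m n"
  obtains \<phi> where "kform n \<phi>" "\<omega> = Ex n \<phi>"
proof -
  define \<phi> where "\<phi> is = (if length is = n \<and> set is \<subseteq> I then \<omega> (map bvec is) else 0)" for "is"
  let ?T = "lie_tuples absK m n" and ?L = "lie_carrier absK m"
  have out: "\<omega> xs = 0" if "xs \<notin> ?T" for xs using \<omega> that unfolding alt_forms_def by blast
  have add: "\<omega> (xs @ (x + y) # ys) = \<omega> (xs @ x # ys) + \<omega> (xs @ y # ys)"
    if "xs @ x # ys \<in> ?T" "y \<in> ?L" for xs ys x y
    using \<omega> that unfolding alt_forms_def by blast
  have scale: "\<omega> (xs @ (\<lambda>j. a * x j) # ys) = a * \<omega> (xs @ x # ys)"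
    if "a \<in> val_ring absK" "xs @ x # ys \<in> ?T" for xs ys x a
    using \<omega> that unfolding alt_forms_def by blast
  have dist: "\<omega> xs = 0" if "xs \<in> ?T" "\<not> distinct xs" for xs using \<omega> that unfolding alt_forms_def by blast
  have t: "xs @ z # ys \<in> ?T \<longleftrightarrow> Suc (length xs + length ys) = n \<and> set xs \<subseteq> ?L \<and> set ys \<subseteq> ?L \<and> z \<in> ?L" for xs ys z
    by (auto simp: lie_tuples_def)
  have swap: "\<omega> (xs @ x # y # ys) = - \<omega> (xs @ y # x # ys)" if T: "xs @ x # y # ys \<in> ?T" for xs ys x y
  proof -
    have c: "x \<in> ?L" "y \<in> ?L" "x + y \<in> ?L" using T by (auto simp: lie_tuples_def intro!: carrier_add)
    have tt: "xs @ u # v # ys \<in> ?T" if "u \<in> ?L" "v \<in> ?L" for u v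
      using T that by (auto simp: lie_tuples_def)
    have a2: "\<omega> (xs @ u # (x + y) # ys) = \<omega> (xs @ u # x # ys) + \<omega> (xs @ u # y # ys)" if "u \<in> ?L" for u
      using add[of "xs @ [u]" x ys y] tt[OF that c(1)] c(2) by simp
    have "\<omega> (xs @ (x + y) # (x + y) # ys) = 0" using tt[OF c(3,3)] by (intro dist) auto
    moreover have "\<omega> (xs @ x # x # ys) = 0" "\<omega> (xs @ y # y # ys) = 0"
      using tt[OF c(1,1)] tt[OF c(2,2)] by (intro dist; simp)+
    ultimately show ?thesis
      \<comment> \<open>Polarisation: \<omega> vanishes with x + y in both places, and so do its two
        diagonal terms.\<close>
      using add[OF tt[OF c(1,3)] c(2)] a2[OF c(1)] a2[OF c(2)] by (simp add: eq_neg_iff_add_eq_0)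
  qed
  have "alternating \<phi>"
    unfolding alternating_def
  proof (intro allI)
    fix ys k l zs
    show "\<phi> (ys @ k # l # zs) = - \<phi> (ys @ l # k # zs)"
      using swap[of "map bvec ys" "bvec k" "bvec l" "map bvec zs"] bvec_tuples[of "ys @ k # l # zs" n]
      by (auto simp: \<phi>_def)
  qed
  then have k: "kform n \<phi>" by (auto simp: kform_def \<phi>_def)
  \<comment> \<open>Coordinates are added one by one, since additivity and homogeneity are given
    only for vectors of the lattice and scalars in the valuation ring; each partial vector stays in
    the lattice.\<close>
  have lin: "\<omega> (ys @ (\<lambda>j. if j \<in> A then x j else 0) # zs) = (\<Sum>i\<in>A. x i * \<omega> (ys @ bvec i # zs))"
    if "finite A" "A \<subseteq> I" "ys @ x # zs \<in> ?T" for A ys zs x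
    using that(1,2)
  proof (induction A rule: finite_induct)
    case empty
    \<comment> \<open>The zero vector is written as 0 times \<open>x\<close> so that homogeneity
      applies.\<close>
    have "\<omega> (ys @ (\<lambda>j. 0 * x j) # zs) = 0 * \<omega> (ys @ x # zs)"
      by (rule scale) (use that(3) in \<open>auto simp: val_ring_def\<close>)
    then show ?case by simp
  next
    case (insert i A)
    let ?u = "\<lambda>j. if j \<in> A then x j else 0"
    have x: "x \<in> ?L" using that(3) by (simp add: t)
    have u: "?u \<in> ?L" using x insert.prems by (auto simp: carrier_iff)
    have xi: "x i \<in> val_ring absK" using x insert.prems by (auto simp: carrier_iff val_ring_def)
    have b: "bvec i \<in> ?L" using insert.prems by (intro bvec_carrier) simp
    have "(\<lambda>j. if j \<in> insert i A then x j else 0) = ?u + (\<lambda>j. x i * bvec i j)"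
      using insert.hyps by (auto simp: bvec_def fun_eq_iff)
    then have "\<omega> (ys @ (\<lambda>j. if j \<in> insert i A then x j else 0) # zs) =
        \<omega> (ys @ ?u # zs) + \<omega> (ys @ (\<lambda>j. x i * bvec i j) # zs)"
      using add[of ys ?u zs "\<lambda>j. x i * bvec i j"] that(3) u carrier_scale[OF xi b] by (simp add: t)
    also have "\<omega> (ys @ (\<lambda>j. x i * bvec i j) # zs) = x i * \<omega> (ys @ bvec i # zs)"
      by (rule scale[OF xi]) (use that(3) b in \<open>simp add: t\<close>)
    finally show ?case using insert by simp
  qed
  have "\<omega> (map bvec as @ xs) = ext (\<lambda>l. \<phi> (as @ l)) xs"
    if "set as \<subseteq> I" "length as + length xs = n" "set xs \<subseteq> ?L" for as xs
    using that
  proof (induction xs arbitrary: as)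
    case Nil
    then show ?case by (simp add: \<phi>_def)
  next
    case (Cons x xs)
    have T: "map bvec as @ x # xs \<in> ?T" using Cons.prems bvec_carrier by (auto simp: t)
    have "x = (\<lambda>j. if j \<in> I then x j else 0)" using Cons.prems by (auto simp: carrier_iff)
    then have "\<omega> (map bvec as @ x # xs) = (\<Sum>i\<in>I. x i * \<omega> (map bvec as @ bvec i # xs))"
      using lin[OF _ order_refl T] by simp
    also have "\<dots> = (\<Sum>i\<in>I. x i * ext (\<lambda>l. \<phi> (as @ i # l)) xs)"
      using Cons.IH[of "as @ [_]"] Cons.prems by (intro sum.cong) auto
    finally show ?case by simp
  qed
  from this[of "[]"] have "\<omega> xs = Ex n \<phi> xs" for xs
    using out[of xs] by (auto simp: Ex_def lie_tuples_def)
  then show thesis using that k by blast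
qed

text \<open>The recursion of \<^const>\<open>lie_deriv\<close> and \<^const>\<open>ce_diff\<close> with vectors in place of indices, for
  trivial coefficients.\<close>

fun vderiv :: "(nat \<Rightarrow> 'k) \<Rightarrow> (nat \<Rightarrow> 'k) list \<Rightarrow> ((nat \<Rightarrow> 'k) list \<Rightarrow> 'k) \<Rightarrow> 'k" where
  "vderiv x [] F = 0"
| "vderiv x (y # ys) F = vderiv x ys (\<lambda>l. F (y # l)) - F (lie_bracket m G x y # ys)"

fun vdiff :: "(nat \<Rightarrow> 'k) list \<Rightarrow> ((nat \<Rightarrow> 'k) list \<Rightarrow> 'k) \<Rightarrow> 'k" where
  "vdiff [] F = 0"
| "vdiff (x # xs) F = vderiv x xs F - vdiff xs (\<lambda>l. F (x # l))"

lemma vderiv_sum: "vderiv x ys (\<lambda>l. \<Sum>i\<in>A. a i * F i l) = (\<Sum>i\<in>A. a i * vderiv x ys (F i))"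
  by (induction ys arbitrary: F) (auto simp: right_diff_distrib sum_subtractf)

lemma vdiff_sum: "vdiff ys (\<lambda>l. \<Sum>i\<in>A. a i * F i l) = (\<Sum>i\<in>A. a i * vdiff ys (F i))"
  by (induction ys arbitrary: F) (auto simp: vderiv_sum right_diff_distrib sum_subtractf)

abbreviation "thK \<equiv> lie_deriv I strc ((*) :: 'k \<Rightarrow> 'k \<Rightarrow> 'k) (\<lambda>_ _. 0)"

lemma vderiv_ext: "vderiv x ys (ext \<phi>) = (\<Sum>i\<in>I. x i * ext (\<lambda>l. thK i l \<phi>) ys)"
proof (induction ys arbitrary: \<phi>)
  case (Cons y ys)
  have 1: "vderiv x ys (\<lambda>l. ext \<phi> (y # l)) = (\<Sum>i\<in>I. \<Sum>k\<in>I. x i * (y k * ext (\<lambda>l. thK i l (\<lambda>l. \<phi> (k # l))) ys))"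
    by (simp add: vderiv_sum Cons.IH sum_distrib_left mult.left_commute) (rule sum.swap)
  have "ext \<phi> (lie_bracket m G x y # ys) =
      (\<Sum>j\<in>I. \<Sum>i\<in>I. \<Sum>k\<in>I. x i * (y k * (strc j i k * ext (\<lambda>l. \<phi> (j # l)) ys)))"
    by (simp add: lie_bracket_eq sum_distrib_right mult.assoc)
  also have "\<dots> = (\<Sum>i\<in>I. \<Sum>j\<in>I. \<Sum>k\<in>I. x i * (y k * (strc j i k * ext (\<lambda>l. \<phi> (j # l)) ys)))"
    by (rule sum.swap)
  also have "\<dots> = (\<Sum>i\<in>I. \<Sum>k\<in>I. \<Sum>j\<in>I. x i * (y k * (strc j i k * ext (\<lambda>l. \<phi> (j # l)) ys)))"
    by (intro sum.cong refl sum.swap)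
  finally have 2: "ext \<phi> (lie_bracket m G x y # ys) =
     (\<Sum>i\<in>I. \<Sum>k\<in>I. x i * (y k * (\<Sum>j\<in>I. strc j i k * ext (\<lambda>l. \<phi> (j # l)) ys)))"
    by (simp add: sum_distrib_left)
  have 3: "ext (\<lambda>l. thK i (k # l) \<phi>) ys = ext (\<lambda>l. thK i l (\<lambda>l. \<phi> (k # l))) ys -
      (\<Sum>j\<in>I. strc j i k * ext (\<lambda>l. \<phi> (j # l)) ys)" for i k
    by (simp add: ext_diff ext_sum ext_scale)
  have "vderiv x (y # ys) (ext \<phi>) = vderiv x ys (\<lambda>l. ext \<phi> (y # l)) - ext \<phi> (lie_bracket m G x y # ys)"
    by simp
  also have "\<dots> = (\<Sum>i\<in>I. \<Sum>k\<in>I. x i * (y k * ext (\<lambda>l. thK i (k # l) \<phi>) ys))"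
    unfolding 1 2 3 by (simp only: right_diff_distrib sum_subtractf)
  also have "\<dots> = (\<Sum>i\<in>I. x i * ext (\<lambda>l. thK i l \<phi>) (y # ys))"
    by (simp only: ext.simps sum_distrib_left)
  finally show ?case .
qed (simp add: ext_zero)

lemma vdiff_ext: "vdiff xs (ext \<phi>) = ext (\<lambda>l. dK l \<phi>) xs"
proof (induction xs arbitrary: \<phi>)
  case (Cons x xs)
  have "vdiff (x # xs) (ext \<phi>) = (\<Sum>i\<in>I. x i * ext (\<lambda>l. thK i l \<phi>) xs)
     - (\<Sum>i\<in>I. x i * ext (\<lambda>l. dK l (\<lambda>l. \<phi> (i # l))) xs)"
    by (simp add: vderiv_ext vdiff_sum Cons.IH)
  also have "\<dots> = (\<Sum>i\<in>I. x i * ext (\<lambda>l. dK (i # l) \<phi>) xs)"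
    by (simp add: ext_diff right_diff_distrib sum_subtractf)
  finally show ?case by simp
qed simp

section \<open>Agreement with the explicit Lie differential\<close>

lemma nths_insert_0: "nths (x # xs) (- {0, Suc s}) = nths xs (- {s})" "nths (x # xs) (- {0}) = xs"
proof -
  have "{j. Suc j \<in> - {0, Suc s}} = - {s}" "{j. Suc j \<in> - {0 :: nat}} = UNIV" by auto
  then show "nths (x # xs) (- {0, Suc s}) = nths xs (- {s})" "nths (x # xs) (- {0}) = xs"
    by (simp_all add: nths_Cons nths_all)
qed

lemma nths_insert_Suc: "nths (x # xs) (- {Suc r, Suc s}) = x # nths xs (- {r, s})"
  "nths (x # xs) (- {Suc s}) = x # nths xs (- {s})"
proof -
  have "{j. Suc j \<in> - {Suc r, Suc s}} = - {r, s}" "{j. Suc j \<in> - {Suc s}} = - {s}" by auto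
  then show "nths (x # xs) (- {Suc r, Suc s}) = x # nths xs (- {r, s})"
    "nths (x # xs) (- {Suc s}) = x # nths xs (- {s})"
    by (simp_all add: nths_Cons)
qed

lemma vderiv_formula:
  assumes "alternating F"
  shows "vderiv x ys F = (\<Sum>s<length ys. (- 1) ^ Suc s * F (lie_bracket m G x (ys ! s) # nths ys (- {s})))"
  using assms
proof (induction ys arbitrary: F)
  case (Cons y ys)
  have "F (y # lie_bracket m G x (ys ! s) # nths ys (- {s})) = - F (lie_bracket m G x (ys ! s) # y # nths ys (- {s}))" for s
    by (rule alternating_swap[OF Cons.prems])
  then have "vderiv x ys (\<lambda>l. F (y # l)) = (\<Sum>s<length ys. (- 1) ^ s * F (lie_bracket m G x (ys ! s) # y # nths ys (- {s})))"
    using Cons.IH[OF alternating_contract[OF Cons.prems]] by (simp only: power_Suc) simp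
  then show ?case
    by (simp add: sum.lessThan_Suc_shift nths_insert_0 nths_insert_Suc del: sum.lessThan_Suc)
qed simp

text \<open>Peeling off the first vector, the pairs with r = 0 come from \<open>vderiv\<close> and
  the others from the induction. Moving the bracket in front of the first vector cancels the minus
  sign of the recursion.\<close>

lemma vdiff_formula:
  assumes "alternating F"
  shows "vdiff xs F = (\<Sum>s<length xs. \<Sum>r<s.
    (- 1) ^ (r + s) * F (lie_bracket m G (xs ! r) (xs ! s) # nths xs (- {r, s})))"
  using assms
proof (induction xs arbitrary: F)
  case (Cons x xs)
  let ?t = "\<lambda>r s. (- 1) ^ (r + s) * F (lie_bracket m G (xs ! r) (xs ! s) # x # nths xs (- {r, s}))"
  have "F (x # lie_bracket m G (xs ! r) (xs ! s) # nths xs (- {r, s})) =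
      - F (lie_bracket m G (xs ! r) (xs ! s) # x # nths xs (- {r, s}))" for r s
    by (rule alternating_swap[OF Cons.prems])
  then have "vdiff xs (\<lambda>l. F (x # l)) = - (\<Sum>s<length xs. \<Sum>r<s. ?t r s)"
    using Cons.IH[OF alternating_contract[OF Cons.prems]] by (simp only: mult_minus_right sum_negf)
  then have "vdiff (x # xs) F = (\<Sum>s<length xs. (- 1) ^ Suc s * F (lie_bracket m G x (xs ! s) # nths xs (- {s}))
      + (\<Sum>r<s. ?t r s))"
    by (simp only: vdiff.simps vderiv_formula[OF Cons.prems] sum.distrib minus_minus diff_minus_eq_add)
  then show ?case
    by (simp add: sum.lessThan_Suc_shift nths_insert_0 nths_insert_Suc del: sum.lessThan_Suc)
qed simp

lemma kform_dK:
  assumes "kform n \<phi>"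
  shows "kform (Suc n) (\<lambda>is. dK is \<phi>)"
  unfolding kform_def
proof (intro conjI allI impI)
  show "alternating (\<lambda>is. dK is \<phi>)" using assms by (intro sc.trivK.alternating_d) (simp add: kform_def)
  show "dK is \<phi> = 0" if "length is \<noteq> Suc n \<or> \<not> set is \<subseteq> I" for "is"
  proof (rule sc.trivK.d_outside[of n])
    show "\<phi> is' = 0" if "length is' \<noteq> n \<or> \<not> set is' \<subseteq> I" for is'
      using assms that unfolding kform_def by blast
  qed (use that in \<open>auto simp: strc_def\<close>)
qed

lemma lie_diff_Ex:
  assumes "kform n \<phi>"
  shows "lie_diff absK m G n (Ex n \<phi>) = Ex (Suc n) (\<lambda>is. dK is \<phi>)"
proof (rule HOL.ext)
  fix xs
  have alt: "alternating (ext \<phi>)" using assms by (intro alternating_ext) (simp add: kform_def)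
  show "lie_diff absK m G n (Ex n \<phi>) xs = Ex (Suc n) (\<lambda>is. dK is \<phi>) xs"
  proof (cases "xs \<in> lie_tuples absK m (Suc n)")
    case True
    then have len: "length xs = Suc n" and sub: "set xs \<subseteq> lie_carrier absK m" by (auto simp: lie_tuples_def)
    have T: "lie_bracket m G (xs ! r) (xs ! s) # nths xs (- {r, s}) \<in> lie_tuples absK m n" if "r < s" "s \<le> n" for r s
    proof -
      have "{i. i < length xs \<and> i \<in> - {r, s}} = {..<Suc n} - {r, s}" using len by auto
      then have "length (nths xs (- {r, s})) = n - 1"
        using that by (simp add: length_nths card_Diff_subset One_nat_def)
      moreover have "lie_bracket m G (xs ! r) (xs ! s) \<in> lie_carrier absK m"
        using sub that len by (intro carrier_bracket) (auto intro: subsetD[OF sub nth_mem])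
      ultimately show ?thesis using sub that set_nths_subset[of xs "- {r, s}"] by (auto simp: lie_tuples_def)
    qed
    have "lie_diff absK m G n (Ex n \<phi>) xs = vdiff xs (ext \<phi>)"
      unfolding vdiff_formula[OF alt] len using True T
      by (auto simp: lie_diff_def Ex_def lessThan_Suc_atMost simp flip: Suc_eq_plus1 intro!: sum.cong)
    then show ?thesis using True by (simp add: vdiff_ext Ex_def)
  next
    case False
    then show ?thesis by (simp add: lie_diff_def Ex_def flip: Suc_eq_plus1)
  qed
qed

end

section \<open>Isomorphisms on cohomology\<close>

definition add_subgroup :: "'a::ab_group_add set \<Rightarrow> bool" where
  "add_subgroup B \<longleftrightarrow> 0 \<in> B \<and> (\<forall>x\<in>B. \<forall>y\<in>B. x - y \<in> B)"

lemma add_subgroup_add: "add_subgroup B \<Longrightarrow> x \<in> B \<Longrightarrow> y \<in> B \<Longrightarrow> x + y \<in> B"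
  unfolding add_subgroup_def by (metis diff_0 diff_minus_eq_add)

lemma coset_eq_iff:
  assumes "add_subgroup B"
  shows "x +o B = y +o B \<longleftrightarrow> x - y \<in> B"
proof
  assume eq: "x +o B = y +o B"
  have "x \<in> x +o B" using assms by (auto simp: elt_set_plus_def add_subgroup_def intro!: bexI[of _ 0])
  then have "x \<in> y +o B" using eq by simp
  then obtain b where "b \<in> B" "x = y + b" by (auto simp: elt_set_plus_def)
  then show "x - y \<in> B" by simp
next
  assume d: "x - y \<in> B"
  have e: "z \<in> w +o B \<longleftrightarrow> z - w \<in> B" for z w
    by (auto simp: elt_set_plus_def intro!: bexI[of _ "z - w"])
  show "x +o B = y +o B"
  proof (rule set_eqI)
    fix z
    have "z - y = (z - x) + (x - y)" "z - x = (z - y) - (x - y)" by simp_all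
    then show "z \<in> x +o B \<longleftrightarrow> z \<in> y +o B"
      unfolding e using d assms add_subgroup_add unfolding add_subgroup_def by metis
  qed
qed

lemma coset_add:
  assumes "add_subgroup B"
  shows "(x +o B) + (y +o B) = (x + y) +o B"
proof -
  have "B + B = B"
  proof
    show "B + B \<subseteq> B" using add_subgroup_add[OF assms] by (auto simp: set_plus_def)
    show "B \<subseteq> B + B" using assms by (force simp: set_plus_def add_subgroup_def)
  qed
  then show ?thesis by (simp add: set_plus_rearrange)
qed

text \<open>A map that is well defined modulo the subgroups gives the same coset for every
  representative; this collapses the unions in \<open>class_scale\<close> and
  \<open>induced_map\<close>.\<close>

lemma UN_cosets:
  assumes B: "add_subgroup B" and B': "add_subgroup B'"
    and f: "\<And>b. b \<in> B \<Longrightarrow> f (x + b) - f x \<in> B'"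
  shows "(\<Union>y\<in>x +o B. f y +o B') = f x +o B'"
proof -
  have "f y +o B' = f x +o B'" if y: "y \<in> x +o B" for y
  proof -
    obtain b where "b \<in> B" "y = x + b" using y by (auto simp: elt_set_plus_def)
    then show ?thesis unfolding coset_eq_iff[OF B'] using f by simp
  qed
  moreover have "x \<in> x +o B" using B by (auto simp: elt_set_plus_def add_subgroup_def intro!: bexI[of _ 0])
  ultimately show ?thesis by blast
qed

lemma cohomology_isomorphismI:
  fixes C :: "('k, 'a::ab_group_add) cochain_complex" and E :: "('k, 'b::ab_group_add) cochain_complex"
  assumes ZC: "\<And>x y. x \<in> cocycles C n \<Longrightarrow> y \<in> cocycles C n \<Longrightarrow> x - y \<in> cocycles C n"
    and BC: "add_subgroup (coboundaries C n)" and BE: "add_subgroup (coboundaries E n)"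
    and sC: "\<And>a x y. scaling C a (x + y) = scaling C a x + scaling C a y"
      "\<And>a x. x \<in> coboundaries C n \<Longrightarrow> scaling C a x \<in> coboundaries C n"
    and sE: "\<And>a x y. scaling E a (x + y) = scaling E a x + scaling E a y"
      "\<And>a x. x \<in> coboundaries E n \<Longrightarrow> scaling E a x \<in> coboundaries E n"
    and F: "\<And>x y. F (x + y) = F x + F y" "\<And>a x. F (scaling C a x) = scaling E a (F x)"
    and FZ: "\<And>x. x \<in> cocycles C n \<Longrightarrow> F x \<in> cocycles E n"
    and FB: "\<And>x. x \<in> coboundaries C n \<Longrightarrow> F x \<in> coboundaries E n"
    and inj: "\<And>x. x \<in> cocycles C n \<Longrightarrow> F x \<in> coboundaries E n \<Longrightarrow> x \<in> coboundaries C n"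
    and surj: "\<And>w. w \<in> cocycles E n \<Longrightarrow> \<exists>x\<in>cocycles C n. F x - w \<in> coboundaries E n"
  shows "cohomology_isomorphism C E n (induced_map E n F)"
proof -
  let ?BC = "coboundaries C n" and ?BE = "coboundaries E n" and ?\<Psi> = "induced_map E n F"
  have \<Psi>: "?\<Psi> (x +o ?BC) = F x +o ?BE" for x
    unfolding induced_map_def by (rule UN_cosets[OF BC BE]) (simp add: F FB)
  have clC: "class_scale C n a (x +o ?BC) = scaling C a x +o ?BC" for a x
    unfolding class_scale_def by (rule UN_cosets[OF BC BC]) (simp add: sC)
  have clE: "class_scale E n a (x +o ?BE) = scaling E a x +o ?BE" for a x
    unfolding class_scale_def by (rule UN_cosets[OF BE BE]) (simp add: sE)
  have Fd: "F (x - y) = F x - F y" for x y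
    using F(1)[of "x - y" y] by (simp add: algebra_simps)
  have "inj_on ?\<Psi> (cohomology C n)"
  proof (rule inj_onI)
    fix A B assume "A \<in> cohomology C n" "B \<in> cohomology C n" and eq: "?\<Psi> A = ?\<Psi> B"
    then obtain x y where x: "x \<in> cocycles C n" "A = x +o ?BC" and y: "y \<in> cocycles C n" "B = y +o ?BC"
      by (auto simp: cohomology_def)
    have "F (x - y) \<in> ?BE" using eq by (simp add: x y \<Psi> coset_eq_iff[OF BE] Fd)
    then have "x - y \<in> ?BC" using inj ZC x y by blast
    then show "A = B" by (simp add: x y coset_eq_iff[OF BC])
  qed
  moreover have "?\<Psi> ` cohomology C n = cohomology E n"
  proof (intro equalityI subsetI)
    fix A assume "A \<in> ?\<Psi> ` cohomology C n"
    then show "A \<in> cohomology E n" using FZ by (auto simp: cohomology_def \<Psi>)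
  next
    fix A assume "A \<in> cohomology E n"
    then obtain w where w: "w \<in> cocycles E n" "A = w +o ?BE" by (auto simp: cohomology_def)
    obtain x where "x \<in> cocycles C n" "F x - w \<in> ?BE" using surj[OF w(1)] by blast
    then have "x +o ?BC \<in> cohomology C n" "?\<Psi> (x +o ?BC) = A"
      by (auto simp: cohomology_def \<Psi> w coset_eq_iff[OF BE])
    then show "A \<in> ?\<Psi> ` cohomology C n" by blast
  qed
  ultimately show ?thesis
    unfolding cohomology_isomorphism_def bij_betw_def cohomology_def
    by (auto simp: coset_add[OF BC] coset_add[OF BE] \<Psi> clC clE F)
qed

context analytic_fgl
begin

declare One_nat_def [simp del] atLeastAtMost_iff [simp del] sc.trivK.scale_scale [simp del]

lemma la_germs_eq: "la_germs absK p m n = {f \<in> in_vars (V n). conv f}"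
  unfolding la_germs_def by (rule tate_algebra_conv) simp

lemma la_diff_delta: "f \<in> in_vars (V n) \<Longrightarrow> la_diff G n f = delta (Suc n) f"
  by (simp add: delta_constant_last)

lemma la_diff_diff:
  assumes "f \<in> in_vars (V n)" "g \<in> in_vars (V n)"
  shows "la_diff G n (f - g) = la_diff G n f - la_diff G n g"
  using delta_diff[OF in_V_mono[OF assms(1) le_SucI[OF order_refl]] in_V_mono[OF assms(2) le_SucI[OF order_refl]]]
  unfolding la_diff_delta[OF assms(1)] la_diff_delta[OF assms(2)] la_diff_delta[OF in_vars_diff[OF assms]] .

lemma la_diff_const_mult:
  assumes "f \<in> in_vars (V n)"
  shows "la_diff G n (mconst a * f) = mconst a * la_diff G n f"
proof -
  have "mconst a * f \<in> in_vars (V n)" using assms by (simp add: in_vars_mult)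
  from la_diff_delta[OF this] show ?thesis
    unfolding la_diff_delta[OF assms] delta_const_mult[OF in_V_mono[OF assms le_SucI[OF order_refl]]] .
qed

lemma la_diff_0: "la_diff G n 0 = 0"
  by (simp add: la_diff_delta)

lemma Phi_cohomology_isomorphism:
  "cohomology_isomorphism (la_complex absK p m G) (lie_complex absK m G) n (Phi_infinity absK m G n)"
proof -
  let ?C = "la_complex absK p m G" and ?E = "lie_complex absK m G"
  let ?germs = "\<lambda>n. {f \<in> in_vars (V n). conv f}"
  have ZC: "f \<in> cocycles ?C n \<longleftrightarrow> f \<in> in_vars (V n) \<and> conv f \<and> la_diff G n f = 0" for f n
    by (simp add: cocycles_def la_complex_def la_germs_eq)
  have BC: "coboundaries ?C 0 = {0}" "coboundaries ?C (Suc k) = la_diff G k ` ?germs k" for k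
    by (simp_all add: coboundaries_def la_complex_def la_germs_eq)
  have alt: "alt_forms absK m k = Ex k ` Collect (kform k)" for k
    using Ex_alt_form alt_form_Ex by (auto simp: image_iff) metis
  have ZE: "w \<in> cocycles ?E n \<longleftrightarrow> (\<exists>\<omega>. w = Ex n \<omega> \<and> kform n \<omega> \<and> (\<forall>is. dK is \<omega> = 0))" for w n
  proof -
    have "lie_diff absK m G n (Ex n \<omega>) = 0 \<longleftrightarrow> (\<forall>is. dK is \<omega> = 0)" if "kform n \<omega>" for \<omega>
      unfolding lie_diff_Ex[OF that] using Ex_inject[OF kform_dK[OF that] kform_0]
      by (auto simp: Ex_zero fun_eq_iff)
    then show ?thesis by (auto simp: cocycles_def lie_complex_def alt)
  qed
  have BE: "coboundaries ?E 0 = {0}"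
    "coboundaries ?E (Suc k) = (\<lambda>\<rho>. Ex (Suc k) (\<lambda>is. dK is \<rho>)) ` Collect (kform k)" for k
    by (auto simp: coboundaries_def lie_complex_def alt lie_diff_Ex image_image cong: image_cong_simp)
  have sc: "scaling ?C a f = mconst a * f" "scaling ?E a w = (\<lambda>xs. a * w xs)" for a f w
    by (simp_all add: la_complex_def lie_complex_def)
  have "add_subgroup (coboundaries ?C n)"
  proof (cases n)
    case (Suc k)
    have "la_diff G k f - la_diff G k g \<in> la_diff G k ` ?germs k" if "f \<in> ?germs k" "g \<in> ?germs k" for f g
      using that by (intro image_eqI[of _ _ "f - g"]) (auto simp: la_diff_diff in_vars_diff conv_diff)
    moreover have "0 \<in> la_diff G k ` ?germs k" by (intro image_eqI[of _ _ 0]) (auto simp: la_diff_0)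
    ultimately show ?thesis unfolding Suc BC(2) add_subgroup_def by blast
  qed (simp add: BC add_subgroup_def)
  moreover have "add_subgroup (coboundaries ?E n)"
  proof (cases n)
    case (Suc k)
    let ?f = "\<lambda>\<rho>. Ex (Suc k) (\<lambda>is. dK is \<rho>)"
    have "?f \<rho> - ?f \<sigma> \<in> ?f ` Collect (kform k)" if "kform k \<rho>" "kform k \<sigma>" for \<rho> \<sigma>
      using that by (intro image_eqI[of _ _ "\<lambda>is. \<rho> is - \<sigma> is"]) (auto simp: Ex_diff sc.trivK.d_diff kform_diff)
    moreover have "0 \<in> ?f ` Collect (kform k)"
      by (intro image_eqI[of _ _ "\<lambda>is. 0"]) (auto simp: sc.trivK.d_zero Ex_zero kform_0)
    ultimately show ?thesis unfolding Suc BE(2) add_subgroup_def by blast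
  qed (simp add: BE add_subgroup_def)
  moreover have "scaling ?C a f \<in> coboundaries ?C n" if "f \<in> coboundaries ?C n" for a f
  proof (cases n)
    case (Suc k)
    then obtain g where "g \<in> ?germs k" "f = la_diff G k g" using \<open>f \<in> coboundaries ?C n\<close> unfolding Suc BC(2) by blast
    then show ?thesis unfolding Suc BC(2) sc
      by (intro image_eqI[of _ _ "mconst a * g"]) (auto simp: la_diff_const_mult in_vars_mult conv_const_mult)
  qed (use that in \<open>simp add: BC sc\<close>)
  moreover have "scaling ?E a w \<in> coboundaries ?E n" if "w \<in> coboundaries ?E n" for a w
  proof (cases n)
    case (Suc k)
    then obtain \<rho> where "kform k \<rho>" "w = Ex (Suc k) (\<lambda>is. dK is \<rho>)" using \<open>w \<in> coboundaries ?E n\<close> unfolding Suc BE(2) by blast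
    then show ?thesis unfolding Suc BE(2) sc
      by (intro image_eqI[of _ _ "\<lambda>is. a * \<rho> is"]) (auto simp: Suc Ex_scale sc.trivK.d_scale kform_scale)
  qed (use that in \<open>auto simp: BE sc\<close>)
  moreover have Phi_add: "Phi absK m n (f + g) = Phi absK m n f + Phi absK m n g" for f g
    unfolding Phi_eq_Ex Ex_add by (simp add: Pb_add[abs_def])
  moreover have "Phi absK m n (scaling ?C a f) = scaling ?E a (Phi absK m n f)" for a f
    unfolding Phi_eq_Ex sc Ex_scale by (simp add: Pb_const_mult[abs_def])
  moreover have "Phi absK m n f \<in> cocycles ?E n" if "f \<in> cocycles ?C n" for f
  proof -
    have f: "f \<in> in_vars (V n)" "la_diff G n f = 0" using that by (auto simp: ZC)
    have "form0 (0 :: 'k series) = (\<lambda>is. 0)" by (auto simp: form0_def)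
    then have "dK is (Pb n f) = 0" for "is"
      using Pb_chain_map[OF f(1), of "is"] f(2) by (simp add: Pb_def PhiT_0)
    then show ?thesis unfolding ZE Phi_eq_Ex using Pb_kform[OF f(1)] by blast
  qed
  moreover have "Phi absK m n f \<in> coboundaries ?E n" if "f \<in> coboundaries ?C n" for f
  proof (cases n)
    case 0
    then have "f = 0" using that by (simp add: BC)
    then have "Phi absK m n f = 0" using Phi_add[of 0 0] by simp
    then show ?thesis using 0 by (simp add: BE)
  next
    case (Suc k)
    then obtain g where g: "g \<in> in_vars (V k)" "f = la_diff G k g" using \<open>f \<in> coboundaries ?C n\<close> unfolding Suc BC(2) by blast
    then have "Pb (Suc k) f = (\<lambda>is. dK is (Pb k g))"
      using Pb_chain_map[OF g(1)] by (intro HOL.ext) simp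
    then have "Phi absK m n f = Ex (Suc k) (\<lambda>is. dK is (Pb k g))"
      unfolding Phi_eq_Ex Suc by simp
    then show ?thesis unfolding Suc BE(2) using Pb_kform[OF g(1)] by blast
  qed
  moreover have "f \<in> coboundaries ?C n" if f: "f \<in> cocycles ?C n" and Pf: "Phi absK m n f \<in> coboundaries ?E n" for f
  proof (cases n)
    case 0
    \<comment> \<open>In degree 0 there are no variables: f is a constant, and \<Phi> returns
      it.\<close>
    have v: "f \<in> in_vars (V 0)" using f 0 by (simp add: ZC)
    have "Ex 0 (Pb 0 f) = Ex 0 (\<lambda>is. 0)" using Pf unfolding Phi_eq_Ex 0 BE Ex_zero by simp
    then have "Pb 0 f [] = 0" using Ex_inject[OF Pb_kform[OF v] kform_0] by (simp add: fun_eq_iff)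
    then have "mcoeff f 0 = 0" by (simp add: Pb_def PhiT_zero form0_def)
    moreover have "\<forall>b. b \<noteq> 0 \<longrightarrow> mcoeff f b = 0" using v by (simp add: in_vars_iff atLeastAtMost_iff)
    ultimately have "mcoeff f b = 0" for b by (cases "b = 0") auto
    then have "f = 0" by (intro mfps_eqI) simp
    then show ?thesis using 0 by (simp add: BC)
  next
    case (Suc k)
    have v: "f \<in> in_vars (V (Suc k))" "conv f" "la_diff G (Suc k) f = 0" using f Suc by (auto simp: ZC)
    obtain \<rho> where \<rho>: "kform k \<rho>" "Ex (Suc k) (Pb (Suc k) f) = Ex (Suc k) (\<lambda>is. dK is \<rho>)"
      using Pf unfolding Phi_eq_Ex Suc BE(2) by blast
    have "Pb (Suc k) f is = dK is \<rho>" for "is"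
      using Ex_inject[OF Pb_kform[OF v(1)] kform_dK[OF \<rho>(1)] \<rho>(2)] by (simp add: fun_eq_iff)
    from Pb_injective[OF v \<rho>(1) this] obtain g where "g \<in> in_vars (V k)" "conv g" "f = la_diff G k g" by blast
    then show ?thesis unfolding Suc BC(2) by blast
  qed
  moreover have "\<exists>f\<in>cocycles ?C n. Phi absK m n f - w \<in> coboundaries ?E n" if wZ: "w \<in> cocycles ?E n" for w
  proof -
    obtain \<omega> where w: "w = Ex n \<omega>" and \<omega>: "kform n \<omega>" "\<And>is. dK is \<omega> = 0" using wZ unfolding ZE by blast
    obtain f \<rho> where f: "f \<in> in_vars (V n)" "conv f" "la_diff G n f = 0" "kform (n - 1) \<rho>"
      and eq: "\<And>is. \<omega> is = Pb n f is + dK is \<rho>" using Pb_surjective[OF \<omega>] by blast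
    have diff: "Phi absK m n f - w = Ex n (\<lambda>is. dK is (\<lambda>is. - \<rho> is))"
      unfolding w Phi_eq_Ex Ex_diff by (simp add: eq sc.trivK.d_uminus)
    have "Phi absK m n f - w \<in> coboundaries ?E n"
    proof (cases n)
      case 0
      \<comment> \<open>In degree 0 only the empty tuple is admissible, and there every differential
        has the value 0; the difference is therefore zero.\<close>
      have "Ex 0 (\<lambda>is. dK is \<sigma>) = 0" for \<sigma> by (auto simp: Ex_def lie_tuples_def)
      then show ?thesis unfolding diff unfolding 0 BE by simp
    next
      case (Suc k)
      have "kform k (\<lambda>is. - \<rho> is)" using kform_scale[OF f(4), of "- 1"] Suc by (simp add: One_nat_def)
      then show ?thesis unfolding diff unfolding Suc BE(2) by blast
    qed
    then show ?thesis using f ZC by blast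
  qed
  moreover have "f - g \<in> cocycles ?C n" if "f \<in> cocycles ?C n" "g \<in> cocycles ?C n" for f g
    using that by (auto simp: ZC in_vars_diff conv_diff la_diff_diff)
  ultimately show ?thesis
    unfolding Phi_infinity_def
    by (intro cohomology_isomorphismI) (auto simp: sc distrib_left)
qed

end

theorem lemma5p19:
  fixes p m n :: nat
    and absK :: "'k::field_char_0 \<Rightarrow> real"
    and G :: "nat \<Rightarrow> 'k series"
  assumes "prime p"
    and "finite_extension_of_Qp p absK"
    and "formal_group_law absK m G"
  shows "cohomology_isomorphism (la_complex absK p m G) (lie_complex absK m G) n
           (Phi_infinity absK m G n)"
proof -
  have "nonarch_absolute_value absK" "absK (of_nat p) = 1 / real p"
    using assms(2) by (auto simp: finite_extension_of_Qp_def)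
  then interpret analytic_fgl m G absK p
    using assms(1,3) by unfold_locales (auto simp: formal_group_law_def val_ring_def)
  show ?thesis by (rule Phi_cohomology_isomorphism)
qed

end
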